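(* Let $\Omega\subset\mathbb{R}^n$ ($n\geq 3$) be a smooth bounded domain and let $1<q<2\leq p<\frac{2n}{n-2}$. Then, for every $r,\nu>0$, there exists $\lambda^*>0$ with the following property: for every $\lambda\in\,]0,\lambda^*[$, every $\mu\in\,]-\lambda^*,\lambda^*[$, and every convex dense set $S\subset H^{-1}(\Omega)$, there exists $\tilde\varphi\in S$, with $\|\tilde\varphi\|_{H^{-1}(\Omega)}<r$, such that the problem $$\begin{cases}-\Delta u=\lambda\left(|u|^{\frac{4}{n-2}}u+\nu|u|^{q-2}u+\mu|u|^{p-2}u+\tilde\varphi\right) & \text{in }\Omega\\ u=0 & \text{on }\partial\Omega\end{cases}$$ has at least two (weak) solutions whose norms in $H^1_0(\Omega)$ are less than or equal to $r$.
   Context: The Sobolev space $H^1_0(\Omega)$ is real and endowed with the scalar product $\langle u,v\rangle=\int_\Omega\nabla u(x)\cdot\nabla v(x)\,dx$ and the induced norm; $H^{-1}(\Omega)$ is its dual space, with the dual norm. Solutions are understood in the weak sense: a weak solution of the problem is any $u\in H^1_0(\Omega)$ such that $$\int_\Omega\nabla u\cdot\nabla v\,dx-\lambda\int_\Omega\left(|u|^{\frac{4}{n-2}}u+\nu|u|^{q-2}u+\mu|u|^{p-2}u\right)v\,dx-\lambda\tilde\varphi(v)=0$$ for all $v\in H^1_0(\Omega)$, where $|t|^{q-2}t$ is taken to be $0$ at $t=0$ (and similarly for $p$). *)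

theory Defs
  imports "HOL-Analysis.Analysis"
begin

text \<open>Elements of the function spaces over \<open>\<Omega>\<close> are represented by functions on the whole
  Euclidean space, of which only the values on \<open>\<Omega>\<close> matter, and only up to Lebesgue null
  sets. None of the notions below singles out a representative, so distinctness of two elements
  has to be expressed by \<open>ae_equal\<close>.\<close>

primrec C_class :: "nat \<Rightarrow> ('a::euclidean_space \<Rightarrow> real) \<Rightarrow> bool" where
  "C_class 0 f \<longleftrightarrow> continuous_on UNIV f"
| "C_class (Suc k) f \<longleftrightarrow> f differentiable_on UNIV \<and>
     (\<forall>i\<in>Basis. C_class k (\<lambda>x. frechet_derivative f (at x) i))"

definition smooth :: "('a::euclidean_space \<Rightarrow> real) \<Rightarrow> bool" where
  "smooth f \<longleftrightarrow> (\<forall>k. C_class k f)"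

text \<open>Near every boundary point, and in suitable orthonormal coordinates with last axis \<open>e\<close>,
  the set is the strict epigraph of a smooth function \<open>\<gamma>\<close> of the remaining coordinates. The
  argument of \<open>\<gamma>\<close> is the orthogonal projection of \<open>x\<close> to the hyperplane normal to \<open>e\<close>.\<close>

definition smooth_boundary :: "'a::euclidean_space set \<Rightarrow> bool" where
  "smooth_boundary \<Omega> \<longleftrightarrow>
     (\<forall>x0\<in>frontier \<Omega>. \<exists>r>0. \<exists>e \<gamma>. norm e = 1 \<and> smooth \<gamma> \<and>
        \<Omega> \<inter> ball x0 r = {x \<in> ball x0 r. \<gamma> (x - (x \<bullet> e) *\<^sub>R e) < x \<bullet> e})"

definition smooth_bounded_domain :: "'a::euclidean_space set \<Rightarrow> bool" where
  "smooth_bounded_domain \<Omega> \<longleftrightarrow>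
     \<Omega> \<noteq> {} \<and> open \<Omega> \<and> connected \<Omega> \<and> bounded \<Omega> \<and> smooth_boundary \<Omega>"

definition test_fun :: "'a::euclidean_space set \<Rightarrow> ('a \<Rightarrow> real) \<Rightarrow> bool" where
  "test_fun \<Omega> \<phi> \<longleftrightarrow>
     smooth \<phi> \<and> compact (closure {x. \<phi> x \<noteq> 0}) \<and> closure {x. \<phi> x \<noteq> 0} \<subseteq> \<Omega>"

definition ae_equal :: "'a::euclidean_space set \<Rightarrow> ('a \<Rightarrow> 'b) \<Rightarrow> ('a \<Rightarrow> 'b) \<Rightarrow> bool" where
  "ae_equal \<Omega> u v \<longleftrightarrow> (AE x in lebesgue_on \<Omega>. u x = v x)"

definition L2 :: "'a::euclidean_space set \<Rightarrow> ('a \<Rightarrow> 'b::euclidean_space) \<Rightarrow> bool" where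
  "L2 \<Omega> f \<longleftrightarrow> f \<in> borel_measurable (lebesgue_on \<Omega>) \<and>
     integrable (lebesgue_on \<Omega>) (\<lambda>x. (norm (f x))\<^sup>2)"

definition locally_integrable ::
    "'a::euclidean_space set \<Rightarrow> ('a \<Rightarrow> 'b::euclidean_space) \<Rightarrow> bool" where
  "locally_integrable \<Omega> f \<longleftrightarrow> (\<forall>K. compact K \<and> K \<subseteq> \<Omega> \<longrightarrow> integrable (lebesgue_on K) f)"

definition weak_gradient ::
    "'a::euclidean_space set \<Rightarrow> ('a \<Rightarrow> real) \<Rightarrow> ('a \<Rightarrow> 'a) \<Rightarrow> bool" where
  "weak_gradient \<Omega> u g \<longleftrightarrow> locally_integrable \<Omega> u \<and> locally_integrable \<Omega> g \<and>
     (\<forall>\<phi>. test_fun \<Omega> \<phi> \<longrightarrow> (\<forall>i\<in>Basis.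
        (\<integral>x. u x * frechet_derivative \<phi> (at x) i \<partial>lebesgue_on \<Omega>) =
        - (\<integral>x. (g x \<bullet> i) * \<phi> x \<partial>lebesgue_on \<Omega>)))"

text \<open>A weak gradient is unique up to null sets, and \<open>grad\<close> only occurs under integrals.\<close>

definition grad :: "'a::euclidean_space set \<Rightarrow> ('a \<Rightarrow> real) \<Rightarrow> 'a \<Rightarrow> 'a" where
  "grad \<Omega> u = (SOME g. weak_gradient \<Omega> u g)"

definition H1 :: "'a::euclidean_space set \<Rightarrow> ('a \<Rightarrow> real) set" where
  "H1 \<Omega> = {u. L2 \<Omega> u \<and> (\<exists>g. weak_gradient \<Omega> u g \<and> L2 \<Omega> g)}"

definition H1_norm :: "'a::euclidean_space set \<Rightarrow> ('a \<Rightarrow> real) \<Rightarrow> real" where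
  "H1_norm \<Omega> u = sqrt ((\<integral>x. (u x)\<^sup>2 \<partial>lebesgue_on \<Omega>) +
                        (\<integral>x. (norm (grad \<Omega> u x))\<^sup>2 \<partial>lebesgue_on \<Omega>))"

text \<open>The closure of the test functions in \<open>H1 \<Omega>\<close>.\<close>

definition H10 :: "'a::euclidean_space set \<Rightarrow> ('a \<Rightarrow> real) set" where
  "H10 \<Omega> = {u \<in> H1 \<Omega>. \<forall>\<epsilon>>0. \<exists>\<phi>. test_fun \<Omega> \<phi> \<and> H1_norm \<Omega> (\<lambda>x. u x - \<phi> x) < \<epsilon>}"

definition H10_inner :: "'a::euclidean_space set \<Rightarrow> ('a \<Rightarrow> real) \<Rightarrow> ('a \<Rightarrow> real) \<Rightarrow> real" where
  "H10_inner \<Omega> u v = (\<integral>x. grad \<Omega> u x \<bullet> grad \<Omega> v x \<partial>lebesgue_on \<Omega>)"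

definition H10_norm :: "'a::euclidean_space set \<Rightarrow> ('a \<Rightarrow> real) \<Rightarrow> real" where
  "H10_norm \<Omega> u = sqrt (H10_inner \<Omega> u u)"

text \<open>The dual space of \<open>H10 \<Omega>\<close>. Functionals are extended by zero outside \<open>H10 \<Omega>\<close>, so that
  equality of functionals is HOL equality. Boundedness and linearity make them respect
  \<open>ae_equal\<close>.\<close>

definition Hm1 :: "'a::euclidean_space set \<Rightarrow> (('a \<Rightarrow> real) \<Rightarrow> real) set" where
  "Hm1 \<Omega> = {\<psi>.
     (\<forall>u\<in>H10 \<Omega>. \<forall>v\<in>H10 \<Omega>. \<psi> (\<lambda>x. u x + v x) = \<psi> u + \<psi> v) \<and>
     (\<forall>u\<in>H10 \<Omega>. \<forall>c. \<psi> (\<lambda>x. c * u x) = c * \<psi> u) \<and>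
     (\<exists>C. \<forall>u\<in>H10 \<Omega>. \<bar>\<psi> u\<bar> \<le> C * H10_norm \<Omega> u) \<and>
     (\<forall>u. u \<notin> H10 \<Omega> \<longrightarrow> \<psi> u = 0)}"

definition Hm1_norm :: "'a::euclidean_space set \<Rightarrow> (('a \<Rightarrow> real) \<Rightarrow> real) \<Rightarrow> real" where
  "Hm1_norm \<Omega> \<psi> = (SUP v\<in>{v \<in> H10 \<Omega>. H10_norm \<Omega> v \<le> 1}. \<bar>\<psi> v\<bar>)"

text \<open>The library's \<open>convex\<close> needs a type of class \<open>real_vector\<close>, which a function type is not.\<close>

definition convex_functionals :: "('b \<Rightarrow> real) set \<Rightarrow> bool" where
  "convex_functionals S \<longleftrightarrow>
     (\<forall>\<phi>\<in>S. \<forall>\<psi>\<in>S. \<forall>s\<ge>0. \<forall>t\<ge>0. s + t = 1 \<longrightarrow> (\<lambda>v. s * \<phi> v + t * \<psi> v) \<in> S)"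

definition dense_in_Hm1 :: "'a::euclidean_space set \<Rightarrow> (('a \<Rightarrow> real) \<Rightarrow> real) set \<Rightarrow> bool" where
  "dense_in_Hm1 \<Omega> S \<longleftrightarrow>
     (\<forall>\<psi>\<in>Hm1 \<Omega>. \<forall>\<epsilon>>0. \<exists>\<phi>\<in>S. Hm1_norm \<Omega> (\<lambda>v. \<phi> v - \<psi> v) < \<epsilon>)"

text \<open>The factor \<open>t\<close> makes the value \<open>0\<close> at \<open>t = 0\<close>, also for \<open>s < 2\<close> and for \<open>s = 2\<close>.\<close>

definition signed_pow :: "real \<Rightarrow> real \<Rightarrow> real" where
  "signed_pow s t = \<bar>t\<bar> powr (s - 2) * t"

definition weak_solution ::
    "(real^'n) set \<Rightarrow> real \<Rightarrow> real \<Rightarrow> real \<Rightarrow> real \<Rightarrow> real \<Rightarrow>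
     ((real^'n \<Rightarrow> real) \<Rightarrow> real) \<Rightarrow> (real^'n \<Rightarrow> real) \<Rightarrow> bool" where
  "weak_solution \<Omega> p q l \<mu> \<nu> \<phi> u \<longleftrightarrow> u \<in> H10 \<Omega> \<and>
     (\<forall>v\<in>H10 \<Omega>.
        (\<integral>x. grad \<Omega> u x \<bullet> grad \<Omega> v x \<partial>lebesgue_on \<Omega>)
        - l * (\<integral>x. (\<bar>u x\<bar> powr (4 / (real CARD('n) - 2)) * u x
                      + \<nu> * signed_pow q (u x) + \<mu> * signed_pow p (u x)) * v x
                 \<partial>lebesgue_on \<Omega>)
        - l * \<phi> v = 0)"

end

theory Submission
  imports Defs "HOL-Complex_Analysis.Great_Picard"
begin

text \<open>On the ball of radius \<open>r\<close> in \<open>H10\<close> and for small \<open>\<lambda>\<close>, the energy is uniformly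
  midpoint convex up to a term that is Lipschitz in the \<open>L\<^sup>2\<close>-norm (the sublinear power), so by the
  Rellich theorem minimizing sequences have convergent subsequences although the exponent
  \<open>2n/(n - 2)\<close> is critical. On the sphere the energy is positive for small \<open>\<lambda>\<close>, hence
  minimizers over the ball are interior and are weak solutions. Without the linear term the energy
  is even and, because \<open>q < 2\<close>, has a negative infimum \<open>c\<close>; evenness makes the infimum of every
  linear perturbation at most \<open>c\<close>. If all perturbed minimizers were unique, a minimax argument in
  the spirit of Ricceri would produce a minimizer of norm \<open>0\<close>, contradicting \<open>c < 0\<close>. So some
  small linear perturbation from \<open>S\<close> has two minimizers.\<close>

section \<open>Power inequalities\<close>

text \<open>\<open>S\<close> is only convex and dense: neither a best perturbation nor the zero
  functional need belong to it. Hence the minimax step works on convex compact sets spanned by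
  finitely many perturbations, which convexity keeps inside \<open>S\<close>. Density enters twice:
  near the zero functional, and near a negative multiple of the inner product with \<open>u\<close>,
  to get a perturbation of norm below \<open>r\<close> whose value at \<open>u\<close> is at most
  -(r/4) times the norm of \<open>u\<close>. The threshold for lambda depends neither on mu nor on
  \<open>S\<close>. On the ball, second differences of the powers with exponents 2n/(n-2) and
  \<open>p\<close> are at most a constant times the squared distance; this follows from the Sobolev
  inequality and homogeneity alone, and for small lambda costs at most half of the convexity in the
  parallelogram identity. The power \<open>q < 2\<close> has no quadratic bound near 0, so its
  defect is measured in a weaker norm. Perturbations enter as lambda times a functional of norm
  below \<open>r\<close>, so on the ball they are at most lambda r^2, the amount by which the energy
  has to be positive on the sphere.\<close>

lemma signed_pow_sgn: "signed_pow a t = sgn t * \<bar>t\<bar> powr (a - 1)"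
proof (cases "t = 0")
  case False
  have "\<bar>t\<bar> powr (a - 1) = \<bar>t\<bar> powr ((a - 2) + 1)" by simp
  also have "\<dots> = \<bar>t\<bar> powr (a - 2) * \<bar>t\<bar>"
    using False by (subst powr_add) simp
  finally show ?thesis using mult_sgn_abs[of t] by (simp add: signed_pow_def mult_ac)
qed (simp add: signed_pow_def)

lemma abs_signed_pow: "\<bar>signed_pow a t\<bar> = \<bar>t\<bar> powr (a - 1)"
  by (cases "t = 0") (auto simp: signed_pow_sgn abs_mult abs_sgn_eq)

text \<open>On each open half-line this is the power rule; at 0 the difference quotient has modulus
  at most |h| powr (a - 1), which tends to 0 because a > 1.\<close>

lemma DERIV_abs_powr:
  assumes "1 < a"
  shows "((\<lambda>t. \<bar>t\<bar> powr a) has_real_derivative a * signed_pow a t) (at t)"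
proof (cases t "0::real" rule: linorder_cases)
  case equal
  have "((\<lambda>h. \<bar>h\<bar> powr a / h) \<longlongrightarrow> 0) (at 0)"
  proof (rule Lim_null_comparison)
    show "\<forall>\<^sub>F h in at 0. norm (\<bar>h\<bar> powr a / h) \<le> \<bar>h\<bar> powr (a - 1)"
      by (auto simp: eventually_at powr_diff intro!: exI[of _ 1])
    show "((\<lambda>h::real. \<bar>h\<bar> powr (a - 1)) \<longlongrightarrow> 0) (at 0)"
      using assms by (auto intro!: tendsto_eq_intros simp: )
  qed
  then show ?thesis by (simp add: equal has_field_derivative_iff signed_pow_def)
next
  case less
  have "((\<lambda>t. (- t) powr a) has_real_derivative a * signed_pow a t) (at t)"
    using less by (auto intro!: derivative_eq_intros simp: signed_pow_sgn powr_diff divide_simps)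
  then show ?thesis
    by (rule has_field_derivative_transform_within_open[where S="{..<0}"]) (use less in auto)
next
  case greater
  have "((\<lambda>t. t powr a) has_real_derivative a * signed_pow a t) (at t)"
    using greater by (auto intro!: derivative_eq_intros simp: signed_pow_sgn powr_diff divide_simps)
  then show ?thesis
    by (rule has_field_derivative_transform_within_open[where S="{0<..}"]) (use greater in auto)
qed

lemma isCont_signed_pow: "1 < a \<Longrightarrow> isCont (signed_pow a) t"
proof (cases "t = 0")
  case True
  assume "1 < a"
  have "(signed_pow a \<longlongrightarrow> 0) (at 0)"
  proof (rule Lim_null_comparison)
    show "\<forall>\<^sub>F h in at 0. norm (signed_pow a h) \<le> \<bar>h\<bar> powr (a - 1)"
      by (simp add: abs_signed_pow)
    show "((\<lambda>h::real. \<bar>h\<bar> powr (a - 1)) \<longlongrightarrow> 0) (at 0)"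
      using \<open>1 < a\<close> by (auto intro!: tendsto_eq_intros simp: )
  qed
  then show ?thesis using True by (simp add: isCont_def signed_pow_def)
next
  case False
  then show ?thesis unfolding signed_pow_def by (intro continuous_intros) auto
qed

lemma continuous_on_signed_pow [continuous_intros]:
  "1 < a \<Longrightarrow> continuous_on S f \<Longrightarrow> continuous_on S (\<lambda>x. signed_pow a (f x))"
  using continuous_on_compose2[of UNIV "signed_pow a" S f] isCont_signed_pow
  by (auto intro: continuous_at_imp_continuous_on)

lemma measurable_signed_pow [measurable]:
  "f \<in> borel_measurable M \<Longrightarrow> (\<lambda>x. signed_pow a (f x)) \<in> borel_measurable M"
  unfolding signed_pow_def by measurable

lemma abs_powr_diff_le:
  fixes x y :: real
  assumes "1 \<le> a"
  shows "\<bar>\<bar>x\<bar> powr a - \<bar>y\<bar> powr a\<bar> \<le> a * (\<bar>x\<bar> + \<bar>y\<bar>) powr (a - 1) * \<bar>x - y\<bar>"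
proof (cases "a = 1")
  case True
  then show ?thesis by (cases "x = 0 \<and> y = 0") (auto simp: powr_zero_eq_one)
next
  case False
  with assms have a: "1 < a" by simp
  have *: "norm (\<bar>x\<bar> powr a - \<bar>y\<bar> powr a) \<le> (a * (\<bar>x\<bar> + \<bar>y\<bar>) powr (a - 1)) * norm (x - y)"
  proof (rule field_differentiable_bound[where S="{min x y..max x y}" and f'="\<lambda>t. a * signed_pow a t"])
    fix z assume z: "z \<in> {min x y..max x y}"
    show "((\<lambda>t. \<bar>t\<bar> powr a) has_real_derivative a * signed_pow a z) (at z within {min x y..max x y})"
      using DERIV_abs_powr[OF a] has_field_derivative_at_within by blast
    have "\<bar>z\<bar> \<le> \<bar>x\<bar> + \<bar>y\<bar>" using z by auto
    then show "norm (a * signed_pow a z) \<le> a * (\<bar>x\<bar> + \<bar>y\<bar>) powr (a - 1)"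
      using a by (auto simp: abs_mult abs_signed_pow intro!: powr_mono2)
  qed auto
  then show ?thesis by simp
qed

text \<open>For equal signs the mean value theorem applies to t powr (a - 1); for different signs |x
  - y| = |x| + |y|, and both values are compared with the value at 0. The case a = 2 is separate
  because \<open>DERIV_abs_powr\<close> is applied with exponent a - 1 > 1.\<close>

lemma signed_pow_Lipschitz:
  fixes x y :: real
  assumes "2 \<le> a" "\<bar>x\<bar> \<le> M" "\<bar>y\<bar> \<le> M"
  shows "\<bar>signed_pow a x - signed_pow a y\<bar> \<le> a * M powr (a - 2) * \<bar>x - y\<bar>"
proof (cases "a = 2")
  case True
  have [simp]: "signed_pow 2 t = t" for t by (cases "t = 0") (auto simp: signed_pow_def)
  \<comment> \<open>\<open>0 powr 0\<close> is 0, so the factor \<open>M powr (a - 2)\<close>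
    vanishes for M = 0; but then x = y = 0.\<close>
  show ?thesis using assms by (cases "M = 0") (auto simp: True)
next
  case False
  with assms have a: "a > 2" by simp
  have *: "\<bar>u powr (a - 1) - v powr (a - 1)\<bar> \<le> (a - 1) * M powr (a - 2) * \<bar>u - v\<bar>"
    if "0 \<le> u" "0 \<le> v" "u \<le> M" "v \<le> M" for u v
  proof -
    have *: "norm (\<bar>u\<bar> powr (a - 1) - \<bar>v\<bar> powr (a - 1)) \<le> ((a - 1) * M powr (a - 2)) * norm (u - v)"
    proof (rule field_differentiable_bound[where S="{min u v..max u v}" and f'="\<lambda>t. (a - 1) * signed_pow (a - 1) t"])
      fix z assume z: "z \<in> {min u v..max u v}"
      show "((\<lambda>t. \<bar>t\<bar> powr (a - 1)) has_real_derivative (a - 1) * signed_pow (a - 1) z) (at z within {min u v..max u v})"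
        using DERIV_abs_powr[of "a - 1"] has_field_derivative_at_within a by (metis less_diff_eq one_add_one)
      have "\<bar>z\<bar> \<le> M" using z that by auto
      then show "norm ((a - 1) * signed_pow (a - 1) z) \<le> (a - 1) * M powr (a - 2)"
        using a by (auto simp: abs_mult abs_signed_pow intro!: powr_mono2)
    qed auto
    then show ?thesis using that by simp
  qed
  have M: "0 \<le> M" using assms by linarith
  have le: "(a - 1) * M powr (a - 2) * \<bar>d\<bar> \<le> a * M powr (a - 2) * \<bar>d\<bar>" for d :: real
    by (intro mult_right_mono) (use a in auto)
  show ?thesis
  proof (cases "sgn x = sgn y")
    case True
    have "\<bar>signed_pow a x - signed_pow a y\<bar> \<le> \<bar>\<bar>x\<bar> powr (a - 1) - \<bar>y\<bar> powr (a - 1)\<bar>"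
      by (simp add: signed_pow_sgn True flip: right_diff_distrib) (simp add: abs_mult abs_sgn_eq)
    also have "\<dots> \<le> (a - 1) * M powr (a - 2) * \<bar>\<bar>x\<bar> - \<bar>y\<bar>\<bar>" using assms by (intro *) auto
    also have "\<bar>\<bar>x\<bar> - \<bar>y\<bar>\<bar> = \<bar>x - y\<bar>" using True by (auto simp: sgn_if split: if_splits)
    finally show ?thesis using le[of "x - y"] by linarith
  next
    case False
    have "\<bar>signed_pow a x - signed_pow a y\<bar> \<le> \<bar>x\<bar> powr (a - 1) + \<bar>y\<bar> powr (a - 1)"
      using abs_triangle_ineq4[of "signed_pow a x" "signed_pow a y"] by (simp add: abs_signed_pow)
    also have "\<dots> \<le> (a - 1) * M powr (a - 2) * \<bar>x\<bar> + (a - 1) * M powr (a - 2) * \<bar>y\<bar>"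
      using *[of "\<bar>x\<bar>" 0] *[of "\<bar>y\<bar>" 0] assms M a by (auto intro!: add_mono)
    also have "\<dots> = (a - 1) * M powr (a - 2) * \<bar>x - y\<bar>"
      using False by (auto simp: sgn_if algebra_simps split: if_splits)
    finally show ?thesis using le[of "x - y"] by linarith
  qed
qed

text \<open>A second difference, estimated without a second derivative: the mean value theorem on
  both halves of the segment leaves a difference of two values of the derivative, which is Lipschitz
  by \<open>signed_pow_Lipschitz\<close>. The two intermediate points lie within |x - y| of the
  midpoint, so at most 2 |x - y| apart.\<close>

lemma abs_powr_midpoint:
  fixes x y :: real
  assumes "2 \<le> a"
  shows "\<bar>\<bar>x\<bar> powr a + \<bar>y\<bar> powr a - 2 * \<bar>(x + y) / 2\<bar> powr a\<bar>
    \<le> a\<^sup>2 * ((\<bar>x\<bar> + \<bar>y\<bar>) powr (a - 2) * \<bar>x - y\<bar>\<^sup>2)"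
proof -
  define M where "M = \<bar>x\<bar> + \<bar>y\<bar>"
  define m where "m = (x + y) / 2"
  have m2: "2 * m = x + y" by (simp add: m_def)
  have mvt: "\<exists>z. \<bar>z\<bar> \<le> M \<and> \<bar>z - m\<bar> \<le> \<bar>x - y\<bar> \<and> \<bar>w\<bar> powr a - \<bar>m\<bar> powr a = (w - m) * (a * signed_pow a z)"
    if w: "w = x \<or> w = y" for w
  proof (cases w m rule: linorder_cases)
    case less
    from MVT2[OF less, of "\<lambda>t. \<bar>t\<bar> powr a" "\<lambda>t. a * signed_pow a t"] obtain z where
      "w < z" "z < m" "\<bar>m\<bar> powr a - \<bar>w\<bar> powr a = (m - w) * (a * signed_pow a z)"
      using DERIV_abs_powr assms by (metis less_le_trans one_less_numeral_iff semiring_norm(76))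
    moreover have "\<bar>z\<bar> \<le> M" "\<bar>z - m\<bar> \<le> \<bar>x - y\<bar>"
      using m2 w \<open>w < z\<close> \<open>z < m\<close>  by (auto simp: M_def abs_if)
    ultimately show ?thesis by (intro exI[of _ z]) (simp add: algebra_simps)
  next
    case equal
    moreover have "\<bar>m\<bar> \<le> M" by (simp add: M_def m_def)
    ultimately show ?thesis by (intro exI[of _ m]) simp
  next
    case greater
    from MVT2[OF greater, of "\<lambda>t. \<bar>t\<bar> powr a" "\<lambda>t. a * signed_pow a t"] obtain z where
      "m < z" "z < w" "\<bar>w\<bar> powr a - \<bar>m\<bar> powr a = (w - m) * (a * signed_pow a z)"
      using DERIV_abs_powr assms by (metis less_le_trans one_less_numeral_iff semiring_norm(76))
    moreover have "\<bar>z\<bar> \<le> M" "\<bar>z - m\<bar> \<le> \<bar>x - y\<bar>"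
      using m2 w \<open>m < z\<close> \<open>z < w\<close>  by (auto simp: M_def abs_if)
    ultimately show ?thesis by (intro exI[of _ z]) simp
  qed
  obtain z1 z2 where z1: "\<bar>z1\<bar> \<le> M" "\<bar>z1 - m\<bar> \<le> \<bar>x - y\<bar>" "\<bar>x\<bar> powr a - \<bar>m\<bar> powr a = (x - m) * (a * signed_pow a z1)"
    and z2: "\<bar>z2\<bar> \<le> M" "\<bar>z2 - m\<bar> \<le> \<bar>x - y\<bar>" "\<bar>y\<bar> powr a - \<bar>m\<bar> powr a = (y - m) * (a * signed_pow a z2)"
    using mvt by blast
  have "\<bar>x\<bar> powr a + \<bar>y\<bar> powr a - 2 * \<bar>m\<bar> powr a = ((x - y) / 2) * a * (signed_pow a z1 - signed_pow a z2)"
    using z1(3) z2(3) by (simp add: m_def field_simps)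
  then have "\<bar>\<bar>x\<bar> powr a + \<bar>y\<bar> powr a - 2 * \<bar>m\<bar> powr a\<bar> = \<bar>((x - y) / 2) * a * (signed_pow a z1 - signed_pow a z2)\<bar>"
    by (rule arg_cong)
  also have "\<dots> = \<bar>x - y\<bar> / 2 * a * \<bar>signed_pow a z1 - signed_pow a z2\<bar>"
    using assms by (simp add: abs_mult)
  also have "\<dots> \<le> \<bar>x - y\<bar> / 2 * a * (a * M powr (a - 2) * \<bar>z1 - z2\<bar>)"
    using assms z1 z2 by (intro mult_left_mono signed_pow_Lipschitz) auto
  also have "\<dots> \<le> \<bar>x - y\<bar> / 2 * a * (a * M powr (a - 2) * (2 * \<bar>x - y\<bar>))"
  proof -
    have "\<bar>z1 - z2\<bar> \<le> 2 * \<bar>x - y\<bar>"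
      using abs_triangle_ineq4[of "z1 - m" "z2 - m"] z1(2) z2(2) by simp
    then show ?thesis using assms by (intro mult_left_mono) auto
  qed
  also have "\<dots> = a\<^sup>2 * (M powr (a - 2) * \<bar>x - y\<bar>\<^sup>2)"
    unfolding power2_eq_square by (simp only: mult_ac times_divide_eq_left times_divide_eq_right)
  finally show ?thesis by (simp only: M_def m_def)
qed

text \<open>The larger of the two numbers absorbs the other one. This crude form of Young's
  inequality suffices because constants are recovered later by scaling.\<close>

lemma powr_mult_le_add_powr:
  fixes w z a b :: real
  assumes "0 \<le> w" "0 \<le> z" "0 < b" "b \<le> a"
  shows "w powr (a - b) * z powr b \<le> w powr a + z powr a"
proof (cases "w \<le> z")
  case True
  have "w powr (a - b) * z powr b \<le> z powr (a - b) * z powr b"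
    using True assms by (intro mult_right_mono powr_mono2) auto
  also have "\<dots> = z powr a" using assms by (simp flip: powr_add)
  finally show ?thesis using powr_ge_zero[of w a] by linarith
next
  case False
  have "w powr (a - b) * z powr b \<le> w powr (a - b) * w powr b"
    using False assms by (intro mult_left_mono powr_mono2) auto
  also have "\<dots> = w powr a" using assms by (simp flip: powr_add)
  finally show ?thesis using powr_ge_zero[of z a] by linarith
qed

lemma add_powr_le:
  fixes x y a :: real
  assumes "0 \<le> x" "0 \<le> y" "0 \<le> a"
  shows "(x + y) powr a \<le> 2 powr a * (x powr a + y powr a)"
proof -
  have "(x + y) powr a \<le> (2 * max x y) powr a" using assms by (intro powr_mono2) auto
  also have "\<dots> = 2 powr a * (max x y) powr a" using assms by (simp add: powr_mult)
  also have "\<dots> \<le> 2 powr a * (x powr a + y powr a)" by (intro mult_left_mono) (auto simp: max_def)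
  finally show ?thesis .
qed

lemma Cauchy_Schwarz_integral:
  fixes f g :: "'a \<Rightarrow> real"
  assumes [measurable]: "f \<in> borel_measurable M" "g \<in> borel_measurable M"
    and i: "integrable M (\<lambda>x. (f x)\<^sup>2)" "integrable M (\<lambda>x. (g x)\<^sup>2)"
  shows "integrable M (\<lambda>x. f x * g x)"
    and "(\<integral>x. \<bar>f x * g x\<bar> \<partial>M) \<le> sqrt (\<integral>x. (f x)\<^sup>2 \<partial>M) * sqrt (\<integral>x. (g x)\<^sup>2 \<partial>M)"
    and "\<bar>\<integral>x. f x * g x \<partial>M\<bar> \<le> sqrt (\<integral>x. (f x)\<^sup>2 \<partial>M) * sqrt (\<integral>x. (g x)\<^sup>2 \<partial>M)"
proof -
  have b: "\<bar>a * b\<bar> \<le> a\<^sup>2 + b\<^sup>2" for a b :: real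
    using sum_squares_bound[of "\<bar>a\<bar>" "\<bar>b\<bar>"] abs_ge_zero[of "a * b"] by (simp only: abs_mult power2_abs)
  show 1: "integrable M (\<lambda>x. f x * g x)"
    by (rule Bochner_Integration.integrable_bound[of M "\<lambda>x. (f x)\<^sup>2 + (g x)\<^sup>2"]) (use i b in \<open>auto\<close>)
  have i1: "integrable M (\<lambda>x. \<bar>f x\<bar> * \<bar>g x\<bar>)"
    using integrable_abs[OF 1] by (simp add: abs_mult)
  have "ennreal ((\<integral>x. \<bar>f x * g x\<bar> \<partial>M)\<^sup>2) = (\<integral>\<^sup>+x. ennreal \<bar>f x\<bar> * ennreal \<bar>g x\<bar> \<partial>M)\<^sup>2"
    using i1 by (subst ennreal_power[symmetric]) (auto simp: nn_integral_eq_integral abs_mult simp flip: ennreal_mult)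
  also have "\<dots> \<le> (\<integral>\<^sup>+x. (ennreal \<bar>f x\<bar>)\<^sup>2 \<partial>M) * (\<integral>\<^sup>+x. (ennreal \<bar>g x\<bar>)\<^sup>2 \<partial>M)"
    by (intro Cauchy_Schwarz_nn_integral) auto
  also have "\<dots> = ennreal ((\<integral>x. (f x)\<^sup>2 \<partial>M) * (\<integral>x. (g x)\<^sup>2 \<partial>M))"
    using i by (simp add: ennreal_power nn_integral_eq_integral ennreal_mult)
  finally have 2: "(\<integral>x. \<bar>f x * g x\<bar> \<partial>M)\<^sup>2 \<le> (\<integral>x. (f x)\<^sup>2 \<partial>M) * (\<integral>x. (g x)\<^sup>2 \<partial>M)"
    by (subst (asm) ennreal_le_iff) auto
  show 3: "(\<integral>x. \<bar>f x * g x\<bar> \<partial>M) \<le> sqrt (\<integral>x. (f x)\<^sup>2 \<partial>M) * sqrt (\<integral>x. (g x)\<^sup>2 \<partial>M)"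
    using real_le_rsqrt[OF 2] by (simp add: real_sqrt_mult)
  show "\<bar>\<integral>x. f x * g x \<partial>M\<bar> \<le> sqrt (\<integral>x. (f x)\<^sup>2 \<partial>M) * sqrt (\<integral>x. (g x)\<^sup>2 \<partial>M)"
    using 3 integral_abs_bound[of M "\<lambda>x. f x * g x"] by linarith
qed

section \<open>The inequalities of Hoelder and Sobolev\<close>

text \<open>With \<open>epow x 0 = 1\<close> also for \<open>x = 0\<close> and \<open>x = \<infinity>\<close>, nonnegative exponents add without
  side conditions on \<open>x\<close>.\<close>

definition epow :: "ennreal \<Rightarrow> real \<Rightarrow> ennreal" where
  "epow x p = (if p = 0 then 1 else if x = top then top else ennreal (enn2real x powr p))"

lemma epow_0 [simp]: "epow x 0 = 1"
  by (simp add: epow_def)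

lemma epow_zero [simp]: "p \<noteq> 0 \<Longrightarrow> epow 0 p = 0"
  by (simp add: epow_def)

lemma epow_top [simp]: "p \<noteq> 0 \<Longrightarrow> epow top p = top"
  by (simp add: epow_def)

lemma epow_ennreal: "0 \<le> x \<Longrightarrow> p \<noteq> 0 \<Longrightarrow> epow (ennreal x) p = ennreal (x powr p)"
  by (simp add: epow_def)

lemma epow_add: "0 \<le> a \<Longrightarrow> 0 \<le> b \<Longrightarrow> epow x (a + b) = epow x a * epow x b"
  by (cases x) (auto simp: epow_def powr_add ennreal_mult'' ennreal_top_mult ennreal_mult_top)

lemma epow_mono: "x \<le> y \<Longrightarrow> 0 \<le> p \<Longrightarrow> epow x p \<le> epow y p"
  by (cases x; cases y) (auto simp: epow_def top_unique intro!: powr_mono2 ennreal_leI split: if_splits)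

lemma measurable_epow [measurable]:
  assumes [measurable]: "f \<in> borel_measurable M"
  shows "(\<lambda>x. epow (f x) p) \<in> borel_measurable M"
  unfolding epow_def by measurable

lemma epow_eq_0: "p > 0 \<Longrightarrow> epow x p = 0 \<longleftrightarrow> x = 0"
  by (cases x) (auto simp: epow_def)

lemma epow_mult_left: "0 \<le> c \<Longrightarrow> 0 < p \<Longrightarrow> 0 < c \<Longrightarrow> epow (ennreal c * x) p = ennreal (c powr p) * epow x p"
proof (cases x)
  case (real r)
  assume c: "0 \<le> c" "0 < p" "0 < c"
  have "ennreal c * x = ennreal (c * r)" using real c by (simp add: ennreal_mult)
  then have "epow (ennreal c * x) p = ennreal ((c * r) powr p)" using real c by (simp add: epow_ennreal)
  also have "\<dots> = ennreal (c powr p) * ennreal (r powr p)" using real c by (simp add: powr_mult ennreal_mult)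
  finally show ?thesis using real c by (simp add: epow_ennreal)
qed (simp add: epow_def ennreal_mult_top)

section \<open>Hoelder's inequality for finitely many factors\<close>

lemma prod_mono_ennreal:
  fixes f g :: "'i \<Rightarrow> ennreal"
  shows "(\<And>i. i \<in> A \<Longrightarrow> f i \<le> g i) \<Longrightarrow> prod f A \<le> prod g A"
  by (induction A rule: infinite_finite_induct) (auto intro: mult_mono)

text \<open>Jensen's inequality for the exponential function at the logarithms of the x j; a
  vanishing x j makes the left side 0.\<close>

lemma weighted_arith_geom_mean:
  fixes x p :: "'i \<Rightarrow> real"
  assumes "finite J" "\<And>j. j \<in> J \<Longrightarrow> 0 < p j" "(\<Sum>j\<in>J. p j) = 1" "\<And>j. j \<in> J \<Longrightarrow> 0 \<le> x j"
  shows "(\<Prod>j\<in>J. x j powr p j) \<le> (\<Sum>j\<in>J. p j * x j)"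
proof (cases "\<exists>j\<in>J. x j = 0")
  case True
  then have "(\<Prod>j\<in>J. x j powr p j) = 0" using assms(1) by (auto intro!: prod_zero)
  also have "\<dots> \<le> (\<Sum>j\<in>J. p j * x j)"
    using assms by (intro sum_nonneg mult_nonneg_nonneg) (auto simp: less_imp_le)
  finally show ?thesis .
next
  case False
  then have pos: "\<And>j. j \<in> J \<Longrightarrow> x j > 0" using assms(4) by force
  have "(\<Prod>j\<in>J. x j powr p j) = exp (\<Sum>j\<in>J. p j *\<^sub>R ln (x j))"
    using pos assms(1) by (simp add: exp_sum) (intro prod.cong, auto simp: powr_def less_imp_neq[symmetric])
  also have "\<dots> \<le> (\<Sum>j\<in>J. p j * exp (ln (x j)))"
    using assms exp_convex by (intro convex_on_sum[where C=UNIV]) (auto simp: less_imp_le)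
  also have "\<dots> = (\<Sum>j\<in>J. p j * x j)"
    using pos by (intro sum.cong) auto
  finally show ?thesis .
qed

lemma weighted_arith_geom_mean_ennreal:
  fixes x :: "'i \<Rightarrow> ennreal"
  assumes "finite J" "\<And>j. j \<in> J \<Longrightarrow> 0 < p j" "(\<Sum>j\<in>J. p j) = 1"
  shows "(\<Prod>j\<in>J. epow (x j) (p j)) \<le> (\<Sum>j\<in>J. ennreal (p j) * x j)"
proof (cases "\<exists>j\<in>J. x j = top")
  case True
  then obtain j where j: "j \<in> J" "x j = top" by auto
  have "(\<Sum>j\<in>J. ennreal (p j) * x j) = top"
    using assms(1) assms(2)[OF j(1)] j
    by (auto simp: ennreal_mult_top ennreal_eq_0_iff intro!: bexI[of _ j])
  then show ?thesis by simp
next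
  case False
  define y where "y j = enn2real (x j)" for j
  have x: "x j = ennreal (y j)" if "j \<in> J" for j
    using that False by (auto simp: y_def less_top)
  have y: "0 \<le> y j" for j by (simp add: y_def)
  have "(\<Prod>j\<in>J. epow (x j) (p j)) = (\<Prod>j\<in>J. ennreal (y j powr p j))"
  proof (intro prod.cong refl)
    fix j assume "j \<in> J"
    then show "epow (x j) (p j) = ennreal (y j powr p j)"
      using epow_ennreal[of "y j" "p j"] x[of j] y assms(2)[of j] by auto
  qed
  also have "\<dots> = ennreal (\<Prod>j\<in>J. y j powr p j)" by (simp add: prod_ennreal)
  also have "\<dots> \<le> ennreal (\<Sum>j\<in>J. p j * y j)"
    using assms by (intro ennreal_leI weighted_arith_geom_mean) (auto simp: y_def)
  also have "\<dots> = (\<Sum>j\<in>J. ennreal (p j * y j))"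
    using assms by (subst sum_ennreal) (auto simp: y_def less_imp_le)
  also have "\<dots> = (\<Sum>j\<in>J. ennreal (p j) * x j)"
    using x assms by (intro sum.cong) (auto simp: ennreal_mult y_def less_imp_le)
  finally show ?thesis .
qed

text \<open>After dividing every f j by its integral, the weighted arithmetic-geometric mean
  inequality holds pointwise, and its right side integrates to the sum of the weights, which is 1.
  If some integral is 0 the product vanishes almost everywhere; if none is 0 and one is infinite,
  the right side is infinite.\<close>

lemma Hoelder_pos:
  fixes f :: "'i \<Rightarrow> 'a \<Rightarrow> ennreal"
  assumes J: "finite J" "\<And>j. j \<in> J \<Longrightarrow> 0 < p j" "(\<Sum>j\<in>J. p j) = 1"
    and [measurable]: "\<And>j. j \<in> J \<Longrightarrow> f j \<in> borel_measurable M"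
  shows "(\<integral>\<^sup>+x. (\<Prod>j\<in>J. epow (f j x) (p j)) \<partial>M) \<le> (\<Prod>j\<in>J. epow (\<integral>\<^sup>+x. f j x \<partial>M) (p j))"
proof -
  define I where "I j = (\<integral>\<^sup>+x. f j x \<partial>M)" for j
  consider (zero) j where "j \<in> J" "I j = 0" | (top) j where "j \<in> J" "I j = top" "\<forall>j\<in>J. I j \<noteq> 0"
    | (fin) "\<forall>j\<in>J. I j \<noteq> 0 \<and> I j \<noteq> top" by blast
  then show ?thesis
  proof cases
    case zero
    then have "AE x in M. f j x = 0"
      by (simp add: I_def nn_integral_0_iff_AE)
    then have "AE x in M. (\<Prod>j\<in>J. epow (f j x) (p j)) = 0"
    proof eventually_elim
      case (elim x)
      with zero J show ?case by (auto intro!: prod_zero bexI[of _ j] simp: less_imp_neq[symmetric])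
    qed
    then have "(\<integral>\<^sup>+x. (\<Prod>j\<in>J. epow (f j x) (p j)) \<partial>M) = 0"
      by (subst nn_integral_0_iff_AE) auto
    then show ?thesis by simp
  next
    case top
    have "(\<Prod>j\<in>J. epow (I j) (p j)) = epow (I j) (p j) * (\<Prod>j\<in>J-{j}. epow (I j) (p j))"
      using top J by (simp add: prod.remove)
    also have "\<dots> = top"
      using top J by (auto simp: less_imp_neq[symmetric] ennreal_top_mult epow_eq_0)
    finally show ?thesis by (simp add: I_def)
  next
    case fin
    define c where "c j = enn2real (I j)" for j
    have c: "I j = ennreal (c j)" "c j > 0" if "j \<in> J" for j
      using that fin by (auto simp: c_def less_top enn2real_positive_iff zero_less_iff_neq_zero)
    have *: "(\<Prod>j\<in>J. epow (f j x) (p j))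
      \<le> (\<Prod>j\<in>J. epow (I j) (p j)) * (\<Sum>j\<in>J. ennreal (p j) * (ennreal (1 / c j) * f j x))" for x
    proof -
      have "(\<Prod>j\<in>J. epow (f j x) (p j)) = (\<Prod>j\<in>J. epow (I j) (p j) * epow (ennreal (1 / c j) * f j x) (p j))"
      proof (intro prod.cong refl)
        fix j assume j: "j \<in> J"
        have "f j x = ennreal (c j) * (ennreal (1 / c j) * f j x)"
          using c[OF j] by (simp add: mult.assoc[symmetric] flip: ennreal_mult)
        also have "epow \<dots> (p j) = ennreal (c j powr p j) * epow (ennreal (1 / c j) * f j x) (p j)"
          using c[OF j] J(2)[OF j] by (intro epow_mult_left) auto
        also have "ennreal (c j powr p j) = epow (I j) (p j)"
          using c[OF j] J(2)[OF j] by (simp add: epow_ennreal)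
        finally show "epow (f j x) (p j) = epow (I j) (p j) * epow (ennreal (1 / c j) * f j x) (p j)" .
      qed
      also have "\<dots> = (\<Prod>j\<in>J. epow (I j) (p j)) * (\<Prod>j\<in>J. epow (ennreal (1 / c j) * f j x) (p j))"
        by (simp add: prod.distrib)
      also have "\<dots> \<le> (\<Prod>j\<in>J. epow (I j) (p j)) * (\<Sum>j\<in>J. ennreal (p j) * (ennreal (1 / c j) * f j x))"
        using J by (intro mult_left_mono weighted_arith_geom_mean_ennreal) auto
      finally show ?thesis .
    qed
    have "(\<integral>\<^sup>+x. (\<Prod>j\<in>J. epow (f j x) (p j)) \<partial>M) \<le>
       (\<integral>\<^sup>+x. (\<Prod>j\<in>J. epow (I j) (p j)) * (\<Sum>j\<in>J. ennreal (p j) * (ennreal (1 / c j) * f j x)) \<partial>M)"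
      by (intro nn_integral_mono *)
    also have "\<dots> = (\<Prod>j\<in>J. epow (I j) (p j)) * (\<Sum>j\<in>J. ennreal (p j) * (ennreal (1 / c j) * I j))"
      by (simp add: nn_integral_cmult nn_integral_sum I_def)
    also have "(\<Sum>j\<in>J. ennreal (p j) * (ennreal (1 / c j) * I j)) = (\<Sum>j\<in>J. ennreal (p j))"
    proof (intro sum.cong refl)
      fix j assume j: "j \<in> J"
      have "ennreal (1 / c j) * I j = 1" using c[OF j] by (simp flip: ennreal_mult)
      then show "ennreal (p j) * (ennreal (1 / c j) * I j) = ennreal (p j)" by simp
    qed
    also have "\<dots> = 1" using J by (subst sum_ennreal) (auto simp: less_imp_le)
    finally show ?thesis by (simp add: I_def)
  qed
qed

lemma Hoelder:
  fixes f :: "'i \<Rightarrow> 'a \<Rightarrow> ennreal"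
  assumes J: "finite J" "\<And>j. j \<in> J \<Longrightarrow> 0 \<le> p j" "(\<Sum>j\<in>J. p j) = 1"
    and [measurable]: "\<And>j. j \<in> J \<Longrightarrow> f j \<in> borel_measurable M"
  shows "(\<integral>\<^sup>+x. (\<Prod>j\<in>J. epow (f j x) (p j)) \<partial>M) \<le> (\<Prod>j\<in>J. epow (\<integral>\<^sup>+x. f j x \<partial>M) (p j))"
proof -
  define K where "K = {j\<in>J. p j \<noteq> 0}"
  have K: "finite K" "K \<subseteq> J" "\<And>j. j \<in> K \<Longrightarrow> 0 < p j" using J by (auto simp: K_def less_le)
  have s: "(\<Sum>j\<in>K. p j) = 1"
    using J by (subst J(3)[symmetric], intro sum.mono_neutral_left) (auto simp: K_def)
  have e: "(\<Prod>j\<in>J. epow (g j) (p j)) = (\<Prod>j\<in>K. epow (g j) (p j))" for g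
    using J by (intro prod.mono_neutral_right) (auto simp: K_def)
  show ?thesis unfolding e using K s by (intro Hoelder_pos) auto
qed

text \<open>For \<open>p = 1 / (card I - 1)\<close> the first factor disappears and this is the inequality behind
  the embedding of \<open>W\<^sup>1\<^sup>,\<^sup>1\<close>. The first factor makes smaller \<open>p\<close> admissible, so that the induction
  on \<open>I\<close> can keep \<open>p\<close> fixed.\<close>

context product_sigma_finite
begin

lemma grid_line_inequality:
  assumes "finite I" "f \<in> borel_measurable (Pi\<^sub>M I M)" "0 \<le> p" "(real (card I) - 1) * p \<le> 1"
  shows "(\<integral>\<^sup>+x. epow (f x) (1 - (real (card I) - 1) * p) * (\<Prod>i\<in>I. epow (\<integral>\<^sup>+y. f (x(i := y)) \<partial>M i) p) \<partial>Pi\<^sub>M I M)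
    \<le> epow (\<integral>\<^sup>+x. f x \<partial>Pi\<^sub>M I M) (1 + p)"
  using assms
proof (induction I arbitrary: f)
  case empty
  \<comment> \<open>Here \<open>real (card I) - 1\<close> is -1, so the first factor has exponent 1
    + p and both sides agree.\<close>
  then show ?case by (simp add: nn_integral_empty)
next
  case (insert i I)
  note fm [measurable] = insert.prems(1)
  have [simp]: "finite I" "i \<notin> I" using insert by auto
  define k where "k = real (card I)"
  have k: "real (card (insert i I)) - 1 = k" "0 \<le> k" by (auto simp: k_def)
  have kp: "k * p \<le> 1" using insert.prems k by simp
  have k1: "(k - 1) * p \<le> 1" using kp \<open>0 \<le> p\<close> by (simp add: algebra_simps)
  define g where "g x = (\<integral>\<^sup>+y. f (x(i := y)) \<partial>M i)" for x
  have g [measurable]: "g \<in> borel_measurable (Pi\<^sub>M I M)"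
    unfolding g_def by measurable
  have ne: "j \<noteq> i" if "j \<in> I" for j using that \<open>i \<notin> I\<close> by auto
  \<comment> \<open>The line integral in direction i does not depend on y and leaves the integral as
    \<open>epow (g x) p\<close>. Hoelder in y is then applied to f with exponent 1 - k p and to the
    k other line integrals with exponent p each, of total exponent 1. The powers p and 1 - k p of g
    x combine to the exponent that the induction hypothesis requires.\<close>
  have main: "(\<integral>\<^sup>+y. epow (f (x(i := y))) (1 - k * p) *
      (\<Prod>j\<in>insert i I. epow (\<integral>\<^sup>+z. f ((x(i := y))(j := z)) \<partial>M j) p) \<partial>M i)
     \<le> epow (g x) (1 - (k - 1) * p) * (\<Prod>j\<in>I. epow (\<integral>\<^sup>+z. g (x(j := z)) \<partial>M j) p)"
    if x: "x \<in> space (Pi\<^sub>M I M)" for x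
  proof -
    have m0 [measurable]: "(\<lambda>y. f (x(i := y))) \<in> borel_measurable (M i)"
      using x by measurable
    have m1 [measurable]: "(\<lambda>(y, z). f ((x(i := y))(j := z))) \<in> borel_measurable (M i \<Otimes>\<^sub>M M j)" if "j \<in> I" for j
    proof -
      have "(\<lambda>(y, z). (x(i := y))(j := z)) \<in> measurable (M i \<Otimes>\<^sub>M M j) (Pi\<^sub>M (insert i I) M)"
        unfolding split_beta'
      proof (rule measurable_PiM_single')
        show "(\<lambda>p. ((x(i := fst p))(j := snd p)) l) \<in> measurable (M i \<Otimes>\<^sub>M M j) (M l)" if "l \<in> insert i I" for l
          using that x by (cases "l = j"; cases "l = i") (auto simp: space_PiM intro!: measurable_const)
        show "(\<lambda>p l. ((x(i := fst p))(j := snd p)) l) \<in> space (M i \<Otimes>\<^sub>M M j) \<rightarrow> (\<Pi>\<^sub>E l\<in>insert i I. space (M l))"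
          using x \<open>j \<in> I\<close> by (auto simp: space_PiM space_pair_measure PiE_iff extensional_def split: if_splits)
      qed
      from measurable_compose[OF this fm] show ?thesis unfolding split_beta' .
    qed
    define F where "F j y = (if j = i then f (x(i := y)) else (\<integral>\<^sup>+z. f ((x(i := y))(j := z)) \<partial>M j))" for j y
    define e where "e j = (if j = i then 1 - k * p else p)" for j
    have Fm [measurable]: "F j \<in> borel_measurable (M i)" if "j \<in> insert i I" for j
    proof (cases "j = i")
      case False
      then have "j \<in> I" using that by auto
      from sigma_finite_measure.borel_measurable_nn_integral[OF sigma_finite_measures m1[OF this]] False
      show ?thesis unfolding F_def[abs_def] by simp
    qed (simp add: F_def[abs_def])
    have "(\<integral>\<^sup>+y. epow (f (x(i := y))) (1 - k * p) *
      (\<Prod>j\<in>insert i I. epow (\<integral>\<^sup>+z. f ((x(i := y))(j := z)) \<partial>M j) p) \<partial>M i)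
     = (\<integral>\<^sup>+y. epow (g x) p * (\<Prod>j\<in>insert i I. epow (F j y) (e j)) \<partial>M i)"
      by (intro nn_integral_cong) (auto simp: F_def e_def g_def ne mult_ac intro!: prod.cong)
    also have "\<dots> = epow (g x) p * (\<integral>\<^sup>+y. (\<Prod>j\<in>insert i I. epow (F j y) (e j)) \<partial>M i)"
      by (intro nn_integral_cmult) measurable
    also have "\<dots> \<le> epow (g x) p * (\<Prod>j\<in>insert i I. epow (\<integral>\<^sup>+y. F j y \<partial>M i) (e j))"
    proof (intro mult_left_mono Hoelder)
      have "(\<Sum>j\<in>I. e j) = (\<Sum>j\<in>I. p)" by (intro sum.cong) (auto simp: e_def ne)
      then show "sum e (insert i I) = 1" by (simp add: e_def k_def)
    qed (use kp \<open>0 \<le> p\<close> in \<open>auto simp: e_def\<close>)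
    also have "(\<Prod>j\<in>insert i I. epow (\<integral>\<^sup>+y. F j y \<partial>M i) (e j))
       = epow (g x) (1 - k * p) * (\<Prod>j\<in>I. epow (\<integral>\<^sup>+y. F j y \<partial>M i) (e j))"
      by (simp add: F_def e_def g_def)
    also have "(\<Prod>j\<in>I. epow (\<integral>\<^sup>+y. F j y \<partial>M i) (e j)) = (\<Prod>j\<in>I. epow (\<integral>\<^sup>+z. g (x(j := z)) \<partial>M j) p)"
    proof (intro prod.cong refl)
      fix j assume j: "j \<in> I"
      interpret pair_sigma_finite "M i" "M j" ..
      have "(\<integral>\<^sup>+y. F j y \<partial>M i) = (\<integral>\<^sup>+y. \<integral>\<^sup>+z. f ((x(i := y))(j := z)) \<partial>M j \<partial>M i)"
        using ne[OF j] by (simp add: F_def)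
      also have "\<dots> = (\<integral>\<^sup>+z. \<integral>\<^sup>+y. f ((x(i := y))(j := z)) \<partial>M i \<partial>M j)"
        by (rule Fubini'[symmetric]) (rule m1[OF j])
      also have "\<dots> = (\<integral>\<^sup>+z. g (x(j := z)) \<partial>M j)"
        using ne[OF j] by (simp add: g_def fun_upd_twist)
      finally show "epow (\<integral>\<^sup>+y. F j y \<partial>M i) (e j) = epow (\<integral>\<^sup>+z. g (x(j := z)) \<partial>M j) p"
        using ne[OF j] by (simp add: e_def)
    qed
    also have "epow (g x) p * (epow (g x) (1 - k * p) * (\<Prod>j\<in>I. epow (\<integral>\<^sup>+z. g (x(j := z)) \<partial>M j) p))
      = epow (g x) (1 - (k - 1) * p) * (\<Prod>j\<in>I. epow (\<integral>\<^sup>+z. g (x(j := z)) \<partial>M j) p)"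
      using kp \<open>0 \<le> p\<close> epow_add[of p "1 - k * p" "g x"] by (simp add: algebra_simps)
    finally show ?thesis .
  qed
  have "(\<integral>\<^sup>+x. epow (f x) (1 - (real (card (insert i I)) - 1) * p) *
      (\<Prod>j\<in>insert i I. epow (\<integral>\<^sup>+y. f (x(j := y)) \<partial>M j) p) \<partial>Pi\<^sub>M (insert i I) M)
    = (\<integral>\<^sup>+x. (\<integral>\<^sup>+y. epow (f (x(i := y))) (1 - k * p) *
      (\<Prod>j\<in>insert i I. epow (\<integral>\<^sup>+z. f ((x(i := y))(j := z)) \<partial>M j) p) \<partial>M i) \<partial>Pi\<^sub>M I M)"
    unfolding k
  proof (rule product_nn_integral_insert)
    have "(\<lambda>x. \<integral>\<^sup>+y. f (x(j := y)) \<partial>M j) \<in> borel_measurable (Pi\<^sub>M (insert i I) M)" if "j \<in> insert i I" for j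
    proof -
      have "(\<lambda>(x, y). x(j := y)) \<in> measurable (Pi\<^sub>M (insert i I) M \<Otimes>\<^sub>M M j) (Pi\<^sub>M (insert i I) M)"
      proof -
        have "insert j (insert i I) = insert i I" using that by auto
        then show ?thesis using measurable_add_dim[of j "insert i I" M] by (simp only:)
      qed
      from measurable_compose[OF this fm]
      have "(\<lambda>(x, y). f (x(j := y))) \<in> borel_measurable (Pi\<^sub>M (insert i I) M \<Otimes>\<^sub>M M j)"
        unfolding split_beta' .
      from sigma_finite_measure.borel_measurable_nn_integral[OF sigma_finite_measures this]
      show ?thesis by simp
    qed
    then show "(\<lambda>x. epow (f x) (1 - k * p) * (\<Prod>j\<in>insert i I. epow (\<integral>\<^sup>+y. f (x(j := y)) \<partial>M j) p))
        \<in> borel_measurable (Pi\<^sub>M (insert i I) M)"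
      by (intro borel_measurable_times_ennreal borel_measurable_prod_ennreal measurable_epow) auto
  qed auto
  also have "\<dots> \<le> (\<integral>\<^sup>+x. epow (g x) (1 - (k - 1) * p) * (\<Prod>j\<in>I. epow (\<integral>\<^sup>+z. g (x(j := z)) \<partial>M j) p) \<partial>Pi\<^sub>M I M)"
    by (intro nn_integral_mono main)
  also have "\<dots> \<le> epow (\<integral>\<^sup>+x. g x \<partial>Pi\<^sub>M I M) (1 + p)"
    using insert.IH[OF g \<open>0 \<le> p\<close>] k1 unfolding k_def by blast
  also have "(\<integral>\<^sup>+x. g x \<partial>Pi\<^sub>M I M) = (\<integral>\<^sup>+x. f x \<partial>Pi\<^sub>M (insert i I) M)"
    unfolding g_def by (intro product_nn_integral_insert[symmetric]) auto
  finally show ?case .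
qed

end

section \<open>The Sobolev inequality for continuously differentiable functions of compact
  support\<close>

definition C1c :: "('a::euclidean_space \<Rightarrow> real) \<Rightarrow> ('a \<Rightarrow> 'a) \<Rightarrow> bool" where
  "C1c u D \<longleftrightarrow> (\<forall>x. (u has_derivative (\<lambda>h. D x \<bullet> h)) (at x)) \<and> continuous_on UNIV D \<and>
     (\<exists>R. \<forall>x. R \<le> norm x \<longrightarrow> u x = 0 \<and> D x = 0)"

lemma C1c_continuous: "C1c u D \<Longrightarrow> continuous_on UNIV u"
  unfolding C1c_def using has_derivative_continuous by (blast intro: continuous_at_imp_continuous_on)

lemma integrable_continuous_compact_support:
  fixes f :: "'a::euclidean_space \<Rightarrow> 'b::euclidean_space"
  assumes "continuous_on UNIV f" "\<And>x. R \<le> norm x \<Longrightarrow> f x = 0"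
  shows "integrable lborel f"
proof -
  have "integrable lborel (\<lambda>x. indicator (cball 0 R) x *\<^sub>R f x)"
    using assms(1) by (intro borel_integrable_compact) (auto intro: continuous_on_subset)
  also have "(\<lambda>x. indicator (cball 0 R) x *\<^sub>R f x) = f"
    using assms(2) by (auto simp: fun_eq_iff indicator_def)
  finally show ?thesis .
qed

text \<open>The point x + (t - x . i) i is x with its i-th coordinate replaced by t, so in product
  coordinates this is \<open>grid_line_inequality\<close>; as (n - 1) p = 1, its first factor has
  exponent 0.\<close>

lemma Gagliardo_Nirenberg_lines:
  fixes W :: "'a::euclidean_space \<Rightarrow> ennreal"
  assumes [measurable]: "W \<in> borel_measurable borel" and d: "DIM('a) \<ge> 2"
  defines "p \<equiv> 1 / (real DIM('a) - 1)"
  shows "(\<integral>\<^sup>+x. (\<Prod>i\<in>Basis. epow (\<integral>\<^sup>+t. W (x + (t - x \<bullet> i) *\<^sub>R i) \<partial>lborel) p) \<partial>lborel)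
    \<le> epow (\<integral>\<^sup>+x. W x \<partial>lborel) (1 + p)"
proof -
  interpret product_sigma_finite "\<lambda>_::'a. lborel :: real measure" ..
  let ?P = "Pi\<^sub>M (Basis :: 'a set) (\<lambda>_. lborel :: real measure)"
  let ?e = "\<lambda>f. \<Sum>b\<in>(Basis :: 'a set). f b *\<^sub>R b"
  have D: "(\<integral>\<^sup>+x. g x \<partial>(lborel :: 'a measure)) = (\<integral>\<^sup>+f. g (?e f) \<partial>?P)"
    if [measurable]: "g \<in> borel_measurable borel" for g
    by (subst lborel_eq[where 'a='a]) (simp add: nn_integral_distr)
  have [measurable]: "(\<lambda>x. \<integral>\<^sup>+t. W (x + (t - x \<bullet> i) *\<^sub>R i) \<partial>lborel) \<in> borel_measurable borel" for i
    by (intro sigma_finite_measure.borel_measurable_nn_integral[OF lborel.sigma_finite_measure_axioms]) measurable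
  have e: "?e f + (t - ?e f \<bullet> i) *\<^sub>R i = ?e (f(i := t))" if "i \<in> Basis" for f t i
    by (rule euclidean_eqI) (use that in \<open>auto simp: inner_add_left inner_Basis\<close>)
  have p: "0 \<le> p" "(real (card (Basis::'a set)) - 1) * p = 1" using d by (auto simp: p_def)
  have "(\<integral>\<^sup>+x. (\<Prod>i\<in>Basis. epow (\<integral>\<^sup>+t. W (x + (t - x \<bullet> i) *\<^sub>R i) \<partial>lborel) p) \<partial>lborel)
     = (\<integral>\<^sup>+f. (\<Prod>i\<in>Basis. epow (\<integral>\<^sup>+t. W (?e f + (t - ?e f \<bullet> i) *\<^sub>R i) \<partial>lborel) p) \<partial>?P)"
    by (rule D) measurable
  also have "\<dots> = (\<integral>\<^sup>+f. (\<Prod>i\<in>Basis. epow (\<integral>\<^sup>+t. W (?e (f(i := t))) \<partial>lborel) p) \<partial>?P)"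
    by (intro nn_integral_cong prod.cong refl) (simp only: e)
  also have "\<dots> \<le> epow (\<integral>\<^sup>+f. W (?e f) \<partial>?P) (1 + p)"
    using grid_line_inequality[of "Basis :: 'a set" "\<lambda>f. W (?e f)" p] p by simp
  also have "(\<integral>\<^sup>+f. W (?e f) \<partial>?P) = (\<integral>\<^sup>+x. W x \<partial>lborel)"
    by (rule D[symmetric]) simp
  finally show ?thesis .
qed

text \<open>|u| powr g is continuously differentiable for g > 1, so the fundamental theorem of
  calculus along the line in direction i, started outside the support of u, recovers its value at
  x.\<close>

lemma abs_powr_le_line_integral:
  fixes u :: "'a::euclidean_space \<Rightarrow> real"
  assumes u: "C1c u D" and g: "1 < g" and i: "i \<in> Basis"
  defines "W \<equiv> \<lambda>y. ennreal (g * \<bar>u y\<bar> powr (g - 1) * norm (D y))"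
  shows "ennreal (\<bar>u x\<bar> powr g) \<le> (\<integral>\<^sup>+t. W (x + (t - x \<bullet> i) *\<^sub>R i) \<partial>lborel)"
proof -
  obtain R where R: "\<And>x. R \<le> norm x \<Longrightarrow> u x = 0" using u by (auto simp: C1c_def)
  define l where "l t = x + (t - x \<bullet> i) *\<^sub>R i" for t
  \<comment> \<open>Left of x on the line and of modulus at least R, so that the point
    \<open>l a\<close> lies where u vanishes.\<close>
  define a where "a = min (x \<bullet> i) (- \<bar>R\<bar>)"
  have cu: "continuous_on UNIV u" "continuous_on UNIV D" using u C1c_continuous by (auto simp: C1c_def)
  have cl: "continuous_on S l" for S unfolding l_def by (intro continuous_intros)
  have cul: "continuous_on S (\<lambda>t. u (l t))" "continuous_on S (\<lambda>t. D (l t))" for S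
    using continuous_on_compose2[OF cu(1) cl] continuous_on_compose2[OF cu(2) cl] by auto
  have dl: "((\<lambda>t. u (l t)) has_real_derivative D (l t) \<bullet> i) (at t)" for t
  proof -
    have "(l has_vector_derivative i) (at t)" unfolding l_def
      by (auto intro!: derivative_eq_intros)
    moreover have "(u has_derivative (\<lambda>h. D (l t) \<bullet> h)) (at (l t))" using u by (auto simp: C1c_def)
    ultimately have "((u \<circ> l) has_vector_derivative (D (l t) \<bullet> i)) (at t)"
      using vector_derivative_diff_chain_within[of l i t UNIV u] by (auto intro: has_derivative_at_withinI)
    then show ?thesis by (simp add: has_real_derivative_iff_has_vector_derivative o_def)
  qed
  define f where "f t = g * signed_pow g (u (l t)) * (D (l t) \<bullet> i)" for t
  have df: "((\<lambda>t. \<bar>u (l t)\<bar> powr g) has_real_derivative f t) (at t)" for t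
    using DERIV_chain2[OF DERIV_abs_powr[OF g] dl] by (simp add: f_def)
  have cf: "continuous_on S f" for S
    unfolding f_def using g by (intro continuous_intros cul)
  have fb: "norm (f t) \<le> g * \<bar>u (l t)\<bar> powr (g - 1) * norm (D (l t))" for t
    using Basis_le_norm[OF i, of "D (l t)"] g by (auto simp: f_def abs_mult abs_signed_pow intro!: mult_left_mono)
  have "R \<le> norm (l a)"
    using Basis_le_norm[OF i, of "l a"] i by (auto simp: l_def inner_add_left a_def min_def split: if_splits)
  then have la: "u (l a) = 0" by (rule R)
  have lx: "l (x \<bullet> i) = x" by (simp add: l_def)
  have "(\<integral>t. indicator {a .. x \<bullet> i} t *\<^sub>R f t \<partial>lborel) = \<bar>u (l (x \<bullet> i))\<bar> powr g - \<bar>u (l a)\<bar> powr g"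
    using df cf by (intro integral_FTC_atLeastAtMost)
      (auto simp: a_def has_real_derivative_iff_has_vector_derivative intro: has_vector_derivative_at_within)
  also have "\<dots> = \<bar>u x\<bar> powr g" by (simp add: la lx)
  finally have "ennreal (\<bar>u x\<bar> powr g) = ennreal (norm (\<integral>t. indicator {a .. x \<bullet> i} t *\<^sub>R f t \<partial>lborel))"
    by simp
  also have "\<dots> \<le> (\<integral>\<^sup>+t. ennreal (norm (indicator {a .. x \<bullet> i} t *\<^sub>R f t)) \<partial>lborel)"
    using cf by (intro integral_norm_bound_ennreal borel_integrable_compact) auto
  also have "\<dots> \<le> (\<integral>\<^sup>+t. W (l t) \<partial>lborel)"
    unfolding W_def using fb order_trans[OF norm_ge_zero fb]
    by (intro nn_integral_mono ennreal_leI) (auto simp: indicator_def)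
  finally show ?thesis by (simp add: l_def)
qed

lemma Sobolev_C1c:
  fixes u :: "'a::euclidean_space \<Rightarrow> real"
  assumes u: "C1c u D" and d: "DIM('a) \<ge> 3"
  defines "n \<equiv> real DIM('a)"
  defines "s \<equiv> 2 * n / (n - 2)"
  shows "(\<integral>x. \<bar>u x\<bar> powr s \<partial>lborel) \<le> (s * (\<integral>x. (norm (D x))\<^sup>2 \<partial>lborel) powr (1/2)) powr s"
proof -
  obtain R where R: "\<And>x. R \<le> norm x \<Longrightarrow> u x = 0" "\<And>x. R \<le> norm x \<Longrightarrow> D x = 0" using u by (auto simp: C1c_def)
  have n: "n \<ge> 3" using d by (simp add: n_def)
  \<comment> \<open>The exponent is determined by two demands: 2 (g - 1) = s, so that Cauchy-Schwarz
    reproduces the integral of |u| powr s, and g (1 + p) = s, so that the product of the n line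
    bounds, each of power p, is again |u| powr s.\<close>
  define g where "g = 2 * (n - 1) / (n - 2)"
  define p where "p = 1 / (n - 1)"
  have p1: "1 + p = n / (n - 1)" using n by (simp add: p_def field_simps)
  have "g * (1 + p) = s"
  proof -
    define k where "k = n - 1"
    have k: "n = k + 1" "k \<noteq> 0" "n - 1 = k" "n - 2 = k - 1" using n by (auto simp: k_def)
    show ?thesis unfolding p1 g_def s_def k(3,4) unfolding k(1) using k(2) by simp
  qed
  then have g: "1 < g" "g \<le> s" "2 * (g - 1) = s" "g * (1 + p) = s" "0 < p" "n * p = 1 + p"
    using n by (auto simp: g_def s_def p_def field_simps)
  have s: "0 < s" using n by (auto simp: s_def)
  have cu: "continuous_on UNIV u" "continuous_on UNIV D" using u C1c_continuous by (auto simp: C1c_def)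
  then have [measurable]: "u \<in> borel_measurable borel" "D \<in> borel_measurable borel"
    by (auto intro: borel_measurable_continuous_onI)
  have cp: "continuous_on UNIV (\<lambda>x. \<bar>u x\<bar> powr a)" if "a > 0" for a
    using that by (intro continuous_on_powr' continuous_intros cu) auto
  define A where "A = (\<integral>x. \<bar>u x\<bar> powr s \<partial>lborel)"
  define B where "B = (\<integral>x. (norm (D x))\<^sup>2 \<partial>lborel)"
  define C where "C = (\<integral>x. \<bar>u x\<bar> powr (g - 1) * norm (D x) \<partial>lborel)"
  have iA: "integrable lborel (\<lambda>x. \<bar>u x\<bar> powr s)"
    using R s by (intro integrable_continuous_compact_support[of _ R] cp) auto
  have iB: "integrable lborel (\<lambda>x. (norm (D x))\<^sup>2)"
    using R by (intro integrable_continuous_compact_support[of _ R] continuous_intros cu) auto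
  have iC: "integrable lborel (\<lambda>x. \<bar>u x\<bar> powr (g - 1) * norm (D x))"
    using R g by (intro integrable_continuous_compact_support[of _ R] continuous_intros cu cp) auto
  have pos: "A \<ge> 0" "B \<ge> 0" "C \<ge> 0" by (auto simp: A_def B_def C_def)
  have sq: "(\<bar>u x\<bar> powr (g - 1))\<^sup>2 = \<bar>u x\<bar> powr s" for x
    using g(3) by (simp add: power2_eq_square flip: powr_add)
  have "C \<le> sqrt A * sqrt B"
    using Cauchy_Schwarz_integral(3)[of "\<lambda>x. \<bar>u x\<bar> powr (g - 1)" lborel "\<lambda>x. norm (D x)"] iA iB
    by (simp add: sq A_def B_def C_def)
  define W where "W y = ennreal (g * \<bar>u y\<bar> powr (g - 1) * norm (D y))" for y
  have W [measurable]: "W \<in> borel_measurable borel" unfolding W_def by measurable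
  have intW: "(\<integral>\<^sup>+x. W x \<partial>lborel) = ennreal (g * C)"
    unfolding W_def C_def using iC g
    by (subst nn_integral_eq_integral) (auto simp: mult.assoc)
  have "ennreal A = (\<integral>\<^sup>+x. ennreal (\<bar>u x\<bar> powr s) \<partial>lborel)"
    unfolding A_def using iA by (subst nn_integral_eq_integral) auto
  also have "\<dots> \<le> (\<integral>\<^sup>+x. (\<Prod>i\<in>Basis. epow (\<integral>\<^sup>+t. W (x + (t - x \<bullet> i) *\<^sub>R i) \<partial>lborel) p) \<partial>lborel)"
  proof (rule nn_integral_mono)
    fix x
    have "\<bar>u x\<bar> powr s = ((\<bar>u x\<bar> powr g) powr p) powr n"
      using g by (simp add: powr_powr mult_ac)
    also have "ennreal \<dots> = ennreal (\<Prod>i\<in>(Basis::'a set). (\<bar>u x\<bar> powr g) powr p)"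
      by (cases "u x = 0") (simp_all add: n_def powr_realpow)
    also have "\<dots> = (\<Prod>i\<in>(Basis::'a set). epow (ennreal (\<bar>u x\<bar> powr g)) p)"
      using g by (simp add: epow_ennreal ennreal_power)
    also have "\<dots> \<le> (\<Prod>i\<in>(Basis::'a set). epow (\<integral>\<^sup>+t. W (x + (t - x \<bullet> i) *\<^sub>R i) \<partial>lborel) p)"
      unfolding W_def using g by (intro prod_mono_ennreal epow_mono abs_powr_le_line_integral[OF u]) auto
    finally show "ennreal (\<bar>u x\<bar> powr s) \<le> (\<Prod>i\<in>(Basis::'a set). epow (\<integral>\<^sup>+t. W (x + (t - x \<bullet> i) *\<^sub>R i) \<partial>lborel) p)" .
  qed
  also have "\<dots> \<le> epow (\<integral>\<^sup>+x. W x \<partial>lborel) (1 + p)"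
    using Gagliardo_Nirenberg_lines[OF W] d by (simp add: p_def n_def)
  also have "\<dots> = ennreal ((g * C) powr (1 + p))"
    using intW g pos by (simp add: epow_ennreal)
  finally have "A \<le> (g * C) powr (1 + p)" by (subst (asm) ennreal_le_iff) auto
  also have "\<dots> \<le> (s * (sqrt A * sqrt B)) powr (1 + p)"
    using \<open>C \<le> sqrt A * sqrt B\<close> g pos s by (intro powr_mono2 mult_mono) auto
  also have "\<dots> = A powr ((1 + p) / 2) * (s * sqrt B) powr (1 + p)"
    using pos s g by (simp add: powr_mult powr_half_sqrt[symmetric] powr_powr mult_ac)
  finally have le: "A \<le> A powr ((1 + p) / 2) * (s * sqrt B) powr (1 + p)" .
  have "A \<le> (s * sqrt B) powr s"
  proof (cases "A = 0")
    case False
    then have A: "A > 0" using pos by simp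
    \<comment> \<open>The integral A occurs on both sides with different powers. It is finite
      because u has compact support, so A powr ((1 + p) / 2) can be divided out; the remaining
      exponent is (1 + p) / s.\<close>
    have e: "1 - (1 + p) / 2 = (1 + p) / s" "s > 0" using n by (auto simp: s_def p_def field_simps)
    have "A powr ((1 + p) / s) = A / A powr ((1 + p) / 2)"
      using A by (simp flip: e(1) add: powr_diff)
    also have "\<dots> \<le> (s * sqrt B) powr (1 + p)" using le A by (simp add: field_simps)
    finally have "(A powr ((1 + p) / s)) powr (s / (1 + p)) \<le> ((s * sqrt B) powr (1 + p)) powr (s / (1 + p))"
      using e g by (intro powr_mono2) auto
    then show ?thesis using A e g by (simp add: powr_powr)
  qed simp
  then show ?thesis using pos by (simp add: A_def[symmetric] B_def[symmetric] powr_half_sqrt)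
qed

section \<open>Square integrable functions\<close>

text \<open>Formulated for an arbitrary measure and for vector values, because it serves
  \<open>lborel\<close> and \<open>lebesgue_on \<Omega>\<close>, functions and their gradients.
  Functions are not identified when equal almost everywhere, so \<open>L2n\<close> is a
  seminorm.\<close>

definition sq_integrable :: "'x measure \<Rightarrow> ('x \<Rightarrow> 'b::euclidean_space) \<Rightarrow> bool" where
  "sq_integrable M f \<longleftrightarrow> f \<in> borel_measurable M \<and> integrable M (\<lambda>x. (norm (f x))\<^sup>2)"

definition L2n :: "'x measure \<Rightarrow> ('x \<Rightarrow> 'b::euclidean_space) \<Rightarrow> real" where
  "L2n M f = sqrt (\<integral>x. (norm (f x))\<^sup>2 \<partial>M)"

lemma sq_integrable_measurable: "sq_integrable M f \<Longrightarrow> f \<in> borel_measurable M"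
  by (simp add: sq_integrable_def)

lemma L2n_nonneg [simp]: "0 \<le> L2n M f"
  by (simp add: L2n_def)

lemma L2n_power2: "(L2n M f)\<^sup>2 = (\<integral>x. (norm (f x))\<^sup>2 \<partial>M)"
  by (simp add: L2n_def)

lemma sq_integrable_inner:
  fixes f g :: "'x \<Rightarrow> 'b::euclidean_space"
  assumes f: "sq_integrable M f" and g: "sq_integrable M g"
  shows "integrable M (\<lambda>x. f x \<bullet> g x)" "\<bar>\<integral>x. f x \<bullet> g x \<partial>M\<bar> \<le> L2n M f * L2n M g"
    and "integrable M (\<lambda>x. norm (f x) * norm (g x))" "(\<integral>x. norm (f x) * norm (g x) \<partial>M) \<le> L2n M f * L2n M g"
proof -
  have [measurable]: "f \<in> borel_measurable M" "g \<in> borel_measurable M"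
    using f g by (auto simp: sq_integrable_def)
  show 1: "integrable M (\<lambda>x. norm (f x) * norm (g x))"
    using f g by (intro Cauchy_Schwarz_integral) (auto simp: sq_integrable_def)
  show 2: "(\<integral>x. norm (f x) * norm (g x) \<partial>M) \<le> L2n M f * L2n M g"
    using Cauchy_Schwarz_integral(3)[of "\<lambda>x. norm (f x)" M "\<lambda>x. norm (g x)"] f g
    by (simp add: sq_integrable_def L2n_def)
  show 3: "integrable M (\<lambda>x. f x \<bullet> g x)"
    by (rule Bochner_Integration.integrable_bound[OF 1]) (auto intro: Cauchy_Schwarz_ineq2)
  have "\<bar>\<integral>x. f x \<bullet> g x \<partial>M\<bar> \<le> (\<integral>x. \<bar>f x \<bullet> g x\<bar> \<partial>M)" by (rule integral_abs_bound)
  also have "\<dots> \<le> (\<integral>x. norm (f x) * norm (g x) \<partial>M)"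
    using 1 3 by (intro integral_mono) (auto intro: Cauchy_Schwarz_ineq2)
  finally show "\<bar>\<integral>x. f x \<bullet> g x \<partial>M\<bar> \<le> L2n M f * L2n M g" using 2 by simp
qed

lemma sq_integrable_scaleR: "sq_integrable M f \<Longrightarrow> sq_integrable M (\<lambda>x. c *\<^sub>R f x)"
  by (auto simp: sq_integrable_def power_mult_distrib intro: borel_measurable_scaleR)

lemma L2n_scaleR: "L2n M (\<lambda>x. c *\<^sub>R f x) = \<bar>c\<bar> * L2n M f"
  by (simp add: L2n_def power_mult_distrib real_sqrt_mult)

lemma L2n_minus: "L2n M (\<lambda>x. f x - g x) = L2n M (\<lambda>x. g x - f x)"
  by (simp add: L2n_def norm_minus_commute)

lemma L2n_cong_AE:
  assumes "f \<in> borel_measurable M" "g \<in> borel_measurable M" "AE x in M. f x = g x"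
  shows "L2n M f = L2n M g"
  unfolding L2n_def using assms by (intro arg_cong[where f=sqrt] integral_cong_AE) auto

lemma sq_integrable_add:
  fixes f g :: "'x \<Rightarrow> 'b::euclidean_space"
  assumes f: "sq_integrable M f" and g: "sq_integrable M g"
  shows "sq_integrable M (\<lambda>x. f x + g x)" "L2n M (\<lambda>x. f x + g x) \<le> L2n M f + L2n M g"
proof -
  have [measurable]: "f \<in> borel_measurable M" "g \<in> borel_measurable M"
    using f g by (auto simp: sq_integrable_def)
  have i: "integrable M (\<lambda>x. (norm (f x))\<^sup>2)" "integrable M (\<lambda>x. (norm (g x))\<^sup>2)" "integrable M (\<lambda>x. f x \<bullet> g x)"
    using f g sq_integrable_inner(1)[OF f g] by (auto simp: sq_integrable_def)
  have e: "(norm (f x + g x))\<^sup>2 = (norm (f x))\<^sup>2 + 2 * (f x \<bullet> g x) + (norm (g x))\<^sup>2" for x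
    by (simp add: power2_norm_eq_inner inner_add_left inner_add_right inner_commute)
  show "sq_integrable M (\<lambda>x. f x + g x)" unfolding sq_integrable_def e using i by auto
  have "(L2n M (\<lambda>x. f x + g x))\<^sup>2 = (L2n M f)\<^sup>2 + 2 * (\<integral>x. f x \<bullet> g x \<partial>M) + (L2n M g)\<^sup>2"
    unfolding L2n_power2 e using i by simp
  also have "\<dots> \<le> (L2n M f + L2n M g)\<^sup>2"
    using sq_integrable_inner(2)[OF f g] by (simp add: power2_sum)
  finally show "L2n M (\<lambda>x. f x + g x) \<le> L2n M f + L2n M g" by (rule power2_le_imp_le) simp
qed

lemma sq_integrable_diff:
  fixes f g :: "'x \<Rightarrow> 'b::euclidean_space"
  assumes f: "sq_integrable M f" and g: "sq_integrable M g"
  shows "sq_integrable M (\<lambda>x. f x - g x)" "L2n M (\<lambda>x. f x - g x) \<le> L2n M f + L2n M g"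
  using sq_integrable_add[OF f sq_integrable_scaleR[OF g, of "-1"]] L2n_scaleR[of M "-1" g] by auto

lemma L2n_triangle:
  assumes "sq_integrable M f" "sq_integrable M g" "sq_integrable M h"
  shows "L2n M (\<lambda>x. f x - g x) \<le> L2n M (\<lambda>x. f x - h x) + L2n M (\<lambda>x. g x - h x)"
  using sq_integrable_diff(2)[OF sq_integrable_diff(1)[OF assms(1,3)] sq_integrable_diff(1)[OF assms(2,3)]] by simp

lemma L2n_diff_bound:
  assumes "sq_integrable M f" "sq_integrable M g"
  shows "\<bar>L2n M f - L2n M g\<bar> \<le> L2n M (\<lambda>x. f x - g x)"
  using sq_integrable_add(2)[OF sq_integrable_diff(1)[OF assms] assms(2)]
    sq_integrable_add(2)[OF sq_integrable_diff(1)[OF assms(2,1)] assms(1)]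
  by (auto simp: L2n_minus[of M g f])

text \<open>Fatou's lemma. The bound is demanded only eventually, the form in which a Cauchy
  sequence supplies it.\<close>

lemma L2n_bounded_limit:
  fixes f :: "nat \<Rightarrow> 'x \<Rightarrow> 'b::euclidean_space"
  assumes f: "\<And>n. sq_integrable M (f n)" and g: "g \<in> borel_measurable M"
    and lim: "AE x in M. (\<lambda>n. f n x) \<longlonglongrightarrow> g x"
    and b: "\<forall>\<^sub>F n in sequentially. L2n M (f n) \<le> B"
  shows "sq_integrable M g" "L2n M g \<le> B"
proof -
  have [measurable]: "f n \<in> borel_measurable M" "g \<in> borel_measurable M" for n
    using f g by (auto simp: sq_integrable_def)
  obtain N where N: "\<And>n. n \<ge> N \<Longrightarrow> L2n M (f n) \<le> B" using b by (auto simp: eventually_sequentially)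
  have B: "0 \<le> B" using N[of N] order_trans[OF L2n_nonneg] by auto
  have nn: "(\<integral>\<^sup>+x. ennreal ((norm (f n x))\<^sup>2) \<partial>M) = ennreal ((L2n M (f n))\<^sup>2)" for n
    unfolding L2n_power2 using f[of n] by (intro nn_integral_eq_integral) (auto simp: sq_integrable_def)
  have "(\<integral>\<^sup>+x. ennreal ((norm (g x))\<^sup>2) \<partial>M) = (\<integral>\<^sup>+x. liminf (\<lambda>n. ennreal ((norm (f n x))\<^sup>2)) \<partial>M)"
  proof (rule nn_integral_cong_AE, use lim in eventually_elim)
    case (elim x)
    then have "(\<lambda>n. ennreal ((norm (f n x))\<^sup>2)) \<longlonglongrightarrow> ennreal ((norm (g x))\<^sup>2)"
      by (intro tendsto_intros tendsto_ennrealI)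
    then show ?case using lim_imp_Liminf[OF sequentially_bot] by metis
  qed
  also have "\<dots> \<le> liminf (\<lambda>n. \<integral>\<^sup>+x. ennreal ((norm (f n x))\<^sup>2) \<partial>M)"
    by (rule nn_integral_liminf) auto
  also have "\<dots> \<le> ennreal (B\<^sup>2)"
  proof (rule Liminf_le)
    show "\<forall>\<^sub>F n in sequentially. (\<integral>\<^sup>+x. ennreal ((norm (f n x))\<^sup>2) \<partial>M) \<le> ennreal (B\<^sup>2)"
      using b by eventually_elim (auto simp: nn intro!: ennreal_leI power_mono)
  qed simp
  finally have le: "(\<integral>\<^sup>+x. ennreal ((norm (g x))\<^sup>2) \<partial>M) \<le> ennreal (B\<^sup>2)" .
  have i: "integrable M (\<lambda>x. (norm (g x))\<^sup>2)"
    using le by (intro integrableI_bounded) (auto simp: less_top top_unique intro: le_less_trans)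
  then show "sq_integrable M g" by (simp add: sq_integrable_def)
  have "ennreal ((L2n M g)\<^sup>2) \<le> ennreal (B\<^sup>2)"
    using le i by (simp add: L2n_power2 nn_integral_eq_integral)
  then have "(L2n M g)\<^sup>2 \<le> B\<^sup>2" by simp
  then show "L2n M g \<le> B" using B by (rule power2_le_imp_le)
qed

lemma fast_Cauchy_subsequence:
  fixes D :: "nat \<Rightarrow> nat \<Rightarrow> real" and e :: "nat \<Rightarrow> real"
  assumes "\<And>\<epsilon>. \<epsilon> > 0 \<Longrightarrow> \<exists>N. \<forall>m\<ge>N. \<forall>n\<ge>N. D m n \<le> \<epsilon>" "\<And>k. e k > 0"
  shows "\<exists>r. strict_mono r \<and> (\<forall>k. \<forall>m\<ge>r k. \<forall>n\<ge>r k. D m n \<le> e k)"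
proof -
  have "\<forall>k. \<exists>N. \<forall>m\<ge>N. \<forall>n\<ge>N. D m n \<le> e k" using assms(1)[OF assms(2)] by blast
  then obtain N where N: "\<And>k m n. m \<ge> N k \<Longrightarrow> n \<ge> N k \<Longrightarrow> D m n \<le> e k" by metis
  \<comment> \<open>The partial sums make r k at least N k, and the summand k makes r strictly
    increasing.\<close>
  define r where "r k = (\<Sum>i\<le>k. N i) + k" for k
  have "strict_mono r" by (simp add: strict_mono_Suc_iff r_def)
  moreover have "N k \<le> r k" for k
    using member_le_sum[of k "{..k}" N] by (simp add: r_def)
  ultimately show ?thesis using N by (intro exI[of _ r]) (meson order_trans)
qed

lemma L2_AE_convergent_subsequence:
  fixes f :: "nat \<Rightarrow> 'x \<Rightarrow> 'b::euclidean_space"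
  assumes f: "\<And>n. sq_integrable M (f n)"
    and C: "\<And>\<epsilon>. \<epsilon> > 0 \<Longrightarrow> \<exists>N. \<forall>m\<ge>N. \<forall>n\<ge>N. L2n M (\<lambda>x. f m x - f n x) \<le> \<epsilon>"
  shows "\<exists>r. strict_mono r \<and> (AE x in M. convergent (\<lambda>k. f (r k) x))"
proof -
  have [measurable]: "f n \<in> borel_measurable M" for n using f by (auto simp: sq_integrable_def)
  obtain r where r: "strict_mono r" "\<And>k m n. m \<ge> r k \<Longrightarrow> n \<ge> r k \<Longrightarrow> L2n M (\<lambda>x. f m x - f n x) \<le> (1/4)^k"
    using fast_Cauchy_subsequence[of "\<lambda>m n. L2n M (\<lambda>x. f m x - f n x)" "\<lambda>k. (1/4)^k", OF C] by auto
  \<comment> \<open>Consecutive terms of the subsequence differ by at most (1/4)^k in norm, so even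
    with the weight 4^k the integral of h k is at most (1/4)^k. Where the sum of the h k is a finite
    number S, consecutive values differ by at most sqrt S * (1/2)^k, and the sequence of values
    converges.\<close>
  define h where "h k x = 4^k * (norm (f (r (Suc k)) x - f (r k) x))\<^sup>2" for k x
  have hm [measurable]: "h k \<in> borel_measurable M" for k unfolding h_def by measurable
  have hi: "(\<integral>\<^sup>+x. ennreal (h k x) \<partial>M) \<le> ennreal ((1/4)^k)" for k
  proof -
    have "sq_integrable M (\<lambda>x. f (r (Suc k)) x - f (r k) x)" by (intro sq_integrable_diff f)
    then have "(\<integral>\<^sup>+x. ennreal (h k x) \<partial>M) = ennreal (4^k * (L2n M (\<lambda>x. f (r (Suc k)) x - f (r k) x))\<^sup>2)"
      unfolding h_def L2n_power2
      by (subst nn_integral_eq_integral) (auto simp: sq_integrable_def)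
    also have "\<dots> \<le> ennreal (4^k * ((1/4)^k)\<^sup>2)"
      using r(1) by (intro ennreal_leI mult_left_mono power_mono r(2)) (auto simp: strict_mono_less_eq)
    also have "4^k * ((1/4)^k)\<^sup>2 = (1/4::real)^k"
      by (simp add: power2_eq_square power_divide)
    finally show ?thesis .
  qed
  have "(\<integral>\<^sup>+x. (\<Sum>k. ennreal (h k x)) \<partial>M) = (\<Sum>k. \<integral>\<^sup>+x. ennreal (h k x) \<partial>M)"
    by (rule nn_integral_suminf) measurable
  also have "\<dots> \<le> (\<Sum>k. ennreal ((1/4)^k))" by (intro suminf_le hi) auto
  also have "\<dots> = ennreal (\<Sum>k. (1/4)^k)" by (intro suminf_ennreal2) (auto intro: summable_geometric)
  finally have "(\<integral>\<^sup>+x. (\<Sum>k. ennreal (h k x)) \<partial>M) \<noteq> \<infinity>" by (auto simp: top_unique)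
  then have "AE x in M. (\<Sum>k. ennreal (h k x)) \<noteq> \<infinity>"
    by (intro nn_integral_PInf_AE) auto
  then have "AE x in M. convergent (\<lambda>k. f (r k) x)"
  proof eventually_elim
    case (elim x)
    define S where "S = enn2real (\<Sum>k. ennreal (h k x))"
    have hS: "h k x \<le> S" for k
    proof -
      have "ennreal (h k x) \<le> (\<Sum>k. ennreal (h k x))"
        using sum_le_suminf[of "\<lambda>k. ennreal (h k x)" "{k}"] by simp
      also have "\<dots> = ennreal S" using elim by (simp add: S_def less_top)
      finally show ?thesis by (simp add: S_def)
    qed
    have bd: "norm (f (r (Suc k)) x - f (r k) x) \<le> sqrt S * (1/2)^k" for k
    proof -
      have "(norm (f (r (Suc k)) x - f (r k) x))\<^sup>2 \<le> S * (1/4)^k"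
        using hS[of k] by (simp add: h_def field_simps)
      then have "norm (f (r (Suc k)) x - f (r k) x) \<le> sqrt (S * (1/4)^k)" by (rule real_le_rsqrt)
      also have "\<dots> = sqrt S * (1/2)^k" by (simp add: real_sqrt_mult real_sqrt_power real_sqrt_divide)
      finally show ?thesis .
    qed
    have "summable (\<lambda>k. f (r (Suc k)) x - f (r k) x)"
      by (rule summable_comparison_test'[where N=0 and g="\<lambda>k. sqrt S * (1/2)^k"])
         (use bd in \<open>auto intro!: summable_mult summable_geometric\<close>)
    then have "(\<lambda>n. (\<Sum>k<n. f (r (Suc k)) x - f (r k) x)) \<longlonglongrightarrow> (\<Sum>k. f (r (Suc k)) x - f (r k) x)"
      by (rule summable_LIMSEQ)
    then have "(\<lambda>n. (f (r n) x - f (r 0) x) + f (r 0) x) \<longlonglongrightarrow> (\<Sum>k. f (r (Suc k)) x - f (r k) x) + f (r 0) x"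
      unfolding sum_lessThan_telescope[of "\<lambda>k. f (r k) x"] by (intro tendsto_intros)
    then show ?case by (auto simp: convergent_def)
  qed
  then show ?thesis using r(1) by blast
qed

text \<open>For fixed n, f n - g is the almost everywhere limit of f n - f (r k), and these have
  small norm once n and k are large; Fatou transfers the bound to f n - g. Square integrability of g
  is read off from one such difference.\<close>

lemma L2_complete:
  fixes f :: "nat \<Rightarrow> 'x \<Rightarrow> 'b::euclidean_space"
  assumes f: "\<And>n. sq_integrable M (f n)"
    and C: "\<And>\<epsilon>. \<epsilon> > 0 \<Longrightarrow> \<exists>N. \<forall>m\<ge>N. \<forall>n\<ge>N. L2n M (\<lambda>x. f m x - f n x) \<le> \<epsilon>"
  shows "\<exists>g. sq_integrable M g \<and> (\<lambda>n. L2n M (\<lambda>x. f n x - g x)) \<longlonglongrightarrow> 0"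
proof -
  have [measurable]: "f n \<in> borel_measurable M" for n using f by (auto simp: sq_integrable_def)
  obtain r where r: "strict_mono r" "AE x in M. convergent (\<lambda>k. f (r k) x)"
    using L2_AE_convergent_subsequence[OF f C] by auto
  define g where "g x = lim (\<lambda>k. f (r k) x)" for x
  have [measurable]: "g \<in> borel_measurable M" unfolding g_def by (rule borel_measurable_lim_metric) auto
  have lim: "AE x in M. (\<lambda>k. f (r k) x) \<longlonglongrightarrow> g x"
    using r(2) by eventually_elim (simp add: g_def convergent_LIMSEQ_iff)
  have ev: "\<forall>\<^sub>F k in sequentially. r k \<ge> N" for N
    using filterlim_subseq[OF r(1)] by (simp add: filterlim_at_top)
  have key: "\<exists>N. \<forall>n\<ge>N. sq_integrable M (\<lambda>x. f n x - g x) \<and> L2n M (\<lambda>x. f n x - g x) \<le> \<epsilon>" if \<epsilon>: "\<epsilon> > 0" for \<epsilon>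
  proof -
    obtain N where N: "\<And>m n. m \<ge> N \<Longrightarrow> n \<ge> N \<Longrightarrow> L2n M (\<lambda>x. f m x - f n x) \<le> \<epsilon>" using C[OF \<epsilon>] by auto
    have "sq_integrable M (\<lambda>x. f n x - g x) \<and> L2n M (\<lambda>x. f n x - g x) \<le> \<epsilon>" if n: "n \<ge> N" for n
    proof -
      have 1: "sq_integrable M (\<lambda>x. f n x - f (r k) x)" for k by (intro sq_integrable_diff f)
      have 2: "AE x in M. (\<lambda>k. f n x - f (r k) x) \<longlonglongrightarrow> f n x - g x"
        using lim by eventually_elim (intro tendsto_intros)
      have 3: "\<forall>\<^sub>F k in sequentially. L2n M (\<lambda>x. f n x - f (r k) x) \<le> \<epsilon>"
        using ev[of N] by eventually_elim (use N n in auto)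
      show ?thesis
        using L2n_bounded_limit[of M "\<lambda>k x. f n x - f (r k) x" "\<lambda>x. f n x - g x" \<epsilon>, OF 1 _ 2 3] by simp
    qed
    then show ?thesis by auto
  qed
  obtain N where N: "sq_integrable M (\<lambda>x. f N x - g x)" using key[of 1] by auto
  have "sq_integrable M g" using sq_integrable_diff(1)[OF f[of N] N] by simp
  moreover have "(\<lambda>n. L2n M (\<lambda>x. f n x - g x)) \<longlonglongrightarrow> 0"
  proof (rule LIMSEQ_I)
    fix e :: real assume "e > 0"
    with key[of "e / 2"] show "\<exists>N. \<forall>n\<ge>N. norm (L2n M (\<lambda>x. f n x - g x) - 0) < e" by force
  qed
  ultimately show ?thesis by auto
qed

lemma L2_conv_AE_subsequence:
  fixes f :: "nat \<Rightarrow> 'x \<Rightarrow> 'b::euclidean_space"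
  assumes f: "\<And>n. sq_integrable M (f n)" "sq_integrable M g"
    and lim: "(\<lambda>n. L2n M (\<lambda>x. f n x - g x)) \<longlonglongrightarrow> 0"
  shows "\<exists>r. strict_mono r \<and> (AE x in M. (\<lambda>k. f (r k) x) \<longlonglongrightarrow> g x)"
proof -
  define F where "F n x = (norm (f n x - g x))\<^sup>2" for n x
  have i: "integrable M (F n)" for n
    using sq_integrable_diff(1)[OF f(1) f(2)] by (simp add: F_def[abs_def] sq_integrable_def)
  have "(\<lambda>n. \<integral>x. norm (F n x) \<partial>M) \<longlonglongrightarrow> 0"
    using tendsto_power[OF lim, of 2] by (simp add: F_def L2n_power2)
  from tendsto_L1_AE_subseq[OF i this] obtain r where r: "strict_mono r" "AE x in M. (\<lambda>n. F (r n) x) \<longlonglongrightarrow> 0" by auto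
  have "AE x in M. (\<lambda>k. f (r k) x) \<longlonglongrightarrow> g x" using r(2)
  proof eventually_elim
    case (elim x)
    then have "(\<lambda>n. sqrt (F (r n) x)) \<longlonglongrightarrow> sqrt 0" by (intro tendsto_real_sqrt)
    then show ?case by (simp add: F_def tendsto_norm_zero_iff LIM_zero_iff)
  qed
  then show ?thesis using r(1) by auto
qed

section \<open>Test functions and weak gradients\<close>

lemma C_class_Suc_imp: "C_class (Suc k) f \<Longrightarrow> C_class k f"
  by (induction k arbitrary: f) (auto simp: differentiable_imp_continuous_on)

lemma C_class_const: "C_class k (\<lambda>_. c)"
proof (induction k arbitrary: c)
  case (Suc k)
  have "frechet_derivative (\<lambda>_. c) (at x) i = 0" for x i :: 'a
    using frechet_derivative_at[OF has_derivative_const[of c "at x"]] by (metis (no_types))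
  then show ?case using Suc[of 0] by simp
qed simp

lemma frechet_derivativeI:
  "(f has_derivative f') (at x) \<Longrightarrow> frechet_derivative f (at x) = f'"
  using frechet_derivative_at by metis

lemma differentiable_on_UNIV_has_derivative:
  "f differentiable_on UNIV \<Longrightarrow> (f has_derivative frechet_derivative f (at x)) (at x)"
  by (simp add: differentiable_on_def flip: frechet_derivative_works)

lemma C_class_add: "C_class k f \<Longrightarrow> C_class k g \<Longrightarrow> C_class k (\<lambda>x. f x + g x)"
proof (induction k arbitrary: f g)
  case (Suc k)
  have d: "f differentiable_on UNIV" "g differentiable_on UNIV" using Suc.prems by auto
  have e: "frechet_derivative (\<lambda>x. f x + g x) (at x) = (\<lambda>h. frechet_derivative f (at x) h + frechet_derivative g (at x) h)" for x
    by (intro frechet_derivativeI has_derivative_add differentiable_on_UNIV_has_derivative d)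
  show ?case using Suc d by (auto simp: e intro: differentiable_on_add)
qed (auto intro: continuous_intros)

lemma C_class_mult: "C_class k f \<Longrightarrow> C_class k g \<Longrightarrow> C_class k (\<lambda>x. f x * g x)"
proof (induction k arbitrary: f g)
  case (Suc k)
  have d: "f differentiable_on UNIV" "g differentiable_on UNIV" using Suc.prems by auto
  have e: "frechet_derivative (\<lambda>x. f x * g x) (at x) = (\<lambda>h. f x * frechet_derivative g (at x) h + frechet_derivative f (at x) h * g x)" for x
    by (intro frechet_derivativeI has_derivative_mult differentiable_on_UNIV_has_derivative d)
  have m: "C_class k f" "C_class k g" using Suc.prems C_class_Suc_imp by blast+
  show ?case using Suc d m by (auto simp: e intro!: differentiable_on_mult C_class_add)
qed (auto intro: continuous_intros)

lemma C_class_prod: "(\<And>i. i \<in> I \<Longrightarrow> C_class k (f i)) \<Longrightarrow> C_class k (\<lambda>x. \<Prod>i\<in>I. f i x)"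
  by (induction I rule: infinite_finite_induct) (auto intro: C_class_const C_class_mult)

lemma smooth_add: "smooth f \<Longrightarrow> smooth g \<Longrightarrow> smooth (\<lambda>x. f x + g x)"
  and smooth_mult: "smooth f \<Longrightarrow> smooth g \<Longrightarrow> smooth (\<lambda>x. f x * g x)"
  and smooth_const: "smooth (\<lambda>_. c)"
  and smooth_prod: "(\<And>i. i \<in> I \<Longrightarrow> smooth (h i)) \<Longrightarrow> smooth (\<lambda>x. \<Prod>i\<in>I. h i x)"
  by (auto simp: smooth_def C_class_add C_class_mult C_class_const C_class_prod)

lemma smooth_has_derivative: "smooth f \<Longrightarrow> (f has_derivative frechet_derivative f (at x)) (at x)"
  unfolding smooth_def using C_class.simps(2)[of 0 f] differentiable_on_UNIV_has_derivative by blast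

lemma smooth_partial_continuous:
  "smooth f \<Longrightarrow> i \<in> Basis \<Longrightarrow> continuous_on UNIV (\<lambda>x. frechet_derivative f (at x) i)"
  unfolding smooth_def using C_class.simps(2)[of 0 f] by auto

text \<open>With the factor \<open>(1 / t) ^ k\<close> each derivative is a linear combination of members of the
  family, so smoothness follows by one induction for all \<open>k\<close>.\<close>

definition flat_exp :: "nat \<Rightarrow> real \<Rightarrow> real" where
  "flat_exp k t = (if t > 0 then (1 / t) ^ k * exp (- (1 / t)) else 0)"

lemma power_le_fact_exp: "0 \<le> x \<Longrightarrow> x ^ n \<le> fact n * exp (x::real)"
proof -
  assume x: "0 \<le> x"
  have "x ^ n /\<^sub>R fact n \<le> exp x"
    unfolding exp_def using x sum_le_suminf[OF summable_exp_generic[of x], of "{n}"] by simp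
  then show ?thesis by (simp add: field_simps)
qed

text \<open>This is x^(k+1) <= (k+1)! exp x at x = 1/t. It forces the limit 0 at the origin, and
  since flat_exp k h / h = flat_exp (k + 1) h, it also gives the derivative 0 there.\<close>

lemma flat_exp_bound: "\<bar>flat_exp k t\<bar> \<le> fact (Suc k) * \<bar>t\<bar>"
proof (cases "t > 0")
  case True
  have "(1 / t) * ((1 / t) ^ k * exp (- (1 / t))) \<le> fact (Suc k)"
    using power_le_fact_exp[of "1 / t" "Suc k"] True by (simp add: exp_minus field_simps)
  then show ?thesis using True by (simp add: flat_exp_def abs_mult field_simps)
next
  case False
  have "0 \<le> fact (Suc k) * \<bar>t\<bar>" by (intro mult_nonneg_nonneg) auto
  moreover have "flat_exp k t = 0" using False by (simp add: flat_exp_def)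
  ultimately show ?thesis by simp
qed

text \<open>With s = 1/t, whose derivative is -s^2, the product s^k exp(-s) has derivative -k
  s^(k+1) exp(-s) + s^(k+2) exp(-s). On the negative half-line and at 0 all members of the family
  vanish.\<close>

lemma DERIV_flat_exp:
  "(flat_exp k has_real_derivative (- real k * flat_exp (Suc k) t + flat_exp (Suc (Suc k)) t)) (at t)"
proof (cases t "0::real" rule: linorder_cases)
  case less
  have "((\<lambda>_. 0) has_real_derivative (- real k * flat_exp (Suc k) t + flat_exp (Suc (Suc k)) t)) (at t)"
    using less by (auto simp: flat_exp_def)
  then show ?thesis
    by (rule has_field_derivative_transform_within_open[where S="{..<0}"]) (use less in \<open>auto simp: flat_exp_def\<close>)
next
  case equal
  have "(\<lambda>h. flat_exp k h / h) = flat_exp (Suc k)" by (auto simp: flat_exp_def fun_eq_iff)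
  moreover have "(flat_exp (Suc k) \<longlongrightarrow> 0) (at 0)"
  proof (rule Lim_null_comparison)
    show "\<forall>\<^sub>F h in at 0. norm (flat_exp (Suc k) h) \<le> fact (Suc (Suc k)) * \<bar>h\<bar>"
      using flat_exp_bound[of "Suc k"] by (intro always_eventually) simp
    show "((\<lambda>h::real. fact (Suc (Suc k)) * \<bar>h\<bar>) \<longlongrightarrow> 0) (at 0)"
      by (intro tendsto_mult_right_zero tendsto_rabs_zero tendsto_ident_at)
  qed
  ultimately show ?thesis by (simp add: equal has_field_derivative_iff flat_exp_def[of _ 0])
next
  case greater
  have "((\<lambda>t. (1 / t) ^ k * exp (- (1 / t))) has_real_derivative
      (- real k * flat_exp (Suc k) t + flat_exp (Suc (Suc k)) t)) (at t)"
  proof -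
    have d: "((\<lambda>t. 1 / t) has_real_derivative - (1 / t)\<^sup>2) (at t)"
      using greater by (auto intro!: derivative_eq_intros simp: power2_eq_square)
    \<comment> \<open>For k = 0 the truncated exponent k - Suc 0 is harmless because of the factor
      real k.\<close>
    have "real k * (s ^ (k - Suc 0) * - s\<^sup>2) = - real k * s ^ Suc k" for s :: real
      by (cases k) (simp_all add: power2_eq_square algebra_simps)
    from this[of "1 / t"] show ?thesis
      using DERIV_mult[OF DERIV_power[OF d, of k] DERIV_fun_exp[OF DERIV_minus[OF d]]] greater
      by (simp add: flat_exp_def power2_eq_square mult_ac)
  qed
  then show ?thesis
    by (rule has_field_derivative_transform_within_open[where S="{0<..}"]) (use greater in \<open>auto simp: flat_exp_def\<close>)
qed

lemma smooth_flat_exp: "smooth (\<lambda>x::'a::euclidean_space. flat_exp k (x \<bullet> w + c))"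
  unfolding smooth_def
proof
  fix n
  show "C_class n (\<lambda>x::'a. flat_exp k (x \<bullet> w + c))"
  proof (induction n arbitrary: k)
    have d: "((\<lambda>x::'a. flat_exp k (x \<bullet> w + c)) has_derivative
       (\<lambda>h. (h \<bullet> w) * (- real k * flat_exp (Suc k) (x \<bullet> w + c) + flat_exp (Suc (Suc k)) (x \<bullet> w + c)))) (at x)" for k x
    proof -
      have "((\<lambda>x::'a. x \<bullet> w + c) has_derivative (\<lambda>h. h \<bullet> w)) (at x)"
        by (auto intro!: derivative_eq_intros)
      from DERIV_compose_FDERIV[OF DERIV_flat_exp this] show ?thesis by simp
    qed
    {
      case 0
      show ?case using has_derivative_continuous[OF d] by (auto intro!: continuous_at_imp_continuous_on)
    next
      case (Suc n)
      have 1: "(\<lambda>x::'a. flat_exp k (x \<bullet> w + c)) differentiable_on UNIV"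
        using d by (auto simp: differentiable_on_def differentiable_def intro: has_derivative_at_withinI)
      show ?case
        unfolding C_class.simps frechet_derivativeI[OF d]
        by (intro conjI 1 ballI C_class_mult C_class_add C_class_const Suc)
    }
  qed
qed

text \<open>As \<open>m \<rightarrow> \<infinity>\<close>, these test functions increase to the indicator function of \<open>box a b\<close>.\<close>

definition bump :: "'a::euclidean_space \<Rightarrow> 'a \<Rightarrow> real \<Rightarrow> 'a \<Rightarrow> real" where
  "bump a b m x = (\<Prod>i\<in>Basis. flat_exp 0 (m * (x \<bullet> i - a \<bullet> i)) * flat_exp 0 (m * (b \<bullet> i - x \<bullet> i)))"

lemma smooth_bump: "smooth (bump a b m)"
proof -
  have "smooth (\<lambda>x. flat_exp 0 (x \<bullet> (m *\<^sub>R i) + - (m * (a \<bullet> i))) * flat_exp 0 (x \<bullet> (- m *\<^sub>R i) + m * (b \<bullet> i)))" for i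
    by (intro smooth_mult smooth_flat_exp)
  then have "smooth (\<lambda>x. flat_exp 0 (m * (x \<bullet> i - a \<bullet> i)) * flat_exp 0 (m * (b \<bullet> i - x \<bullet> i)))" for i
    by (simp add: algebra_simps)
  then show ?thesis unfolding bump_def[abs_def] by (intro smooth_prod)
qed

lemma flat_exp_0: "0 \<le> flat_exp 0 t" "flat_exp 0 t \<le> 1" "flat_exp 0 t \<noteq> 0 \<longleftrightarrow> 0 < t"
  by (auto simp: flat_exp_def)

lemma bump_bounds: "0 \<le> bump a b m x" "bump a b m x \<le> 1"
  unfolding bump_def using flat_exp_0
  by (auto intro!: prod_nonneg prod_le_1 mult_nonneg_nonneg mult_le_one)

lemma bump_nonzero: "m > 0 \<Longrightarrow> bump a b m x \<noteq> 0 \<longleftrightarrow> x \<in> box a b"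
  unfolding bump_def using flat_exp_0(3) by (auto simp: mem_box zero_less_mult_iff)

lemma bump_tendsto:
  fixes x :: "'a::euclidean_space"
  shows "(\<lambda>m. bump a b (real (Suc m)) x) \<longlonglongrightarrow> indicator (box a b) x"
proof (cases "x \<in> box a b")
  case True
  have "(\<lambda>m. flat_exp 0 (real (Suc m) * t)) \<longlonglongrightarrow> 1" if "t > 0" for t
  proof -
    have "(\<lambda>m. exp (- (1 / real (Suc m) * (1 / t)))) \<longlonglongrightarrow> exp (- (0 * (1 / t)))"
      using LIMSEQ_Suc[OF lim_1_over_n[where 'a=real]] by (intro tendsto_intros) simp
    then show ?thesis using that by (simp add: flat_exp_def zero_less_mult_iff)
  qed
  then have "(\<lambda>m. bump a b (real (Suc m)) x) \<longlonglongrightarrow> (\<Prod>i\<in>(Basis :: 'a set). 1 * 1)"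
    unfolding bump_def using True by (intro tendsto_prod tendsto_mult) (auto simp: mem_box)
  then show ?thesis using True by simp
next
  case False
  then have "bump a b (real (Suc m)) x = 0" for m using bump_nonzero[of "real (Suc m)" a b x] by simp
  then show ?thesis using False by simp
qed

lemma test_fun_bump:
  assumes "m > 0" "cbox a b \<subseteq> \<Omega>"
  shows "test_fun \<Omega> (bump a b m)"
proof -
  have "{x. bump a b m x \<noteq> 0} = box a b" using bump_nonzero assms by auto
  moreover have "closure (box a b) \<subseteq> cbox a b"
    by (rule closure_minimal[OF box_subset_cbox closed_cbox])
  moreover have "bounded (box a b)" by simp
  ultimately show ?thesis using assms smooth_bump unfolding test_fun_def
    by (auto simp: compact_closure)
qed

text \<open>The classical gradient, assembled from partial derivatives and available at every point.
  It differs from \<open>grad\<close> of the same function, which is an arbitrary choice of weak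
  gradient and agrees with it only almost everywhere.\<close>

definition tgrad :: "('a::euclidean_space \<Rightarrow> real) \<Rightarrow> 'a \<Rightarrow> 'a" where
  "tgrad \<phi> x = (\<Sum>i\<in>Basis. frechet_derivative \<phi> (at x) i *\<^sub>R i)"

lemma tgradI: "(\<phi> has_derivative (\<lambda>h. D \<bullet> h)) (at x) \<Longrightarrow> tgrad \<phi> x = D"
  unfolding tgrad_def by (simp add: frechet_derivativeI euclidean_representation)

lemma smooth_has_tgrad:
  assumes "smooth \<phi>"
  shows "(\<phi> has_derivative (\<lambda>h. tgrad \<phi> x \<bullet> h)) (at x)"
proof -
  let ?f = "frechet_derivative \<phi> (at x)"
  have d: "(\<phi> has_derivative ?f) (at x)" by (rule smooth_has_derivative[OF assms])
  interpret bounded_linear ?f using d by (rule has_derivative_bounded_linear)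
  have "?f h = tgrad \<phi> x \<bullet> h" for h
  proof -
    have "?f h = ?f (\<Sum>i\<in>Basis. (h \<bullet> i) *\<^sub>R i)" by (simp add: euclidean_representation)
    also have "\<dots> = tgrad \<phi> x \<bullet> h"
      unfolding tgrad_def inner_sum_left inner_scaleR_left sum scaleR real_scaleR_def
      by (intro sum.cong refl) (simp add: inner_commute)
    finally show ?thesis .
  qed
  then show ?thesis using d by (metis (no_types, lifting) ext)
qed

lemma tgrad_inner_Basis: "i \<in> Basis \<Longrightarrow> tgrad \<phi> x \<bullet> i = frechet_derivative \<phi> (at x) i"
  by (simp add: tgrad_def)

lemma test_fun_outside:
  assumes "test_fun \<Omega> \<phi>" "x \<notin> \<Omega>"
  shows "\<phi> x = 0" "tgrad \<phi> x = 0"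
proof -
  let ?K = "closure {x. \<phi> x \<noteq> 0}"
  have x: "x \<in> - ?K" using assms by (auto simp: test_fun_def)
  then show "\<phi> x = 0" using closure_subset[of "{x. \<phi> x \<noteq> 0}"] by auto
  have "((\<lambda>_. 0) has_derivative (\<lambda>h. 0 \<bullet> h)) (at x)" by simp
  then have "(\<phi> has_derivative (\<lambda>h. 0 \<bullet> h)) (at x)"
    by (rule has_derivative_transform_within_open[OF _ open_Compl[OF closed_closure] x])
       (use closure_subset[of "{x. \<phi> x \<noteq> 0}"] in auto)
  then show "tgrad \<phi> x = 0" by (rule tgradI)
qed

lemma C1c_test_fun:
  assumes "test_fun \<Omega> \<phi>"
  shows "C1c \<phi> (tgrad \<phi>)"
proof -
  have s: "smooth \<phi>" and K: "compact (closure {x. \<phi> x \<noteq> 0})" using assms by (auto simp: test_fun_def)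
  have tf: "test_fun (closure {x. \<phi> x \<noteq> 0}) \<phi>" using s K by (simp add: test_fun_def)
  obtain R where R: "\<And>x. x \<in> closure {x. \<phi> x \<noteq> 0} \<Longrightarrow> norm x < R"
    using compact_imp_bounded[OF K] unfolding bounded_pos_less by blast
  have "continuous_on UNIV (tgrad \<phi>)"
    unfolding tgrad_def[abs_def] by (intro continuous_intros smooth_partial_continuous s)
  then show ?thesis
    unfolding C1c_def using smooth_has_tgrad[OF s] test_fun_outside[OF tf] R
    by (intro conjI allI exI[of _ R] impI) (meson not_le)+
qed

lemma test_fun_zero: "test_fun \<Omega> (\<lambda>_. 0)"
  by (simp add: test_fun_def smooth_const)

lemma test_fun_lincomb:
  assumes "test_fun \<Omega> f" "test_fun \<Omega> g"
  shows "test_fun \<Omega> (\<lambda>x. c * f x + d * g x)"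
    and "tgrad (\<lambda>x. c * f x + d * g x) x = c *\<^sub>R tgrad f x + d *\<^sub>R tgrad g x"
proof -
  have s: "smooth f" "smooth g" using assms by (auto simp: test_fun_def)
  have sub: "{x. c * f x + d * g x \<noteq> 0} \<subseteq> {x. f x \<noteq> 0} \<union> {x. g x \<noteq> 0}" by auto
  from closure_mono[OF this] have cl: "closure {x. c * f x + d * g x \<noteq> 0} \<subseteq> closure {x. f x \<noteq> 0} \<union> closure {x. g x \<noteq> 0}"
    by (simp add: closure_Un)
  have "compact ((closure {x. f x \<noteq> 0} \<union> closure {x. g x \<noteq> 0}) \<inter> closure {x. c * f x + d * g x \<noteq> 0})"
    using assms by (intro compact_Int_closed compact_Un) (auto simp: test_fun_def)
  then have "compact (closure {x. c * f x + d * g x \<noteq> 0})"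
    by (simp only: Int_absorb1[OF cl])
  then show "test_fun \<Omega> (\<lambda>x. c * f x + d * g x)"
    using cl assms s unfolding test_fun_def
    by (auto intro!: smooth_add smooth_mult smooth_const)
  show "tgrad (\<lambda>x. c * f x + d * g x) x = c *\<^sub>R tgrad f x + d *\<^sub>R tgrad g x"
    using smooth_has_tgrad[OF s(1)] smooth_has_tgrad[OF s(2)]
    by (intro tgradI) (auto intro!: derivative_eq_intros simp: inner_add_left)
qed

lemma test_fun_mult:
  assumes "test_fun \<Omega> f" "test_fun \<Omega> g"
  shows "test_fun \<Omega> (\<lambda>x. f x * g x)" "tgrad (\<lambda>x. f x * g x) x = f x *\<^sub>R tgrad g x + g x *\<^sub>R tgrad f x"
proof -
  have s: "smooth f" "smooth g" using assms by (auto simp: test_fun_def)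
  have cl: "closure {x. f x * g x \<noteq> 0} \<subseteq> closure {x. f x \<noteq> 0}" by (rule closure_mono) auto
  have "compact (closure {x. f x \<noteq> 0} \<inter> closure {x. f x * g x \<noteq> 0})"
    using assms by (intro compact_Int_closed) (auto simp: test_fun_def)
  then have "compact (closure {x. f x * g x \<noteq> 0})"
    by (simp only: Int_absorb1[OF cl])
  then show "test_fun \<Omega> (\<lambda>x. f x * g x)"
    using cl assms s unfolding test_fun_def by (auto intro!: smooth_mult)
  show "tgrad (\<lambda>x. f x * g x) x = f x *\<^sub>R tgrad g x + g x *\<^sub>R tgrad f x"
    using smooth_has_tgrad[OF s(1)] smooth_has_tgrad[OF s(2)]
    by (intro tgradI) (auto intro!: derivative_eq_intros simp: inner_add_left)
qed

section \<open>Integration by parts for test functions\<close>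

lemma integral_lborel_translate:
  fixes f :: "'a::euclidean_space \<Rightarrow> 'b::euclidean_space"
  assumes [measurable]: "f \<in> borel_measurable borel"
  shows "(\<integral>x. f (x + c) \<partial>lborel) = (\<integral>x. f x \<partial>lborel)"
proof -
  have "(\<integral>x. f x \<partial>lborel) = (\<integral>x. f x \<partial>distr lborel borel ((+) c))"
    by (simp add: lborel_distr_plus)
  also have "\<dots> = (\<integral>x. f (c + x) \<partial>lborel)" by (rule integral_distr) auto
  finally show ?thesis by (simp add: add.commute)
qed

text \<open>Every difference quotient in direction i has integral 0 by translation invariance. The
  quotients converge to the partial derivative and are dominated by the bound B of the gradient on
  the ball of radius R + 1, since the shifts have length at most 1.\<close>

lemma integral_C1c_partial:
  fixes f :: "'a::euclidean_space \<Rightarrow> real"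
  assumes f: "C1c f D" and i: "i \<in> Basis"
  shows "(\<integral>x. D x \<bullet> i \<partial>lborel) = 0"
proof -
  obtain R where R: "\<And>x. R \<le> norm x \<Longrightarrow> f x = 0" "\<And>x. R \<le> norm x \<Longrightarrow> D x = 0" using f by (auto simp: C1c_def)
  have c: "continuous_on UNIV f" "continuous_on UNIV D" using f C1c_continuous by (auto simp: C1c_def)
  have [measurable]: "f \<in> borel_measurable borel" "D \<in> borel_measurable borel"
    using c by (auto intro: borel_measurable_continuous_onI)
  have int: "integrable lborel f" using integrable_continuous_compact_support[OF c(1) R(1)] .
  have "compact (D ` cball 0 R)" by (intro compact_continuous_image continuous_on_subset[OF c(2)]) auto
  then obtain B where B: "B > 0" "\<And>x. x \<in> cball 0 R \<Longrightarrow> norm (D x) \<le> B"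
    using bounded_pos[of "D ` cball 0 R"] compact_imp_bounded by auto
  have DB: "norm (D x) \<le> B" for x using B R(2)[of x] by (cases "norm x \<le> R") auto
  have lip: "\<bar>f (x + h) - f x\<bar> \<le> B * norm h" for x h
  proof -
    have "norm (f (x + h) - f x) \<le> B * norm (x + h - x)"
    proof (rule differentiable_bound[where S=UNIV and f'="\<lambda>x h. D x \<bullet> h"])
      show "onorm (\<lambda>h. D x \<bullet> h) \<le> B" for x
        using DB[of x] by (intro onorm_le) (smt (verit) Cauchy_Schwarz_ineq2 mult_right_mono norm_ge_zero real_norm_def)
    qed (use f in \<open>auto simp: C1c_def\<close>)
    then show ?thesis by simp
  qed
  define q where "q n x = real (Suc n) * (f (x + (1 / real (Suc n)) *\<^sub>R i) - f x)" for n x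
  have shift_int: "integrable lborel (\<lambda>x. f (x + c))" for c
  proof (rule integrable_continuous_compact_support[of _ "R + norm c"])
    show "continuous_on UNIV (\<lambda>x. f (x + c))"
      by (rule continuous_on_compose2[OF c(1)]) (auto intro!: continuous_intros)
    show "f (x + c) = 0" if "R + norm c \<le> norm x" for x
      using norm_diff_ineq[of x c] that by (intro R(1)) simp
  qed
  have "(\<integral>x. q n x \<partial>lborel) = 0" for n
    unfolding q_def using int shift_int by (simp add: integral_lborel_translate)
  moreover have "(\<lambda>n. \<integral>x. q n x \<partial>lborel) \<longlonglongrightarrow> (\<integral>x. D x \<bullet> i \<partial>lborel)"
  proof (rule integral_dominated_convergence[where w="\<lambda>x. B * indicator (cball 0 (R + 1)) x"])
    show "integrable lborel (\<lambda>x::'a. B * indicator (cball 0 (R + 1)) x :: real)"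
      using emeasure_lborel_cball_finite[of "0::'a" "R + 1"]
      by (intro integrable_mult_right integrable_real_indicator) auto
    show "AE x in lborel. (\<lambda>n. q n x) \<longlonglongrightarrow> D x \<bullet> i"
    proof (intro AE_I2)
      fix x
      have "((\<lambda>t. f (x + t *\<^sub>R i)) has_real_derivative D x \<bullet> i) (at 0)"
      proof -
        have "((\<lambda>t. x + t *\<^sub>R i) has_vector_derivative i) (at 0)" by (auto intro!: derivative_eq_intros)
        moreover have "(f has_derivative (\<lambda>h. D x \<bullet> h)) (at (x + 0 *\<^sub>R i))" using f by (auto simp: C1c_def)
        ultimately have "((f \<circ> (\<lambda>t. x + t *\<^sub>R i)) has_vector_derivative (D x \<bullet> i)) (at 0)"
          using vector_derivative_diff_chain_within[of "\<lambda>t. x + t *\<^sub>R i" i 0 UNIV f]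
          by (auto intro: has_derivative_at_withinI)
        then show ?thesis by (simp add: has_real_derivative_iff_has_vector_derivative o_def)
      qed
      then have "((\<lambda>t. (f (x + t *\<^sub>R i) - f x) / t) \<longlongrightarrow> D x \<bullet> i) (at 0)"
        by (simp add: has_field_derivative_iff)
      moreover have "filterlim (\<lambda>n. 1 / real (Suc n)) (at 0) sequentially"
        using LIMSEQ_Suc[OF lim_1_over_n[where 'a=real]] by (auto simp: filterlim_at)
      ultimately have "(\<lambda>n. (f (x + (1 / real (Suc n)) *\<^sub>R i) - f x) / (1 / real (Suc n))) \<longlonglongrightarrow> D x \<bullet> i"
        by (rule filterlim_compose)
      then show "(\<lambda>n. q n x) \<longlonglongrightarrow> D x \<bullet> i" by (simp add: q_def mult.commute)
    qed
    show "AE x in lborel. norm (q n x) \<le> B * indicator (cball 0 (R + 1)) x" for n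
    proof (intro AE_I2)
      fix x
      have n1: "norm ((1 / real (Suc n)) *\<^sub>R i) \<le> 1" using i by simp
      show "norm (q n x) \<le> B * indicator (cball 0 (R + 1)) x"
      proof (cases "x \<in> cball 0 (R + 1)")
        case True
        have "norm (q n x) \<le> real (Suc n) * (B * norm ((1 / real (Suc n)) *\<^sub>R i))"
          unfolding q_def real_norm_def abs_mult
          using lip[of x "(1 / real (Suc n)) *\<^sub>R i"] by (intro mult_mono) auto
        then show ?thesis using True i by simp
      next
        case False
        then have "R + 1 < norm x" by simp
        then have "R \<le> norm x" "R \<le> norm (x + (1 / real (Suc n)) *\<^sub>R i)"
          using n1 norm_diff_ineq[of x "(1 / real (Suc n)) *\<^sub>R i"] by linarith+
        then show ?thesis using R(1) False by (simp add: q_def)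
      qed
    qed
  qed (simp_all add: q_def[abs_def])
  ultimately show ?thesis by (simp add: LIMSEQ_const_iff)
qed

text \<open>Estimates for test functions are proved over \<open>lborel\<close>, whereas the Sobolev
  spaces live over \<open>lebesgue_on \<Omega>\<close>; this lemma passes from one to the
  other.\<close>

lemma lebesgue_on_zero_outside:
  fixes f :: "'a::euclidean_space \<Rightarrow> 'b::euclidean_space"
  assumes \<Omega>: "open \<Omega>" and f: "f \<in> borel_measurable borel" and z: "\<And>x. x \<notin> \<Omega> \<Longrightarrow> f x = 0"
  shows "integrable (lebesgue_on \<Omega>) f \<longleftrightarrow> integrable lborel f"
    and "integral\<^sup>L (lebesgue_on \<Omega>) f = integral\<^sup>L lborel f"
    and "f \<in> borel_measurable (lebesgue_on \<Omega>)"
proof -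
  have s: "\<Omega> \<inter> space lebesgue \<in> sets lebesgue" using \<Omega> by auto
  have e: "(\<lambda>x. indicator \<Omega> x *\<^sub>R f x) = f" using z by (auto simp: fun_eq_iff indicator_def)
  have m: "f \<in> borel_measurable lborel" using f by simp
  show "integrable (lebesgue_on \<Omega>) f \<longleftrightarrow> integrable lborel f"
    unfolding integrable_restrict_space[OF s] e by (rule integrable_completion[OF m])
  show "integral\<^sup>L (lebesgue_on \<Omega>) f = integral\<^sup>L lborel f"
    unfolding integral_restrict_space[OF s] e by (rule integral_completion[OF m])
  show "f \<in> borel_measurable (lebesgue_on \<Omega>)"
    using f by (intro measurable_restrict_space1 measurable_completion) simp
qed

lemma test_fun_measurable:
  assumes "test_fun \<Omega> \<phi>"
  shows "\<phi> \<in> borel_measurable borel" "tgrad \<phi> \<in> borel_measurable borel"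
  using C1c_test_fun[OF assms] C1c_continuous unfolding C1c_def by (auto intro: borel_measurable_continuous_onI)

lemma test_fun_sq_integrable:
  assumes \<Omega>: "open \<Omega>" and t: "test_fun \<Omega> \<phi>"
  shows "sq_integrable (lebesgue_on \<Omega>) \<phi>" "sq_integrable (lebesgue_on \<Omega>) (tgrad \<phi>)"
    and "L2n (lebesgue_on \<Omega>) \<phi> = L2n lborel \<phi>" "L2n (lebesgue_on \<Omega>) (tgrad \<phi>) = L2n lborel (tgrad \<phi>)"
proof -
  have [measurable]: "\<phi> \<in> borel_measurable borel" "tgrad \<phi> \<in> borel_measurable borel"
    using test_fun_measurable[OF t] by auto
  note z = test_fun_outside[OF t]
  have c: "continuous_on UNIV \<phi>" "continuous_on UNIV (tgrad \<phi>)"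
    using C1c_test_fun[OF t] C1c_continuous by (auto simp: C1c_def)
  obtain R where R: "\<And>x. R \<le> norm x \<Longrightarrow> \<phi> x = 0 \<and> tgrad \<phi> x = 0"
    using C1c_test_fun[OF t] by (auto simp: C1c_def)
  have i: "integrable lborel (\<lambda>x. (norm (\<phi> x))\<^sup>2)" "integrable lborel (\<lambda>x. (norm (tgrad \<phi> x))\<^sup>2)"
    using R by (auto intro!: integrable_continuous_compact_support[of _ R] continuous_intros c simp del: real_norm_def)
  show "sq_integrable (lebesgue_on \<Omega>) \<phi>" "sq_integrable (lebesgue_on \<Omega>) (tgrad \<phi>)"
    using i z lebesgue_on_zero_outside(3)[OF \<Omega>, of \<phi>] lebesgue_on_zero_outside(3)[OF \<Omega>, of "tgrad \<phi>"]
      lebesgue_on_zero_outside(1)[OF \<Omega>, of "\<lambda>x. (norm (\<phi> x))\<^sup>2"] lebesgue_on_zero_outside(1)[OF \<Omega>, of "\<lambda>x. (norm (tgrad \<phi> x))\<^sup>2"]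
    by (auto simp: sq_integrable_def)
  show "L2n (lebesgue_on \<Omega>) \<phi> = L2n lborel \<phi>" "L2n (lebesgue_on \<Omega>) (tgrad \<phi>) = L2n lborel (tgrad \<phi>)"
    using z lebesgue_on_zero_outside(2)[OF \<Omega>, of "\<lambda>x. (norm (\<phi> x))\<^sup>2"] lebesgue_on_zero_outside(2)[OF \<Omega>, of "\<lambda>x. (norm (tgrad \<phi> x))\<^sup>2"]
    by (auto simp: L2n_def)
qed

text \<open>The product of two test functions is a test function, so its partial derivative has
  integral 0; the product rule splits this integral.\<close>

lemma test_fun_parts:
  assumes \<Omega>: "open \<Omega>" and t: "test_fun \<Omega> \<phi>" "test_fun \<Omega> \<psi>" and i: "i \<in> Basis"
  shows "(\<integral>x. \<phi> x * frechet_derivative \<psi> (at x) i \<partial>lebesgue_on \<Omega>) = - (\<integral>x. (tgrad \<phi> x \<bullet> i) * \<psi> x \<partial>lebesgue_on \<Omega>)"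
proof -
  let ?M = "lebesgue_on \<Omega>"
  note s = test_fun_sq_integrable[OF \<Omega>]
  have si: "sq_integrable ?M (\<lambda>x. tgrad f x \<bullet> i)" if "test_fun \<Omega> f" for f
  proof -
    have [measurable]: "tgrad f \<in> borel_measurable ?M" using s[OF that] by (simp add: sq_integrable_def)
    have le: "(tgrad f x \<bullet> i)\<^sup>2 \<le> (norm (tgrad f x))\<^sup>2" for x
      using abs_le_square_iff[of "tgrad f x \<bullet> i" "norm (tgrad f x)"] Basis_le_norm[OF i, of "tgrad f x"] by simp
    have "integrable ?M (\<lambda>x. (norm (tgrad f x \<bullet> i))\<^sup>2)"
      by (rule Bochner_Integration.integrable_bound[of _ "\<lambda>x. (norm (tgrad f x))\<^sup>2"])
         (use s[OF that] i le in \<open>auto simp: sq_integrable_def intro!: AE_I2\<close>)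
    then show ?thesis by (simp add: sq_integrable_def)
  qed
  have 1: "integrable ?M (\<lambda>x. \<phi> x * (tgrad \<psi> x \<bullet> i))" "integrable ?M (\<lambda>x. \<psi> x * (tgrad \<phi> x \<bullet> i))"
    using sq_integrable_inner(1)[OF s(1)[OF t(1)] si[OF t(2)]] sq_integrable_inner(1)[OF s(1)[OF t(2)] si[OF t(1)]] by auto
  have "0 = (\<integral>x. tgrad (\<lambda>x. \<phi> x * \<psi> x) x \<bullet> i \<partial>lborel)"
    using integral_C1c_partial[OF C1c_test_fun[OF test_fun_mult(1)[OF t]] i] by simp
  also have "\<dots> = (\<integral>x. tgrad (\<lambda>x. \<phi> x * \<psi> x) x \<bullet> i \<partial>?M)"
    using test_fun_measurable(2)[OF test_fun_mult(1)[OF t]] test_fun_outside(2)[OF test_fun_mult(1)[OF t]]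
    by (intro lebesgue_on_zero_outside(2)[symmetric, OF \<Omega>]) auto
  also have "\<dots> = (\<integral>x. \<phi> x * (tgrad \<psi> x \<bullet> i) \<partial>?M) + (\<integral>x. \<psi> x * (tgrad \<phi> x \<bullet> i) \<partial>?M)"
    unfolding test_fun_mult(2)[OF t] using 1 by (simp add: inner_add_left)
  finally show ?thesis using i by (simp add: tgrad_inner_Basis mult.commute)
qed

section \<open>Local integrability and the fundamental lemma of the calculus of variations\<close>

lemma sq_integrable_integrable_on:
  fixes f :: "'a::euclidean_space \<Rightarrow> 'b::euclidean_space"
  assumes f: "sq_integrable (lebesgue_on \<Omega>) f" and \<Omega>: "\<Omega> \<in> sets lebesgue" and K: "K \<subseteq> \<Omega>" "K \<in> lmeasurable"
  shows "integrable (lebesgue_on K) f"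
proof -
  have sK: "K \<inter> space lebesgue \<in> sets lebesgue" "\<Omega> \<inter> space lebesgue \<in> sets lebesgue" using K \<Omega> by auto
  have m: "f \<in> borel_measurable (lebesgue_on K)"
    using f K(1) measurable_restrict_mono unfolding sq_integrable_def by blast
  have 1: "integrable lebesgue (\<lambda>x. indicator \<Omega> x *\<^sub>R (norm (f x))\<^sup>2)"
    using f sK by (simp add: sq_integrable_def integrable_restrict_space)
  have 2: "integrable lebesgue (indicator K :: 'a \<Rightarrow> real)"
    using K by (intro integrable_real_indicator) (auto simp: fmeasurable_def)
  \<comment> \<open>On the set K of finite measure this dominates the norm of f by 1 plus its
    square.\<close>
  have le: "t \<le> 1 + t\<^sup>2" for t :: real
    using sum_squares_bound[of t 1] zero_le_power2[of t] by (simp, linarith)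
  have "integrable lebesgue (\<lambda>x. indicator K x *\<^sub>R f x)"
  proof (rule Bochner_Integration.integrable_bound[OF Bochner_Integration.integrable_add[OF 2 1]])
    show "(\<lambda>x. indicator K x *\<^sub>R f x) \<in> borel_measurable lebesgue"
      using m sK by (simp add: borel_measurable_restrict_space_iff)
    show "AE x in lebesgue. norm (indicator K x *\<^sub>R f x) \<le> norm (indicator K x + indicator \<Omega> x *\<^sub>R (norm (f x))\<^sup>2)"
      using K(1) le by (intro AE_I2) (auto simp: indicator_def)
  qed
  then show ?thesis using sK by (simp add: integrable_restrict_space)
qed

lemma sq_integrable_locally_integrable:
  "open \<Omega> \<Longrightarrow> sq_integrable (lebesgue_on \<Omega>) f \<Longrightarrow> locally_integrable \<Omega> f"
  unfolding locally_integrable_def by (auto intro: sq_integrable_integrable_on lmeasurable_compact)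

lemma locally_integrable_mult_test_fun:
  assumes \<Omega>: "open \<Omega>" and h: "locally_integrable \<Omega> h" and t: "test_fun \<Omega> \<phi>"
  shows "integrable (lebesgue_on \<Omega>) (\<lambda>x. h x * \<phi> x :: real)"
proof -
  let ?K = "closure {x. \<phi> x \<noteq> 0}"
  have K: "compact ?K" "?K \<subseteq> \<Omega>" using t by (auto simp: test_fun_def)
  then have sK: "?K \<inter> space lebesgue \<in> sets lebesgue" "\<Omega> \<inter> space lebesgue \<in> sets lebesgue" using \<Omega> by auto
  have zK: "\<phi> x = 0" if "x \<notin> ?K" for x using that closure_subset[of "{x. \<phi> x \<noteq> 0}"] by auto
  have "bounded (\<phi> ` ?K)"
    using C1c_continuous[OF C1c_test_fun[OF t]] K
    by (intro compact_imp_bounded compact_continuous_image) (auto intro: continuous_on_subset)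
  then obtain B where BK: "\<And>x. x \<in> ?K \<Longrightarrow> \<bar>\<phi> x\<bar> \<le> B" unfolding bounded_iff by auto
  have B: "\<bar>\<phi> x\<bar> \<le> \<bar>B\<bar>" for x
  proof (cases "x \<in> ?K")
    case True
    then show ?thesis using BK[of x] by linarith
  next
    case False
    from zK[OF False] show ?thesis by simp
  qed
  have hK: "integrable lebesgue (\<lambda>x. indicator ?K x *\<^sub>R h x)"
    using h K unfolding integrable_restrict_space[OF sK(1), symmetric] by (auto simp: locally_integrable_def)
  have \<phi>m: "\<phi> \<in> borel_measurable lebesgue" using test_fun_measurable[OF t] by (intro measurable_completion) simp
  have "integrable lebesgue (\<lambda>x. indicator \<Omega> x *\<^sub>R (h x * \<phi> x))"
  proof (rule Bochner_Integration.integrable_bound[OF integrable_mult_right[OF hK, of "\<bar>B\<bar>"]])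
    have "(\<lambda>x. indicator \<Omega> x *\<^sub>R (h x * \<phi> x)) = (\<lambda>x. (indicator ?K x *\<^sub>R h x) * \<phi> x)"
    proof
      fix x
      show "indicator \<Omega> x *\<^sub>R (h x * \<phi> x) = (indicator ?K x *\<^sub>R h x) * \<phi> x"
      proof (cases "x \<in> ?K")
        case True
        with K(2) have "x \<in> \<Omega>" by blast
        with True show ?thesis by (simp add: indicator_def)
      next
        case False
        from zK[OF False] show ?thesis by simp
      qed
    qed
    then show "(\<lambda>x. indicator \<Omega> x *\<^sub>R (h x * \<phi> x)) \<in> borel_measurable lebesgue"
      using borel_measurable_times[OF borel_measurable_integrable[OF hK] \<phi>m] by simp
    show "AE x in lebesgue. norm (indicator \<Omega> x *\<^sub>R (h x * \<phi> x)) \<le> norm (\<bar>B\<bar> * (indicator ?K x *\<^sub>R h x))"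
    proof (intro AE_I2)
      fix x
      show "norm (indicator \<Omega> x *\<^sub>R (h x * \<phi> x)) \<le> norm (\<bar>B\<bar> * (indicator ?K x *\<^sub>R h x))"
      proof (cases "x \<in> ?K")
        case True
        with K(2) have "x \<in> \<Omega>" by blast
        with True B[of x] show ?thesis
          by (simp add: indicator_def abs_mult mult.commute mult_right_mono)
      next
        case False
        from zK[OF False] show ?thesis by simp
      qed
    qed
  qed
  then show ?thesis using sK by (simp add: integrable_restrict_space)
qed

text \<open>The positive and the negative part of f define two measures that agree and are finite on
  boxes. Boxes are an intersection-stable generator of the Borel sets, so the measures coincide and
  then so do their densities. A Borel representative g replaces f because boxes generate only the
  Borel sets.\<close>

lemma AE_zero_if_box_integrals_zero:
  fixes f :: "'a::euclidean_space \<Rightarrow> real"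
  assumes f: "integrable lebesgue f" and z: "\<And>c d. (\<integral>x. f x * indicator (box c d) x \<partial>lebesgue) = 0"
  shows "AE x in lebesgue. f x = 0"
proof -
  obtain g where g [measurable]: "g \<in> borel_measurable lborel" and fg: "AE x in lborel. f x = g x"
    using completion_ex_borel_measurable_real[of f lborel] f by auto
  have fg': "AE x in lebesgue. f x = g x" by (rule AE_completion[OF fg])
  have gm: "g \<in> borel_measurable lebesgue" by (rule measurable_completion[OF g])
  have "integrable lebesgue g" using integrable_cong_AE[OF borel_measurable_integrable[OF f] gm fg'] f by simp
  then have ig: "integrable lborel g" using integrable_completion[OF g] by simp
  have zg: "(\<integral>x. g x * indicator (box c d) x \<partial>lborel) = 0" for c d
  proof -
    have "(\<integral>x. g x * indicator (box c d) x \<partial>lborel) = (\<integral>x. g x * indicator (box c d) x \<partial>lebesgue)"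
      by (rule integral_completion[symmetric]) measurable
    also have "\<dots> = (\<integral>x. f x * indicator (box c d) x \<partial>lebesgue)"
      using fg' by (intro integral_cong_AE borel_measurable_times borel_measurable_integrable[OF f] gm
        borel_measurable_indicator) (auto elim!: eventually_mono)
    finally show ?thesis using z by simp
  qed
  \<comment> \<open>\<open>ennreal\<close> maps negative numbers to 0, so these are the densities of
    the positive and the negative part of g.\<close>
  let ?P = "density lborel (\<lambda>x. ennreal (g x))" and ?N = "density lborel (\<lambda>x. ennreal (- g x))"
  have em: "emeasure ?P (box c d) = emeasure ?N (box c d)" "emeasure ?P (box c d) \<noteq> \<infinity>" for c d
  proof -
    let ?I = "indicator (box c d) :: 'a \<Rightarrow> real"
    have i: "integrable lborel (\<lambda>x. max 0 (g x) * ?I x)" "integrable lborel (\<lambda>x. max 0 (- g x) * ?I x)"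
      using ig by (auto intro!: integrable_real_mult_indicator integrable_max)
    have "emeasure ?P (box c d) = (\<integral>\<^sup>+x. ennreal (max 0 (g x) * ?I x) \<partial>lborel)"
      by (subst emeasure_density) (auto intro!: nn_integral_cong simp: indicator_def max_def ennreal_neg)
    also have "\<dots> = ennreal (\<integral>x. max 0 (g x) * ?I x \<partial>lborel)"
      by (rule nn_integral_eq_integral[OF i(1)]) auto
    finally have 1: "emeasure ?P (box c d) = ennreal (\<integral>x. max 0 (g x) * ?I x \<partial>lborel)" .
    have "emeasure ?N (box c d) = (\<integral>\<^sup>+x. ennreal (max 0 (- g x) * ?I x) \<partial>lborel)"
      by (subst emeasure_density) (auto intro!: nn_integral_cong simp: indicator_def max_def ennreal_neg)
    also have "\<dots> = ennreal (\<integral>x. max 0 (- g x) * ?I x \<partial>lborel)"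
      by (rule nn_integral_eq_integral[OF i(2)]) auto
    finally have 2: "emeasure ?N (box c d) = ennreal (\<integral>x. max 0 (- g x) * ?I x \<partial>lborel)" .
    have "(\<integral>x. max 0 (g x) * ?I x \<partial>lborel) - (\<integral>x. max 0 (- g x) * ?I x \<partial>lborel) = (\<integral>x. g x * ?I x \<partial>lborel)"
      unfolding Bochner_Integration.integral_diff[OF i, symmetric]
      by (intro Bochner_Integration.integral_cong refl) (auto simp: max_def)
    then show "emeasure ?P (box c d) = emeasure ?N (box c d)" "emeasure ?P (box c d) \<noteq> \<infinity>"
      using zg 1 2 by auto
  qed
  have "?P = ?N"
  proof (rule measure_eqI_generator_eq[where \<Omega>=UNIV and E="range (\<lambda>(a, b). box a b :: 'a set)" and A="\<lambda>i::nat. box (- (real i *\<^sub>R One)) (real i *\<^sub>R One)"])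
    show "Int_stable (range (\<lambda>(a, b). box a b :: 'a set))"
      by (auto simp: Int_stable_def box_Int_box)
    show "sets ?P = sigma_sets UNIV (range (\<lambda>(a, b). box a b :: 'a set))"
      by (simp add: borel_eq_box)
    show "sets ?N = sigma_sets UNIV (range (\<lambda>(a, b). box a b :: 'a set))"
      by (simp add: borel_eq_box)
    show "(\<Union>i::nat. box (- (real i *\<^sub>R One)) (real i *\<^sub>R One)) = (UNIV :: 'a set)"
      by (rule UN_box_eq_UNIV)
  qed (use em in auto)
  then have "AE x in lborel. ennreal (g x) = ennreal (- g x)"
    using sigma_finite_measure.density_unique_iff[OF lborel.sigma_finite_measure_axioms, of "\<lambda>x. ennreal (g x)" "\<lambda>x. ennreal (- g x)"] by auto
  then have "AE x in lborel. g x = 0"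
  proof eventually_elim
    case (elim x)
    show ?case
    proof (cases "0 \<le> g x")
      case True
      then show ?thesis using elim by (simp add: ennreal_neg ennreal_eq_0_iff)
    next
      case False
      then have "ennreal (g x) = 0" by (intro ennreal_neg) simp
      with elim False show ?thesis by (metis ennreal_eq_0_iff neg_le_0_iff_le linear)
    qed
  qed
  then have "AE x in lebesgue. g x = 0" by (rule AE_completion)
  with fg' show ?thesis by eventually_elim simp
qed

text \<open>Bump functions converge boundedly to indicators of boxes, so h has integral 0 over every
  box whose closure lies in the open set. Intersecting with further boxes makes the previous lemma
  applicable to h on each such box, and countably many of these boxes cover the open set by
  Lindelof's theorem.\<close>

lemma du_Bois_Reymond:
  fixes h :: "'a::euclidean_space \<Rightarrow> real"
  assumes \<Omega>: "open \<Omega>" and h: "locally_integrable \<Omega> h"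
    and z: "\<And>\<phi>. test_fun \<Omega> \<phi> \<Longrightarrow> (\<integral>x. h x * \<phi> x \<partial>lebesgue_on \<Omega>) = 0"
  shows "AE x in lebesgue_on \<Omega>. h x = 0"
proof -
  have s: "\<Omega> \<inter> space lebesgue \<in> sets lebesgue" using \<Omega> by auto
  have ih: "integrable lebesgue (\<lambda>x. indicator (cbox a b) x *\<^sub>R h x)" if "cbox a b \<subseteq> \<Omega>" for a b
  proof -
    have "cbox a b \<inter> space lebesgue \<in> sets lebesgue" by simp
    then show ?thesis
      unfolding integrable_restrict_space[OF \<open>cbox a b \<inter> space lebesgue \<in> sets lebesgue\<close>, symmetric]
      using h that by (auto simp: locally_integrable_def)
  qed
  have box0: "(\<integral>x. h x * indicator (box a b) x \<partial>lebesgue) = 0" if ab: "cbox a b \<subseteq> \<Omega>" for a b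
  proof -
    let ?h = "\<lambda>x. indicator (cbox a b) x *\<^sub>R h x"
    have bz: "bump a b (real (Suc m)) x = 0" if "x \<notin> cbox a b" for m x
      using bump_nonzero[of "real (Suc m)" a b x] box_subset_cbox that by auto
    have "(\<integral>x. ?h x * bump a b (real (Suc m)) x \<partial>lebesgue) = 0" for m
    proof -
      have "(\<integral>x. ?h x * bump a b (real (Suc m)) x \<partial>lebesgue) = (\<integral>x. h x * bump a b (real (Suc m)) x \<partial>lebesgue_on \<Omega>)"
        unfolding integral_restrict_space[OF s] using ab bz
        by (intro Bochner_Integration.integral_cong) (auto simp: indicator_def subset_iff)
      also have "\<dots> = 0" by (intro z test_fun_bump ab) simp
      finally show ?thesis .
    qed
    moreover have "(\<lambda>m. \<integral>x. ?h x * bump a b (real (Suc m)) x \<partial>lebesgue) \<longlonglongrightarrow> (\<integral>x. ?h x * indicator (box a b) x \<partial>lebesgue)"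
    proof (rule integral_dominated_convergence[where w="\<lambda>x. \<bar>?h x\<bar>"])
      have m: "bump a b (real (Suc m)) \<in> borel_measurable lebesgue" for m
        using test_fun_measurable(1)[OF test_fun_bump[OF _ ab, of "real (Suc m)"]] by (intro measurable_completion) simp
      show "(\<lambda>x. ?h x * bump a b (real (Suc m)) x) \<in> borel_measurable lebesgue" for m
        by (rule borel_measurable_times[OF borel_measurable_integrable[OF ih[OF ab]] m])
      have "(indicator (box a b) :: 'a \<Rightarrow> real) \<in> borel_measurable lebesgue"
        by (intro borel_measurable_indicator) auto
      then show "(\<lambda>x. ?h x * indicator (box a b) x) \<in> borel_measurable lebesgue"
        by (rule borel_measurable_times[OF borel_measurable_integrable[OF ih[OF ab]]])
      show "integrable lebesgue (\<lambda>x. \<bar>?h x\<bar>)" using ih[OF ab] by (rule integrable_abs)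
      show "AE x in lebesgue. (\<lambda>m. ?h x * bump a b (real (Suc m)) x) \<longlonglongrightarrow> ?h x * indicator (box a b) x"
        by (intro AE_I2 tendsto_mult tendsto_const bump_tendsto)
      show "AE x in lebesgue. norm (?h x * bump a b (real (Suc m)) x) \<le> \<bar>?h x\<bar>" for m
        using bump_bounds[of a b "real (Suc m)"] by (intro AE_I2) (auto simp: abs_mult intro!: mult_left_le)
    qed
    ultimately have "(\<integral>x. ?h x * indicator (box a b) x \<partial>lebesgue) = 0"
      by (simp only: LIMSEQ_const_iff)
    moreover have "(\<lambda>x. ?h x * indicator (box a b) x) = (\<lambda>x. h x * indicator (box a b) x)"
      using box_subset_cbox[of a b] by (auto simp: fun_eq_iff indicator_def)
    ultimately show ?thesis by simp
  qed
  have AEbox: "AE x in lebesgue. x \<in> box a b \<longrightarrow> h x = 0" if ab: "cbox a b \<subseteq> \<Omega>" for a b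
  proof -
    have e: "(\<lambda>x. h x * indicator (box a b) x) = (\<lambda>x. (indicator (cbox a b) x *\<^sub>R h x) * indicator (box a b) x)"
      using box_subset_cbox[of a b] by (auto simp: fun_eq_iff indicator_def)
    have "AE x in lebesgue. h x * indicator (box a b) x = 0"
    proof (rule AE_zero_if_box_integrals_zero)
      show "integrable lebesgue (\<lambda>x. h x * indicator (box a b) x)"
        unfolding e by (intro integrable_real_mult_indicator ih ab) auto
      fix c d :: 'a
      define a' where "a' = (\<Sum>i\<in>Basis. max (a \<bullet> i) (c \<bullet> i) *\<^sub>R i)"
      define b' where "b' = (\<Sum>i\<in>Basis. min (b \<bullet> i) (d \<bullet> i) *\<^sub>R i)"
      have "box a b \<inter> box c d = box a' b'" by (simp add: box_Int_box a'_def b'_def)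
      then have "(\<integral>x. h x * indicator (box a b) x * indicator (box c d) x \<partial>lebesgue) = (\<integral>x. h x * indicator (box a' b') x \<partial>lebesgue)"
        by (simp add: mult.assoc flip: indicator_inter_arith)
      also have "\<dots> = 0"
        using ab by (intro box0) (auto simp: a'_def b'_def mem_box subset_iff)
      finally show "(\<integral>x. h x * indicator (box a b) x * indicator (box c d) x \<partial>lebesgue) = 0" .
    qed
    then show ?thesis by eventually_elim (auto simp: indicator_def split: if_splits)
  qed
  define \<F> where "\<F> = {box a b | a b. cbox a b \<subseteq> \<Omega>}"
  obtain D where D: "countable D" "D \<subseteq> \<F>" "\<Union>D = \<Union>\<F>"
  proof -
    have "open S" if "S \<in> \<F>" for S using that by (auto simp: \<F>_def)
    from Lindelof[of \<F>, OF this] show ?thesis using that by metis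
  qed
  have cover: "\<Omega> \<subseteq> \<Union>\<F>"
  proof
    fix x assume "x \<in> \<Omega>"
    then obtain e where e: "e > 0" "ball x e \<subseteq> \<Omega>" using \<Omega> openE by blast
    obtain a b where ab: "x \<in> box a b" "box a b \<subseteq> ball x (e / 2)"
      using rational_boxes[of "e / 2" x] e by auto
    have "cbox a b = closure (box a b)" using ab(1) by (intro closure_box[symmetric]) auto
    also have "\<dots> \<subseteq> cball x (e / 2)" using ab(2) by (intro closure_minimal) auto
    also have "\<dots> \<subseteq> \<Omega>" using e by auto
    finally show "x \<in> \<Union>\<F>" using ab(1) by (auto simp: \<F>_def)
  qed
  have "AE x in lebesgue. \<forall>X\<in>D. x \<in> X \<longrightarrow> h x = 0"
  proof (subst AE_ball_countable[OF D(1)], rule ballI)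
    fix X assume "X \<in> D"
    then show "AE x in lebesgue. x \<in> X \<longrightarrow> h x = 0"
      using AEbox D(2) by (auto simp: \<F>_def)
  qed
  then have "AE x in lebesgue. x \<in> \<Omega> \<longrightarrow> h x = 0"
    by eventually_elim (use cover D(3) in blast)
  then show ?thesis using s by (simp add: AE_restrict_space_iff)
qed

lemma weak_gradient_unique:
  fixes u :: "'a::euclidean_space \<Rightarrow> real"
  assumes \<Omega>: "open \<Omega>" and g: "weak_gradient \<Omega> u g" "weak_gradient \<Omega> u g'"
  shows "AE x in lebesgue_on \<Omega>. g x = g' x"
proof -
  have "AE x in lebesgue_on \<Omega>. (g x - g' x) \<bullet> i = 0" if i: "i \<in> Basis" for i
  proof (rule du_Bois_Reymond[OF \<Omega>])
    have li: "locally_integrable \<Omega> (\<lambda>x. g x \<bullet> i)" "locally_integrable \<Omega> (\<lambda>x. g' x \<bullet> i)"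
      using g by (auto simp: weak_gradient_def locally_integrable_def)
    then show "locally_integrable \<Omega> (\<lambda>x. (g x - g' x) \<bullet> i)"
      by (auto simp: locally_integrable_def inner_diff_left)
    fix \<phi> assume t: "test_fun \<Omega> \<phi>"
    have "(\<integral>x. (g x \<bullet> i) * \<phi> x \<partial>lebesgue_on \<Omega>) = (\<integral>x. (g' x \<bullet> i) * \<phi> x \<partial>lebesgue_on \<Omega>)"
    proof -
      have "(\<integral>x. u x * frechet_derivative \<phi> (at x) i \<partial>lebesgue_on \<Omega>) = - (\<integral>x. (f x \<bullet> i) * \<phi> x \<partial>lebesgue_on \<Omega>)"
        if "weak_gradient \<Omega> u f" for f using that t i by (auto simp: weak_gradient_def)
      from this[OF g(1)] this[OF g(2)] show ?thesis by linarith
    qed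
    then show "(\<integral>x. (g x - g' x) \<bullet> i * \<phi> x \<partial>lebesgue_on \<Omega>) = 0"
      using locally_integrable_mult_test_fun[OF \<Omega> li(1) t] locally_integrable_mult_test_fun[OF \<Omega> li(2) t]
      by (simp add: inner_diff_left left_diff_distrib)
  qed
  then have "AE x in lebesgue_on \<Omega>. \<forall>i\<in>Basis. (g x - g' x) \<bullet> i = 0"
    by (subst AE_ball_countable) (auto intro: countable_finite)
  then show ?thesis
    by eventually_elim (rule euclidean_eqI, simp add: inner_diff_left)
qed

section \<open>Compactness of the embedding into the square integrable functions\<close>

lemma nn_integral_lborel_translate:
  fixes f :: "'a::euclidean_space \<Rightarrow> ennreal"
  assumes [measurable]: "f \<in> borel_measurable borel"
  shows "(\<integral>\<^sup>+x. f (x + c) \<partial>lborel) = (\<integral>\<^sup>+x. f x \<partial>lborel)"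
proof -
  have "(\<integral>\<^sup>+x. f x \<partial>lborel) = (\<integral>\<^sup>+x. f x \<partial>distr lborel borel ((+) c))"
    by (simp add: lborel_distr_plus)
  also have "\<dots> = (\<integral>\<^sup>+x. f (c + x) \<partial>lborel)" by (rule nn_integral_distr) auto
  finally show ?thesis by (simp add: add.commute)
qed

text \<open>The increment is the integral of D (x + t z) . z over t in [0, 1]. Cauchy-Schwarz in t
  bounds its square, and after exchanging the integrals the shift by t z disappears. Both the
  Poincare inequality and compactness rest on this.\<close>

lemma translation_estimate:
  fixes u :: "'a::euclidean_space \<Rightarrow> real"
  assumes u: "C1c u D"
  shows "(\<integral>\<^sup>+x. ennreal ((u (x + z) - u x)\<^sup>2) \<partial>lborel) \<le> ennreal ((norm z)\<^sup>2) * (\<integral>\<^sup>+x. ennreal ((norm (D x))\<^sup>2) \<partial>lborel)"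
proof -
  have cu: "continuous_on UNIV u" "continuous_on UNIV D" using u C1c_continuous by (auto simp: C1c_def)
  then have [measurable]: "u \<in> borel_measurable borel" "D \<in> borel_measurable borel"
    by (auto intro: borel_measurable_continuous_onI)
  have pt: "ennreal ((u (x + z) - u x)\<^sup>2) \<le> (\<integral>\<^sup>+t. indicator {0..1::real} t * (ennreal ((norm z)\<^sup>2) * ennreal ((norm (D (x + t *\<^sub>R z)))\<^sup>2)) \<partial>lborel)" for x
  proof -
    define f where "f t = D (x + t *\<^sub>R z) \<bullet> z" for t
    have cf: "continuous_on S f" for S unfolding f_def
      by (intro continuous_intros continuous_on_compose2[OF cu(2)]) auto
    have d: "((\<lambda>t. u (x + t *\<^sub>R z)) has_vector_derivative f t) (at t)" for t
    proof -
      have "((\<lambda>t. x + t *\<^sub>R z) has_vector_derivative z) (at t)" by (auto intro!: derivative_eq_intros)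
      moreover have "(u has_derivative (\<lambda>h. D (x + t *\<^sub>R z) \<bullet> h)) (at (x + t *\<^sub>R z))" using u by (auto simp: C1c_def)
      ultimately have "((u \<circ> (\<lambda>t. x + t *\<^sub>R z)) has_vector_derivative f t) (at t)"
        using vector_derivative_diff_chain_within[of "\<lambda>t. x + t *\<^sub>R z" z t UNIV u]
        by (auto intro: has_derivative_at_withinI simp: f_def)
      then show ?thesis by (simp add: o_def)
    qed
    have i: "integrable lborel (\<lambda>t. indicator {0..1} t *\<^sub>R f t)"
      using cf by (intro borel_integrable_compact) auto
    have "(\<integral>t. indicator {0..1} t *\<^sub>R f t \<partial>lborel) = u (x + 1 *\<^sub>R z) - u (x + 0 *\<^sub>R z)"
      using d cf by (intro integral_FTC_atLeastAtMost) (auto intro: has_vector_derivative_at_within)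
    then have "ennreal \<bar>u (x + z) - u x\<bar> = ennreal (norm (\<integral>t. indicator {0..1} t *\<^sub>R f t \<partial>lborel))" by simp
    also have "\<dots> \<le> (\<integral>\<^sup>+t. ennreal (norm (indicator {0..1} t *\<^sub>R f t)) \<partial>lborel)"
      by (rule integral_norm_bound_ennreal[OF i])
    also have "\<dots> = (\<integral>\<^sup>+t. indicator {0..1} t * (indicator {0..1} t * ennreal \<bar>f t\<bar>) \<partial>lborel)"
      by (intro nn_integral_cong) (auto simp: indicator_def)
    finally have "(ennreal \<bar>u (x + z) - u x\<bar>)\<^sup>2 \<le> (\<integral>\<^sup>+t. indicator {0..1} t * (indicator {0..1} t * ennreal \<bar>f t\<bar>) \<partial>lborel)\<^sup>2"
      by (rule power_mono) simp
    also have "\<dots> \<le> (\<integral>\<^sup>+t. (indicator {0..1::real} t)\<^sup>2 \<partial>lborel) * (\<integral>\<^sup>+t. (indicator {0..1} t * ennreal \<bar>f t\<bar>)\<^sup>2 \<partial>lborel)"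
    proof (rule Cauchy_Schwarz_nn_integral)
      have "f \<in> borel_measurable borel" using cf by (intro borel_measurable_continuous_onI)
      then show "(\<lambda>t. indicator {0..1} t * ennreal \<bar>f t\<bar>) \<in> borel_measurable lborel" by measurable
    qed measurable
    also have "(\<integral>\<^sup>+t. (indicator {0..1::real} t)\<^sup>2 \<partial>lborel) = (\<integral>\<^sup>+t. indicator {0..1::real} t \<partial>lborel)"
      by (intro nn_integral_cong) (auto simp: indicator_def)
    also have "\<dots> = 1" by simp
    also have "1 * (\<integral>\<^sup>+t. (indicator {0..1} t * ennreal \<bar>f t\<bar>)\<^sup>2 \<partial>lborel)
        \<le> (\<integral>\<^sup>+t. indicator {0..1::real} t * (ennreal ((norm z)\<^sup>2) * ennreal ((norm (D (x + t *\<^sub>R z)))\<^sup>2)) \<partial>lborel)"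
      unfolding mult_1
    proof (rule nn_integral_mono)
      fix t :: real
      have "(ennreal \<bar>f t\<bar>)\<^sup>2 \<le> ennreal ((norm z)\<^sup>2 * (norm (D (x + t *\<^sub>R z)))\<^sup>2)"
        using power_mono[OF Cauchy_Schwarz_ineq2[of "D (x + t *\<^sub>R z)" z], of 2]
        by (subst ennreal_power) (auto simp: f_def power_mult_distrib mult.commute intro!: ennreal_leI)
      then show "(indicator {0..1} t * ennreal \<bar>f t\<bar>)\<^sup>2 \<le> indicator {0..1::real} t * (ennreal ((norm z)\<^sup>2) * ennreal ((norm (D (x + t *\<^sub>R z)))\<^sup>2))"
        by (auto simp: indicator_def ennreal_mult)
    qed
    finally show ?thesis by (simp add: ennreal_power)
  qed
  have m: "(\<lambda>(x, t). indicator {0..1::real} t * (ennreal ((norm z)\<^sup>2) * ennreal ((norm (D (x + t *\<^sub>R z)))\<^sup>2)))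
      \<in> borel_measurable (lborel \<Otimes>\<^sub>M lborel)" by measurable
  have "(\<integral>\<^sup>+x. ennreal ((u (x + z) - u x)\<^sup>2) \<partial>lborel) \<le>
    (\<integral>\<^sup>+x. \<integral>\<^sup>+t. indicator {0..1::real} t * (ennreal ((norm z)\<^sup>2) * ennreal ((norm (D (x + t *\<^sub>R z)))\<^sup>2)) \<partial>lborel \<partial>lborel)"
    by (intro nn_integral_mono pt)
  also have "\<dots> = (\<integral>\<^sup>+t. \<integral>\<^sup>+x. indicator {0..1::real} t * (ennreal ((norm z)\<^sup>2) * ennreal ((norm (D (x + t *\<^sub>R z)))\<^sup>2)) \<partial>lborel \<partial>lborel)"
    by (rule lborel_pair.Fubini'[symmetric]) (use m in simp)
  also have "\<dots> = (\<integral>\<^sup>+t. indicator {0..1::real} t * (ennreal ((norm z)\<^sup>2) * (\<integral>\<^sup>+x. ennreal ((norm (D x))\<^sup>2) \<partial>lborel)) \<partial>lborel)"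
    using nn_integral_lborel_translate[of "\<lambda>x. ennreal ((norm (D x))\<^sup>2)"]
    by (intro nn_integral_cong) (simp add: nn_integral_cmult)
  also have "\<dots> = ennreal ((norm z)\<^sup>2) * (\<integral>\<^sup>+x. ennreal ((norm (D x))\<^sup>2) \<partial>lborel)"
    by (subst nn_integral_multc) auto
  finally show ?thesis .
qed

lemma C1c_sq_integrable:
  assumes u: "C1c u D"
  shows "sq_integrable lborel u" "sq_integrable lborel D"
proof -
  obtain R where R: "\<And>x. R \<le> norm x \<Longrightarrow> u x = 0 \<and> D x = 0" using u by (auto simp: C1c_def)
  have c: "continuous_on UNIV u" "continuous_on UNIV D" using u C1c_continuous by (auto simp: C1c_def)
  have i: "integrable lborel (\<lambda>x. (norm (u x))\<^sup>2)" "integrable lborel (\<lambda>x. (norm (D x))\<^sup>2)"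
    using R by (auto intro!: integrable_continuous_compact_support[of _ R] continuous_intros c simp del: real_norm_def)
  then show "sq_integrable lborel u" "sq_integrable lborel D"
    using c by (auto simp: sq_integrable_def intro: borel_measurable_continuous_onI)
qed

lemma nn_integral_norm_power2: "sq_integrable M f \<Longrightarrow> (\<integral>\<^sup>+x. ennreal ((norm (f x))\<^sup>2) \<partial>M) = ennreal ((L2n M f)\<^sup>2)"
  unfolding L2n_power2 by (intro nn_integral_eq_integral) (auto simp: sq_integrable_def)

text \<open>A translation by a vector of length 2 R moves the ball of radius R off itself, so u (x +
  z) = 0 wherever u x is nonzero. Hence the square of u is at most the square of its increment, to
  which \<open>translation_estimate\<close> applies.\<close>

lemma Poincare_C1c:
  fixes u :: "'a::euclidean_space \<Rightarrow> real"
  assumes u: "C1c u D" and R: "\<And>x. R \<le> norm x \<Longrightarrow> u x = 0" "0 \<le> R"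
  shows "L2n lborel u \<le> 2 * R * L2n lborel D"
proof -
  obtain i :: 'a where i: "i \<in> Basis" using nonempty_Basis by blast
  define z where "z = (2 * R) *\<^sub>R i"
  have nz: "norm z = 2 * R" using i R(2) by (simp add: z_def)
  have "ennreal ((L2n lborel u)\<^sup>2) = (\<integral>\<^sup>+x. ennreal ((norm (u x))\<^sup>2) \<partial>lborel)"
    using nn_integral_norm_power2[OF C1c_sq_integrable(1)[OF u]] by simp
  also have "\<dots> \<le> (\<integral>\<^sup>+x. ennreal ((u (x + z) - u x)\<^sup>2) \<partial>lborel)"
  proof (intro nn_integral_mono ennreal_leI)
    fix x
    show "(norm (u x))\<^sup>2 \<le> (u (x + z) - u x)\<^sup>2"
    proof (cases "R \<le> norm x")
      case True
      from R(1)[OF True] show ?thesis by simp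
    next
      case False
      then have "R \<le> norm (x + z)" using norm_diff_ineq[of z x] nz by (simp add: add.commute)
      from R(1)[OF this] show ?thesis by simp
    qed
  qed
  also have "\<dots> \<le> ennreal ((norm z)\<^sup>2) * (\<integral>\<^sup>+x. ennreal ((norm (D x))\<^sup>2) \<partial>lborel)" by (rule translation_estimate[OF u])
  also have "\<dots> = ennreal ((2 * R * L2n lborel D)\<^sup>2)"
    by (simp add: nn_integral_norm_power2[OF C1c_sq_integrable(2)[OF u]] nz power_mult_distrib flip: ennreal_mult)
  finally have "(L2n lborel u)\<^sup>2 \<le> (2 * R * L2n lborel D)\<^sup>2" by simp
  then show ?thesis using R(2) by (intro power2_le_imp_le[of "L2n lborel u"]) auto
qed

text \<open>An integer label of the grid cube of side h that contains x; multiplied by h it is the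
  lower corner of that cube. Points share a cube exactly when they share the label.\<close>

definition cell :: "real \<Rightarrow> 'a::euclidean_space \<Rightarrow> 'a" where
  "cell h x = (\<Sum>i\<in>Basis. of_int \<lfloor>x \<bullet> i / h\<rfloor> *\<^sub>R i)"

lemma cell_eq_iff: "cell h x = cell h y \<longleftrightarrow> (\<forall>i\<in>Basis. \<lfloor>x \<bullet> i / h\<rfloor> = \<lfloor>y \<bullet> i / h\<rfloor>)"
  unfolding euclidean_eq_iff[of "cell h x"] by (simp add: cell_def)

lemma measurable_cell [measurable]: "cell h \<in> borel_measurable borel"
  unfolding cell_def[abs_def] by measurable

lemma cell_dist: "0 < h \<Longrightarrow> cell h x = cell h y \<Longrightarrow> y - x \<in> cbox (- (h *\<^sub>R One)) (h *\<^sub>R One)"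
proof -
  assume h: "0 < h" and e: "cell h x = cell h y"
  have "\<bar>y \<bullet> i - x \<bullet> i\<bar> \<le> h" if "i \<in> Basis" for i
  proof -
    have "\<lfloor>x \<bullet> i / h\<rfloor> = \<lfloor>y \<bullet> i / h\<rfloor>" using e that by (simp add: cell_eq_iff)
    then have "\<bar>y \<bullet> i / h - x \<bullet> i / h\<bar> \<le> 1" by linarith
    then have "\<bar>(y \<bullet> i - x \<bullet> i) / h\<bar> \<le> 1" by (simp add: diff_divide_distrib)
    then show ?thesis using h by (simp add: abs_divide)
  qed
  then show ?thesis by (force simp: mem_box inner_diff_left abs_le_iff)
qed

text \<open>A cell is a half-open cube, caught between the open and the closed box with the same
  corners, which have equal volume.\<close>

lemma measure_cell:
  fixes x :: "'a::euclidean_space"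
  assumes h: "0 < h"
  shows "emeasure lborel {y. cell h y = cell h x} = ennreal (h ^ DIM('a))"
proof -
  define a where "a = h *\<^sub>R cell h x"
  have ci: "cell h x \<bullet> i = of_int \<lfloor>x \<bullet> i / h\<rfloor>" if "i \<in> Basis" for i using that by (simp add: cell_def)
  have S: "{y. cell h y = cell h x} \<in> sets borel"
    using measurable_sets[OF measurable_cell, of "{cell h x}" h] by (simp add: vimage_def)
  have sub1: "box a (a + h *\<^sub>R One) \<subseteq> {y. cell h y = cell h x}"
  proof
    fix y assume y: "y \<in> box a (a + h *\<^sub>R One)"
    have "\<lfloor>y \<bullet> i / h\<rfloor> = \<lfloor>x \<bullet> i / h\<rfloor>" if i: "i \<in> Basis" for i
    proof -
      have "h * of_int \<lfloor>x \<bullet> i / h\<rfloor> < y \<bullet> i" "y \<bullet> i < h * of_int \<lfloor>x \<bullet> i / h\<rfloor> + h"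
        using y i ci[OF i] by (auto simp: mem_box a_def inner_add_left)
      then show ?thesis using h by (intro floor_unique) (auto simp: field_simps)
    qed
    then show "y \<in> {y. cell h y = cell h x}" by (simp add: cell_eq_iff)
  qed
  have sub2: "{y. cell h y = cell h x} \<subseteq> cbox a (a + h *\<^sub>R One)"
  proof
    fix y assume y: "y \<in> {y. cell h y = cell h x}"
    have "h * of_int \<lfloor>x \<bullet> i / h\<rfloor> \<le> y \<bullet> i \<and> y \<bullet> i \<le> h * of_int \<lfloor>x \<bullet> i / h\<rfloor> + h" if i: "i \<in> Basis" for i
    proof -
      have "\<lfloor>x \<bullet> i / h\<rfloor> = \<lfloor>y \<bullet> i / h\<rfloor>" using y i by (simp add: cell_eq_iff)
      then have "of_int \<lfloor>x \<bullet> i / h\<rfloor> \<le> y \<bullet> i / h" "y \<bullet> i / h \<le> of_int \<lfloor>x \<bullet> i / h\<rfloor> + 1" by linarith+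
      then show ?thesis using h by (simp add: field_simps)
    qed
    then show "y \<in> cbox a (a + h *\<^sub>R One)" using ci by (auto simp: mem_box a_def inner_add_left)
  qed
  have "emeasure lborel (box a (a + h *\<^sub>R One)) = ennreal (h ^ DIM('a))"
    using h by (subst emeasure_lborel_box) (auto simp: inner_add_left)
  moreover have "emeasure lborel (cbox a (a + h *\<^sub>R One)) = ennreal (h ^ DIM('a))"
    using h by (subst emeasure_lborel_cbox) (auto simp: inner_add_left)
  ultimately show ?thesis
    using emeasure_mono[OF sub1, of lborel] emeasure_mono[OF sub2, of lborel] S by (simp add: antisym)
qed

lemma finite_cells: "bounded S \<Longrightarrow> finite (cell h ` S)"
  for S :: "'a::euclidean_space set"
proof -
  assume "bounded S"
  then obtain B where B: "\<And>x. x \<in> S \<Longrightarrow> norm x \<le> B" unfolding bounded_iff by auto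
  define F where "F = (\<lambda>f. \<Sum>i\<in>(Basis :: 'a set). of_int (f i) *\<^sub>R i) ` (\<Pi>\<^sub>E i\<in>Basis. {\<lfloor>- (B / \<bar>h\<bar>)\<rfloor>..\<lfloor>B / \<bar>h\<bar>\<rfloor>})"
  have "cell h x \<in> F" if x: "x \<in> S" for x
  proof -
    have *: "\<bar>x \<bullet> i / h\<bar> \<le> B / \<bar>h\<bar>" if "i \<in> Basis" for i
      using Basis_le_norm[OF that, of x] B[OF x] by (simp add: divide_right_mono)
    have "\<lfloor>x \<bullet> i / h\<rfloor> \<in> {\<lfloor>- (B / \<bar>h\<bar>)\<rfloor>..\<lfloor>B / \<bar>h\<bar>\<rfloor>}" if "i \<in> Basis" for i
    proof -
      have "- (B / \<bar>h\<bar>) \<le> x \<bullet> i / h" "x \<bullet> i / h \<le> B / \<bar>h\<bar>" using *[OF that] by linarith+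
      then show ?thesis unfolding atLeastAtMost_iff by (intro conjI floor_mono)
    qed
    then show ?thesis unfolding F_def cell_def
      by (intro image_eqI[of _ _ "\<lambda>i\<in>Basis. \<lfloor>x \<bullet> i / h\<rfloor>"]) auto
  qed
  moreover have "finite F" unfolding F_def by (intro finite_imageI finite_PiE) auto
  ultimately show ?thesis by (auto intro: finite_subset)
qed

lemma indicator_power2: "(indicator A x :: real)\<^sup>2 = indicator A x"
  by (simp add: indicator_def)

text \<open>On a cell of volume \<open>v\<close> the double integral of \<open>(u y - u x)\<^sup>2\<close> is
  \<open>2 v (\<integral> u\<^sup>2) - 2 (\<integral> u)\<^sup>2\<close>; summed over the cells it is at most the integral of
  \<open>(u (x + z) - u x)\<^sup>2\<close> over \<open>x\<close> and small \<open>z\<close>, which the translation estimate controls.\<close>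

lemma cell_Poincare:
  fixes u :: "'a::euclidean_space \<Rightarrow> real"
  assumes u: "C1c u D" and h: "0 < h" and S: "bounded S" "\<And>x. x \<notin> S \<Longrightarrow> u x = 0"
  defines "Q \<equiv> \<lambda>c. {x. cell h x = c}"
  shows "(L2n lborel u)\<^sup>2 \<le> 2 ^ DIM('a) * (real DIM('a) * h\<^sup>2) * (L2n lborel D)\<^sup>2
     + (\<Sum>c\<in>cell h ` S. (\<integral>x. u x * indicator (Q c) x \<partial>lborel)\<^sup>2) / h ^ DIM('a)"
proof -
  let ?C = "cell h ` S"
  define v where "v = h ^ DIM('a)"
  have v: "v > 0" using h by (simp add: v_def)
  have fin: "finite ?C" by (rule finite_cells[OF S(1)])
  have [measurable]: "u \<in> borel_measurable borel"
    using C1c_continuous[OF u] by (intro borel_measurable_continuous_onI)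
  have Qm [measurable]: "Q c \<in> sets borel" for c
    using measurable_sets[OF measurable_cell, of "{c}" h] by (simp add: vimage_def Q_def)
  have u2: "integrable lborel (\<lambda>x. (u x)\<^sup>2)" using C1c_sq_integrable(1)[OF u] by (simp add: sq_integrable_def)
  have u1: "integrable lborel u"
  proof -
    obtain R where "\<And>x. R \<le> norm x \<Longrightarrow> u x = 0" using u by (auto simp: C1c_def)
    from integrable_continuous_compact_support[OF C1c_continuous[OF u] this] show ?thesis .
  qed
  have vQ: "emeasure lborel (Q c) = ennreal v" if "c \<in> ?C" for c
    using that measure_cell[OF h] by (auto simp: Q_def v_def)
  define s where "s c = (\<integral>x. u x * indicator (Q c) x \<partial>lborel)" for c
  define t where "t c = (\<integral>x. (u x)\<^sup>2 * indicator (Q c) x \<partial>lborel)" for c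
  have iQ: "integrable lborel (\<lambda>x. (u x)\<^sup>2 * indicator (Q c) x)" "integrable lborel (\<lambda>x. u x * indicator (Q c) x)" for c
    using u1 u2 by (auto intro: integrable_real_mult_indicator)
  have i1: "integrable lborel (indicator (Q c) :: 'a \<Rightarrow> real)" "integral\<^sup>L lborel (indicator (Q c)) = v" if "c \<in> ?C" for c
    using vQ[OF that] v by (auto intro!: integrable_real_indicator simp: measure_def)
  have V: "(\<integral>\<^sup>+x. \<integral>\<^sup>+y. ennreal (indicator (Q c) x * indicator (Q c) y * (u y - u x)\<^sup>2) \<partial>lborel \<partial>lborel)
      = ennreal (2 * v * t c - 2 * (s c)\<^sup>2)" if c: "c \<in> ?C" for c
  proof -
    have e: "indicator (Q c) x * indicator (Q c) y * (u y - u x)\<^sup>2 =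
       indicator (Q c) x * ((u y)\<^sup>2 * indicator (Q c) y - 2 * u x * (u y * indicator (Q c) y) + (u x)\<^sup>2 * indicator (Q c) y)" for x y
      by (simp add: power2_diff algebra_simps)
    have in1: "integrable lborel (\<lambda>y. indicator (Q c) x * indicator (Q c) y * (u y - u x)\<^sup>2)" for x
      unfolding e using iQ i1[OF c] by auto
    have in2: "(\<integral>y. indicator (Q c) x * indicator (Q c) y * (u y - u x)\<^sup>2 \<partial>lborel) =
       t c * indicator (Q c) x - 2 * s c * (u x * indicator (Q c) x) + v * ((u x)\<^sup>2 * indicator (Q c) x)" for x
    proof -
      have I: "(\<integral>y. (u y)\<^sup>2 * indicator (Q c) y - 2 * u x * (u y * indicator (Q c) y) + (u x)\<^sup>2 * indicator (Q c) y \<partial>lborel)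
        = t c - 2 * u x * s c + (u x)\<^sup>2 * v"
        using iQ i1[OF c] by (simp add: s_def t_def)
      then show ?thesis unfolding e integral_mult_right_zero I by (simp add: algebra_simps)
    qed
    have nn: "0 \<le> t c * indicator (Q c) x - 2 * s c * (u x * indicator (Q c) x) + v * ((u x)\<^sup>2 * indicator (Q c) x)" for x
      unfolding in2[symmetric] by (intro Bochner_Integration.integral_nonneg) auto
    have "(\<integral>\<^sup>+x. \<integral>\<^sup>+y. ennreal (indicator (Q c) x * indicator (Q c) y * (u y - u x)\<^sup>2) \<partial>lborel \<partial>lborel)
      = (\<integral>\<^sup>+x. ennreal (t c * indicator (Q c) x - 2 * s c * (u x * indicator (Q c) x) + v * ((u x)\<^sup>2 * indicator (Q c) x)) \<partial>lborel)"
      by (intro nn_integral_cong) (simp add: nn_integral_eq_integral[OF in1] in2)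
    also have "\<dots> = ennreal (\<integral>x. t c * indicator (Q c) x - 2 * s c * (u x * indicator (Q c) x) + v * ((u x)\<^sup>2 * indicator (Q c) x) \<partial>lborel)"
      using iQ i1[OF c] nn by (intro nn_integral_eq_integral) auto
    also have "(\<integral>x. t c * indicator (Q c) x - 2 * s c * (u x * indicator (Q c) x) + v * ((u x)\<^sup>2 * indicator (Q c) x) \<partial>lborel)
       = 2 * v * t c - 2 * (s c)\<^sup>2"
      using iQ i1[OF c] by (simp add: s_def[symmetric] t_def[symmetric]) (simp add: power2_eq_square algebra_simps)
    finally show ?thesis .
  qed
  let ?B = "cbox (- (h *\<^sub>R One)) (h *\<^sub>R One) :: 'a set"
  let ?K = "ennreal (2 ^ DIM('a) * v * (real DIM('a) * h\<^sup>2) * (L2n lborel D)\<^sup>2)"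
  have Vnn: "0 \<le> 2 * v * t c - 2 * (s c)\<^sup>2" if c: "c \<in> ?C" for c
  proof -
    have "(s c)\<^sup>2 \<le> t c * v"
    proof -
      have "\<bar>\<integral>x. (u x * indicator (Q c) x) * indicator (Q c) x \<partial>lborel\<bar> \<le>
         sqrt (\<integral>x. (u x * indicator (Q c) x)\<^sup>2 \<partial>lborel) * sqrt (\<integral>x. (indicator (Q c) x)\<^sup>2 \<partial>lborel)"
        using iQ(1)[of c] i1[OF c]
        by (intro Cauchy_Schwarz_integral(3)) (auto simp: power_mult_distrib indicator_power2)
      moreover have "(\<lambda>x. (u x * indicator (Q c) x)\<^sup>2) = (\<lambda>x. (u x)\<^sup>2 * indicator (Q c) x)"
        "(\<lambda>x. (indicator (Q c) x)\<^sup>2) = (indicator (Q c) :: 'a \<Rightarrow> real)"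
        "(\<lambda>x. (u x * indicator (Q c) x) * indicator (Q c) x) = (\<lambda>x. u x * indicator (Q c) x)"
        by (auto simp: indicator_def fun_eq_iff)
      ultimately have "\<bar>s c\<bar> \<le> sqrt (t c * v)"
        using i1[OF c] by (simp add: s_def t_def real_sqrt_mult)
      then have "\<bar>s c\<bar>\<^sup>2 \<le> (sqrt (t c * v))\<^sup>2" by (rule power_mono) simp
      moreover have "0 \<le> t c" unfolding t_def by (intro Bochner_Integration.integral_nonneg) auto
      ultimately show ?thesis using v by simp
    qed
    then show ?thesis by (simp add: mult.commute)
  qed
  have "ennreal (\<Sum>c\<in>?C. 2 * v * t c - 2 * (s c)\<^sup>2)
     = (\<Sum>c\<in>?C. \<integral>\<^sup>+x. \<integral>\<^sup>+y. ennreal (indicator (Q c) x * indicator (Q c) y * (u y - u x)\<^sup>2) \<partial>lborel \<partial>lborel)"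
    using Vnn V by (subst sum_ennreal[symmetric]) auto
  also have "\<dots> = (\<integral>\<^sup>+x. \<integral>\<^sup>+y. (\<Sum>c\<in>?C. ennreal (indicator (Q c) x * indicator (Q c) y * (u y - u x)\<^sup>2)) \<partial>lborel \<partial>lborel)"
  proof -
    have "(\<Sum>c\<in>?C. \<integral>\<^sup>+x. \<integral>\<^sup>+y. ennreal (indicator (Q c) x * indicator (Q c) y * (u y - u x)\<^sup>2) \<partial>lborel \<partial>lborel)
      = (\<integral>\<^sup>+x. (\<Sum>c\<in>?C. \<integral>\<^sup>+y. ennreal (indicator (Q c) x * indicator (Q c) y * (u y - u x)\<^sup>2) \<partial>lborel) \<partial>lborel)"
      by (rule nn_integral_sum[symmetric]) measurable
    also have "\<dots> = (\<integral>\<^sup>+x. \<integral>\<^sup>+y. (\<Sum>c\<in>?C. ennreal (indicator (Q c) x * indicator (Q c) y * (u y - u x)\<^sup>2)) \<partial>lborel \<partial>lborel)"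
      by (intro nn_integral_cong nn_integral_sum[symmetric]) measurable
    finally show ?thesis .
  qed
  also have "\<dots> \<le> (\<integral>\<^sup>+x. \<integral>\<^sup>+y. indicator ?B (y - x) * ennreal ((u y - u x)\<^sup>2) \<partial>lborel \<partial>lborel)"
  proof (intro nn_integral_mono)
    fix x y :: 'a
    \<comment> \<open>At most one cell contains both points, and then the coordinates of y - x have
      modulus at most h.\<close>
    have "(\<Sum>c\<in>?C. indicator (Q c) x * indicator (Q c) y :: real) \<le> indicator ?B (y - x)"
    proof (cases "cell h x = cell h y")
      case True
      have "(\<Sum>c\<in>?C. indicator (Q c) x * indicator (Q c) y :: real) = (\<Sum>c\<in>?C. if c = cell h x then 1 else 0)"
        using True by (intro sum.cong) (auto simp: Q_def indicator_def)
      also have "\<dots> \<le> 1" using fin by (simp add: sum.delta)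
      also have "\<dots> = indicator ?B (y - x)" using cell_dist[OF h True] by simp
      finally show ?thesis .
    next
      case False
      then have "(\<Sum>c\<in>?C. indicator (Q c) x * indicator (Q c) y :: real) = 0"
        by (intro sum.neutral) (auto simp: Q_def indicator_def)
      then show ?thesis by simp
    qed
    then have "(\<Sum>c\<in>?C. indicator (Q c) x * indicator (Q c) y) * (u y - u x)\<^sup>2 \<le> indicator ?B (y - x) * (u y - u x)\<^sup>2"
      by (rule mult_right_mono) simp
    then have "ennreal (\<Sum>c\<in>?C. indicator (Q c) x * indicator (Q c) y * (u y - u x)\<^sup>2) \<le> ennreal (indicator ?B (y - x) * (u y - u x)\<^sup>2)"
      by (intro ennreal_leI) (simp add: sum_distrib_right)
    also have "\<dots> = indicator ?B (y - x) * ennreal ((u y - u x)\<^sup>2)" by (auto simp: indicator_def)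
    finally show "(\<Sum>c\<in>?C. ennreal (indicator (Q c) x * indicator (Q c) y * (u y - u x)\<^sup>2)) \<le> indicator ?B (y - x) * ennreal ((u y - u x)\<^sup>2)"
      by (subst sum_ennreal) auto
  qed
  also have "\<dots> = (\<integral>\<^sup>+x. \<integral>\<^sup>+z. indicator ?B z * ennreal ((u (x + z) - u x)\<^sup>2) \<partial>lborel \<partial>lborel)"
  proof (rule nn_integral_cong)
    fix x :: 'a
    show "(\<integral>\<^sup>+y. indicator ?B (y - x) * ennreal ((u y - u x)\<^sup>2) \<partial>lborel) = (\<integral>\<^sup>+z. indicator ?B z * ennreal ((u (x + z) - u x)\<^sup>2) \<partial>lborel)"
      by (subst nn_integral_lborel_translate[symmetric, of _ x]) (simp_all add: add.commute)
  qed
  also have "\<dots> = (\<integral>\<^sup>+z. \<integral>\<^sup>+x. indicator ?B z * ennreal ((u (x + z) - u x)\<^sup>2) \<partial>lborel \<partial>lborel)"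
    by (rule lborel_pair.Fubini'[symmetric]) measurable
  also have "\<dots> \<le> (\<integral>\<^sup>+z. indicator ?B z * ennreal (real DIM('a) * h\<^sup>2 * (L2n lborel D)\<^sup>2) \<partial>lborel)"
  proof (rule nn_integral_mono)
    fix z :: 'a
    have "(\<integral>\<^sup>+x. ennreal ((u (x + z) - u x)\<^sup>2) \<partial>lborel) \<le> ennreal (real DIM('a) * h\<^sup>2 * (L2n lborel D)\<^sup>2)" if z: "z \<in> ?B"
    proof -
      have "(z \<bullet> i)\<^sup>2 \<le> h\<^sup>2" if "i \<in> Basis" for i
        using z that h by (intro abs_le_square_iff[THEN iffD1]) (auto simp: mem_box abs_le_iff)
      then have "(\<Sum>i\<in>Basis. (z \<bullet> i)\<^sup>2) \<le> (\<Sum>i\<in>(Basis :: 'a set). h\<^sup>2)" by (rule sum_mono)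
      moreover have "(norm z)\<^sup>2 = (\<Sum>i\<in>Basis. (z \<bullet> i)\<^sup>2)"
        unfolding power2_norm_eq_inner by (subst euclidean_inner) (simp add: power2_eq_square)
      ultimately have "(norm z)\<^sup>2 \<le> real DIM('a) * h\<^sup>2" by simp
      have "(\<integral>\<^sup>+x. ennreal ((u (x + z) - u x)\<^sup>2) \<partial>lborel) \<le> ennreal ((norm z)\<^sup>2) * (\<integral>\<^sup>+x. ennreal ((norm (D x))\<^sup>2) \<partial>lborel)"
        by (rule translation_estimate[OF u])
      also have "\<dots> = ennreal ((norm z)\<^sup>2 * (L2n lborel D)\<^sup>2)"
        by (simp add: nn_integral_norm_power2[OF C1c_sq_integrable(2)[OF u]] flip: ennreal_mult)
      also have "\<dots> \<le> ennreal (real DIM('a) * h\<^sup>2 * (L2n lborel D)\<^sup>2)"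
        using \<open>(norm z)\<^sup>2 \<le> real DIM('a) * h\<^sup>2\<close> by (intro ennreal_leI mult_right_mono) auto
      finally show ?thesis .
    qed
    then show "(\<integral>\<^sup>+x. indicator ?B z * ennreal ((u (x + z) - u x)\<^sup>2) \<partial>lborel) \<le> indicator ?B z * ennreal (real DIM('a) * h\<^sup>2 * (L2n lborel D)\<^sup>2)"
      by (cases "z \<in> ?B") auto
  qed
  also have "\<dots> = emeasure lborel ?B * ennreal (real DIM('a) * h\<^sup>2 * (L2n lborel D)\<^sup>2)"
    by (subst nn_integral_multc) auto
  \<comment> \<open>Differences of points of a cell range over a cube of side 2 h, the origin of the
    factor 2 ^ DIM('a) in the claim.\<close>
  also have "emeasure lborel ?B = ennreal ((2 * h) ^ DIM('a))"
  proof -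
    have "emeasure lborel ?B = ennreal (\<Prod>i\<in>Basis. (h *\<^sub>R One - - (h *\<^sub>R One)) \<bullet> (i :: 'a))"
      using h by (intro emeasure_lborel_cbox) auto
    also have "(\<Prod>i\<in>Basis. (h *\<^sub>R One - - (h *\<^sub>R One)) \<bullet> (i :: 'a)) = (\<Prod>i\<in>(Basis :: 'a set). 2 * h)"
      by (intro prod.cong refl) (simp add: inner_add_left)
    finally show ?thesis by simp
  qed
  also have "\<dots> * ennreal (real DIM('a) * h\<^sup>2 * (L2n lborel D)\<^sup>2) = ?K"
    using h by (simp add: v_def power_mult_distrib mult_ac flip: ennreal_mult)
  finally have "(\<Sum>c\<in>?C. 2 * v * t c - 2 * (s c)\<^sup>2) \<le> 2 ^ DIM('a) * v * (real DIM('a) * h\<^sup>2) * (L2n lborel D)\<^sup>2"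
    using v by (subst (asm) ennreal_le_iff) auto
  moreover have "(\<Sum>c\<in>?C. 2 * v * t c - 2 * (s c)\<^sup>2) = 2 * v * (\<Sum>c\<in>?C. t c) - 2 * (\<Sum>c\<in>?C. (s c)\<^sup>2)"
    by (simp add: sum_subtractf sum_distrib_left)
  moreover have "(\<Sum>c\<in>?C. t c) = (L2n lborel u)\<^sup>2"
  proof -
    have pt: "(\<Sum>c\<in>?C. (u x)\<^sup>2 * indicator (Q c) x) = (u x)\<^sup>2" for x
    proof (cases "x \<in> S")
      case True
      have "(\<Sum>c\<in>?C. (u x)\<^sup>2 * indicator (Q c) x) = (\<Sum>c\<in>?C. if c = cell h x then (u x)\<^sup>2 else 0)"
        by (intro sum.cong) (auto simp: Q_def indicator_def)
      then show ?thesis using True fin by (simp add: sum.delta)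
    qed (simp add: S(2))
    have "(\<Sum>c\<in>?C. t c) = (\<integral>x. (\<Sum>c\<in>?C. (u x)\<^sup>2 * indicator (Q c) x) \<partial>lborel)"
      unfolding t_def using iQ by (subst Bochner_Integration.integral_sum) auto
    also have "\<dots> = (L2n lborel u)\<^sup>2" unfolding pt by (simp add: L2n_power2)
    finally show ?thesis .
  qed
  ultimately have "2 * v * (L2n lborel u)\<^sup>2 \<le> 2 ^ DIM('a) * v * (real DIM('a) * h\<^sup>2) * (L2n lborel D)\<^sup>2 + 2 * (\<Sum>c\<in>?C. (s c)\<^sup>2)"
    by simp
  then have "v * (L2n lborel u)\<^sup>2 \<le> v * (2 ^ DIM('a) * (real DIM('a) * h\<^sup>2) * (L2n lborel D)\<^sup>2) + (\<Sum>c\<in>?C. (s c)\<^sup>2)"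
  proof -
    have "0 \<le> v * (2 ^ DIM('a) * (real DIM('a) * h\<^sup>2) * (L2n lborel D)\<^sup>2)" using v by simp
    moreover assume "2 * v * (L2n lborel u)\<^sup>2 \<le> 2 ^ DIM('a) * v * (real DIM('a) * h\<^sup>2) * (L2n lborel D)\<^sup>2 + 2 * (\<Sum>c\<in>?C. (s c)\<^sup>2)"
    ultimately show ?thesis by (simp add: mult_ac)
  qed
  then show ?thesis using v unfolding s_def v_def[symmetric] by (simp add: field_simps)
qed

lemma sum_power2_tendsto_Cauchy:
  fixes a :: "'c \<Rightarrow> nat \<Rightarrow> real"
  assumes "finite C" "\<And>c. c \<in> C \<Longrightarrow> \<exists>l. a c \<longlonglongrightarrow> l" "\<epsilon> > 0"
  shows "\<exists>N. \<forall>m\<ge>N. \<forall>n\<ge>N. (\<Sum>c\<in>C. (a c m - a c n)\<^sup>2) \<le> \<epsilon>"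
proof -
  obtain l where l: "\<And>c. c \<in> C \<Longrightarrow> a c \<longlonglongrightarrow> l c" using assms(2) by metis
  have "(\<lambda>n. (\<Sum>c\<in>C. (a c n - l c)\<^sup>2)) \<longlonglongrightarrow> (\<Sum>c\<in>C. (l c - l c)\<^sup>2)"
    by (intro tendsto_sum tendsto_power tendsto_diff l tendsto_const)
  then have "\<forall>\<^sub>F n in sequentially. (\<Sum>c\<in>C. (a c n - l c)\<^sup>2) < \<epsilon> / 4"
    using assms(3) by (intro order_tendstoD(2)) auto
  then obtain N where N: "\<And>n. n \<ge> N \<Longrightarrow> (\<Sum>c\<in>C. (a c n - l c)\<^sup>2) < \<epsilon> / 4"
    by (auto simp: eventually_sequentially)
  have "(\<Sum>c\<in>C. (a c m - a c n)\<^sup>2) \<le> \<epsilon>" if "m \<ge> N" "n \<ge> N" for m n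
  proof -
    have "(x - y)\<^sup>2 \<le> 2 * (x - z)\<^sup>2 + 2 * (y - z)\<^sup>2" for x y z :: real
      using zero_le_power2[of "(x - z) + (y - z)"] by (simp add: power2_eq_square algebra_simps)
    then have "(\<Sum>c\<in>C. (a c m - a c n)\<^sup>2) \<le> (\<Sum>c\<in>C. 2 * (a c m - l c)\<^sup>2 + 2 * (a c n - l c)\<^sup>2)"
      by (intro sum_mono)
    also have "\<dots> = 2 * (\<Sum>c\<in>C. (a c m - l c)\<^sup>2) + 2 * (\<Sum>c\<in>C. (a c n - l c)\<^sup>2)"
      by (simp add: sum.distrib sum_distrib_left)
    also have "\<dots> \<le> \<epsilon>" using N[OF that(1)] N[OF that(2)] by linarith
    finally show ?thesis .
  qed
  then show ?thesis by blast
qed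

lemma C1c_diff: "C1c u D \<Longrightarrow> C1c v E \<Longrightarrow> C1c (\<lambda>x. u x - v x) (\<lambda>x. D x - E x)"
proof -
  assume u: "C1c u D" and v: "C1c v E"
  obtain R R' where "\<And>x. R \<le> norm x \<Longrightarrow> u x = 0 \<and> D x = 0" "\<And>x. R' \<le> norm x \<Longrightarrow> v x = 0 \<and> E x = 0"
    using u v by (auto simp: C1c_def)
  then have "\<exists>R. \<forall>x. R \<le> norm x \<longrightarrow> u x - v x = 0 \<and> D x - E x = 0"
    by (intro exI[of _ "max R R'"]) auto
  then show ?thesis using u v unfolding C1c_def
    by (auto intro!: derivative_eq_intros continuous_intros simp: inner_diff_left)
qed

text \<open>The integrals over the cells of all meshes 1 / (k + 1) are countably many bounded
  sequences, so a diagonal subsequence makes all of them converge. By \<open>cell_Poincare\<close>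
  the norm of a difference is controlled by a fine mesh and then by finitely many of these
  integrals.\<close>

lemma Rellich_C1c:
  fixes u :: "nat \<Rightarrow> 'a::euclidean_space \<Rightarrow> real"
  assumes u: "\<And>n. C1c (u n) (D n)" and S: "bounded S" "\<And>n x. x \<notin> S \<Longrightarrow> u n x = 0"
    and B: "\<And>n. L2n lborel (D n) \<le> B"
  shows "\<exists>r :: nat \<Rightarrow> nat. strict_mono r \<and> (\<forall>\<epsilon>>0. \<exists>N. \<forall>m\<ge>N. \<forall>n\<ge>N. L2n lborel (\<lambda>x. u (r m) x - u (r n) x) \<le> \<epsilon>)"
proof -
  obtain R where R: "R > 0" "\<And>x. x \<in> S \<Longrightarrow> norm x < R" using S(1) bounded_pos_less[of S] by auto
  have uR: "u n x = 0" if "R \<le> norm x" for n x using S(2)[of x n] R(2)[of x] that by (cases "x \<in> S") auto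
  define Q where "Q k c = {x::'a. cell (1 / real (Suc k)) x = c}" for k c
  have Qm [measurable]: "Q k c \<in> sets borel" for k c
    using measurable_sets[OF measurable_cell, of "{c}" "1 / real (Suc k)"] by (simp add: vimage_def Q_def)
  define C where "C k = cell (1 / real (Suc k)) ` S" for k
  have fC: "finite (C k)" for k unfolding C_def by (rule finite_cells[OF S(1)])
  define l where "l n p = (\<integral>x. u n x * indicator (Q (fst p) (snd p)) x \<partial>lborel)" for n and p :: "nat \<times> 'a"
  have cb: "integrable lborel (indicator (cball 0 R) :: 'a \<Rightarrow> real)"
    using emeasure_lborel_cball_finite[of "0::'a" R] by (intro integrable_real_indicator) auto
  define L where "L = (2 * R * B) * sqrt (\<integral>x. (indicator (cball 0 R) (x::'a))\<^sup>2 \<partial>lborel)"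
  have L: "norm (l n p) \<le> L" for n p
  proof -
    have [measurable]: "u n \<in> borel_measurable borel"
      using C1c_continuous[OF u] by (intro borel_measurable_continuous_onI)
    have u2: "integrable lborel (\<lambda>x. (u n x)\<^sup>2)" using C1c_sq_integrable(1)[OF u] by (simp add: sq_integrable_def)
    have cb2: "integrable lborel (\<lambda>x::'a. (indicator (cball 0 R) x :: real)\<^sup>2)"
      using cb by (simp add: indicator_power2)
    have "u n \<in> borel_measurable lborel" "(indicator (cball 0 R) :: 'a \<Rightarrow> real) \<in> borel_measurable lborel"
      using borel_measurable_integrable[OF cb] by auto
    note CS = Cauchy_Schwarz_integral[OF this u2 cb2]
    have iu: "integrable lborel (u n)" using integrable_continuous_compact_support[OF C1c_continuous[OF u] uR] by auto
    have "norm (l n p) \<le> (\<integral>x. norm (u n x * indicator (Q (fst p) (snd p)) x) \<partial>lborel)"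
      unfolding l_def by (rule integral_norm_bound)
    also have "\<dots> \<le> (\<integral>x. \<bar>u n x * indicator (cball 0 R) x\<bar> \<partial>lborel)"
    proof (rule integral_mono)
      show "integrable lborel (\<lambda>x. norm (u n x * indicator (Q (fst p) (snd p)) x))"
        using iu by (intro integrable_norm integrable_real_mult_indicator) auto
      show "integrable lborel (\<lambda>x. \<bar>u n x * indicator (cball 0 R) x\<bar>)" by (rule integrable_abs[OF CS(1)])
      show "norm (u n x * indicator (Q (fst p) (snd p)) x) \<le> \<bar>u n x * indicator (cball 0 R) x\<bar>" for x
        using uR[of x n] by (cases "R \<le> norm x") (auto simp: indicator_def)
    qed
    also have "\<dots> \<le> L2n lborel (u n) * sqrt (\<integral>x. (indicator (cball 0 R) (x::'a))\<^sup>2 \<partial>lborel)"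
      using CS(2) by (simp add: L2n_def)
    also have "\<dots> \<le> L"
    proof -
      have "L2n lborel (u n) \<le> 2 * R * L2n lborel (D n)"
        by (rule Poincare_C1c[OF u]) (use uR R(1) in auto)
      also have "\<dots> \<le> 2 * R * B" using B[of n] R(1) by (intro mult_left_mono) auto
      finally show ?thesis unfolding L_def by (intro mult_right_mono) auto
    qed
    finally show ?thesis .
  qed
  \<comment> \<open>The index pairs are the mesh and the cell label; each mesh has only finitely
    many cells meeting S.\<close>
  have "countable (SIGMA k:(UNIV::nat set). C k)" using fC by (intro countable_SIGMA) (auto intro: countable_finite)
  from function_convergent_subsequence[of _ l L, OF this L]
  obtain r where r: "strict_mono r" "\<And>p. p \<in> (SIGMA k:UNIV. C k) \<Longrightarrow> \<exists>a. (\<lambda>n. l (r n) p) \<longlonglongrightarrow> a"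
    by metis
  have "\<exists>N. \<forall>m\<ge>N. \<forall>n\<ge>N. L2n lborel (\<lambda>x. u (r m) x - u (r n) x) \<le> \<epsilon>" if \<epsilon>: "\<epsilon> > 0" for \<epsilon>
  proof -
    \<comment> \<open>The constant of \<open>cell_Poincare\<close>, with the gradient of a
      difference bounded by 2 B. The mesh is fixed first, so that the gradient term stays below half
      of the squared tolerance; only then is the index N chosen, so that the finitely many cell
      integrals use up the other half.\<close>
    define K where "K = 2 ^ DIM('a) * real DIM('a) * (2 * B)\<^sup>2"
    have "(\<lambda>k. K * (1 / real (Suc k))\<^sup>2) \<longlonglongrightarrow> K * 0\<^sup>2"
      using LIMSEQ_Suc[OF lim_1_over_n[where 'a=real]] by (intro tendsto_mult tendsto_power tendsto_const)
    then have "\<forall>\<^sub>F k in sequentially. K * (1 / real (Suc k))\<^sup>2 < \<epsilon>\<^sup>2 / 2"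
      using \<epsilon> by (intro order_tendstoD(2)) auto
    then obtain k where k: "K * (1 / real (Suc k))\<^sup>2 < \<epsilon>\<^sup>2 / 2" by (auto simp: eventually_sequentially)
    define h where "h = 1 / real (Suc k)"
    have h: "h > 0" by (simp add: h_def)
    obtain N where N: "\<And>m n. m \<ge> N \<Longrightarrow> n \<ge> N \<Longrightarrow> (\<Sum>c\<in>C k. (l (r m) (k, c) - l (r n) (k, c))\<^sup>2) \<le> h ^ DIM('a) * (\<epsilon>\<^sup>2 / 2)"
    proof -
      have "\<exists>N. \<forall>m\<ge>N. \<forall>n\<ge>N. (\<Sum>c\<in>C k. (l (r m) (k, c) - l (r n) (k, c))\<^sup>2) \<le> h ^ DIM('a) * (\<epsilon>\<^sup>2 / 2)"
        by (rule sum_power2_tendsto_Cauchy[of "C k" "\<lambda>c n. l (r n) (k, c)"]) (use fC r(2) h \<epsilon> in auto)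
      then show ?thesis using that by blast
    qed
    have "L2n lborel (\<lambda>x. u (r m) x - u (r n) x) \<le> \<epsilon>" if mn: "m \<ge> N" "n \<ge> N" for m n
    proof -
      let ?w = "\<lambda>x. u (r m) x - u (r n) x" and ?D = "\<lambda>x. D (r m) x - D (r n) x"
      have "L2n lborel ?D \<le> 2 * B"
        using sq_integrable_diff(2)[OF C1c_sq_integrable(2)[OF u] C1c_sq_integrable(2)[OF u], of "r m" "r n"] B[of "r m"] B[of "r n"] by linarith
      then have D2: "(L2n lborel ?D)\<^sup>2 \<le> (2 * B)\<^sup>2" by (intro power_mono) auto
      have iu: "integrable lborel (\<lambda>x. u n x * indicator (Q k c) x)" for n c
        using integrable_continuous_compact_support[OF C1c_continuous[OF u] uR] by (intro integrable_real_mult_indicator) auto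
      have lw: "(\<integral>x. ?w x * indicator (Q k c) x \<partial>lborel) = l (r m) (k, c) - l (r n) (k, c)" for c
        unfolding l_def using iu by (simp add: left_diff_distrib)
      have "(L2n lborel ?w)\<^sup>2 \<le> 2 ^ DIM('a) * (real DIM('a) * h\<^sup>2) * (L2n lborel ?D)\<^sup>2
         + (\<Sum>c\<in>C k. (\<integral>x. ?w x * indicator (Q k c) x \<partial>lborel)\<^sup>2) / h ^ DIM('a)"
        using cell_Poincare[OF C1c_diff[OF u u] h S(1), of "r m" "r n"] S(2) by (simp add: C_def Q_def h_def)
      also have "\<dots> \<le> 2 ^ DIM('a) * (real DIM('a) * h\<^sup>2) * (2 * B)\<^sup>2 + (h ^ DIM('a) * (\<epsilon>\<^sup>2 / 2)) / h ^ DIM('a)"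
        unfolding lw using D2 N[OF mn] h by (intro add_mono mult_left_mono divide_right_mono) auto
      also have "\<dots> \<le> \<epsilon>\<^sup>2"
      proof -
        have "2 ^ DIM('a) * (real DIM('a) * h\<^sup>2) * (2 * B)\<^sup>2 = K * h\<^sup>2" by (simp add: K_def mult_ac)
        moreover have "(h ^ DIM('a) * (\<epsilon>\<^sup>2 / 2)) / h ^ DIM('a) = \<epsilon>\<^sup>2 / 2" using h by simp
        ultimately show ?thesis using k unfolding h_def[symmetric] by linarith
      qed
      finally have "(L2n lborel ?w)\<^sup>2 \<le> \<epsilon>\<^sup>2" .
      from power2_le_imp_le[OF this] \<epsilon> show ?thesis by (simp only: less_imp_le)
    qed
    then show ?thesis by blast
  qed
  then show ?thesis using r(1) by blast
qed

section \<open>The space \<open>H10\<close>\<close>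

text \<open>Lebesgue measure is complete. This makes the arbitrarily chosen function
  \<open>grad\<close> measurable on all of the open set as soon as some weak gradient is.\<close>

lemma measurable_lebesgue_on_AE:
  fixes f g :: "'a::euclidean_space \<Rightarrow> 'b::euclidean_space"
  assumes \<Omega>: "\<Omega> \<in> sets lebesgue" and f: "f \<in> borel_measurable (lebesgue_on \<Omega>)" and e: "AE x in lebesgue_on \<Omega>. f x = g x"
  shows "g \<in> borel_measurable (lebesgue_on \<Omega>)"
proof -
  have s: "\<Omega> \<inter> space lebesgue \<in> sets lebesgue" using \<Omega> by auto
  have "(\<lambda>x. indicator \<Omega> x *\<^sub>R f x) \<in> borel_measurable lebesgue"
    using f s by (simp add: borel_measurable_restrict_space_iff)
  moreover have "AE x in lebesgue. indicator \<Omega> x *\<^sub>R f x = indicator \<Omega> x *\<^sub>R g x"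
    using e s by (simp add: AE_restrict_space_iff) (auto elim!: eventually_mono simp: indicator_def)
  ultimately have "(\<lambda>x. indicator \<Omega> x *\<^sub>R g x) \<in> borel_measurable lebesgue"
    by (rule borel_measurable_AE)
  then show ?thesis using s by (simp add: borel_measurable_restrict_space_iff)
qed

lemma sq_integrable_cong_AE:
  fixes f g :: "'x \<Rightarrow> 'b::euclidean_space"
  assumes f: "sq_integrable M f" and g: "g \<in> borel_measurable M" and e: "AE x in M. f x = g x"
  shows "sq_integrable M g"
proof -
  have [measurable]: "f \<in> borel_measurable M" "g \<in> borel_measurable M" using f g by (auto simp: sq_integrable_def)
  have "integrable M (\<lambda>x. (norm (g x))\<^sup>2) \<longleftrightarrow> integrable M (\<lambda>x. (norm (f x))\<^sup>2)"
    using e by (intro integrable_cong_AE) auto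
  then show ?thesis using f g by (simp add: sq_integrable_def)
qed

lemma sq_integrable_inner_const:
  fixes f :: "'x \<Rightarrow> 'b::euclidean_space"
  assumes "sq_integrable M f" shows "sq_integrable M (\<lambda>x. f x \<bullet> w)"
proof -
  have [measurable]: "f \<in> borel_measurable M" using assms by (simp add: sq_integrable_def)
  have "integrable M (\<lambda>x. (norm w)\<^sup>2 * (norm (f x))\<^sup>2)" using assms by (simp add: sq_integrable_def)
  then have "integrable M (\<lambda>x. (norm (f x \<bullet> w))\<^sup>2)"
  proof (rule Bochner_Integration.integrable_bound)
    have "(norm (f x \<bullet> w))\<^sup>2 \<le> (norm w * norm (f x))\<^sup>2" for x
      using Cauchy_Schwarz_ineq2[of "f x" w] by (intro power_mono) (auto simp: mult.commute)
    then show "AE x in M. norm ((norm (f x \<bullet> w))\<^sup>2) \<le> norm ((norm w)\<^sup>2 * (norm (f x))\<^sup>2)"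
      by (simp add: power_mult_distrib)
  qed measurable
  then show ?thesis by (simp add: sq_integrable_def)
qed

lemma sq_integrable_scaleR_const:
  fixes f :: "'x \<Rightarrow> real" and w :: "'b::euclidean_space"
  assumes "sq_integrable M f" shows "sq_integrable M (\<lambda>x. f x *\<^sub>R w)"
  using assms by (auto simp: sq_integrable_def power_mult_distrib intro: borel_measurable_scaleR)

lemma L2_inner_tendsto:
  fixes f :: "nat \<Rightarrow> 'x \<Rightarrow> 'b::euclidean_space"
  assumes f: "\<And>n. sq_integrable M (f n)" and g: "sq_integrable M g" and k: "sq_integrable M k"
    and lim: "(\<lambda>n. L2n M (\<lambda>x. f n x - g x)) \<longlonglongrightarrow> 0"
  shows "(\<lambda>n. \<integral>x. f n x \<bullet> k x \<partial>M) \<longlonglongrightarrow> (\<integral>x. g x \<bullet> k x \<partial>M)"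
proof (rule LIM_zero_cancel, rule Lim_null_comparison)
  show "\<forall>\<^sub>F n in sequentially. norm ((\<integral>x. f n x \<bullet> k x \<partial>M) - (\<integral>x. g x \<bullet> k x \<partial>M)) \<le> L2n M (\<lambda>x. f n x - g x) * L2n M k"
  proof (intro always_eventually allI)
    fix n
    have "(\<integral>x. f n x \<bullet> k x \<partial>M) - (\<integral>x. g x \<bullet> k x \<partial>M) = (\<integral>x. (f n x - g x) \<bullet> k x \<partial>M)"
      using sq_integrable_inner(1)[OF f k] sq_integrable_inner(1)[OF g k] by (simp add: inner_diff_left)
    then show "norm ((\<integral>x. f n x \<bullet> k x \<partial>M) - (\<integral>x. g x \<bullet> k x \<partial>M)) \<le> L2n M (\<lambda>x. f n x - g x) * L2n M k"
      using sq_integrable_inner(2)[OF sq_integrable_diff(1)[OF f g] k] by simp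
  qed
  show "(\<lambda>n. L2n M (\<lambda>x. f n x - g x) * L2n M k) \<longlonglongrightarrow> 0" by (rule tendsto_mult_left_zero[OF lim])
qed

lemma L2n_tendsto:
  assumes f: "\<And>n. sq_integrable M (f n)" and g: "sq_integrable M g"
    and lim: "(\<lambda>n. L2n M (\<lambda>x. f n x - g x)) \<longlonglongrightarrow> 0"
  shows "(\<lambda>n. L2n M (f n)) \<longlonglongrightarrow> L2n M g"
proof (rule LIM_zero_cancel, rule Lim_null_comparison[OF _ lim])
  show "\<forall>\<^sub>F n in sequentially. norm (L2n M (f n) - L2n M g) \<le> L2n M (\<lambda>x. f n x - g x)"
    using L2n_diff_bound[OF f g] by (intro always_eventually) auto
qed

lemma L2_iff: "L2 \<Omega> f \<longleftrightarrow> sq_integrable (lebesgue_on \<Omega>) f"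
  by (simp add: L2_def sq_integrable_def)

locale open_set =
  fixes \<Omega> :: "'a::euclidean_space set"
  assumes open_\<Omega>: "open \<Omega>"
begin

abbreviation M where "M \<equiv> lebesgue_on \<Omega>"

lemma sets_\<Omega>: "\<Omega> \<in> sets lebesgue" using open_\<Omega> by auto

lemmas tf_sq = test_fun_sq_integrable[OF open_\<Omega>]

lemma weak_gradient_test_fun: "test_fun \<Omega> \<phi> \<Longrightarrow> weak_gradient \<Omega> \<phi> (tgrad \<phi>)"
  unfolding weak_gradient_def using test_fun_parts[OF open_\<Omega>] tf_sq
  by (auto intro: sq_integrable_locally_integrable[OF open_\<Omega>])

text \<open>Both sides of integration by parts are written as integrals of inner products of square
  integrable functions, the form to which \<open>sq_integrable_inner\<close> and
  \<open>L2_inner_tendsto\<close> apply.\<close>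

lemma weak_gradientI:
  assumes "sq_integrable M u" "sq_integrable M g"
    and "\<And>\<psi> i. test_fun \<Omega> \<psi> \<Longrightarrow> i \<in> Basis \<Longrightarrow>
      (\<integral>x. u x \<bullet> (tgrad \<psi> x \<bullet> i) \<partial>M) = - (\<integral>x. g x \<bullet> (\<psi> x *\<^sub>R i) \<partial>M)"
  shows "weak_gradient \<Omega> u g"
  unfolding weak_gradient_def using assms
  by (auto intro: sq_integrable_locally_integrable[OF open_\<Omega>] simp: tgrad_inner_Basis mult.commute)

lemma weak_gradientD:
  assumes "weak_gradient \<Omega> u g" "test_fun \<Omega> \<psi>" "i \<in> Basis"
  shows "(\<integral>x. u x \<bullet> (tgrad \<psi> x \<bullet> i) \<partial>M) = - (\<integral>x. g x \<bullet> (\<psi> x *\<^sub>R i) \<partial>M)"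
  using assms unfolding weak_gradient_def by (auto simp: tgrad_inner_Basis mult.commute)

lemma weak_gradient_diff:
  assumes u: "sq_integrable M u" "sq_integrable M g" "weak_gradient \<Omega> u g"
    and v: "sq_integrable M v" "sq_integrable M k" "weak_gradient \<Omega> v k"
  shows "weak_gradient \<Omega> (\<lambda>x. u x - v x) (\<lambda>x. g x - k x)"
proof (rule weak_gradientI)
  fix \<psi> and i :: 'a assume t: "test_fun \<Omega> \<psi>" "i \<in> Basis"
  have s: "sq_integrable M (\<lambda>x. tgrad \<psi> x \<bullet> i)" "sq_integrable M (\<lambda>x. \<psi> x *\<^sub>R i)"
    using tf_sq[OF t(1)] by (auto intro: sq_integrable_inner_const sq_integrable_scaleR_const)
  have "(\<integral>x. (u x - v x) \<bullet> (tgrad \<psi> x \<bullet> i) \<partial>M) = (\<integral>x. u x \<bullet> (tgrad \<psi> x \<bullet> i) \<partial>M) - (\<integral>x. v x \<bullet> (tgrad \<psi> x \<bullet> i) \<partial>M)"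
    unfolding inner_diff_left
    by (rule Bochner_Integration.integral_diff[OF sq_integrable_inner(1)[OF u(1) s(1)] sq_integrable_inner(1)[OF v(1) s(1)]])
  also have "\<dots> = - ((\<integral>x. g x \<bullet> (\<psi> x *\<^sub>R i) \<partial>M) - (\<integral>x. k x \<bullet> (\<psi> x *\<^sub>R i) \<partial>M))"
    using weak_gradientD[OF u(3) t] weak_gradientD[OF v(3) t] by simp
  also have "\<dots> = - (\<integral>x. (g x - k x) \<bullet> (\<psi> x *\<^sub>R i) \<partial>M)"
    unfolding inner_diff_left
    by (subst Bochner_Integration.integral_diff[OF sq_integrable_inner(1)[OF u(2) s(2)] sq_integrable_inner(1)[OF v(2) s(2)]]) simp
  finally show "(\<integral>x. (u x - v x) \<bullet> (tgrad \<psi> x \<bullet> i) \<partial>M) = - (\<integral>x. (g x - k x) \<bullet> (\<psi> x *\<^sub>R i) \<partial>M)" .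
qed (intro sq_integrable_diff u v)+

text \<open>For a fixed test function, both sides of integration by parts depend continuously on the
  function and on its gradient in the square norm.\<close>

lemma weak_gradient_limit:
  assumes u: "sq_integrable M u" "sq_integrable M g" and \<phi>: "\<And>n. test_fun \<Omega> (\<phi> n)"
    and lim: "(\<lambda>n. L2n M (\<lambda>x. \<phi> n x - u x)) \<longlonglongrightarrow> 0" "(\<lambda>n. L2n M (\<lambda>x. tgrad (\<phi> n) x - g x)) \<longlonglongrightarrow> 0"
  shows "weak_gradient \<Omega> u g"
proof (rule weak_gradientI[OF u])
  fix \<psi> and i :: 'a assume t: "test_fun \<Omega> \<psi>" "i \<in> Basis"
  have s: "sq_integrable M (\<lambda>x. tgrad \<psi> x \<bullet> i)" "sq_integrable M (\<lambda>x. \<psi> x *\<^sub>R i)"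
    using tf_sq[OF t(1)] by (auto intro: sq_integrable_inner_const sq_integrable_scaleR_const)
  have "(\<lambda>n. \<integral>x. \<phi> n x \<bullet> (tgrad \<psi> x \<bullet> i) \<partial>M) \<longlonglongrightarrow> (\<integral>x. u x \<bullet> (tgrad \<psi> x \<bullet> i) \<partial>M)"
    by (rule L2_inner_tendsto[OF tf_sq(1)[OF \<phi>] u(1) s(1) lim(1)])
  moreover have "(\<lambda>n. - (\<integral>x. tgrad (\<phi> n) x \<bullet> (\<psi> x *\<^sub>R i) \<partial>M)) \<longlonglongrightarrow> - (\<integral>x. g x \<bullet> (\<psi> x *\<^sub>R i) \<partial>M)"
    by (intro tendsto_minus L2_inner_tendsto[OF tf_sq(2)[OF \<phi>] u(2) s(2) lim(2)])
  ultimately show "(\<integral>x. u x \<bullet> (tgrad \<psi> x \<bullet> i) \<partial>M) = - (\<integral>x. g x \<bullet> (\<psi> x *\<^sub>R i) \<partial>M)"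
    unfolding weak_gradientD[OF weak_gradient_test_fun[OF \<phi>] t] by (rule LIMSEQ_unique)
qed

text \<open>The choice operator in \<open>grad\<close> is unfolded only here; afterwards
  \<open>grad\<close> is compared with an explicit weak gradient.\<close>

lemma grad_eq:
  assumes g: "weak_gradient \<Omega> u g" "sq_integrable M g"
  shows "weak_gradient \<Omega> u (grad \<Omega> u)" "AE x in M. grad \<Omega> u x = g x" "sq_integrable M (grad \<Omega> u)"
proof -
  show 1: "weak_gradient \<Omega> u (grad \<Omega> u)" unfolding grad_def by (rule someI[of "weak_gradient \<Omega> u" g, OF g(1)])
  show 2: "AE x in M. grad \<Omega> u x = g x" by (rule weak_gradient_unique[OF open_\<Omega> 1 g(1)])
  then have 3: "AE x in M. g x = grad \<Omega> u x" by eventually_elim simp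
  have "grad \<Omega> u \<in> borel_measurable M"
    using g(2) by (intro measurable_lebesgue_on_AE[OF sets_\<Omega> _ 3]) (simp add: sq_integrable_def)
  then show "sq_integrable M (grad \<Omega> u)" by (rule sq_integrable_cong_AE[OF g(2) _ 3])
qed

lemma H1_norm_eq:
  assumes "weak_gradient \<Omega> u g" "sq_integrable M g"
  shows "H1_norm \<Omega> u = sqrt ((L2n M u)\<^sup>2 + (L2n M g)\<^sup>2)"
proof -
  have "L2n M (grad \<Omega> u) = L2n M g"
    using grad_eq[OF assms] assms(2) by (intro L2n_cong_AE) (auto simp: sq_integrable_def)
  then show ?thesis by (simp add: H1_norm_def flip: L2n_power2) (simp add: L2n_power2)
qed

text \<open>Together with \<open>H10_D\<close> this describes \<open>H10\<close> by sequences of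
  test functions that converge along with their classical gradients. The chosen gradient of the
  difference u - \<phi>, on which \<open>H1_norm\<close> depends, then no longer occurs.\<close>

lemma H10_I:
  assumes u: "sq_integrable M u" "sq_integrable M g" and \<phi>: "\<And>n. test_fun \<Omega> (\<phi> n)"
    and lim: "(\<lambda>n. L2n M (\<lambda>x. \<phi> n x - u x)) \<longlonglongrightarrow> 0" "(\<lambda>n. L2n M (\<lambda>x. tgrad (\<phi> n) x - g x)) \<longlonglongrightarrow> 0"
  shows "u \<in> H10 \<Omega>" "AE x in M. grad \<Omega> u x = g x"
proof -
  note w = weak_gradient_limit[OF u \<phi> lim]
  show "AE x in M. grad \<Omega> u x = g x" by (rule grad_eq(2)[OF w u(2)])
  have e: "H1_norm \<Omega> (\<lambda>x. u x - \<phi> n x) = sqrt ((L2n M (\<lambda>x. \<phi> n x - u x))\<^sup>2 + (L2n M (\<lambda>x. tgrad (\<phi> n) x - g x))\<^sup>2)" for n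
    using H1_norm_eq[OF weak_gradient_diff[OF u w tf_sq(1,2)[OF \<phi>] weak_gradient_test_fun[OF \<phi>]] sq_integrable_diff(1)[OF u(2) tf_sq(2)[OF \<phi>]], of n]
    by (simp add: L2n_minus[of M u] L2n_minus[of M g])
  have "(\<lambda>n. H1_norm \<Omega> (\<lambda>x. u x - \<phi> n x)) \<longlonglongrightarrow> sqrt (0\<^sup>2 + 0\<^sup>2)"
    unfolding e by (intro tendsto_intros lim)
  then have "\<exists>\<phi>. test_fun \<Omega> \<phi> \<and> H1_norm \<Omega> (\<lambda>x. u x - \<phi> x) < \<epsilon>" if "\<epsilon> > 0" for \<epsilon>
    using order_tendstoD(2)[of _ 0 sequentially \<epsilon>] that \<phi> by (force simp: eventually_sequentially)
  then show "u \<in> H10 \<Omega>" using u w by (auto simp: H10_def H1_def L2_iff)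
qed

lemma H10_D:
  assumes "u \<in> H10 \<Omega>"
  shows "sq_integrable M u" "sq_integrable M (grad \<Omega> u)" "weak_gradient \<Omega> u (grad \<Omega> u)"
    and "\<exists>\<phi>. (\<forall>n. test_fun \<Omega> (\<phi> n)) \<and> (\<lambda>n. L2n M (\<lambda>x. \<phi> n x - u x)) \<longlonglongrightarrow> 0 \<and>
      (\<lambda>n. L2n M (\<lambda>x. tgrad (\<phi> n) x - grad \<Omega> u x)) \<longlonglongrightarrow> 0"
proof -
  obtain g where g: "weak_gradient \<Omega> u g" "sq_integrable M g" and u: "sq_integrable M u"
    using assms by (auto simp: H10_def H1_def L2_iff)
  note gr = grad_eq[OF g]
  show "sq_integrable M u" "sq_integrable M (grad \<Omega> u)" "weak_gradient \<Omega> u (grad \<Omega> u)" using u gr by auto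
  have "\<forall>n. \<exists>\<phi>. test_fun \<Omega> \<phi> \<and> H1_norm \<Omega> (\<lambda>x. u x - \<phi> x) < 1 / real (Suc n)"
    using assms by (auto simp: H10_def)
  then obtain \<phi> where \<phi>: "\<And>n. test_fun \<Omega> (\<phi> n)" "\<And>n. H1_norm \<Omega> (\<lambda>x. u x - \<phi> n x) < 1 / real (Suc n)" by metis
  have e: "H1_norm \<Omega> (\<lambda>x. u x - \<phi> n x) = sqrt ((L2n M (\<lambda>x. \<phi> n x - u x))\<^sup>2 + (L2n M (\<lambda>x. tgrad (\<phi> n) x - grad \<Omega> u x))\<^sup>2)" for n
    using H1_norm_eq[OF weak_gradient_diff[OF u gr(3,1) tf_sq(1,2)[OF \<phi>(1)] weak_gradient_test_fun[OF \<phi>(1)]] sq_integrable_diff(1)[OF gr(3) tf_sq(2)[OF \<phi>(1)]], of n]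
    by (simp add: L2n_minus[of M u] L2n_minus[of M "grad \<Omega> u"])
  have le: "L2n M (\<lambda>x. \<phi> n x - u x) \<le> 1 / real (Suc n)" "L2n M (\<lambda>x. tgrad (\<phi> n) x - grad \<Omega> u x) \<le> 1 / real (Suc n)" for n
    using \<phi>(2)[of n] real_sqrt_sum_squares_ge1[of "L2n M (\<lambda>x. \<phi> n x - u x)" "L2n M (\<lambda>x. tgrad (\<phi> n) x - grad \<Omega> u x)"]
      real_sqrt_sum_squares_ge2[of "L2n M (\<lambda>x. tgrad (\<phi> n) x - grad \<Omega> u x)" "L2n M (\<lambda>x. \<phi> n x - u x)"]
    unfolding e by linarith+
  have "(\<lambda>n. L2n M (\<lambda>x. \<phi> n x - u x)) \<longlonglongrightarrow> 0"
    by (rule Lim_null_comparison[OF _ LIMSEQ_Suc[OF lim_1_over_n]]) (use le in auto)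
  moreover have "(\<lambda>n. L2n M (\<lambda>x. tgrad (\<phi> n) x - grad \<Omega> u x)) \<longlonglongrightarrow> 0"
    by (rule Lim_null_comparison[OF _ LIMSEQ_Suc[OF lim_1_over_n]]) (use le in auto)
  ultimately show "\<exists>\<phi>. (\<forall>n. test_fun \<Omega> (\<phi> n)) \<and> (\<lambda>n. L2n M (\<lambda>x. \<phi> n x - u x)) \<longlonglongrightarrow> 0 \<and>
      (\<lambda>n. L2n M (\<lambda>x. tgrad (\<phi> n) x - grad \<Omega> u x)) \<longlonglongrightarrow> 0" using \<phi>(1) by blast
qed

lemma H10_approx:
  assumes "u \<in> H10 \<Omega>" "\<epsilon> > 0"
  shows "\<exists>\<phi>. test_fun \<Omega> \<phi> \<and> L2n M (\<lambda>x. \<phi> x - u x) < \<epsilon> \<and> L2n M (\<lambda>x. tgrad \<phi> x - grad \<Omega> u x) < \<epsilon>"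
proof -
  obtain \<phi> where \<phi>: "\<And>n. test_fun \<Omega> (\<phi> n)" "(\<lambda>n. L2n M (\<lambda>x. \<phi> n x - u x)) \<longlonglongrightarrow> 0"
      "(\<lambda>n. L2n M (\<lambda>x. tgrad (\<phi> n) x - grad \<Omega> u x)) \<longlonglongrightarrow> 0" using H10_D(4)[OF assms(1)] by blast
  have "\<forall>\<^sub>F n in sequentially. L2n M (\<lambda>x. \<phi> n x - u x) < \<epsilon> \<and> L2n M (\<lambda>x. tgrad (\<phi> n) x - grad \<Omega> u x) < \<epsilon>"
    using \<phi> assms(2) by (intro eventually_conj order_tendstoD(2)) auto
  then show ?thesis using \<phi>(1) by (auto simp: eventually_sequentially)
qed

lemma H10_approx_sequence:
  fixes u :: "nat \<Rightarrow> 'a \<Rightarrow> real"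
  assumes u: "\<And>n. u n \<in> H10 \<Omega>"
  shows "\<exists>\<phi>. \<forall>n. test_fun \<Omega> (\<phi> n) \<and> L2n M (\<lambda>x. \<phi> n x - u n x) < 1 / real (Suc n) \<and>
    L2n M (\<lambda>x. tgrad (\<phi> n) x - grad \<Omega> (u n) x) < 1 / real (Suc n)"
  by (rule choice, rule allI, rule H10_approx[OF u]) simp

lemma test_fun_H10:
  assumes "test_fun \<Omega> \<phi>"
  shows "\<phi> \<in> H10 \<Omega>" "AE x in M. grad \<Omega> \<phi> x = tgrad \<phi> x"
  using H10_I[of \<phi> "tgrad \<phi>" "\<lambda>_. \<phi>", OF tf_sq(1,2)[OF assms]] assms by (simp_all add: L2n_def)

lemma sq_integrable_lincomb:
  fixes f g :: "'x \<Rightarrow> 'b::euclidean_space"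
  assumes "sq_integrable M' f" "sq_integrable M' g"
  shows "sq_integrable M' (\<lambda>x. c *\<^sub>R f x + d *\<^sub>R g x)"
    and "L2n M' (\<lambda>x. c *\<^sub>R f x + d *\<^sub>R g x) \<le> \<bar>c\<bar> * L2n M' f + \<bar>d\<bar> * L2n M' g"
  using sq_integrable_add[OF sq_integrable_scaleR[OF assms(1), of c] sq_integrable_scaleR[OF assms(2), of d]]
  by (auto simp: L2n_scaleR)

lemma L2_lincomb_tendsto:
  fixes f g :: "'x \<Rightarrow> 'b::euclidean_space"
  assumes "\<And>n. sq_integrable M' (F n)" "\<And>n. sq_integrable M' (G n)" "sq_integrable M' f" "sq_integrable M' g"
    and "(\<lambda>n. L2n M' (\<lambda>x. F n x - f x)) \<longlonglongrightarrow> 0" "(\<lambda>n. L2n M' (\<lambda>x. G n x - g x)) \<longlonglongrightarrow> 0"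
  shows "(\<lambda>n. L2n M' (\<lambda>x. (c *\<^sub>R F n x + d *\<^sub>R G n x) - (c *\<^sub>R f x + d *\<^sub>R g x))) \<longlonglongrightarrow> 0"
proof (rule Lim_null_comparison)
  have e: "(\<lambda>x. (c *\<^sub>R F n x + d *\<^sub>R G n x) - (c *\<^sub>R f x + d *\<^sub>R g x)) = (\<lambda>x. c *\<^sub>R (F n x - f x) + d *\<^sub>R (G n x - g x))" for n
    by (simp add: fun_eq_iff algebra_simps)
  show "\<forall>\<^sub>F n in sequentially. norm (L2n M' (\<lambda>x. (c *\<^sub>R F n x + d *\<^sub>R G n x) - (c *\<^sub>R f x + d *\<^sub>R g x)))
      \<le> \<bar>c\<bar> * L2n M' (\<lambda>x. F n x - f x) + \<bar>d\<bar> * L2n M' (\<lambda>x. G n x - g x)"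
    unfolding e using sq_integrable_lincomb(2)[OF sq_integrable_diff(1)[OF assms(1,3)] sq_integrable_diff(1)[OF assms(2,4)]]
    by (intro always_eventually) simp
  show "(\<lambda>n. \<bar>c\<bar> * L2n M' (\<lambda>x. F n x - f x) + \<bar>d\<bar> * L2n M' (\<lambda>x. G n x - g x)) \<longlonglongrightarrow> 0"
    using tendsto_add[OF tendsto_mult_right_zero[OF assms(5)] tendsto_mult_right_zero[OF assms(6)]] by simp
qed

lemma H10_lincomb:
  assumes "u \<in> H10 \<Omega>" "v \<in> H10 \<Omega>"
  shows "(\<lambda>x. c * u x + d * v x) \<in> H10 \<Omega>" "AE x in M. grad \<Omega> (\<lambda>x. c * u x + d * v x) x = c *\<^sub>R grad \<Omega> u x + d *\<^sub>R grad \<Omega> v x"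
proof -
  note u = H10_D[OF assms(1)] and v = H10_D[OF assms(2)]
  obtain \<phi> where \<phi>: "\<And>n. test_fun \<Omega> (\<phi> n)" "(\<lambda>n. L2n M (\<lambda>x. \<phi> n x - u x)) \<longlonglongrightarrow> 0"
      "(\<lambda>n. L2n M (\<lambda>x. tgrad (\<phi> n) x - grad \<Omega> u x)) \<longlonglongrightarrow> 0" using u(4) by blast
  obtain \<psi> where \<psi>: "\<And>n. test_fun \<Omega> (\<psi> n)" "(\<lambda>n. L2n M (\<lambda>x. \<psi> n x - v x)) \<longlonglongrightarrow> 0"
      "(\<lambda>n. L2n M (\<lambda>x. tgrad (\<psi> n) x - grad \<Omega> v x)) \<longlonglongrightarrow> 0" using v(4) by blast
  have tg: "tgrad (\<lambda>x. c * \<phi> n x + d * \<psi> n x) = (\<lambda>x. c *\<^sub>R tgrad (\<phi> n) x + d *\<^sub>R tgrad (\<psi> n) x)" for n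
    using test_fun_lincomb(2)[OF \<phi>(1) \<psi>(1)] by (simp add: fun_eq_iff)
  have "(\<lambda>x. c * u x + d * v x) \<in> H10 \<Omega> \<and> (AE x in M. grad \<Omega> (\<lambda>x. c * u x + d * v x) x = c *\<^sub>R grad \<Omega> u x + d *\<^sub>R grad \<Omega> v x)"
  proof (intro conjI H10_I[where \<phi>="\<lambda>n x. c * \<phi> n x + d * \<psi> n x"])
    show "sq_integrable M (\<lambda>x. c * u x + d * v x)" "sq_integrable M (\<lambda>x. c * u x + d * v x)"
      using sq_integrable_lincomb(1)[OF u(1) v(1), of c d] by auto
    show "sq_integrable M (\<lambda>x. c *\<^sub>R grad \<Omega> u x + d *\<^sub>R grad \<Omega> v x)" "sq_integrable M (\<lambda>x. c *\<^sub>R grad \<Omega> u x + d *\<^sub>R grad \<Omega> v x)"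
      using sq_integrable_lincomb(1)[OF u(2) v(2), of c d] by auto
    show "test_fun \<Omega> (\<lambda>x. c * \<phi> n x + d * \<psi> n x)" "test_fun \<Omega> (\<lambda>x. c * \<phi> n x + d * \<psi> n x)" for n
      by (rule test_fun_lincomb(1)[OF \<phi>(1) \<psi>(1)])+
    show "(\<lambda>n. L2n M (\<lambda>x. (c * \<phi> n x + d * \<psi> n x) - (c * u x + d * v x))) \<longlonglongrightarrow> 0"
         "(\<lambda>n. L2n M (\<lambda>x. (c * \<phi> n x + d * \<psi> n x) - (c * u x + d * v x))) \<longlonglongrightarrow> 0"
      using L2_lincomb_tendsto[OF tf_sq(1)[OF \<phi>(1)] tf_sq(1)[OF \<psi>(1)] u(1) v(1) \<phi>(2) \<psi>(2), of c d] by auto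
    show "(\<lambda>n. L2n M (\<lambda>x. tgrad (\<lambda>x. c * \<phi> n x + d * \<psi> n x) x - (c *\<^sub>R grad \<Omega> u x + d *\<^sub>R grad \<Omega> v x))) \<longlonglongrightarrow> 0"
      "(\<lambda>n. L2n M (\<lambda>x. tgrad (\<lambda>x. c * \<phi> n x + d * \<psi> n x) x - (c *\<^sub>R grad \<Omega> u x + d *\<^sub>R grad \<Omega> v x))) \<longlonglongrightarrow> 0"
      unfolding tg using L2_lincomb_tendsto[OF tf_sq(2)[OF \<phi>(1)] tf_sq(2)[OF \<psi>(1)] u(2) v(2) \<phi>(3) \<psi>(3), of c d] by auto
  qed
  then show "(\<lambda>x. c * u x + d * v x) \<in> H10 \<Omega>" "AE x in M. grad \<Omega> (\<lambda>x. c * u x + d * v x) x = c *\<^sub>R grad \<Omega> u x + d *\<^sub>R grad \<Omega> v x" by auto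
qed

lemma H10_zero: "(\<lambda>_. 0) \<in> H10 \<Omega>"
  by (rule test_fun_H10(1)[OF test_fun_zero])

lemma H10_norm_eq: "H10_norm \<Omega> u = L2n M (grad \<Omega> u)"
  by (simp add: H10_norm_def H10_inner_def L2n_def power2_norm_eq_inner)

lemma H10_norm_nonneg [simp]: "0 \<le> H10_norm \<Omega> u"
  by (simp add: H10_norm_eq)

lemma H10_norm_lincomb_eq:
  assumes "u \<in> H10 \<Omega>" "v \<in> H10 \<Omega>"
  shows "H10_norm \<Omega> (\<lambda>x. c * u x + d * v x) = L2n M (\<lambda>x. c *\<^sub>R grad \<Omega> u x + d *\<^sub>R grad \<Omega> v x)"
  unfolding H10_norm_eq using H10_lincomb[OF assms, of c d]
  by (intro L2n_cong_AE sq_integrable_measurable H10_D(2) sq_integrable_lincomb(1) assms)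

lemma H10_diff: "u \<in> H10 \<Omega> \<Longrightarrow> v \<in> H10 \<Omega> \<Longrightarrow> (\<lambda>x. u x - v x) \<in> H10 \<Omega>"
  and H10_norm_diff: "u \<in> H10 \<Omega> \<Longrightarrow> v \<in> H10 \<Omega> \<Longrightarrow> H10_norm \<Omega> (\<lambda>x. u x - v x) = L2n M (\<lambda>x. grad \<Omega> u x - grad \<Omega> v x)"
  using H10_lincomb(1)[of u v 1 "-1"] H10_norm_lincomb_eq[of u v 1 "-1"] by auto

lemma H10_add: "u \<in> H10 \<Omega> \<Longrightarrow> v \<in> H10 \<Omega> \<Longrightarrow> (\<lambda>x. u x + v x) \<in> H10 \<Omega>"
  using H10_lincomb(1)[of u v 1 1] by simp

lemma H10_scale: "u \<in> H10 \<Omega> \<Longrightarrow> (\<lambda>x. c * u x) \<in> H10 \<Omega>"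
  and H10_norm_scale: "u \<in> H10 \<Omega> \<Longrightarrow> H10_norm \<Omega> (\<lambda>x. c * u x) = \<bar>c\<bar> * H10_norm \<Omega> u"
  using H10_lincomb(1)[of u u c 0] H10_norm_lincomb_eq[of u u c 0] by (auto simp: L2n_scaleR H10_norm_eq)

lemma H10_norm_lincomb:
  "u \<in> H10 \<Omega> \<Longrightarrow> v \<in> H10 \<Omega> \<Longrightarrow> H10_norm \<Omega> (\<lambda>x. c * u x + d * v x) \<le> \<bar>c\<bar> * H10_norm \<Omega> u + \<bar>d\<bar> * H10_norm \<Omega> v"
  unfolding H10_norm_lincomb_eq using sq_integrable_lincomb(2)[OF H10_D(2) H10_D(2)] by (simp add: H10_norm_eq)

lemma H10_norm_triangle:
  assumes "u \<in> H10 \<Omega>" "v \<in> H10 \<Omega>" "w \<in> H10 \<Omega>"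
  shows "H10_norm \<Omega> (\<lambda>x. u x - v x) \<le> H10_norm \<Omega> (\<lambda>x. u x - w x) + H10_norm \<Omega> (\<lambda>x. v x - w x)"
    and "\<bar>H10_norm \<Omega> u - H10_norm \<Omega> v\<bar> \<le> H10_norm \<Omega> (\<lambda>x. u x - v x)"
  using L2n_triangle[OF H10_D(2)[OF assms(1)] H10_D(2)[OF assms(2)] H10_D(2)[OF assms(3)]]
    L2n_diff_bound[OF H10_D(2)[OF assms(1)] H10_D(2)[OF assms(2)]]
  unfolding H10_norm_diff[OF assms(1,2)] H10_norm_diff[OF assms(1,3)] H10_norm_diff[OF assms(2,3)] H10_norm_eq by auto

text \<open>The exact convexity gain at a midpoint; it is the only source of convexity in the energy
  estimates.\<close>

lemma H10_parallelogram:
  assumes "u \<in> H10 \<Omega>" "v \<in> H10 \<Omega>"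
  shows "(H10_norm \<Omega> (\<lambda>x. (1/2) * u x + (1/2) * v x))\<^sup>2 = (H10_norm \<Omega> u)\<^sup>2 / 2 + (H10_norm \<Omega> v)\<^sup>2 / 2 - (H10_norm \<Omega> (\<lambda>x. u x - v x))\<^sup>2 / 4"
proof -
  let ?g = "grad \<Omega> u" and ?k = "grad \<Omega> v"
  have s: "sq_integrable M ?g" "sq_integrable M ?k" using assms by (auto intro: H10_D)
  have e: "(norm ((1/2) *\<^sub>R a + (1/2) *\<^sub>R b))\<^sup>2 = (norm a)\<^sup>2 / 2 + (norm b)\<^sup>2 / 2 - (norm (a - b))\<^sup>2 / 4" for a b :: 'a
    by (simp add: power2_norm_eq_inner inner_add_left inner_add_right inner_diff_left inner_diff_right inner_commute field_simps)
  show ?thesis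
    unfolding H10_norm_lincomb_eq[OF assms] H10_norm_diff[OF assms] unfolding H10_norm_eq L2n_power2 e
    using s sq_integrable_diff(1)[OF s] by (simp add: sq_integrable_def)
qed

text \<open>Integration by parts sees only the almost everywhere class of u, so the gradient of u is
  a weak gradient of v. Used contrapositively: minimizers at nonzero distance are different elements
  of the space.\<close>

lemma H10_ae_equal:
  assumes "u \<in> H10 \<Omega>" "v \<in> H10 \<Omega>" "ae_equal \<Omega> u v"
  shows "H10_norm \<Omega> (\<lambda>x. u x - v x) = 0"
proof -
  have ae: "AE x in M. u x = v x" using assms(3) by (simp add: ae_equal_def)
  have "weak_gradient \<Omega> v (grad \<Omega> u)"
  proof (rule weak_gradientI)
    fix \<psi> and i :: 'a assume t: "test_fun \<Omega> \<psi>" "i \<in> Basis"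
    have s: "sq_integrable M (\<lambda>x. tgrad \<psi> x \<bullet> i)" using tf_sq[OF t(1)] by (auto intro: sq_integrable_inner_const)
    have "(\<integral>x. v x \<bullet> (tgrad \<psi> x \<bullet> i) \<partial>M) = (\<integral>x. u x \<bullet> (tgrad \<psi> x \<bullet> i) \<partial>M)"
      using ae sq_integrable_inner(1)[OF H10_D(1)[OF assms(2)] s] sq_integrable_inner(1)[OF H10_D(1)[OF assms(1)] s]
      by (intro integral_cong_AE) (auto elim!: eventually_mono)
    then show "(\<integral>x. v x \<bullet> (tgrad \<psi> x \<bullet> i) \<partial>M) = - (\<integral>x. grad \<Omega> u x \<bullet> (\<psi> x *\<^sub>R i) \<partial>M)"
      using weak_gradientD[OF H10_D(3)[OF assms(1)] t] by simp
  qed (use H10_D assms in auto)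
  from grad_eq(2)[OF this H10_D(2)[OF assms(1)]] have "AE x in M. grad \<Omega> u x - grad \<Omega> v x = 0" by eventually_elim simp
  then have "L2n M (\<lambda>x. grad \<Omega> u x - grad \<Omega> v x) = L2n M (\<lambda>x. 0 :: 'a)"
    using H10_D(2)[OF assms(1)] H10_D(2)[OF assms(2)] by (intro L2n_cong_AE) (auto simp: sq_integrable_def)
  then show ?thesis by (simp add: H10_norm_diff assms L2n_def)
qed

end

section \<open>Poincare, completeness, Rellich and Sobolev on bounded open sets\<close>

locale bounded_open_set = open_set +
  assumes bounded_\<Omega>: "bounded \<Omega>"
begin

definition rad :: real where "rad = (SOME R. 0 < R \<and> (\<forall>x\<in>\<Omega>. norm x < R))"

lemma rad: "0 < rad" "x \<in> \<Omega> \<Longrightarrow> norm x < rad"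
proof -
  have "\<exists>R. 0 < R \<and> (\<forall>x\<in>\<Omega>. norm x < R)" using bounded_\<Omega> unfolding bounded_pos_less by blast
  from someI_ex[OF this] show "0 < rad" "x \<in> \<Omega> \<Longrightarrow> norm x < rad" by (auto simp: rad_def)
qed

lemma finite_measure_M: "finite_measure M"
proof (rule finite_measureI)
  have "\<Omega> \<in> lmeasurable" using bounded_\<Omega> open_\<Omega> by (intro lmeasurable_open)
  then show "emeasure M (space M) \<noteq> \<infinity>"
    by (simp add: emeasure_restrict_space sets_\<Omega> fmeasurable_def less_top)
qed

lemma Poincare:
  assumes "u \<in> H10 \<Omega>"
  shows "L2n M u \<le> 2 * rad * H10_norm \<Omega> u"
proof -
  obtain \<phi> where \<phi>: "\<And>n. test_fun \<Omega> (\<phi> n)" "(\<lambda>n. L2n M (\<lambda>x. \<phi> n x - u x)) \<longlonglongrightarrow> 0"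
      "(\<lambda>n. L2n M (\<lambda>x. tgrad (\<phi> n) x - grad \<Omega> u x)) \<longlonglongrightarrow> 0" using H10_D(4)[OF assms] by blast
  have p: "L2n M (\<phi> n) \<le> 2 * rad * L2n M (tgrad (\<phi> n))" for n
    unfolding tf_sq(3,4)[OF \<phi>(1)]
    using test_fun_outside(1)[OF \<phi>(1)] rad by (intro Poincare_C1c C1c_test_fun[OF \<phi>(1)]) (force simp: not_less[symmetric])+
  show ?thesis unfolding H10_norm_eq
    by (rule LIMSEQ_le[OF L2n_tendsto[OF tf_sq(1)[OF \<phi>(1)] H10_D(1)[OF assms] \<phi>(2)]
       tendsto_mult_left[OF L2n_tendsto[OF tf_sq(2)[OF \<phi>(1)] H10_D(2)[OF assms] \<phi>(3)]]]) (use p in auto)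
qed

text \<open>By Poincare, a sequence that is Cauchy for the gradients is also Cauchy itself, so
  functions and gradients have separate limits in the square norm. Test functions at distance less
  than 1 / (n + 1) from u n converge to the same pair, and \<open>H10_I\<close> recognizes it as a
  function in the space with its gradient.\<close>

lemma H10_complete:
  fixes u :: "nat \<Rightarrow> 'a \<Rightarrow> real"
  assumes u: "\<And>n. u n \<in> H10 \<Omega>"
    and C: "\<And>\<epsilon>. \<epsilon> > 0 \<Longrightarrow> \<exists>N. \<forall>m\<ge>N. \<forall>n\<ge>N. H10_norm \<Omega> (\<lambda>x. u m x - u n x) \<le> \<epsilon>"
  shows "\<exists>w\<in>H10 \<Omega>. (\<lambda>n. H10_norm \<Omega> (\<lambda>x. u n x - w x)) \<longlonglongrightarrow> 0"
proof -
  have "\<exists>N. \<forall>m\<ge>N. \<forall>n\<ge>N. L2n M (\<lambda>x. u m x - u n x) \<le> \<epsilon>" if \<epsilon>: "\<epsilon> > 0" for \<epsilon>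
  proof -
    obtain N where N: "\<And>m n. m \<ge> N \<Longrightarrow> n \<ge> N \<Longrightarrow> H10_norm \<Omega> (\<lambda>x. u m x - u n x) \<le> \<epsilon> / (2 * rad)"
      using C[of "\<epsilon> / (2 * rad)"] \<epsilon> rad(1) by auto
    have "L2n M (\<lambda>x. u m x - u n x) \<le> \<epsilon>" if "m \<ge> N" "n \<ge> N" for m n
      using Poincare[OF H10_diff[OF u u], of m n] N[OF that] rad(1) by (simp add: field_simps)
    then show ?thesis by blast
  qed
  from L2_complete[OF H10_D(1)[OF u] this] obtain w where w: "sq_integrable M w" "(\<lambda>n. L2n M (\<lambda>x. u n x - w x)) \<longlonglongrightarrow> 0" by auto
  from L2_complete[OF H10_D(2)[OF u] C[unfolded H10_norm_diff[OF u u]]]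
  obtain g where g: "sq_integrable M g" "(\<lambda>n. L2n M (\<lambda>x. grad \<Omega> (u n) x - g x)) \<longlonglongrightarrow> 0" by auto
  obtain \<phi> where "\<forall>n. test_fun \<Omega> (\<phi> n) \<and> L2n M (\<lambda>x. \<phi> n x - u n x) < 1 / real (Suc n) \<and>
      L2n M (\<lambda>x. tgrad (\<phi> n) x - grad \<Omega> (u n) x) < 1 / real (Suc n)"
    using H10_approx_sequence[of u, OF u] by (rule exE)
  then have \<phi>: "\<And>n. test_fun \<Omega> (\<phi> n)" "\<And>n. L2n M (\<lambda>x. \<phi> n x - u n x) < 1 / real (Suc n)"
    "\<And>n. L2n M (\<lambda>x. tgrad (\<phi> n) x - grad \<Omega> (u n) x) < 1 / real (Suc n)" by simp_all
  have l1: "(\<lambda>n. L2n M (\<lambda>x. \<phi> n x - w x)) \<longlonglongrightarrow> 0"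
  proof (rule Lim_null_comparison)
    show "\<forall>\<^sub>F n in sequentially. norm (L2n M (\<lambda>x. \<phi> n x - w x)) \<le> 1 / real (Suc n) + L2n M (\<lambda>x. u n x - w x)"
    proof (intro always_eventually allI)
      fix n
      show "norm (L2n M (\<lambda>x. \<phi> n x - w x)) \<le> 1 / real (Suc n) + L2n M (\<lambda>x. u n x - w x)"
        using L2n_triangle[OF tf_sq(1)[OF \<phi>(1)[of n]] w(1) H10_D(1)[OF u[of n]]] \<phi>(2)[of n] L2n_minus[of M w "u n"] by simp
    qed
    show "(\<lambda>n. 1 / real (Suc n) + L2n M (\<lambda>x. u n x - w x)) \<longlonglongrightarrow> 0"
      using tendsto_add[OF LIMSEQ_Suc[OF lim_1_over_n[where 'a=real]] w(2)] by simp
  qed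
  have l2: "(\<lambda>n. L2n M (\<lambda>x. tgrad (\<phi> n) x - g x)) \<longlonglongrightarrow> 0"
  proof (rule Lim_null_comparison)
    show "\<forall>\<^sub>F n in sequentially. norm (L2n M (\<lambda>x. tgrad (\<phi> n) x - g x)) \<le> 1 / real (Suc n) + L2n M (\<lambda>x. grad \<Omega> (u n) x - g x)"
    proof (intro always_eventually allI)
      fix n
      show "norm (L2n M (\<lambda>x. tgrad (\<phi> n) x - g x)) \<le> 1 / real (Suc n) + L2n M (\<lambda>x. grad \<Omega> (u n) x - g x)"
        using L2n_triangle[OF tf_sq(2)[OF \<phi>(1)[of n]] g(1) H10_D(2)[OF u[of n]]] \<phi>(3)[of n] L2n_minus[of M g "grad \<Omega> (u n)"] by simp
    qed
    show "(\<lambda>n. 1 / real (Suc n) + L2n M (\<lambda>x. grad \<Omega> (u n) x - g x)) \<longlonglongrightarrow> 0"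
      using tendsto_add[OF LIMSEQ_Suc[OF lim_1_over_n[where 'a=real]] g(2)] by simp
  qed
  note W = H10_I[OF w(1) g(1) \<phi>(1) l1 l2]
  have eq: "H10_norm \<Omega> (\<lambda>x. u n x - w x) = L2n M (\<lambda>x. grad \<Omega> (u n) x - g x)" for n
    unfolding H10_norm_diff[OF u W(1)]
    using W(2) by (intro L2n_cong_AE sq_integrable_measurable sq_integrable_diff(1) H10_D(2) u W(1) g(1)) (auto elim!: eventually_mono)
  have "(\<lambda>n. H10_norm \<Omega> (\<lambda>x. u n x - w x)) \<longlonglongrightarrow> 0" using g(2) by (simp only: eq)
  then show ?thesis using W(1) by blast
qed

text \<open>Each u n is replaced by a test function at distance less than 1 / (n + 1), all supported
  in one bounded set with bounded gradients; a subsequence good for these is good for u, by the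
  triangle inequality with three equal parts.\<close>

lemma Rellich:
  fixes u :: "nat \<Rightarrow> 'a \<Rightarrow> real"
  assumes u: "\<And>n. u n \<in> H10 \<Omega>" and B: "\<And>n. H10_norm \<Omega> (u n) \<le> B"
  shows "\<exists>r :: nat \<Rightarrow> nat. strict_mono r \<and> (\<forall>\<epsilon>>0. \<exists>N. \<forall>m\<ge>N. \<forall>n\<ge>N. L2n M (\<lambda>x. u (r m) x - u (r n) x) \<le> \<epsilon>)"
proof -
  obtain \<phi> where "\<forall>n. test_fun \<Omega> (\<phi> n) \<and> L2n M (\<lambda>x. \<phi> n x - u n x) < 1 / real (Suc n) \<and>
      L2n M (\<lambda>x. tgrad (\<phi> n) x - grad \<Omega> (u n) x) < 1 / real (Suc n)"
    using H10_approx_sequence[of u, OF u] by (rule exE)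
  then have \<phi>: "\<And>n. test_fun \<Omega> (\<phi> n)" "\<And>n. L2n M (\<lambda>x. \<phi> n x - u n x) < 1 / real (Suc n)"
    "\<And>n. L2n M (\<lambda>x. tgrad (\<phi> n) x - grad \<Omega> (u n) x) < 1 / real (Suc n)" by simp_all
  have z: "\<phi> n x = 0" if "x \<notin> \<Omega>" for n x by (rule test_fun_outside(1)[OF \<phi>(1) that])
  have "L2n lborel (tgrad (\<phi> n)) \<le> B + 1" for n
  proof -
    have "1 / real (Suc n) \<le> 1" by simp
    then show ?thesis
      using L2n_diff_bound[OF tf_sq(2)[OF \<phi>(1)] H10_D(2)[OF u], of n n] \<phi>(3)[of n] B[of n]
      unfolding H10_norm_eq tf_sq(4)[OF \<phi>(1), symmetric] by linarith
  qed
  then have "\<exists>r :: nat \<Rightarrow> nat. strict_mono r \<and> (\<forall>\<epsilon>>0. \<exists>N. \<forall>m\<ge>N. \<forall>n\<ge>N. L2n lborel (\<lambda>x. \<phi> (r m) x - \<phi> (r n) x) \<le> \<epsilon>)"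
    using Rellich_C1c[of \<phi> "\<lambda>n. tgrad (\<phi> n)" \<Omega> "B + 1"] C1c_test_fun[OF \<phi>(1)] bounded_\<Omega> z by blast
  then obtain r :: "nat \<Rightarrow> nat" where r: "strict_mono r"
    "\<And>\<epsilon>. \<epsilon> > 0 \<Longrightarrow> \<exists>N. \<forall>m\<ge>N. \<forall>n\<ge>N. L2n lborel (\<lambda>x. \<phi> (r m) x - \<phi> (r n) x) \<le> \<epsilon>" by blast
  have tfd: "test_fun \<Omega> (\<lambda>x. \<phi> m x - \<phi> n x)" for m n
    using test_fun_lincomb(1)[OF \<phi>(1) \<phi>(1), of 1 m "-1" n] by simp
  have "\<exists>N. \<forall>m\<ge>N. \<forall>n\<ge>N. L2n M (\<lambda>x. u (r m) x - u (r n) x) \<le> \<epsilon>" if \<epsilon>: "\<epsilon> > 0" for \<epsilon>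
  proof -
    obtain N1 where N1: "\<And>m n. m \<ge> N1 \<Longrightarrow> n \<ge> N1 \<Longrightarrow> L2n lborel (\<lambda>x. \<phi> (r m) x - \<phi> (r n) x) \<le> \<epsilon> / 3"
      using r(2)[of "\<epsilon> / 3"] \<epsilon> by auto
    have "\<forall>\<^sub>F n in sequentially. 1 / real (Suc n) < \<epsilon> / 3"
      using order_tendstoD(2)[OF LIMSEQ_Suc[OF lim_1_over_n[where 'a=real]], of "\<epsilon> / 3"] \<epsilon> by simp
    then obtain N2 where N2: "\<And>n. n \<ge> N2 \<Longrightarrow> 1 / real (Suc n) < \<epsilon> / 3" by (auto simp: eventually_sequentially)
    have "L2n M (\<lambda>x. u (r m) x - u (r n) x) \<le> \<epsilon>" if mn: "m \<ge> max N1 N2" "n \<ge> max N1 N2" for m n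
    proof -
      have "L2n M (\<lambda>x. \<phi> (r m) x - \<phi> (r n) x) \<le> \<epsilon> / 3"
        unfolding tf_sq(3)[OF tfd] using mn by (intro N1) auto
      moreover have "L2n M (\<lambda>x. \<phi> (r k) x - u (r k) x) \<le> \<epsilon> / 3" if "k \<ge> max N1 N2" for k
        using \<phi>(2)[of "r k"] N2[of "r k"] that seq_suble[OF r(1), of k] by simp
      from this[OF mn(1)] this[OF mn(2)]
      have "L2n M (\<lambda>x. \<phi> (r m) x - u (r m) x) \<le> \<epsilon> / 3" "L2n M (\<lambda>x. \<phi> (r n) x - u (r n) x) \<le> \<epsilon> / 3" .
      ultimately show ?thesis
        using L2n_triangle[OF H10_D(1)[OF u] H10_D(1)[OF u] tf_sq(1)[OF \<phi>(1)], of "r m" "r n" "r m"]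
          L2n_triangle[OF H10_D(1)[OF u] tf_sq(1)[OF \<phi>(1)] tf_sq(1)[OF \<phi>(1)], of "r n" "r m" "r n"]
          L2n_minus[of M "\<phi> (r m)" "u (r m)"] L2n_minus[of M "\<phi> (r n)" "u (r n)"] by linarith
    qed
    then show ?thesis by blast
  qed
  then show ?thesis using r(1) by blast
qed

text \<open>Fatou along approximating test functions that converge almost everywhere: the gradient
  norms converge, and for the left side lower semicontinuity is enough.\<close>

lemma Sobolev:
  assumes u: "u \<in> H10 \<Omega>" and d: "DIM('a) \<ge> 3"
  defines "s \<equiv> 2 * real DIM('a) / (real DIM('a) - 2)"
  shows "integrable M (\<lambda>x. \<bar>u x\<bar> powr s)" "(\<integral>x. \<bar>u x\<bar> powr s \<partial>M) \<le> (s * H10_norm \<Omega> u) powr s"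
proof -
  have s: "s > 0" using d by (simp add: s_def)
  obtain \<phi> where \<phi>: "\<And>n. test_fun \<Omega> (\<phi> n)" "(\<lambda>n. L2n M (\<lambda>x. \<phi> n x - u x)) \<longlonglongrightarrow> 0"
      "(\<lambda>n. L2n M (\<lambda>x. tgrad (\<phi> n) x - grad \<Omega> u x)) \<longlonglongrightarrow> 0" using H10_D(4)[OF u] by blast
  obtain r where r: "strict_mono r" "AE x in M. (\<lambda>k. \<phi> (r k) x) \<longlonglongrightarrow> u x"
    using L2_conv_AE_subsequence[OF tf_sq(1)[OF \<phi>(1)] H10_D(1)[OF u] \<phi>(2)] by auto
  have [measurable]: "u \<in> borel_measurable M" "\<phi> n \<in> borel_measurable M" for n
    using H10_D(1)[OF u] tf_sq(1)[OF \<phi>(1)] by (auto simp: sq_integrable_def)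
  have lim: "(\<lambda>k. L2n M (tgrad (\<phi> (r k)))) \<longlonglongrightarrow> H10_norm \<Omega> u"
    using LIMSEQ_subseq_LIMSEQ[OF L2n_tendsto[OF tf_sq(2)[OF \<phi>(1)] H10_D(2)[OF u] \<phi>(3)] r(1)]
    by (simp add: o_def H10_norm_eq)
  have bd: "(\<integral>\<^sup>+x. ennreal (\<bar>\<phi> n x\<bar> powr s) \<partial>M) \<le> ennreal ((s * L2n M (tgrad (\<phi> n))) powr s)" for n
  proof -
    have cp: "continuous_on UNIV (\<lambda>x. \<bar>\<phi> n x\<bar> powr s)"
      using s C1c_continuous[OF C1c_test_fun[OF \<phi>(1)]] by (intro continuous_on_powr' continuous_intros) auto
    obtain R where "\<And>x. R \<le> norm x \<Longrightarrow> \<phi> n x = 0" using C1c_test_fun[OF \<phi>(1)[of n]] unfolding C1c_def by blast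
    then have i: "integrable lborel (\<lambda>x. \<bar>\<phi> n x\<bar> powr s)"
      using s by (intro integrable_continuous_compact_support[OF cp, of R]) auto
    have m: "(\<lambda>x. \<bar>\<phi> n x\<bar> powr s) \<in> borel_measurable borel" using cp by (rule borel_measurable_continuous_onI)
    have z: "\<bar>\<phi> n x\<bar> powr s = 0" if "x \<notin> \<Omega>" for x using test_fun_outside(1)[OF \<phi>(1) that] by simp
    note lz = lebesgue_on_zero_outside[OF open_\<Omega> m z]
    have "(\<integral>\<^sup>+x. ennreal (\<bar>\<phi> n x\<bar> powr s) \<partial>M) = ennreal (\<integral>x. \<bar>\<phi> n x\<bar> powr s \<partial>lborel)"
      using lz i by (subst nn_integral_eq_integral) auto
    also have "\<dots> \<le> ennreal ((s * (\<integral>x. (norm (tgrad (\<phi> n) x))\<^sup>2 \<partial>lborel) powr (1/2)) powr s)"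
      unfolding s_def by (intro ennreal_leI Sobolev_C1c C1c_test_fun[OF \<phi>(1)] d)
    also have "(\<integral>x. (norm (tgrad (\<phi> n) x))\<^sup>2 \<partial>lborel) powr (1/2) = L2n M (tgrad (\<phi> n))"
      unfolding tf_sq(4)[OF \<phi>(1)] by (simp add: L2n_def powr_half_sqrt)
    finally show ?thesis .
  qed
  have "(\<integral>\<^sup>+x. ennreal (\<bar>u x\<bar> powr s) \<partial>M) = (\<integral>\<^sup>+x. liminf (\<lambda>k. ennreal (\<bar>\<phi> (r k) x\<bar> powr s)) \<partial>M)"
  proof (rule nn_integral_cong_AE, use r(2) in eventually_elim)
    case (elim x)
    then have "(\<lambda>k. ennreal (\<bar>\<phi> (r k) x\<bar> powr s)) \<longlonglongrightarrow> ennreal (\<bar>u x\<bar> powr s)"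
      using s by (intro tendsto_ennrealI tendsto_powr' tendsto_rabs tendsto_const) auto
    then show ?case using lim_imp_Liminf[OF sequentially_bot] by metis
  qed
  also have "\<dots> \<le> liminf (\<lambda>k. \<integral>\<^sup>+x. ennreal (\<bar>\<phi> (r k) x\<bar> powr s) \<partial>M)" by (rule nn_integral_liminf) measurable
  also have "\<dots> \<le> liminf (\<lambda>k. ennreal ((s * L2n M (tgrad (\<phi> (r k)))) powr s))"
    using bd by (intro Liminf_mono always_eventually) auto
  also have "\<dots> = ennreal ((s * H10_norm \<Omega> u) powr s)"
    using s lim by (intro lim_imp_Liminf sequentially_bot tendsto_ennrealI tendsto_powr' tendsto_mult tendsto_const) auto
  finally have le: "(\<integral>\<^sup>+x. ennreal (\<bar>u x\<bar> powr s) \<partial>M) \<le> ennreal ((s * H10_norm \<Omega> u) powr s)" .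
  show i: "integrable M (\<lambda>x. \<bar>u x\<bar> powr s)"
    using le by (intro integrableI_bounded) (auto intro: le_less_trans simp: less_top)
  have "ennreal (\<integral>x. \<bar>u x\<bar> powr s \<partial>M) \<le> ennreal ((s * H10_norm \<Omega> u) powr s)"
    using le i by (simp add: nn_integral_eq_integral)
  then show "(\<integral>x. \<bar>u x\<bar> powr s \<partial>M) \<le> (s * H10_norm \<Omega> u) powr s" by simp
qed

end

section \<open>A minimax argument for two minimizers\<close>

text \<open>Sequential compactness for uniform convergence on \<open>X\<close>; the values outside
  \<open>X\<close> are not constrained.\<close>

definition seq_compact_functionals :: "'u set \<Rightarrow> ('u \<Rightarrow> real) set \<Rightarrow> bool" where
  "seq_compact_functionals X C \<longleftrightarrow> (\<forall>c :: nat \<Rightarrow> 'u \<Rightarrow> real. range c \<subseteq> C \<longrightarrow>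
     (\<exists>r \<phi>. strict_mono r \<and> \<phi> \<in> C \<and> (\<forall>\<epsilon>>0. \<forall>\<^sub>F n in sequentially. \<forall>u\<in>X. \<bar>c (r n) u - \<phi> u\<bar> \<le> \<epsilon>)))"

lemma convex_functionalsD:
  "convex_functionals C \<Longrightarrow> \<phi> \<in> C \<Longrightarrow> \<psi> \<in> C \<Longrightarrow> 0 \<le> t \<Longrightarrow> t \<le> 1 \<Longrightarrow> (\<lambda>v. (1 - t) * \<phi> v + t * \<psi> v) \<in> C"
  unfolding convex_functionals_def by (elim ballE[of _ _ \<phi>] ballE[of _ _ \<psi>] allE[of _ "1 - t"] allE[of _ t]) auto

text \<open>C' is the union of the segments from points of C to \<phi>. Convex combinations of two
  such points regroup into one point of C and \<phi>; compactness is inherited from the product of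
  the interval and C.\<close>

lemma convex_seq_compact_join:
  fixes X :: "'u set"
  assumes C: "C \<subseteq> T" "C \<noteq> {}" "convex_functionals C" "seq_compact_functionals X C"
    and T: "convex_functionals T" "\<phi> \<in> T" "\<forall>\<psi>\<in>T. \<forall>u\<in>X. \<bar>\<psi> u\<bar> \<le> K"
  defines "C' \<equiv> (\<lambda>(s, a) v. (1 - s) * a v + s * \<phi> v) ` ({0..1} \<times> C)"
  shows "C' \<subseteq> T" "C \<subseteq> C'" "\<phi> \<in> C'" "convex_functionals C'" "seq_compact_functionals X C'"
proof -
  have C'I: "(\<lambda>v. (1 - s) * a v + s * \<phi> v) \<in> C'" if "0 \<le> s" "s \<le> 1" "a \<in> C" for s a
    using that by (auto simp: C'_def intro!: image_eqI[of _ _ "(s, a)"])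
  show "C' \<subseteq> T" using convex_functionalsD[OF T(1)] C(1) T(2) by (auto simp: C'_def)
  show "C \<subseteq> C'" using C'I[of 0] by auto
  show "\<phi> \<in> C'" using C'I[of 1] C(2) by auto
  show "convex_functionals C'"
    unfolding convex_functionals_def
  proof (intro ballI allI impI)
    fix f g and p q :: real assume "f \<in> C'" "g \<in> C'" and p: "0 \<le> p" "0 \<le> q" "p + q = 1"
    then obtain s a s' a' where f: "f = (\<lambda>v. (1 - s) * a v + s * \<phi> v)" "0 \<le> s" "s \<le> 1" "a \<in> C"
      and g: "g = (\<lambda>v. (1 - s') * a' v + s' * \<phi> v)" "0 \<le> s'" "s' \<le> 1" "a' \<in> C"
      unfolding C'_def by auto
    \<comment> \<open>The total weight that the combination puts on C. If it is 0 only \<phi>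
      remains; otherwise the part in C, divided by this weight, is again a convex combination of
      points of C.\<close>
    define \<sigma> where "\<sigma> = p * (1 - s) + q * (1 - s')"
    have s1: "p * s + q * s' = 1 - \<sigma>" using p by (simp add: \<sigma>_def algebra_simps)
    have nn: "0 \<le> p * (1 - s)" "0 \<le> q * (1 - s')" "0 \<le> p * s" "0 \<le> q * s'" using f g p by auto
    then have \<sigma>: "0 \<le> \<sigma>" "\<sigma> \<le> 1" using s1 by (auto simp: \<sigma>_def)
    show "(\<lambda>v. p * f v + q * g v) \<in> C'"
    proof (cases "\<sigma> = 0")
      case True
      then have z: "p * (1 - s) = 0" "q * (1 - s') = 0" using nn unfolding \<sigma>_def by linarith+
      have "p * f v + q * g v = \<phi> v" for v
      proof -
        have "p * f v + q * g v = (p * (1 - s)) * a v + (q * (1 - s')) * a' v + (p * s + q * s') * \<phi> v"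
          by (simp add: f g algebra_simps)
        then show ?thesis using z s1 True by simp
      qed
      then show ?thesis using \<open>\<phi> \<in> C'\<close> by simp
    next
      case False
      define b where "b v = (1 - q * (1 - s') / \<sigma>) * a v + q * (1 - s') / \<sigma> * a' v" for v
      have e: "1 - q * (1 - s') / \<sigma> = p * (1 - s) / \<sigma>" using False by (simp add: \<sigma>_def field_simps)
      have "b \<in> C" unfolding b_def
        using convex_functionalsD[OF C(3) f(4) g(4), of "q * (1 - s') / \<sigma>"] nn \<sigma> False
        by (simp add: divide_le_eq_1) (simp add: \<sigma>_def)
      moreover have "p * f v + q * g v = (1 - (1 - \<sigma>)) * b v + (1 - \<sigma>) * \<phi> v" for v
      proof -
        have "p * f v + q * g v = (p * (1 - s)) * a v + (q * (1 - s')) * a' v + (p * s + q * s') * \<phi> v"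
          by (simp add: f g algebra_simps)
        moreover have "\<sigma> * b v = (p * (1 - s)) * a v + (q * (1 - s')) * a' v"
          unfolding b_def e using False by (simp add: field_simps)
        ultimately show ?thesis using s1 by simp
      qed
      ultimately show ?thesis using C'I[of "1 - \<sigma>" b] \<sigma> by simp
    qed
  qed
  show "seq_compact_functionals X C'"
    unfolding seq_compact_functionals_def
  proof (intro allI impI)
    fix c :: "nat \<Rightarrow> 'u \<Rightarrow> real" assume "range c \<subseteq> C'"
    then have cC: "c n \<in> C'" for n by auto
    have "\<exists>s a. s \<in> {0..1} \<and> a \<in> C \<and> c n = (\<lambda>v. (1 - s) * a v + s * \<phi> v)" for n
    proof -
      from cC[of n] obtain x where "x \<in> {0..1} \<times> C" "c n = (\<lambda>(s, a) v. (1 - s) * a v + s * \<phi> v) x"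
        unfolding C'_def by (elim imageE)
      then show ?thesis by (intro exI[of _ "fst x"] exI[of _ "snd x"]) auto
    qed
    then obtain s a where s: "\<And>n. s n \<in> {0..1::real}" and a: "\<And>n. a n \<in> C"
      and c: "\<And>n. c n = (\<lambda>v. (1 - s n) * a n v + s n * \<phi> v)"
      by metis
    obtain l r where l: "l \<in> {0..1}" "strict_mono r" "(s \<circ> r) \<longlonglongrightarrow> l"
      using s compact_Icc[of 0 "1::real"] unfolding compact_def by metis
    obtain r' \<psi> where r': "strict_mono r'" "\<psi> \<in> C"
        "\<And>\<epsilon>. \<epsilon> > 0 \<Longrightarrow> \<forall>\<^sub>F n in sequentially. \<forall>u\<in>X. \<bar>a (r (r' n)) u - \<psi> u\<bar> \<le> \<epsilon>"
      using C(4) a unfolding seq_compact_functionals_def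
      by (elim allE[of _ "\<lambda>n. a (r n)"]) auto
    define f where "f v = (1 - l) * \<psi> v + l * \<phi> v" for v
    have K: "\<bar>a n u\<bar> \<le> K" "\<bar>\<phi> u\<bar> \<le> K" if "u \<in> X" for n u
      using a C(1) T that by (auto dest!: subsetD)
    have lim: "(\<lambda>n. s (r (r' n))) \<longlonglongrightarrow> l"
      using LIMSEQ_subseq_LIMSEQ[OF l(3) r'(1)] by (simp add: o_def)
    have "\<forall>\<^sub>F n in sequentially. \<forall>u\<in>X. \<bar>c (r (r' n)) u - f u\<bar> \<le> \<epsilon>" if "\<epsilon> > 0" for \<epsilon>
    proof -
      \<comment> \<open>Tolerance for the parameter s: multiplied by 2 |K|, the largest possible
        difference of two functionals on X, it costs at most half of \<epsilon>. The summand 1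
        allows K = 0.\<close>
      define \<eta> where "\<eta> = \<epsilon> / (2 * (2 * \<bar>K\<bar> + 1))"
      have \<eta>: "\<eta> > 0" using that by (simp add: \<eta>_def)
      have \<epsilon>: "\<eta> * (2 * \<bar>K\<bar>) \<le> \<epsilon> / 2"
        using that by (simp add: \<eta>_def field_simps)
      have "\<forall>\<^sub>F n in sequentially. (\<forall>u\<in>X. \<bar>a (r (r' n)) u - \<psi> u\<bar> \<le> \<epsilon> / 2) \<and> dist (s (r (r' n))) l < \<eta>"
        using that by (intro eventually_conj r'(3) tendstoD[OF lim \<eta>]) auto
      then show ?thesis
      proof eventually_elim
        case (elim n)
        show ?case
        proof
          fix u assume u: "u \<in> X"
          let ?n = "r (r' n)"
          \<comment> \<open>Splitting the error into a change of the point of C and a change of the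
            parameter; uniform boundedness on X controls the second part.\<close>
          have "c ?n u - f u = (1 - l) * (a ?n u - \<psi> u) + (l - s ?n) * (a ?n u - \<phi> u)"
            by (simp add: c f_def algebra_simps)
          also have "\<bar>\<dots>\<bar> \<le> (1 - l) * \<bar>a ?n u - \<psi> u\<bar> + \<bar>l - s ?n\<bar> * \<bar>a ?n u - \<phi> u\<bar>"
            using l(1) by (intro order_trans[OF abs_triangle_ineq]) (simp add: abs_mult)
          also have "\<dots> \<le> 1 * (\<epsilon> / 2) + \<eta> * (2 * \<bar>K\<bar>)"
            using elim u l(1) K(1)[OF u, of ?n] K(2)[OF u] by (intro add_mono mult_mono) (auto simp: dist_real_def)
          also have "\<dots> \<le> \<epsilon>" using \<epsilon> by simp
          finally show "\<bar>c ?n u - f u\<bar> \<le> \<epsilon>" .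
        qed
      qed
    qed
    moreover have "f \<in> C'" unfolding f_def using C'I l r' by auto
    moreover have "strict_mono (\<lambda>n. r (r' n))" using l(2) r'(1) by (simp add: strict_mono_def)
    ultimately show "\<exists>r \<phi>. strict_mono r \<and> \<phi> \<in> C' \<and>
        (\<forall>\<epsilon>>0. \<forall>\<^sub>F n in sequentially. \<forall>u\<in>X. \<bar>c (r n) u - \<phi> u\<bar> \<le> \<epsilon>)" by blast
  qed
qed

text \<open>C plays the role of the convex hull of F and is built by joining one functional at a
  time to a single functional.\<close>

lemma finite_subset_convex_seq_compact:
  fixes X :: "'u set"
  assumes "finite F" "F \<noteq> {}" "F \<subseteq> T"
    and T: "convex_functionals T" "\<forall>\<psi>\<in>T. \<forall>u\<in>X. \<bar>\<psi> u\<bar> \<le> K"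
  shows "\<exists>C. F \<subseteq> C \<and> C \<subseteq> T \<and> convex_functionals C \<and> seq_compact_functionals X C"
  using assms(1-3)
proof (induction F rule: finite_ne_induct)
  case (singleton \<phi>)
  have "seq_compact_functionals X {\<phi>}"
    unfolding seq_compact_functionals_def
  proof (intro allI impI exI[of _ id] exI[of _ \<phi>] conjI)
    fix c :: "nat \<Rightarrow> 'u \<Rightarrow> real" and \<epsilon> :: real assume "range c \<subseteq> {\<phi>}" "0 < \<epsilon>"
    then have "c n = \<phi>" for n by blast
    then show "\<forall>\<^sub>F n in sequentially. \<forall>u\<in>X. \<bar>c (id n) u - \<phi> u\<bar> \<le> \<epsilon>" using \<open>0 < \<epsilon>\<close> by simp
  qed (auto simp: strict_mono_id)
  moreover have "convex_functionals {\<phi>}"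
    by (auto simp: convex_functionals_def fun_eq_iff simp flip: distrib_right)
  ultimately show ?case using singleton by blast
next
  case (insert \<phi> F)
  then obtain C where C: "F \<subseteq> C" "C \<subseteq> T" "convex_functionals C" "seq_compact_functionals X C" by auto
  have "C \<noteq> {}" using C insert by auto
  have \<phi>: "\<phi> \<in> T" using insert.prems by auto
  note j = convex_seq_compact_join[of C T X \<phi> K, OF C(2) \<open>C \<noteq> {}\<close> C(3,4) T(1) \<phi> T(2)]
  show ?case using j C(1) by (intro exI conjI) auto
qed

text \<open>Suppose that every perturbed minimizer is unique. Let \<open>F \<subseteq> T\<close> be finite, \<open>C \<supseteq> F\<close> convex and
  compact, and let \<open>\<phi>\<^sub>0 \<in> C\<close> maximize the concave function \<open>\<phi> \<mapsto> inf (E - \<phi>)\<close> on \<open>C\<close>. Moving \<open>\<phi>\<^sub>0\<close>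
  towards \<open>\<phi> \<in> C\<close> and using uniqueness, the minimizer \<open>u\<close> for \<open>\<phi>\<^sub>0\<close> satisfies
  \<open>E u - \<phi> u \<le> c\<close> for all \<open>\<phi> \<in> F\<close>. Enlarging \<open>F\<close> step by step with a functional \<open>f\<^sub>k\<close> that
  is very negative at the \<open>k\<close>-th point \<open>u\<^sub>k\<close> while \<open>f\<^sub>k(u\<^sub>l) \<ge> 0\<close> for \<open>l > k\<close> keeps \<open>u\<^sub>l\<close> away from
  \<open>u\<^sub>k\<close>, although \<open>(u\<^sub>k)\<close> minimizes \<open>E\<close> and so has a convergent subsequence.\<close>

lemma minimax_two_minimizers:
  fixes X :: "'u set" and E N :: "'u \<Rightarrow> real" and d :: "'u \<Rightarrow> 'u \<Rightarrow> real"
  assumes T: "convex_functionals T"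
    and lip: "\<And>\<phi> u v. \<phi> \<in> T \<Longrightarrow> u \<in> X \<Longrightarrow> v \<in> X \<Longrightarrow> \<bar>\<phi> u - \<phi> v\<bar> \<le> \<delta> * d u v"
    and \<delta>: "0 \<le> \<delta>"
    and K: "\<And>\<phi> u. \<phi> \<in> T \<Longrightarrow> u \<in> X \<Longrightarrow> \<bar>\<phi> u\<bar> \<le> K"
    and d: "\<And>u v w. u \<in> X \<Longrightarrow> v \<in> X \<Longrightarrow> w \<in> X \<Longrightarrow> d u v \<le> d u w + d v w"
    and N: "\<And>u v. u \<in> X \<Longrightarrow> v \<in> X \<Longrightarrow> \<bar>N u - N v\<bar> \<le> d u v"
    and low: "\<And>u. u \<in> X \<Longrightarrow> c \<le> E u"
    and below: "\<And>\<phi>. \<phi> \<in> T \<Longrightarrow> \<exists>u\<in>X. E u - \<phi> u \<le> c"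
    and Npos: "\<And>u. u \<in> X \<Longrightarrow> E u = c \<Longrightarrow> N u > 0"
    and small: "\<And>\<epsilon>. \<epsilon> > 0 \<Longrightarrow> \<exists>\<phi>\<in>T. \<forall>u\<in>X. \<bar>\<phi> u\<bar> \<le> \<epsilon>"
    and sep: "\<kappa> > 0" "\<And>u. u \<in> X \<Longrightarrow> \<exists>\<phi>\<in>T. \<phi> u \<le> - \<kappa> * N u"
    and comp: "\<And>(u :: nat \<Rightarrow> 'u) \<phi> c'. (\<And>n. u n \<in> X) \<Longrightarrow> \<phi> \<in> T \<or> \<phi> = (\<lambda>_. 0) \<Longrightarrow>
        (\<And>w. w \<in> X \<Longrightarrow> c' \<le> E w - \<phi> w) \<Longrightarrow> (\<lambda>n. E (u n) - \<phi> (u n)) \<longlonglongrightarrow> c' \<Longrightarrow>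
        \<exists>r w. strict_mono r \<and> w \<in> X \<and> (\<lambda>n. d (u (r n)) w) \<longlonglongrightarrow> 0 \<and> E w - \<phi> w = c'"
  shows "\<exists>\<phi>\<in>T. \<exists>u\<in>X. \<exists>v\<in>X. (\<forall>w\<in>X. E u - \<phi> u \<le> E w - \<phi> w) \<and> (\<forall>w\<in>X. E v - \<phi> v \<le> E w - \<phi> w) \<and> d u v \<noteq> 0"
proof (rule ccontr)
  assume "\<not> ?thesis"
  then have uniq: "d u v = 0" if "\<phi> \<in> T" "u \<in> X" "v \<in> X" "\<forall>w\<in>X. E u - \<phi> u \<le> E w - \<phi> w"
    "\<forall>w\<in>X. E v - \<phi> v \<le> E w - \<phi> w" for \<phi> u v using that by blast
  have ex: "\<exists>u\<in>X. \<forall>w\<in>X. E u - \<phi> u \<le> E w - \<phi> w" if \<phi>: "\<phi> \<in> T" for \<phi>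
  proof -
    define c' where "c' = (INF u\<in>X. E u - \<phi> u)"
    have ne: "X \<noteq> {}" using below[OF \<phi>] by auto
    have bd: "bdd_below ((\<lambda>u. E u - \<phi> u) ` X)"
      using low K[OF \<phi>] by (intro bdd_belowI2[of _ "c - K"]) (smt (verit))
    have "\<exists>u\<in>X. E u - \<phi> u < c' + 1 / Suc n" for n
      using cINF_less_iff[OF ne bd, of "c' + 1 / Suc n"] by (simp add: c'_def[symmetric])
    then obtain u where u: "\<And>n. u n \<in> X" "\<And>n. E (u n) - \<phi> (u n) < c' + 1 / Suc n" by metis
    have lb: "c' \<le> E w - \<phi> w" if "w \<in> X" for w
      unfolding c'_def by (intro cINF_lower bd that)
    have "(\<lambda>n. E (u n) - \<phi> (u n)) \<longlonglongrightarrow> c'"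
    proof (rule tendsto_sandwich[of "\<lambda>_. c'"])
      show "(\<lambda>n. c' + 1 / Suc n) \<longlonglongrightarrow> c'"
        using tendsto_add[OF tendsto_const[of c'] LIMSEQ_Suc[OF lim_1_over_n]] by simp
    qed (use lb u in \<open>auto intro!: always_eventually less_imp_le\<close>)
    from comp[OF u(1) _ lb this] \<phi> obtain w where "w \<in> X" "E w - \<phi> w = c'" by auto
    then show ?thesis using lb by auto
  qed
  then obtain m where m: "\<And>\<phi>. \<phi> \<in> T \<Longrightarrow> m \<phi> \<in> X" "\<And>\<phi> w. \<phi> \<in> T \<Longrightarrow> w \<in> X \<Longrightarrow> E (m \<phi>) - \<phi> (m \<phi>) \<le> E w - \<phi> w"
    by metis
  define g where "g \<phi> = E (m \<phi>) - \<phi> (m \<phi>)" for \<phi>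
  have gle: "g \<phi> \<le> E w - \<phi> w" if "\<phi> \<in> T" "w \<in> X" for \<phi> w using m that by (auto simp: g_def)
  have gc: "g \<phi> \<le> c" if "\<phi> \<in> T" for \<phi> using below[OF that] gle[OF that] by force
  have claim: "\<exists>u\<in>X. \<forall>\<phi>\<in>F. E u - \<phi> u \<le> c" if F: "finite F" "F \<noteq> {}" "F \<subseteq> T" for F
  proof -
    obtain C where C: "F \<subseteq> C" "C \<subseteq> T" "convex_functionals C" "seq_compact_functionals X C"
      using finite_subset_convex_seq_compact[OF F T, of X K] K by auto
    have ne: "C \<noteq> {}" using C F by auto
    have bd: "bdd_above (g ` C)" using gc C by (intro bdd_aboveI2[of _ _ c]) auto
    define s where "s = (SUP \<phi>\<in>C. g \<phi>)"
    have gs: "g \<phi> \<le> s" if "\<phi> \<in> C" for \<phi> unfolding s_def by (intro cSUP_upper bd that)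
    have "\<exists>\<phi>\<in>C. s - 1 / Suc n < g \<phi>" for n
      using less_cSUP_iff[OF ne bd, of "s - 1 / Suc n"] by (simp add: s_def[symmetric])
    then obtain f where f: "\<And>n. f n \<in> C" "\<And>n. s - 1 / Suc n < g (f n)" by metis
    obtain r \<phi>0 where r: "strict_mono r" "\<phi>0 \<in> C"
        "\<And>\<epsilon>. \<epsilon> > 0 \<Longrightarrow> \<forall>\<^sub>F n in sequentially. \<forall>u\<in>X. \<bar>f (r n) u - \<phi>0 u\<bar> \<le> \<epsilon>"
      using C(4) f(1) unfolding seq_compact_functionals_def
      by (elim allE[of _ f]) auto
    have \<phi>0: "\<phi>0 \<in> T" using r C by auto
    \<comment> \<open>As an infimum of functions of the functional, g is upper semicontinuous:
      testing g (f (r n)) at the minimizer for the limit costs only the uniform distance. So the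
      limit functional attains the maximum over C.\<close>
    have "s \<le> g \<phi>0"
    proof (rule field_le_epsilon)
      fix \<epsilon> :: real assume \<epsilon>: "\<epsilon> > 0"
      have "\<forall>\<^sub>F n in sequentially. 1 / Suc n < \<epsilon> / 2"
        using order_tendstoD(2)[OF LIMSEQ_Suc[OF lim_1_over_n], of "\<epsilon> / 2"] \<epsilon> by simp
      then have "\<forall>\<^sub>F n in sequentially. 1 / Suc n < \<epsilon> / 2 \<and> (\<forall>u\<in>X. \<bar>f (r n) u - \<phi>0 u\<bar> \<le> \<epsilon> / 2)"
        using r(3)[of "\<epsilon> / 2"] \<epsilon> by (intro eventually_conj) auto
      then obtain n where n: "1 / Suc n < \<epsilon> / 2" "\<forall>u\<in>X. \<bar>f (r n) u - \<phi>0 u\<bar> \<le> \<epsilon> / 2"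
        by (auto simp: eventually_sequentially)
      have "1 / Suc (r n) \<le> 1 / Suc n" using seq_suble[OF r(1), of n] by (simp add: frac_le)
      then have "s - \<epsilon> / 2 \<le> g (f (r n))" using f(2)[of "r n"] n(1) by linarith
      also have "\<dots> \<le> E (m \<phi>0) - f (r n) (m \<phi>0)" using f(1) C(2) m(1)[OF \<phi>0] by (intro gle) auto
      also have "\<dots> \<le> g \<phi>0 + \<epsilon> / 2" using bspec[OF n(2) m(1)[OF \<phi>0]] unfolding g_def by linarith
      finally show "s \<le> g \<phi>0 + \<epsilon>" by simp
    qed
    have "E (m \<phi>0) - \<phi> (m \<phi>0) \<le> c" if \<phi>: "\<phi> \<in> C" for \<phi>
    proof -
      define t where "t n = 1 / real (Suc n)" for n
      have t: "0 < t n" "t n \<le> 1" for n by (auto simp: t_def)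
      define p where "p n = (\<lambda>v. (1 - t n) * \<phi>0 v + t n * \<phi> v)" for n
      have pC: "p n \<in> C" for n unfolding p_def using t[of n] by (intro convex_functionalsD C r \<phi>) auto
      then have pT: "p n \<in> T" for n using C by auto
      have \<phi>T: "\<phi> \<in> T" using \<phi> C by auto
      define u where "u n = m (p n)" for n
      have u: "u n \<in> X" for n using m(1)[OF pT] by (simp add: u_def)
      \<comment> \<open>Maximality of g at \<phi>0, read at the minimizer u n for the functional p
        n. Combined with g \<phi>0 <= E (u n) - \<phi>0 (u n) it gives \<phi> >= \<phi>0 at u n, and
        it shows that u n is a minimizing sequence for \<phi>0.\<close>
      have gp: "E (u n) - \<phi>0 (u n) - t n * (\<phi> (u n) - \<phi>0 (u n)) \<le> g \<phi>0" for n
      proof -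
        have "g (p n) \<le> g \<phi>0" using gs[OF pC] \<open>s \<le> g \<phi>0\<close> by (rule order_trans)
        moreover have "g (p n) = E (u n) - \<phi>0 (u n) - t n * (\<phi> (u n) - \<phi>0 (u n))"
          by (simp add: g_def u_def p_def algebra_simps)
        ultimately show ?thesis by simp
      qed
      have pos: "0 \<le> \<phi> (u n) - \<phi>0 (u n)" for n
      proof -
        have "0 \<le> t n * (\<phi> (u n) - \<phi>0 (u n))" using gp[of n] gle[OF \<phi>0 u[of n]] by linarith
        then show ?thesis using t(1)[of n] by (simp add: zero_le_mult_iff)
      qed
      have "(\<lambda>n. E (u n) - \<phi>0 (u n)) \<longlonglongrightarrow> g \<phi>0"
      proof (rule tendsto_sandwich[of "\<lambda>_. g \<phi>0"])
        have "t n * (\<phi> (u n) - \<phi>0 (u n)) \<le> t n * (2 * K)" for n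
          using t[of n] K[OF \<phi>T u[of n]] K[OF \<phi>0 u[of n]] by (intro mult_left_mono) auto
        then show "\<forall>\<^sub>F n in sequentially. E (u n) - \<phi>0 (u n) \<le> g \<phi>0 + t n * (2 * K)"
          using gp by (intro always_eventually allI) (smt (verit))
        have "t \<longlonglongrightarrow> 0" unfolding t_def using LIMSEQ_Suc[OF lim_1_over_n[where 'a=real]] by simp
        then show "(\<lambda>n. g \<phi>0 + t n * (2 * K)) \<longlonglongrightarrow> g \<phi>0" by (auto intro!: tendsto_eq_intros)
      qed (use gle[OF \<phi>0 u] in auto)
      from comp[OF u _ _ this] \<phi>0 gle[OF \<phi>0]
      obtain q w where q: "strict_mono q" "w \<in> X" "(\<lambda>n. d (u (q n)) w) \<longlonglongrightarrow> 0" "E w - \<phi>0 w = g \<phi>0"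
        by auto
      have lim: "(\<lambda>n. f (u (q n))) \<longlonglongrightarrow> f w" if "f \<in> T" for f
      proof (rule LIM_zero_cancel, rule Lim_null_comparison)
        show "\<forall>\<^sub>F n in sequentially. norm (f (u (q n)) - f w) \<le> \<delta> * d (u (q n)) w"
          using lip[OF that u q(2)] by (intro always_eventually) auto
        show "(\<lambda>n. \<delta> * d (u (q n)) w) \<longlonglongrightarrow> 0" using tendsto_mult_right_zero[OF q(3)] .
      qed
      have "0 \<le> \<phi> w - \<phi>0 w"
        by (rule LIMSEQ_le_const[OF tendsto_diff[OF lim[OF \<phi>T] lim[OF \<phi>0]]]) (use pos in auto)
      \<comment> \<open>The limit w minimizes for \<phi>0, as m \<phi>0 does, so assumed uniqueness
        puts them at distance 0 and functionals of T cannot tell them apart. Thus the sign found at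
        w holds at m \<phi>0, a point independent of \<phi>.\<close>
      moreover have "d w (m \<phi>0) = 0"
        using q gle[OF \<phi>0] m[OF \<phi>0] by (intro uniq[OF \<phi>0]) auto
      then have "\<phi> w = \<phi> (m \<phi>0)" "\<phi>0 w = \<phi>0 (m \<phi>0)"
        using lip[OF \<phi>T q(2) m(1)[OF \<phi>0]] lip[OF \<phi>0 q(2) m(1)[OF \<phi>0]] by simp_all
      ultimately have "0 \<le> \<phi> (m \<phi>0) - \<phi>0 (m \<phi>0)" by simp
      then show ?thesis using gc[OF \<phi>0] by (simp add: g_def)
    qed
    then show ?thesis using m(1)[OF \<phi>0] C(1) by blast
  qed
  \<comment> \<open>A functional \<tau> k below 1 / (k + 1) on X is included at stage k. It forces E
    (u k) <= c + 1 / (k + 1), so that the constructed points minimize the unperturbed E.\<close>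
  have "\<forall>k. \<exists>\<phi>. \<phi> \<in> T \<and> (\<forall>u\<in>X. \<bar>\<phi> u\<bar> \<le> 1 / Suc k)" using small by (auto simp: Bex_def)
  then obtain \<tau> where \<tau>: "\<And>k. \<tau> k \<in> T" "\<And>k u. u \<in> X \<Longrightarrow> \<bar>\<tau> k u\<bar> \<le> 1 / Suc k" by metis
  \<comment> \<open>A state is the finite set of functionals collected so far together with the
    current point. P says that the point satisfies all bounds, including the one for \<tau> k; Q
    adds to the next set a functional that is negative at the current point.\<close>
  define P where "P k x = (finite (fst x) \<and> fst x \<subseteq> T \<and> snd x \<in> X \<and>
      (\<forall>\<phi>\<in>insert (\<tau> k) (fst x). E (snd x) - \<phi> (snd x) \<le> c))" for k and x :: "('u \<Rightarrow> real) set \<times> 'u"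
  define Q where "Q x y = (\<exists>\<phi>\<in>T. \<phi> (snd x) \<le> - \<kappa> * N (snd x) \<and> fst y = insert \<phi> (fst x))"
    for x y :: "('u \<Rightarrow> real) set \<times> 'u"
  have "\<exists>h. \<forall>k. P k (h k) \<and> Q (h k) (h (Suc k))"
  proof (rule dependent_nat_choice)
    show "\<exists>x. P 0 x" using claim[of "{\<tau> 0}"] \<tau>(1) by (force simp: P_def)
    fix x k assume x: "P k x"
    then have "snd x \<in> X" by (simp add: P_def)
    from sep(2)[OF this] obtain \<phi> where \<phi>: "\<phi> \<in> T" "\<phi> (snd x) \<le> - \<kappa> * N (snd x)" by blast
    obtain u where "u \<in> X" "\<forall>\<psi>\<in>insert (\<tau> (Suc k)) (insert \<phi> (fst x)). E u - \<psi> u \<le> c"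
      using claim[of "insert (\<tau> (Suc k)) (insert \<phi> (fst x))"] \<tau>(1) \<phi>(1) x by (auto simp: P_def)
    then show "\<exists>y. P (Suc k) y \<and> Q x y"
      using \<phi> x by (intro exI[of _ "(insert \<phi> (fst x), u)"]) (auto simp: P_def Q_def)
  qed
  then obtain h where h: "\<And>k. P k (h k)" "\<And>k. Q (h k) (h (Suc k))" by auto
  define u where "u k = snd (h k)" for k
  define F where "F k = fst (h k)" for k
  have u: "u k \<in> X" for k using h(1)[of k] by (simp add: P_def u_def)
  have "\<exists>\<phi>. \<phi> \<in> T \<and> \<phi> (u k) \<le> - \<kappa> * N (u k) \<and> F (Suc k) = insert \<phi> (F k)" for k
    using h(2)[of k] by (auto simp: Q_def u_def F_def)
  then obtain f where f: "\<And>k. f k \<in> T" "\<And>k. f k (u k) \<le> - \<kappa> * N (u k)" "\<And>k. F (Suc k) = insert (f k) (F k)"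
    by metis
  have "F k \<subseteq> F l" if "k \<le> l" for k l
    using f(3) by (intro lift_Suc_mono_le[OF _ that]) auto
  then have fF: "f k \<in> F l" if "k < l" for k l
    using f(3)[of k] that by (metis Suc_leI insertI1 subsetD)
  \<comment> \<open>At later points E - f k is at most c while E is at least c.\<close>
  have fpos: "0 \<le> f k (u l)" if "k < l" for k l
    using h(1)[of l] fF[OF that] low[OF u[of l]] by (force simp: P_def u_def F_def)
  have "(\<lambda>n. E (u n) - 0) \<longlonglongrightarrow> c"
  proof (rule tendsto_sandwich[of "\<lambda>_. c"])
    show "\<forall>\<^sub>F n in sequentially. E (u n) - 0 \<le> c + 1 / Suc n"
    proof (intro always_eventually allI)
      fix n
      have "E (u n) - \<tau> n (u n) \<le> c" using h(1)[of n] by (simp add: P_def u_def)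
      then show "E (u n) - 0 \<le> c + 1 / Suc n" using \<tau>(2)[OF u[of n], of n] by linarith
    qed
    show "(\<lambda>n. c + 1 / Suc n) \<longlonglongrightarrow> c"
      using tendsto_add[OF tendsto_const[of c] LIMSEQ_Suc[OF lim_1_over_n]] by simp
  qed (use low u in auto)
  from comp[OF u _ _ this] low obtain r w where r: "strict_mono r" "w \<in> X"
    "(\<lambda>n. d (u (r n)) w) \<longlonglongrightarrow> 0" "E w = c" by auto
  have "N w \<le> 0"
  proof (rule LIMSEQ_le_const)
    show "\<exists>k. \<forall>n\<ge>k. N w \<le> d (u (r n)) w + (\<delta> / \<kappa>) * (d (u (r (Suc n))) w + d (u (r n)) w)"
    proof (intro exI allI impI)
      fix n
      let ?k = "r n" and ?l = "r (Suc n)"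
      have "?k < ?l" using r(1) by (simp add: strict_mono_def)
      \<comment> \<open>The functional f k separates u k from each later point by at least \<kappa>
        N (u k), but it is Lipschitz. Since the subsequence converges, N must vanish at the limit,
        which has energy c.\<close>
      have "\<kappa> * N (u ?k) \<le> f ?k (u ?l) - f ?k (u ?k)" using f(2)[of ?k] fpos[OF \<open>?k < ?l\<close>] by simp
      also have "\<dots> \<le> \<delta> * d (u ?l) (u ?k)" using lip[OF f(1) u u, of ?k ?l ?k] by simp
      also have "\<dots> \<le> \<delta> * (d (u ?l) w + d (u ?k) w)"
        using \<delta> by (intro mult_left_mono d u r)
      finally have "N (u ?k) \<le> (\<delta> / \<kappa>) * (d (u ?l) w + d (u ?k) w)" using sep(1) by (simp add: field_simps)
      then show "N w \<le> d (u ?k) w + (\<delta> / \<kappa>) * (d (u ?l) w + d (u ?k) w)"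
        using N[OF u r(2), of ?k] by linarith
    qed
    show "(\<lambda>n. d (u (r n)) w + (\<delta> / \<kappa>) * (d (u (r (Suc n))) w + d (u (r n)) w)) \<longlonglongrightarrow> 0"
      using tendsto_add[OF r(3) tendsto_mult_left[OF tendsto_add[OF LIMSEQ_Suc[OF r(3)] r(3)], of "\<delta> / \<kappa>"]] by simp
  qed
  then show False using Npos[OF r(2,4)] by simp
qed

section \<open>The energy functional\<close>

locale sobolev_set = bounded_open_set +
  assumes dim3: "3 \<le> DIM('a)"
begin

definition s :: real where "s = 2 * real DIM('a) / (real DIM('a) - 2)"

lemma s_gt: "2 < s"
  using dim3 by (simp add: s_def field_simps)

definition J :: "real \<Rightarrow> ('a \<Rightarrow> real) \<Rightarrow> real" where
  "J a u = (\<integral>x. \<bar>u x\<bar> powr a \<partial>M)"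

abbreviation N where "N \<equiv> H10_norm \<Omega>"

definition X :: "real \<Rightarrow> ('a \<Rightarrow> real) set" where
  "X r = {u \<in> H10 \<Omega>. N u \<le> r}"

lemma H10_measurable: "u \<in> H10 \<Omega> \<Longrightarrow> u \<in> borel_measurable M"
  using H10_D(1) by (simp add: sq_integrable_def)

lemma J_nonneg: "0 \<le> J a u"
  unfolding J_def by (intro Bochner_Integration.integral_nonneg) auto

lemma integrable_const_M: "integrable M (\<lambda>_. c :: real)"
  using finite_measure.integrable_const[OF finite_measure_M] .

lemma integrable_powr:
  assumes u: "u \<in> H10 \<Omega>" and a: "0 < a" "a \<le> s"
  shows "integrable M (\<lambda>x. \<bar>u x\<bar> powr a)" "J a u \<le> measure M (space M) + (s * N u) powr s"
proof -
  have [measurable]: "u \<in> borel_measurable M" by (rule H10_measurable[OF u])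
  have i: "integrable M (\<lambda>x. \<bar>u x\<bar> powr s)" "J s u \<le> (s * N u) powr s"
    using Sobolev[OF u dim3] by (simp_all add: s_def J_def)
  have le: "\<bar>t\<bar> powr a \<le> 1 + \<bar>t\<bar> powr s" for t :: real
  proof (cases "\<bar>t\<bar> \<le> 1")
    case True
    then have "\<bar>t\<bar> powr a \<le> 1 powr a" using a by (intro powr_mono2) auto
    then show ?thesis using powr_ge_zero[of "\<bar>t\<bar>" s] by (simp; linarith)
  next
    case False
    then have "\<bar>t\<bar> powr a \<le> \<bar>t\<bar> powr s" using a by (intro powr_mono) auto
    then show ?thesis by simp
  qed
  have i2: "integrable M (\<lambda>x. 1 + \<bar>u x\<bar> powr s)"
    by (intro Bochner_Integration.integrable_add integrable_const_M i)
  show "integrable M (\<lambda>x. \<bar>u x\<bar> powr a)"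
    by (rule Bochner_Integration.integrable_bound[OF i2]) (use le in auto)
  then have "J a u \<le> (\<integral>x. 1 + \<bar>u x\<bar> powr s \<partial>M)"
    unfolding J_def by (intro integral_mono i2 le)
  also have "\<dots> = measure M (space M) + J s u"
    using i integrable_const_M[of 1] by (simp add: J_def)
  finally show "J a u \<le> measure M (space M) + (s * N u) powr s" using i by simp
qed

lemma J_scale: "J a (\<lambda>x. c * u x) = \<bar>c\<bar> powr a * J a u"
  unfolding J_def by (simp add: abs_mult powr_mult)

text \<open>The bound in \<open>integrable_powr\<close> has an additive constant but J is
  homogeneous, so the bound is applied to multiples of u with norm at most 1 and scaled
  back.\<close>

lemma J_growth:
  assumes a: "0 < a" "a \<le> s"
  shows "\<exists>K\<ge>0. \<forall>u\<in>H10 \<Omega>. J a u \<le> K * N u powr a"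
proof -
  define K where "K = measure M (space M) + s powr s"
  have K: "0 \<le> K" by (simp add: K_def)
  have sc: "c powr a * J a u \<le> K" if u: "u \<in> H10 \<Omega>" and c: "c > 0" "c * N u \<le> 1" for u c
  proof -
    have "c powr a * J a u = J a (\<lambda>x. c * u x)" using c by (simp add: J_scale)
    also have "\<dots> \<le> measure M (space M) + (s * N (\<lambda>x. c * u x)) powr s"
      by (intro integrable_powr(2) H10_scale u a)
    also have "(s * N (\<lambda>x. c * u x)) powr s \<le> s powr s"
      using c s_gt u by (intro powr_mono2) (auto simp: H10_norm_scale mult_left_le)
    finally show ?thesis by (simp add: K_def)
  qed
  have "J a u \<le> K * N u powr a" if u: "u \<in> H10 \<Omega>" for u
  proof (cases "N u = 0")
    case True
    have "J a u \<le> 0"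
    proof (rule ccontr)
      assume "\<not> J a u \<le> 0"
      then have p: "J a u > 0" by simp
      \<comment> \<open>If N u = 0, every multiple of u has norm 0; this one would have J equal to K
        + 1, exceeding the bound K.\<close>
      define c where "c = ((K + 1) / J a u) powr (1 / a)"
      have "c > 0" using p K by (simp add: c_def)
      have "c powr a = (K + 1) / J a u" using p K a by (simp add: c_def powr_powr)
      with sc[OF u \<open>c > 0\<close>] True p show False by simp
    qed
    then show ?thesis using True by simp
  next
    case False
    then have p: "N u > 0" using H10_norm_nonneg[of u] by linarith
    have "(1 / N u) powr a * J a u \<le> K" using p by (intro sc u) auto
    then show ?thesis using p by (simp add: powr_divide field_simps)
  qed
  then show ?thesis using K by blast
qed

lemma X_H10: "u \<in> X r \<Longrightarrow> u \<in> H10 \<Omega>" and X_N: "u \<in> X r \<Longrightarrow> N u \<le> r"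
  by (auto simp: X_def)

lemma mixed_bound:
  assumes ab: "0 < b" "b \<le> a" "a \<le> s" and r: "0 < r"
  shows "\<exists>C\<ge>0. \<forall>u\<in>X r. \<forall>v\<in>X r. integrable M (\<lambda>x. (\<bar>u x\<bar> + \<bar>v x\<bar>) powr (a - b) * \<bar>u x - v x\<bar> powr b) \<and>
     (\<integral>x. (\<bar>u x\<bar> + \<bar>v x\<bar>) powr (a - b) * \<bar>u x - v x\<bar> powr b \<partial>M) \<le> C * N (\<lambda>x. u x - v x) powr b"
proof -
  have a: "0 < a" using ab by simp
  obtain K where K: "K \<ge> 0" "\<And>u. u \<in> H10 \<Omega> \<Longrightarrow> J a u \<le> K * N u powr a" using J_growth[OF a ab(3)] by blast
  define C0 where "C0 = 2 powr a * (2 * (K * r powr a)) + K * r powr a"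
  define C where "C = C0 / r powr b"
  have C0: "0 \<le> C0" using K by (simp add: C0_def)
  have C: "0 \<le> C" using C0 by (simp add: C_def)
  show ?thesis
  proof (intro exI conjI ballI, rule C)
    fix u v assume X: "u \<in> X r" "v \<in> X r"
    then have H: "u \<in> H10 \<Omega>" "v \<in> H10 \<Omega>" "N u \<le> r" "N v \<le> r" by (auto simp: X_def)
    then have H': "(\<lambda>x. u x - v x) \<in> H10 \<Omega>" by (intro H10_diff)
    have [measurable]: "u \<in> borel_measurable M" "v \<in> borel_measurable M" using H by (auto intro: H10_measurable)
    have iu: "integrable M (\<lambda>x. \<bar>u x\<bar> powr a)" "integrable M (\<lambda>x. \<bar>v x\<bar> powr a)" "integrable M (\<lambda>x. \<bar>u x - v x\<bar> powr a)"
      using integrable_powr(1)[OF _ a ab(3)] H H' by auto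
    have Jr: "J a u \<le> K * r powr a" "J a v \<le> K * r powr a"
    proof -
      have "K * N f powr a \<le> K * r powr a" if "N f \<le> r" for f
        using that a K(1) by (intro mult_left_mono powr_mono2) auto
      then show "J a u \<le> K * r powr a" "J a v \<le> K * r powr a"
        using K(2)[OF H(1)] K(2)[OF H(2)] H(3,4) by (blast intro: order_trans)+
    qed
    let ?w = "\<lambda>x. \<bar>u x\<bar> + \<bar>v x\<bar>" and ?z = "\<lambda>x. \<bar>u x - v x\<bar>"
    have wi: "integrable M (\<lambda>x. 2 powr a * (\<bar>u x\<bar> powr a + \<bar>v x\<bar> powr a))" using iu by auto
    have pw: "?w x powr a \<le> 2 powr a * (\<bar>u x\<bar> powr a + \<bar>v x\<bar> powr a)" for x
      using a by (intro add_powr_le) auto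
    have key: "c powr b * (?w x powr (a - b) * ?z x powr b) \<le> 2 powr a * (\<bar>u x\<bar> powr a + \<bar>v x\<bar> powr a) + c powr a * ?z x powr a"
      if "c > 0" for c x
    proof -
      have "c powr b * (?w x powr (a - b) * ?z x powr b) = ?w x powr (a - b) * (c * ?z x) powr b"
        using that by (simp add: powr_mult)
      also have "\<dots> \<le> ?w x powr a + (c * ?z x) powr a"
        using that ab by (intro powr_mult_le_add_powr) auto
      also have "\<dots> \<le> 2 powr a * (\<bar>u x\<bar> powr a + \<bar>v x\<bar> powr a) + c powr a * ?z x powr a"
        using pw[of x] that by (simp add: powr_mult)
      finally show ?thesis .
    qed
    show i: "integrable M (\<lambda>x. ?w x powr (a - b) * ?z x powr b)"
      by (rule Bochner_Integration.integrable_bound[OF Bochner_Integration.integrable_add[OF wi iu(3)]])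
         (use key[of 1] in auto)
    let ?I = "\<integral>x. ?w x powr (a - b) * ?z x powr b \<partial>M"
    \<comment> \<open>The factor r / \<eta> brings u - v to norm at most r, so every term of order a
      is at most a multiple of r powr a; dividing by (r / \<eta>) powr b leaves \<eta> powr b.
      Taking \<eta> strictly positive and letting it decrease to the distance covers distance
      0.\<close>
    have main: "?I \<le> C * \<eta> powr b" if \<eta>: "\<eta> > 0" "N (\<lambda>x. u x - v x) \<le> \<eta>" for \<eta>
    proof -
      have c: "r / \<eta> > 0" using r \<eta> by simp
      have i3: "integrable M (\<lambda>x. 2 powr a * (\<bar>u x\<bar> powr a + \<bar>v x\<bar> powr a) + (r / \<eta>) powr a * ?z x powr a)"
        using wi iu by auto
      have "(r / \<eta>) powr b * ?I = (\<integral>x. (r / \<eta>) powr b * (?w x powr (a - b) * ?z x powr b) \<partial>M)" by simp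
      also have "\<dots> \<le> (\<integral>x. 2 powr a * (\<bar>u x\<bar> powr a + \<bar>v x\<bar> powr a) + (r / \<eta>) powr a * ?z x powr a \<partial>M)"
        using i by (intro integral_mono i3 key c) auto
      also have "\<dots> = 2 powr a * (J a u + J a v) + (r / \<eta>) powr a * J a (\<lambda>x. u x - v x)"
        using iu by (simp add: J_def)
      also have "\<dots> \<le> 2 powr a * (K * r powr a + K * r powr a) + (r / \<eta>) powr a * (K * \<eta> powr a)"
      proof -
        have "K * N (\<lambda>x. u x - v x) powr a \<le> K * \<eta> powr a"
          using K(1) \<eta> a by (intro mult_left_mono powr_mono2) auto
        with K(2)[OF H'] have "J a (\<lambda>x. u x - v x) \<le> K * \<eta> powr a" by (rule order_trans)
        then show ?thesis using Jr by (intro add_mono mult_left_mono) auto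
      qed
      also have "(r / \<eta>) powr a * (K * \<eta> powr a) = K * r powr a"
        using r \<eta> by (simp add: powr_divide)
      finally have "(r / \<eta>) powr b * ?I \<le> C0" by (simp add: C0_def)
      then show ?thesis using r \<eta> by (simp add: C_def powr_divide field_simps)
    qed
    show "?I \<le> C * N (\<lambda>x. u x - v x) powr b"
    proof (rule LIMSEQ_le_const)
      have "(\<lambda>n. N (\<lambda>x. u x - v x) + 1 / real (Suc n)) \<longlonglongrightarrow> N (\<lambda>x. u x - v x) + 0"
        using LIMSEQ_Suc[OF lim_1_over_n[where 'a=real]] by (intro tendsto_add tendsto_const)
      then show "(\<lambda>n. C * (N (\<lambda>x. u x - v x) + 1 / real (Suc n)) powr b) \<longlonglongrightarrow> C * N (\<lambda>x. u x - v x) powr b"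
        using ab by (intro tendsto_mult tendsto_const tendsto_powr') auto
      show "\<exists>n0. \<forall>n\<ge>n0. ?I \<le> C * (N (\<lambda>x. u x - v x) + 1 / real (Suc n)) powr b"
        by (intro exI allI impI main) (auto simp: add_nonneg_pos)
    qed
  qed
qed

lemma mid_X: "u \<in> X r \<Longrightarrow> v \<in> X r \<Longrightarrow> (\<lambda>x. (1/2) * u x + (1/2) * v x) \<in> X r"
  using H10_norm_lincomb[of u v "1/2" "1/2"] H10_lincomb(1)[of u v "1/2" "1/2"] by (auto simp: X_def)

lemma J_Lipschitz:
  assumes a: "1 \<le> a" "a \<le> s" and r: "0 < r"
  shows "\<exists>C\<ge>0. \<forall>u\<in>X r. \<forall>v\<in>X r. \<bar>J a u - J a v\<bar> \<le> C * N (\<lambda>x. u x - v x)"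
proof -
  obtain C where C: "C \<ge> 0" and CI: "\<And>u v. u \<in> X r \<Longrightarrow> v \<in> X r \<Longrightarrow>
      integrable M (\<lambda>x. (\<bar>u x\<bar> + \<bar>v x\<bar>) powr (a - 1) * \<bar>u x - v x\<bar> powr 1) \<and>
      (\<integral>x. (\<bar>u x\<bar> + \<bar>v x\<bar>) powr (a - 1) * \<bar>u x - v x\<bar> powr 1 \<partial>M) \<le> C * N (\<lambda>x. u x - v x) powr 1"
    using mixed_bound[of 1 a r] a r by auto
  have "\<bar>J a u - J a v\<bar> \<le> (a * C) * N (\<lambda>x. u x - v x)" if X: "u \<in> X r" "v \<in> X r" for u v
  proof -
    have iu: "integrable M (\<lambda>x. \<bar>u x\<bar> powr a)" "integrable M (\<lambda>x. \<bar>v x\<bar> powr a)"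
      using integrable_powr(1)[OF X_H10[OF X(1)], of a] integrable_powr(1)[OF X_H10[OF X(2)], of a] a by auto
    note CI' = CI[OF X, simplified]
    have "\<bar>J a u - J a v\<bar> = \<bar>\<integral>x. \<bar>u x\<bar> powr a - \<bar>v x\<bar> powr a \<partial>M\<bar>" using iu by (simp add: J_def)
    also have "\<dots> \<le> (\<integral>x. \<bar>\<bar>u x\<bar> powr a - \<bar>v x\<bar> powr a\<bar> \<partial>M)" by (rule integral_abs_bound)
    also have "\<dots> \<le> (\<integral>x. a * ((\<bar>u x\<bar> + \<bar>v x\<bar>) powr (a - 1) * \<bar>u x - v x\<bar>) \<partial>M)"
      using iu CI' abs_powr_diff_le[OF a(1)] by (intro integral_mono) (auto simp: mult.assoc)
    also have "\<dots> \<le> a * (C * N (\<lambda>x. u x - v x))"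
      using CI' a by (subst integral_mult_right_zero) (intro mult_left_mono, auto)
    finally show ?thesis by (simp add: mult.assoc)
  qed
  then show ?thesis using C a by (intro exI[of _ "a * C"]) auto
qed

text \<open>Second differences of J are quadratic in the distance on a ball, even at the critical
  exponent. A small multiple of J therefore cannot destroy the convexity of the squared
  norm.\<close>

lemma J_midpoint:
  assumes a: "2 \<le> a" "a \<le> s" and r: "0 < r"
  shows "\<exists>C\<ge>0. \<forall>u\<in>X r. \<forall>v\<in>X r. \<bar>J a u + J a v - 2 * J a (\<lambda>x. (1/2) * u x + (1/2) * v x)\<bar> \<le> C * (N (\<lambda>x. u x - v x))\<^sup>2"
proof -
  obtain C where C: "C \<ge> 0" and CI: "\<And>u v. u \<in> X r \<Longrightarrow> v \<in> X r \<Longrightarrow>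
      integrable M (\<lambda>x. (\<bar>u x\<bar> + \<bar>v x\<bar>) powr (a - 2) * \<bar>u x - v x\<bar> powr 2) \<and>
      (\<integral>x. (\<bar>u x\<bar> + \<bar>v x\<bar>) powr (a - 2) * \<bar>u x - v x\<bar> powr 2 \<partial>M) \<le> C * N (\<lambda>x. u x - v x) powr 2"
    using mixed_bound[of 2 a r] a r by auto
  have p2: "t powr 2 = t\<^sup>2" if "0 \<le> t" for t :: real using that by simp
  have "\<bar>J a u + J a v - 2 * J a (\<lambda>x. (1/2) * u x + (1/2) * v x)\<bar> \<le> (a\<^sup>2 * C) * (N (\<lambda>x. u x - v x))\<^sup>2"
    if X: "u \<in> X r" "v \<in> X r" for u v
  proof -
    let ?m = "\<lambda>x. (1/2) * u x + (1/2) * v x"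
    have iu: "integrable M (\<lambda>x. \<bar>u x\<bar> powr a)" "integrable M (\<lambda>x. \<bar>v x\<bar> powr a)" "integrable M (\<lambda>x. \<bar>?m x\<bar> powr a)"
      using integrable_powr(1)[OF X_H10[OF X(1)], of a] integrable_powr(1)[OF X_H10[OF X(2)], of a]
        integrable_powr(1)[OF X_H10[OF mid_X[OF X]], of a] a by auto
    have CI': "integrable M (\<lambda>x. (\<bar>u x\<bar> + \<bar>v x\<bar>) powr (a - 2) * \<bar>u x - v x\<bar>\<^sup>2)"
      "(\<integral>x. (\<bar>u x\<bar> + \<bar>v x\<bar>) powr (a - 2) * \<bar>u x - v x\<bar>\<^sup>2 \<partial>M) \<le> C * (N (\<lambda>x. u x - v x))\<^sup>2"
      using CI[OF X] unfolding p2[OF abs_ge_zero] p2[OF H10_norm_nonneg] by auto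
    have "\<bar>J a u + J a v - 2 * J a ?m\<bar> = \<bar>\<integral>x. \<bar>u x\<bar> powr a + \<bar>v x\<bar> powr a - 2 * \<bar>?m x\<bar> powr a \<partial>M\<bar>"
      using iu by (simp add: J_def)
    also have "\<dots> \<le> (\<integral>x. \<bar>\<bar>u x\<bar> powr a + \<bar>v x\<bar> powr a - 2 * \<bar>?m x\<bar> powr a\<bar> \<partial>M)" by (rule integral_abs_bound)
    also have "\<dots> \<le> (\<integral>x. a\<^sup>2 * ((\<bar>u x\<bar> + \<bar>v x\<bar>) powr (a - 2) * \<bar>u x - v x\<bar>\<^sup>2) \<partial>M)"
    proof (rule integral_mono)
      show "integrable M (\<lambda>x. \<bar>\<bar>u x\<bar> powr a + \<bar>v x\<bar> powr a - 2 * \<bar>?m x\<bar> powr a\<bar>)"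
        using iu by (intro integrable_abs Bochner_Integration.integrable_diff Bochner_Integration.integrable_add integrable_mult_right)
      show "integrable M (\<lambda>x. a\<^sup>2 * ((\<bar>u x\<bar> + \<bar>v x\<bar>) powr (a - 2) * \<bar>u x - v x\<bar>\<^sup>2))"
        by (rule integrable_mult_right[OF CI'(1)])
      show "\<bar>\<bar>u x\<bar> powr a + \<bar>v x\<bar> powr a - 2 * \<bar>?m x\<bar> powr a\<bar> \<le> a\<^sup>2 * ((\<bar>u x\<bar> + \<bar>v x\<bar>) powr (a - 2) * \<bar>u x - v x\<bar>\<^sup>2)" for x
      proof -
        have "?m x = (u x + v x) / 2" by simp
        then show ?thesis using abs_powr_midpoint[OF a(1), of "u x" "v x"] by (simp only:)
      qed
    qed
    also have "\<dots> \<le> a\<^sup>2 * (C * (N (\<lambda>x. u x - v x))\<^sup>2)"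
      unfolding integral_mult_right_zero using CI'(2) by (intro mult_left_mono) auto
    finally show ?thesis by (simp only: mult.assoc)
  qed
  then show ?thesis using C by (intro exI[of _ "a\<^sup>2 * C"]) auto
qed

text \<open>For an exponent below 2 there is no quadratic bound as in \<open>J_midpoint\<close>.
  Instead w powr (q - 1) <= 1 + w because q - 1 < 1, and Cauchy-Schwarz bounds the difference by the
  square norm, which is small along Rellich subsequences.\<close>

lemma J_L2_Lipschitz:
  assumes q: "1 < q" "q < 2" and r: "0 < r"
  shows "\<exists>C\<ge>0. \<forall>u\<in>X r. \<forall>v\<in>X r. \<bar>J q u - J q v\<bar> \<le> C * L2n M (\<lambda>x. u x - v x)"
proof -
  \<comment> \<open>Bounds the norm of 1 + |u| + |v|: the Poincare inequality contributes 2 rad r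
    for each of the two functions.\<close>
  define A where "A = L2n M (\<lambda>_::'a. 1::real) + 4 * rad * r"
  have "\<bar>J q u - J q v\<bar> \<le> (2 * A) * L2n M (\<lambda>x. u x - v x)" if X: "u \<in> X r" "v \<in> X r" for u v
  proof -
    have H: "u \<in> H10 \<Omega>" "v \<in> H10 \<Omega>" "N u \<le> r" "N v \<le> r" using X by (auto simp: X_def)
    have iu: "integrable M (\<lambda>x. \<bar>u x\<bar> powr q)" "integrable M (\<lambda>x. \<bar>v x\<bar> powr q)"
      using integrable_powr(1)[OF H(1), of q] integrable_powr(1)[OF H(2), of q] q s_gt by auto
    have abs_sq: "sq_integrable M (\<lambda>x. \<bar>f x\<bar>)" "L2n M (\<lambda>x. \<bar>f x\<bar>) = L2n M f" if "sq_integrable M f" for f :: "'a \<Rightarrow> real"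
      using that by (auto simp: sq_integrable_def L2n_def)
    have s1: "sq_integrable M (\<lambda>_. 1::real)" using integrable_const_M[of 1] by (simp add: sq_integrable_def)
    have su: "sq_integrable M u" "sq_integrable M v" using H H10_D(1) by auto
    note a1 = sq_integrable_add[OF abs_sq(1)[OF su(1)] abs_sq(1)[OF su(2)]]
    note a2 = sq_integrable_add[OF s1 a1(1)]
    note d = sq_integrable_diff(1)[OF su]
    have p: "L2n M f \<le> 2 * rad * r" if "f \<in> H10 \<Omega>" "N f \<le> r" for f
      by (rule order_trans[OF Poincare[OF that(1)]], rule mult_left_mono[OF that(2)]) (use rad(1) in simp)
    have A: "L2n M (\<lambda>x. 1 + (\<bar>u x\<bar> + \<bar>v x\<bar>)) \<le> A"
      using a2(2) a1(2) p[OF H(1,3)] p[OF H(2,4)] by (simp add: A_def abs_sq su)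
    note I = sq_integrable_inner(3,4)[OF a2(1) d]
    have ptw: "\<bar>\<bar>x\<bar> powr q - \<bar>y\<bar> powr q\<bar> \<le> 2 * (norm (1 + (\<bar>x\<bar> + \<bar>y\<bar>)) * norm (x - y))" for x y :: real
    proof -
      let ?w = "\<bar>x\<bar> + \<bar>y\<bar>"
      have "?w powr (q - 1) \<le> 1 + ?w"
      proof (cases "?w \<le> 1")
        case True
        then have "?w powr (q - 1) \<le> 1 powr (q - 1)" using q by (intro powr_mono2) auto
        then show ?thesis by (simp; linarith)
      next
        case False
        then have "?w powr (q - 1) \<le> ?w powr 1" using q by (intro powr_mono) auto
        then show ?thesis using False by simp
      qed
      then have "q * ?w powr (q - 1) \<le> 2 * (1 + ?w)" using q by (intro mult_mono) auto
      then have "q * ?w powr (q - 1) * \<bar>x - y\<bar> \<le> 2 * (1 + ?w) * \<bar>x - y\<bar>" by (rule mult_right_mono) simp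
      with abs_powr_diff_le[of q x y] q have "\<bar>\<bar>x\<bar> powr q - \<bar>y\<bar> powr q\<bar> \<le> 2 * (1 + ?w) * \<bar>x - y\<bar>"
        by (meson less_imp_le order_trans)
      moreover have "norm (1 + ?w) = 1 + ?w" by simp
      ultimately show ?thesis by (simp only: real_norm_def mult.assoc)
    qed
    have "\<bar>J q u - J q v\<bar> = \<bar>\<integral>x. \<bar>u x\<bar> powr q - \<bar>v x\<bar> powr q \<partial>M\<bar>" using iu by (simp add: J_def)
    also have "\<dots> \<le> (\<integral>x. \<bar>\<bar>u x\<bar> powr q - \<bar>v x\<bar> powr q\<bar> \<partial>M)" by (rule integral_abs_bound)
    also have "\<dots> \<le> (\<integral>x. 2 * (norm (1 + (\<bar>u x\<bar> + \<bar>v x\<bar>)) * norm (u x - v x)) \<partial>M)"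
      using iu by (intro integral_mono ptw integrable_mult_right[OF I(1)] integrable_abs Bochner_Integration.integrable_diff)
    also have "\<dots> \<le> 2 * (L2n M (\<lambda>x. 1 + (\<bar>u x\<bar> + \<bar>v x\<bar>)) * L2n M (\<lambda>x. u x - v x))"
      unfolding integral_mult_right_zero using I(2) by (intro mult_left_mono) auto
    also have "\<dots> \<le> 2 * (A * L2n M (\<lambda>x. u x - v x))"
      using A by (intro mult_left_mono mult_right_mono) auto
    finally show ?thesis by (simp only: mult.assoc)
  qed
  moreover have "0 \<le> 2 * A" using rad(1) r by (simp add: A_def)
  ultimately show ?thesis by blast
qed

text \<open>Dominated convergence of the difference quotients, bounded through
  \<open>abs_powr_diff_le\<close> by a multiple of (|u| + |v|) powr a. Positive increments 1 / (n +
  1) are enough, since criticality is later deduced by testing both v and -v.\<close>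

lemma J_derivative:
  assumes a: "1 < a" "a \<le> s" and u: "u \<in> H10 \<Omega>" "v \<in> H10 \<Omega>"
  shows "integrable M (\<lambda>x. signed_pow a (u x) * v x)"
    and "(\<lambda>n. (J a (\<lambda>x. u x + (1 / real (Suc n)) * v x) - J a u) * real (Suc n)) \<longlonglongrightarrow> a * (\<integral>x. signed_pow a (u x) * v x \<partial>M)"
proof -
  have [measurable]: "u \<in> borel_measurable M" "v \<in> borel_measurable M" using u by (auto intro: H10_measurable)
  have iu: "integrable M (\<lambda>x. \<bar>f x\<bar> powr a)" if "f \<in> H10 \<Omega>" for f
    using integrable_powr(1)[OF that, of a] a by auto
  let ?W = "\<lambda>x. \<bar>u x\<bar> + \<bar>v x\<bar>"
  have pw: "?W x powr a \<le> 2 powr a * (\<bar>u x\<bar> powr a + \<bar>v x\<bar> powr a)" for x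
    using a by (intro add_powr_le) auto
  have iW: "integrable M (\<lambda>x. ?W x powr a)"
    by (rule Bochner_Integration.integrable_bound[of _ "\<lambda>x. 2 powr a * (\<bar>u x\<bar> powr a + \<bar>v x\<bar> powr a)"])
       (use iu u pw in auto)
  define t where "t n = 1 / real (Suc n)" for n
  have t: "0 < t n" "t n \<le> 1" "1 / t n = real (Suc n)" for n by (auto simp: t_def)
  define Q where "Q n x = (\<bar>u x + t n * v x\<bar> powr a - \<bar>u x\<bar> powr a) * real (Suc n)" for n x
  have bd: "\<bar>Q n x\<bar> \<le> a * (2 powr a * ?W x powr a)" for n x
  proof -
    have w: "\<bar>u x + t n * v x\<bar> + \<bar>u x\<bar> \<le> 2 * ?W x"
    proof -
      have "\<bar>t n * v x\<bar> \<le> \<bar>v x\<bar>" using t[of n] by (simp add: abs_mult mult_left_le_one_le)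
      from order_trans[OF abs_triangle_ineq add_left_mono[OF this]]
      have "\<bar>u x + t n * v x\<bar> \<le> \<bar>u x\<bar> + \<bar>v x\<bar>" .
      then show ?thesis using abs_ge_zero[of "v x"] by argo
    qed
    have "\<bar>Q n x\<bar> \<le> (a * (\<bar>u x + t n * v x\<bar> + \<bar>u x\<bar>) powr (a - 1) * \<bar>t n * v x\<bar>) * real (Suc n)"
      unfolding Q_def abs_mult[of _ "real (Suc n)"]
      using abs_powr_diff_le[of a "u x + t n * v x" "u x"] a by (intro mult_mono) auto
    also have "\<dots> = a * ((\<bar>u x + t n * v x\<bar> + \<bar>u x\<bar>) powr (a - 1) * \<bar>v x\<bar>)"
      using t(1)[of n] by (simp add: t_def abs_mult)
    also have "\<dots> \<le> a * ((2 * ?W x) powr (a - 1) * (2 * ?W x))"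
      using w a by (intro mult_left_mono mult_mono powr_mono2) auto
    also have "(2 * ?W x) powr (a - 1) * (2 * ?W x) = (2 * ?W x) powr a"
      using powr_add[of "2 * ?W x" "a - 1" 1] by (cases "?W x = 0") auto
    also have "\<dots> = 2 powr a * ?W x powr a" by (rule powr_mult)
    finally show ?thesis .
  qed
  have lim: "(\<lambda>n. Q n x) \<longlonglongrightarrow> a * (signed_pow a (u x) * v x)" for x
  proof -
    have "((\<lambda>h. \<bar>u x + h * v x\<bar> powr a) has_real_derivative (a * signed_pow a (u x + 0 * v x)) * v x) (at 0)"
      by (rule DERIV_chain2[OF DERIV_abs_powr[OF a(1)]]) (auto intro!: derivative_eq_intros)
    then have "((\<lambda>h. (\<bar>u x + h * v x\<bar> powr a - \<bar>u x\<bar> powr a) / h) \<longlongrightarrow> a * (signed_pow a (u x) * v x)) (at 0)"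
      by (simp add: has_field_derivative_iff mult.assoc)
    moreover have "filterlim t (at 0) sequentially"
      using LIMSEQ_Suc[OF lim_1_over_n[where 'a=real]] by (auto simp: filterlim_at t_def[abs_def])
    ultimately have "(\<lambda>n. (\<bar>u x + t n * v x\<bar> powr a - \<bar>u x\<bar> powr a) / t n) \<longlonglongrightarrow> a * (signed_pow a (u x) * v x)"
      by (rule filterlim_compose)
    then show ?thesis by (simp add: Q_def t_def)
  qed
  have iB: "integrable M (\<lambda>x. a * (2 powr a * ?W x powr a))" using iW by auto
  have mQ: "Q n \<in> borel_measurable M" for n unfolding Q_def[abs_def] by measurable
  have mS: "(\<lambda>x. a * (signed_pow a (u x) * v x)) \<in> borel_measurable M" by measurable
  have AEl: "AE x in M. (\<lambda>n. Q n x) \<longlonglongrightarrow> a * (signed_pow a (u x) * v x)" using lim by (intro AE_I2)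
  have AEb: "AE x in M. norm (Q n x) \<le> a * (2 powr a * ?W x powr a)" for n using bd by (intro AE_I2) simp
  note dc1 = integrable_dominated_convergence[OF mS mQ iB AEl AEb]
    and dc2 = integral_dominated_convergence[OF mS mQ iB AEl AEb]
  show "integrable M (\<lambda>x. signed_pow a (u x) * v x)"
    using integrable_mult_right[OF dc1, of "1 / a"] a by simp
  have "(\<integral>x. Q n x \<partial>M) = (J a (\<lambda>x. u x + t n * v x) - J a u) * real (Suc n)" for n
  proof -
    have "(\<lambda>x. u x + t n * v x) \<in> H10 \<Omega>" using H10_lincomb(1)[OF u, of 1 "t n"] by simp
    from iu[OF this] iu[OF u(1)] show ?thesis
      unfolding Q_def J_def by (subst integral_mult_left_zero) simp
  qed
  with dc2 show "(\<lambda>n. (J a (\<lambda>x. u x + (1 / real (Suc n)) * v x) - J a u) * real (Suc n)) \<longlonglongrightarrow> a * (\<integral>x. signed_pow a (u x) * v x \<partial>M)"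
    by (simp add: t_def)
qed

end

lemma divide_le_if_ge_1: "x / a \<le> y" if "x \<le> y" "0 \<le> y" "1 \<le> a" for x y a :: real
proof -
  have "x / a \<le> y / a" using that by (intro divide_right_mono) auto
  also have "\<dots> \<le> y / 1" using that by (intro frac_le) auto
  finally show ?thesis by simp
qed

section \<open>Inner product and dual space\<close>

context open_set
begin

lemma H10_inner_lincomb:
  assumes "u \<in> H10 \<Omega>" "v \<in> H10 \<Omega>" "w \<in> H10 \<Omega>"
  shows "H10_inner \<Omega> u (\<lambda>x. c * v x + d * w x) = c * H10_inner \<Omega> u v + d * H10_inner \<Omega> u w"
proof -
  note u = H10_D(2)[OF assms(1)] and v = H10_D(2)[OF assms(2)] and w = H10_D(2)[OF assms(3)]
  note vw = H10_lincomb[OF assms(2,3), of c d]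
  have "H10_inner \<Omega> u (\<lambda>x. c * v x + d * w x) = (\<integral>x. grad \<Omega> u x \<bullet> (c *\<^sub>R grad \<Omega> v x + d *\<^sub>R grad \<Omega> w x) \<partial>M)"
    unfolding H10_inner_def
  proof (rule integral_cong_AE)
    show "(\<lambda>x. grad \<Omega> u x \<bullet> grad \<Omega> (\<lambda>x. c * v x + d * w x) x) \<in> borel_measurable M"
      by (rule borel_measurable_integrable[OF sq_integrable_inner(1)[OF u H10_D(2)[OF vw(1)]]])
    show "(\<lambda>x. grad \<Omega> u x \<bullet> (c *\<^sub>R grad \<Omega> v x + d *\<^sub>R grad \<Omega> w x)) \<in> borel_measurable M"
      by (rule borel_measurable_integrable[OF sq_integrable_inner(1)[OF u sq_integrable_lincomb(1)[OF v w]]])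
    show "AE x in M. grad \<Omega> u x \<bullet> grad \<Omega> (\<lambda>x. c * v x + d * w x) x = grad \<Omega> u x \<bullet> (c *\<^sub>R grad \<Omega> v x + d *\<^sub>R grad \<Omega> w x)"
      using vw(2) by eventually_elim simp
  qed
  also have "\<dots> = c * H10_inner \<Omega> u v + d * H10_inner \<Omega> u w"
    using sq_integrable_inner(1)[OF u v] sq_integrable_inner(1)[OF u w]
    by (simp add: inner_add_right H10_inner_def)
  finally show ?thesis .
qed

lemma H10_Cauchy_Schwarz: "u \<in> H10 \<Omega> \<Longrightarrow> v \<in> H10 \<Omega> \<Longrightarrow> \<bar>H10_inner \<Omega> u v\<bar> \<le> H10_norm \<Omega> u * H10_norm \<Omega> v"
  unfolding H10_inner_def H10_norm_eq by (intro sq_integrable_inner(2) H10_D)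

lemma H10_inner_self: "H10_inner \<Omega> u u = (H10_norm \<Omega> u)\<^sup>2"
  unfolding H10_norm_eq L2n_power2 H10_inner_def by (simp add: power2_norm_eq_inner)

lemma H10_norm_add_power2:
  assumes "u \<in> H10 \<Omega>" "v \<in> H10 \<Omega>"
  shows "(H10_norm \<Omega> (\<lambda>x. u x + t * v x))\<^sup>2 = (H10_norm \<Omega> u)\<^sup>2 + 2 * t * H10_inner \<Omega> u v + t\<^sup>2 * (H10_norm \<Omega> v)\<^sup>2"
proof -
  note u = H10_D(2)[OF assms(1)] and v = H10_D(2)[OF assms(2)]
  have e: "(norm (a + t *\<^sub>R b))\<^sup>2 = (norm a)\<^sup>2 + 2 * t * (a \<bullet> b) + t\<^sup>2 * (norm b)\<^sup>2" for a b :: 'a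
    unfolding power2_norm_eq_inner by (simp add: inner_add_left inner_add_right inner_commute power2_eq_square)
  show ?thesis
    using H10_norm_lincomb_eq[OF assms, of 1 t] u v sq_integrable_inner(1)[OF u v]
    unfolding H10_norm_eq H10_inner_def by (simp add: L2n_power2 e sq_integrable_def)
qed

lemma Hm1_lincomb_arg:
  assumes "\<phi> \<in> Hm1 \<Omega>" "u \<in> H10 \<Omega>" "v \<in> H10 \<Omega>"
  shows "\<phi> (\<lambda>x. c * u x + d * v x) = c * \<phi> u + d * \<phi> v"
proof -
  have "\<phi> (\<lambda>x. c * u x + d * v x) = \<phi> (\<lambda>x. c * u x) + \<phi> (\<lambda>x. d * v x)"
    using assms H10_scale[OF assms(2), of c] H10_scale[OF assms(3), of d] by (simp add: Hm1_def)
  then show ?thesis using assms unfolding Hm1_def by simp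
qed

text \<open>The supremum defining \<open>Hm1_norm\<close> is meaningful because boundedness of the
  functional bounds the set above. Normalizing u proves the claim, and for norm 0 the same
  boundedness gives the value 0.\<close>

lemma Hm1_bound:
  assumes "\<phi> \<in> Hm1 \<Omega>" "u \<in> H10 \<Omega>"
  shows "\<bar>\<phi> u\<bar> \<le> Hm1_norm \<Omega> \<phi> * H10_norm \<Omega> u"
proof -
  obtain C where C: "\<And>u. u \<in> H10 \<Omega> \<Longrightarrow> \<bar>\<phi> u\<bar> \<le> C * H10_norm \<Omega> u" using assms(1) unfolding Hm1_def by blast
  show ?thesis
  proof (cases "H10_norm \<Omega> u = 0")
    case True
    then show ?thesis using C[OF assms(2)] by simp
  next
    case False
    then have p: "H10_norm \<Omega> u > 0" using H10_norm_nonneg[of u] by linarith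
    let ?S = "{v \<in> H10 \<Omega>. H10_norm \<Omega> v \<le> 1}"
    have bdd: "bdd_above ((\<lambda>v. \<bar>\<phi> v\<bar>) ` ?S)"
    proof (rule bdd_aboveI2)
      fix v assume v: "v \<in> ?S"
      have "\<bar>\<phi> v\<bar> \<le> \<bar>C\<bar> * H10_norm \<Omega> v" using C[of v] v by (auto intro: order_trans[OF _ mult_right_mono])
      also have "\<dots> \<le> \<bar>C\<bar> * 1" using v by (intro mult_left_mono) auto
      finally show "\<bar>\<phi> v\<bar> \<le> \<bar>C\<bar>" by simp
    qed
    let ?v = "\<lambda>x. (1 / H10_norm \<Omega> u) * u x"
    have "H10_norm \<Omega> ?v = \<bar>1 / H10_norm \<Omega> u\<bar> * H10_norm \<Omega> u" by (rule H10_norm_scale[OF assms(2)])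
    also have "\<dots> = 1" using p by simp
    finally have "H10_norm \<Omega> ?v = 1" .
    then have v: "?v \<in> ?S" using H10_scale[OF assms(2), of "1 / H10_norm \<Omega> u"]
      by (simp only: mem_Collect_eq order_refl simp_thms)
    have "\<bar>\<phi> ?v\<bar> \<le> Hm1_norm \<Omega> \<phi>" unfolding Hm1_norm_def by (rule cSUP_upper[OF v bdd])
    moreover have "\<phi> ?v = (1 / H10_norm \<Omega> u) * \<phi> u"
    proof -
      have "\<forall>u\<in>H10 \<Omega>. \<forall>c. \<phi> (\<lambda>x. c * u x) = c * \<phi> u" using assms(1) by (simp add: Hm1_def)
      from bspec[OF this assms(2)] show ?thesis by (rule spec)
    qed
    ultimately have "\<bar>(1 / H10_norm \<Omega> u) * \<phi> u\<bar> \<le> Hm1_norm \<Omega> \<phi>" by simp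
    then show ?thesis using p by (simp add: abs_mult field_simps)
  qed
qed

lemma Hm1_norm_le:
  assumes "\<And>u. u \<in> H10 \<Omega> \<Longrightarrow> \<bar>\<phi> u\<bar> \<le> c * H10_norm \<Omega> u" "0 \<le> c"
  shows "Hm1_norm \<Omega> \<phi> \<le> c"
  unfolding Hm1_norm_def
proof (rule cSUP_least)
  have "H10_norm \<Omega> (\<lambda>_. 0) = 0" using H10_norm_scale[OF H10_zero, of 0] by simp
  then show "{v \<in> H10 \<Omega>. H10_norm \<Omega> v \<le> 1} \<noteq> {}" using H10_zero by force
  fix v assume v: "v \<in> {v \<in> H10 \<Omega>. H10_norm \<Omega> v \<le> 1}"
  then have "\<bar>\<phi> v\<bar> \<le> c * H10_norm \<Omega> v" using assms(1) by simp
  also have "\<dots> \<le> c * 1" using v assms(2) by (intro mult_left_mono) auto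
  finally show "\<bar>\<phi> v\<bar> \<le> c" by simp
qed

lemma Hm1_lincomb:
  assumes "\<phi> \<in> Hm1 \<Omega>" "\<psi> \<in> Hm1 \<Omega>"
  shows "(\<lambda>v. c * \<phi> v + d * \<psi> v) \<in> Hm1 \<Omega>"
proof -
  have b: "\<bar>c * \<phi> u + d * \<psi> u\<bar> \<le> (\<bar>c\<bar> * Hm1_norm \<Omega> \<phi> + \<bar>d\<bar> * Hm1_norm \<Omega> \<psi>) * H10_norm \<Omega> u" if "u \<in> H10 \<Omega>" for u
  proof -
    have "\<bar>c * \<phi> u + d * \<psi> u\<bar> \<le> \<bar>c\<bar> * \<bar>\<phi> u\<bar> + \<bar>d\<bar> * \<bar>\<psi> u\<bar>"
      using abs_triangle_ineq[of "c * \<phi> u" "d * \<psi> u"] by (simp add: abs_mult)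
    also have "\<dots> \<le> \<bar>c\<bar> * (Hm1_norm \<Omega> \<phi> * H10_norm \<Omega> u) + \<bar>d\<bar> * (Hm1_norm \<Omega> \<psi> * H10_norm \<Omega> u)"
      using Hm1_bound[OF assms(1) that] Hm1_bound[OF assms(2) that] by (intro add_mono mult_left_mono) auto
    finally show ?thesis by (simp add: algebra_simps)
  qed
  have "\<phi> (\<lambda>x. u x + v x) = \<phi> u + \<phi> v" "\<psi> (\<lambda>x. u x + v x) = \<psi> u + \<psi> v" if "u \<in> H10 \<Omega>" "v \<in> H10 \<Omega>" for u v
    using assms that unfolding Hm1_def by auto
  moreover have "\<phi> (\<lambda>x. t * u x) = t * \<phi> u" "\<psi> (\<lambda>x. t * u x) = t * \<psi> u" if "u \<in> H10 \<Omega>" for u t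
    using assms that unfolding Hm1_def by auto
  moreover have "\<phi> u = 0" "\<psi> u = 0" if "u \<notin> H10 \<Omega>" for u
    using assms that unfolding Hm1_def by auto
  moreover have "\<exists>C. \<forall>u\<in>H10 \<Omega>. \<bar>c * \<phi> u + d * \<psi> u\<bar> \<le> C * H10_norm \<Omega> u" using b by blast
  ultimately show ?thesis unfolding Hm1_def by (simp add: algebra_simps)
qed

lemma Hm1_zero: "(\<lambda>_. 0) \<in> Hm1 \<Omega>"
  unfolding Hm1_def by (auto intro: exI[of _ 0])

text \<open>Functionals given by an inner product, cut off to 0 outside the space as membership in
  \<open>Hm1\<close> demands; they are approximated from \<open>S\<close> to find perturbations that
  are negative at a given u.\<close>

lemma Hm1_inner:
  assumes u: "u \<in> H10 \<Omega>"
  shows "(\<lambda>v. if v \<in> H10 \<Omega> then c * H10_inner \<Omega> u v else 0) \<in> Hm1 \<Omega>"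
proof -
  have "\<bar>c * H10_inner \<Omega> u v\<bar> \<le> (\<bar>c\<bar> * H10_norm \<Omega> u) * H10_norm \<Omega> v" if "v \<in> H10 \<Omega>" for v
    using mult_left_mono[OF H10_Cauchy_Schwarz[OF u that], of "\<bar>c\<bar>"] by (simp add: abs_mult mult.assoc)
  then have "\<exists>C. \<forall>v\<in>H10 \<Omega>. \<bar>c * H10_inner \<Omega> u v\<bar> \<le> C * H10_norm \<Omega> v" by blast
  moreover have "H10_inner \<Omega> u (\<lambda>x. v x + w x) = H10_inner \<Omega> u v + H10_inner \<Omega> u w" if "v \<in> H10 \<Omega>" "w \<in> H10 \<Omega>" for v w
    using H10_inner_lincomb[OF u that, of 1 1] by simp
  moreover have "H10_inner \<Omega> u (\<lambda>x. t * v x) = t * H10_inner \<Omega> u v" if "v \<in> H10 \<Omega>" for v t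
    using H10_inner_lincomb[OF u that that, of t 0] by simp
  ultimately show ?thesis unfolding Hm1_def using H10_add H10_scale by (simp add: algebra_simps)
qed

end

section \<open>Estimates, minimizing sequences and critical points of the energy\<close>

context sobolev_set
begin

text \<open>Critical points of \<open>energy p q l \<mu> \<nu> u - l * \<phi> u\<close> are the weak
  solutions. The linear term is kept apart because the remaining part is even in u.\<close>

definition energy :: "real \<Rightarrow> real \<Rightarrow> real \<Rightarrow> real \<Rightarrow> real \<Rightarrow> ('a \<Rightarrow> real) \<Rightarrow> real" where
  "energy p q l \<mu> \<nu> u = (N u)\<^sup>2 / 2 - l * (J s u / s + \<nu> * (J q u / q) + \<mu> * (J p u / p))"

lemma energy_minus: "u \<in> H10 \<Omega> \<Longrightarrow> energy p q l \<mu> \<nu> (\<lambda>x. - u x) = energy p q l \<mu> \<nu> u"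
  using H10_norm_scale[of u "-1"] by (simp add: energy_def J_def)

lemma J_bounded:
  assumes "0 < a" "a \<le> s" "0 < r"
  shows "\<exists>B\<ge>0. \<forall>u\<in>X r. J a u \<le> B"
proof -
  obtain K where K: "K \<ge> 0" "\<And>u. u \<in> H10 \<Omega> \<Longrightarrow> J a u \<le> K * N u powr a" using J_growth[OF assms(1,2)] by blast
  have "J a u \<le> K * r powr a" if "u \<in> X r" for u
    using K(2)[OF X_H10[OF that]] mult_left_mono[OF powr_mono2[of a "N u" r] K(1)] X_N[OF that] assms
    by (auto intro: order_trans)
  then show ?thesis using K(1) by (intro exI[of _ "K * r powr a"]) auto
qed

text \<open>The four conclusions serve, in order, for compactness of minimizing sequences, for
  keeping minimizers off the sphere (on the ball a linear perturbation is at most l r^2), for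
  finiteness of the infimum, and for continuity. One threshold works for all admissible l and
  \<mu>.\<close>

lemma energy_estimates:
  assumes p: "2 \<le> p" "p \<le> s" and q: "1 < q" "q < 2" and r: "0 < r" and \<nu>: "0 < \<nu>"
  shows "\<exists>l1>0. \<forall>l \<mu>. 0 < l \<and> l < l1 \<and> \<bar>\<mu>\<bar> < l1 \<longrightarrow>
    (\<exists>L\<ge>0. \<forall>u\<in>X r. \<forall>v\<in>X r. energy p q l \<mu> \<nu> (\<lambda>x. (1/2) * u x + (1/2) * v x)
       \<le> (energy p q l \<mu> \<nu> u + energy p q l \<mu> \<nu> v) / 2 - (N (\<lambda>x. u x - v x))\<^sup>2 / 16 + L * L2n M (\<lambda>x. u x - v x)) \<and>
    (\<forall>u\<in>X r. N u = r \<longrightarrow> l * r\<^sup>2 < energy p q l \<mu> \<nu> u) \<and>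
    (\<exists>B. \<forall>u\<in>X r. B \<le> energy p q l \<mu> \<nu> u) \<and>
    (\<exists>C. \<forall>u\<in>X r. \<forall>v\<in>X r. \<bar>energy p q l \<mu> \<nu> u - energy p q l \<mu> \<nu> v\<bar> \<le> C * N (\<lambda>x. u x - v x))"
proof -
  have s: "2 < s" by (rule s_gt)
  have ss: "2 \<le> s" "1 \<le> s" "0 < s" "0 < p" "1 \<le> p" "0 < q" "1 \<le> q" "q \<le> s" using s p q by auto
  obtain Cs where Cs: "0 \<le> Cs" "\<And>u v. u \<in> X r \<Longrightarrow> v \<in> X r \<Longrightarrow> \<bar>J s u + J s v - 2 * J s (\<lambda>x. (1/2) * u x + (1/2) * v x)\<bar> \<le> Cs * (N (\<lambda>x. u x - v x))\<^sup>2"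
    using J_midpoint[OF ss(1) order_refl r] by blast
  obtain Cp where Cp: "0 \<le> Cp" "\<And>u v. u \<in> X r \<Longrightarrow> v \<in> X r \<Longrightarrow> \<bar>J p u + J p v - 2 * J p (\<lambda>x. (1/2) * u x + (1/2) * v x)\<bar> \<le> Cp * (N (\<lambda>x. u x - v x))\<^sup>2"
    using J_midpoint[OF p r] by blast
  obtain Cq where Cq: "0 \<le> Cq" "\<And>u v. u \<in> X r \<Longrightarrow> v \<in> X r \<Longrightarrow> \<bar>J q u - J q v\<bar> \<le> Cq * L2n M (\<lambda>x. u x - v x)"
    using J_L2_Lipschitz[OF q r] by blast
  obtain Bs where Bs: "0 \<le> Bs" "\<And>u. u \<in> X r \<Longrightarrow> J s u \<le> Bs" using J_bounded[OF ss(3) order_refl r] by blast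
  obtain Bp where Bp: "0 \<le> Bp" "\<And>u. u \<in> X r \<Longrightarrow> J p u \<le> Bp" using J_bounded[OF ss(4) p(2) r] by blast
  obtain Bq where Bq: "0 \<le> Bq" "\<And>u. u \<in> X r \<Longrightarrow> J q u \<le> Bq" using J_bounded[OF ss(6,8) r] by blast
  obtain Ls where Ls: "0 \<le> Ls" "\<And>u v. u \<in> X r \<Longrightarrow> v \<in> X r \<Longrightarrow> \<bar>J s u - J s v\<bar> \<le> Ls * N (\<lambda>x. u x - v x)"
    using J_Lipschitz[OF ss(2) order_refl r] by blast
  obtain Lp where Lp: "0 \<le> Lp" "\<And>u v. u \<in> X r \<Longrightarrow> v \<in> X r \<Longrightarrow> \<bar>J p u - J p v\<bar> \<le> Lp * N (\<lambda>x. u x - v x)"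
    using J_Lipschitz[OF ss(5) p(2) r] by blast
  obtain Lq where Lq: "0 \<le> Lq" "\<And>u v. u \<in> X r \<Longrightarrow> v \<in> X r \<Longrightarrow> \<bar>J q u - J q v\<bar> \<le> Lq * N (\<lambda>x. u x - v x)"
    using J_Lipschitz[OF ss(7,8) r] by blast
  define Bt where "Bt = Bs + \<nu> * Bq + Bp"
  have Bt: "0 \<le> Bt" using Bs Bp Bq \<nu> by (simp add: Bt_def)
  \<comment> \<open>The entry 1 gives |\<mu>| <= 1. The second gives l (Cs + Cp) <= 1/8, so the
    critical and the p-term use at most half of the convexity. The third gives l (Bt + r^2) <= r^2 /
    4, so that on the sphere r^2 / 2 exceeds the nonlinear terms by more than l r^2. The summands 1
    keep the denominators positive.\<close>
  define l1 where "l1 = min 1 (min (1 / (8 * (Cs + Cp + 1))) (r\<^sup>2 / (4 * (Bt + r\<^sup>2 + 1))))"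
  have d: "0 < Bt + r\<^sup>2 + 1" using Bt by (simp add: add_nonneg_pos)
  have "l1 > 0" using Cs(1) Cp(1) d r by (simp add: l1_def)
  moreover have
    "(\<exists>L\<ge>0. \<forall>u\<in>X r. \<forall>v\<in>X r. energy p q l \<mu> \<nu> (\<lambda>x. (1/2) * u x + (1/2) * v x)
       \<le> (energy p q l \<mu> \<nu> u + energy p q l \<mu> \<nu> v) / 2 - (N (\<lambda>x. u x - v x))\<^sup>2 / 16 + L * L2n M (\<lambda>x. u x - v x)) \<and>
    (\<forall>u\<in>X r. N u = r \<longrightarrow> l * r\<^sup>2 < energy p q l \<mu> \<nu> u) \<and>
    (\<exists>B. \<forall>u\<in>X r. B \<le> energy p q l \<mu> \<nu> u) \<and>
    (\<exists>C. \<forall>u\<in>X r. \<forall>v\<in>X r. \<bar>energy p q l \<mu> \<nu> u - energy p q l \<mu> \<nu> v\<bar> \<le> C * N (\<lambda>x. u x - v x))"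
    if l: "0 < l" "l < l1" "\<bar>\<mu>\<bar> < l1" for l \<mu>
  proof (intro conjI)
    have \<mu>: "\<bar>\<mu>\<bar> \<le> 1" using l by (simp add: l1_def)
    have lC: "l * (Cs + Cp) \<le> 1 / 8"
    proof -
      have "l * (8 * (Cs + Cp + 1)) \<le> 1" using l Cs(1) Cp(1) by (simp add: l1_def field_simps)
      then show ?thesis using l(1) by (simp add: algebra_simps)
    qed
    have lB: "l * (Bt + r\<^sup>2) \<le> r\<^sup>2 / 4"
    proof -
      have "l \<le> r\<^sup>2 / (4 * (Bt + r\<^sup>2 + 1))" using l by (simp add: l1_def)
      then have "l * (4 * (Bt + r\<^sup>2 + 1)) \<le> r\<^sup>2" using d by (simp add: pos_le_divide_eq)
      then show ?thesis using l(1) by (simp add: algebra_simps)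
    qed
    have nl: "\<bar>J s u / s + \<nu> * (J q u / q) + \<mu> * (J p u / p)\<bar> \<le> Bt" if u: "u \<in> X r" for u
    proof -
      have 1: "J s u / s \<le> Bs" "J q u / q \<le> Bq" "J p u / p \<le> Bp"
      proof -
        show "J s u / s \<le> Bs" by (rule divide_le_if_ge_1[OF Bs(2)[OF u] Bs(1)]) (use s in simp)
        show "J q u / q \<le> Bq" by (rule divide_le_if_ge_1[OF Bq(2)[OF u] Bq(1)]) (use q in simp)
        show "J p u / p \<le> Bp" by (rule divide_le_if_ge_1[OF Bp(2)[OF u] Bp(1)]) (use p in simp)
      qed
      have 2: "0 \<le> J s u / s" "0 \<le> J q u / q" "0 \<le> J p u / p" using J_nonneg s p q by auto
      have "\<bar>\<mu> * (J p u / p)\<bar> \<le> 1 * Bp" unfolding abs_mult using \<mu> 1 2 by (intro mult_mono) auto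
      moreover have "0 \<le> \<nu> * (J q u / q)" by (rule mult_nonneg_nonneg) (use 2 \<nu> in auto)
      moreover have "\<nu> * (J q u / q) \<le> \<nu> * Bq" by (rule mult_left_mono) (use 1 \<nu> in auto)
      ultimately show ?thesis unfolding Bt_def using 1(1) 2(1) by linarith
    qed
    have nl': "\<bar>l * (J s u / s + \<nu> * (J q u / q) + \<mu> * (J p u / p))\<bar> \<le> l * Bt" if "u \<in> X r" for u
      unfolding abs_mult using nl[OF that] l(1) by (simp add: mult_left_mono)
    show "\<forall>u\<in>X r. N u = r \<longrightarrow> l * r\<^sup>2 < energy p q l \<mu> \<nu> u"
    proof (intro ballI impI)
      fix u assume u: "u \<in> X r" "N u = r"
      have "0 < r\<^sup>2" using r by simp
      moreover have "l * Bt + l * r\<^sup>2 \<le> r\<^sup>2 / 4" using lB by (simp add: distrib_left)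
      ultimately show "l * r\<^sup>2 < energy p q l \<mu> \<nu> u" using nl'[OF u(1)] u(2) unfolding energy_def by (simp only: abs_le_iff) linarith
    qed
    show "\<exists>B. \<forall>u\<in>X r. B \<le> energy p q l \<mu> \<nu> u"
    proof (intro exI ballI)
      fix u assume u: "u \<in> X r"
      show "- (l * Bt) \<le> energy p q l \<mu> \<nu> u" using nl'[OF u] zero_le_power2[of "N u"] unfolding energy_def by linarith
    qed
    show "\<exists>C. \<forall>u\<in>X r. \<forall>v\<in>X r. \<bar>energy p q l \<mu> \<nu> u - energy p q l \<mu> \<nu> v\<bar> \<le> C * N (\<lambda>x. u x - v x)"
    proof (intro exI ballI)
      fix u v assume X: "u \<in> X r" "v \<in> X r"
      let ?d = "N (\<lambda>x. u x - v x)"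
      have H: "u \<in> H10 \<Omega>" "v \<in> H10 \<Omega>" using X X_H10 by auto
      have "(N u)\<^sup>2 / 2 - (N v)\<^sup>2 / 2 = (N u - N v) * ((N u + N v) / 2)"
        by (simp add: power2_eq_square field_simps)
      then have "\<bar>(N u)\<^sup>2 / 2 - (N v)\<^sup>2 / 2\<bar> = \<bar>N u - N v\<bar> * \<bar>(N u + N v) / 2\<bar>"
        by (simp only: abs_mult)
      also have "\<bar>(N u + N v) / 2\<bar> = (N u + N v) / 2" by (rule abs_of_nonneg) simp
      also have "\<bar>N u - N v\<bar> * ((N u + N v) / 2) \<le> ?d * r"
        using H10_norm_triangle(2)[OF H H(1)] X_N[OF X(1)] X_N[OF X(2)] by (intro mult_mono) auto
      finally have 1: "\<bar>(N u)\<^sup>2 / 2 - (N v)\<^sup>2 / 2\<bar> \<le> r * ?d" by (simp add: mult.commute)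
      have dv: "\<bar>l * (k * (J a u / a)) - l * (k * (J a v / a))\<bar> \<le> (l * (\<bar>k\<bar> * (La / a))) * ?d"
        if "\<bar>J a u - J a v\<bar> \<le> La * ?d" "0 < a" for a La k
      proof -
        have "\<bar>l * (k * (J a u / a)) - l * (k * (J a v / a))\<bar> = (l * (\<bar>k\<bar> / a)) * \<bar>J a u - J a v\<bar>"
        proof -
          have "l * (k * (J a u / a)) - l * (k * (J a v / a)) = (l * (k / a)) * (J a u - J a v)"
            by (simp add: algebra_simps)
          then show ?thesis using l(1) that(2) by (simp add: abs_mult)
        qed
        also have "\<dots> \<le> (l * (\<bar>k\<bar> / a)) * (La * ?d)" using that l(1) by (intro mult_left_mono) auto
        finally show ?thesis by (simp add: mult_ac)
      qed
      have aux: "\<bar>(a - (s1 + q1 + p1)) - (b - (s2 + q2 + p2))\<bar> \<le> \<bar>a - b\<bar> + \<bar>s1 - s2\<bar> + \<bar>q1 - q2\<bar> + \<bar>p1 - p2\<bar>"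
        for a b s1 s2 q1 q2 p1 p2 :: real by linarith
      have eu: "energy p q l \<mu> \<nu> u = (N u)\<^sup>2 / 2 - (l * (1 * (J s u / s)) + l * (\<nu> * (J q u / q)) + l * (\<mu> * (J p u / p)))" for u
        by (simp add: energy_def distrib_left)
      have "\<bar>energy p q l \<mu> \<nu> u - energy p q l \<mu> \<nu> v\<bar> \<le> \<bar>(N u)\<^sup>2 / 2 - (N v)\<^sup>2 / 2\<bar>
         + \<bar>l * (1 * (J s u / s)) - l * (1 * (J s v / s))\<bar>
         + \<bar>l * (\<nu> * (J q u / q)) - l * (\<nu> * (J q v / q))\<bar> + \<bar>l * (\<mu> * (J p u / p)) - l * (\<mu> * (J p v / p))\<bar>"
        unfolding eu by (rule aux)
      also have "\<dots> \<le> r * ?d + (l * (\<bar>1\<bar> * (Ls / s))) * ?d + (l * (\<bar>\<nu>\<bar> * (Lq / q))) * ?d + (l * (\<bar>\<mu>\<bar> * (Lp / p))) * ?d"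
        using Ls(2)[OF X] Lp(2)[OF X] Lq(2)[OF X] p q s by (intro add_mono 1 dv) auto
      finally show "\<bar>energy p q l \<mu> \<nu> u - energy p q l \<mu> \<nu> v\<bar> \<le> (r + l * (\<bar>1\<bar> * (Ls / s)) + l * (\<bar>\<nu>\<bar> * (Lq / q)) + l * (\<bar>\<mu>\<bar> * (Lp / p))) * ?d"
        by (simp only: distrib_right)
    qed
    show "\<exists>L\<ge>0. \<forall>u\<in>X r. \<forall>v\<in>X r. energy p q l \<mu> \<nu> (\<lambda>x. (1/2) * u x + (1/2) * v x)
       \<le> (energy p q l \<mu> \<nu> u + energy p q l \<mu> \<nu> v) / 2 - (N (\<lambda>x. u x - v x))\<^sup>2 / 16 + L * L2n M (\<lambda>x. u x - v x)"
    proof (intro exI[of _ "l * (\<nu> * Cq)"] conjI ballI)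
      show "0 \<le> l * (\<nu> * Cq)" using l \<nu> Cq by simp
      fix u v assume X: "u \<in> X r" "v \<in> X r"
      let ?d = "N (\<lambda>x. u x - v x)" and ?m = "\<lambda>x. (1/2) * u x + (1/2) * v x" and ?e = "L2n M (\<lambda>x. u x - v x)"
      have H: "u \<in> H10 \<Omega>" "v \<in> H10 \<Omega>" using X X_H10 by auto
      have "(\<lambda>x. ?m x - u x) = (\<lambda>x. (-(1/2)) *\<^sub>R (u x - v x))" by (rule ext) (simp add: field_simps)
      then have e1: "L2n M (\<lambda>x. ?m x - u x) = ?e / 2" using L2n_scaleR[of M "-(1/2)" "\<lambda>x. u x - v x"] by simp
      have "(\<lambda>x. ?m x - v x) = (\<lambda>x. (1/2) *\<^sub>R (u x - v x))" by (rule ext) (simp add: field_simps)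
      then have e2: "L2n M (\<lambda>x. ?m x - v x) = ?e / 2" using L2n_scaleR[of M "1/2" "\<lambda>x. u x - v x"] by simp
      have "(J q u + J q v) / 2 - J q ?m \<le> Cq * ?e"
        using Cq(2)[OF mid_X[OF X] X(1)] Cq(2)[OF mid_X[OF X] X(2)] unfolding e1 e2 abs_le_iff
        using mult_nonneg_nonneg[OF Cq(1) L2n_nonneg[of M "\<lambda>x. u x - v x"]] by (simp add: algebra_simps)
      then have "((J q u + J q v) / 2 - J q ?m) / q \<le> Cq * ?e"
        using q by (intro divide_le_if_ge_1 mult_nonneg_nonneg[OF Cq(1) L2n_nonneg]) auto
      then have "l * (\<nu> * (((J q u + J q v) / 2 - J q ?m) / q)) \<le> l * (\<nu> * (Cq * ?e))"
        using l \<nu> by (intro mult_left_mono) auto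
      also have "\<dots> = l * (\<nu> * Cq) * ?e" by (simp only: mult.assoc)
      finally have q1: "l * (\<nu> * (((J q u + J q v) / 2 - J q ?m) / q)) \<le> l * (\<nu> * Cq) * ?e" .
      have half: "\<bar>(a + b) / 2 - m\<bar> = \<bar>a + b - 2 * m\<bar> / 2" for a b m :: real
      proof -
        have "(a + b) / 2 - m = (a + b - 2 * m) / 2" by (simp add: field_simps)
        then show ?thesis by (simp only: abs_divide abs_numeral)
      qed
      have dn: "0 \<le> Cs * ?d\<^sup>2" "0 \<le> Cp * ?d\<^sup>2" using Cs(1) Cp(1) by auto
      have s0: "\<bar>((J s u + J s v) / 2 - J s ?m) / s\<bar> \<le> Cs * ?d\<^sup>2 / 2"
      proof -
        have "\<bar>(J s u + J s v) / 2 - J s ?m\<bar> \<le> Cs * ?d\<^sup>2 / 2" unfolding half by (intro divide_right_mono Cs(2) X) simp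
        also have "\<dots> \<le> s * (Cs * ?d\<^sup>2 / 2)" using dn(1) s by (simp add: mult_le_cancel_right1)
        finally show ?thesis using s by (simp add: abs_divide pos_divide_le_eq mult.commute)
      qed
      have s1: "l * (((J s u + J s v) / 2 - J s ?m) / s) \<le> l * (Cs * ?d\<^sup>2 / 2)"
        by (rule mult_left_mono[OF abs_le_D1[OF s0]]) (use l in simp)
      have p0: "\<bar>((J p u + J p v) / 2 - J p ?m) / p\<bar> \<le> Cp * ?d\<^sup>2 / 2"
      proof -
        have "\<bar>(J p u + J p v) / 2 - J p ?m\<bar> \<le> Cp * ?d\<^sup>2 / 2" unfolding half by (intro divide_right_mono Cp(2) X) simp
        also have "\<dots> \<le> p * (Cp * ?d\<^sup>2 / 2)" using dn(2) p by (simp add: mult_le_cancel_right1)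
        finally show ?thesis using p by (simp add: abs_divide pos_divide_le_eq mult.commute)
      qed
      have "\<bar>\<mu> * (((J p u + J p v) / 2 - J p ?m) / p)\<bar> \<le> 1 * (Cp * ?d\<^sup>2 / 2)"
        unfolding abs_mult[of \<mu>] by (rule mult_mono[OF \<mu> p0 zero_le_one abs_ge_zero])
      then have "\<bar>\<mu> * (((J p u + J p v) / 2 - J p ?m) / p)\<bar> \<le> Cp * ?d\<^sup>2 / 2"
        unfolding mult_1 .
      from mult_left_mono[OF abs_le_D1[OF this], of l]
      have p1: "l * (\<mu> * (((J p u + J p v) / 2 - J p ?m) / p)) \<le> l * (Cp * ?d\<^sup>2 / 2)"
        using l by simp
      have "l * (Cs * ?d\<^sup>2 / 2) + l * (Cp * ?d\<^sup>2 / 2) = (l * (Cs + Cp)) * (?d\<^sup>2 / 2)" by (simp add: algebra_simps)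
      also have "\<dots> \<le> (1 / 8) * (?d\<^sup>2 / 2)" using lC by (intro mult_right_mono) auto
      finally have c1: "l * (Cs * ?d\<^sup>2 / 2) + l * (Cp * ?d\<^sup>2 / 2) \<le> ?d\<^sup>2 / 16" by simp
      have fin: "x \<le> y - d / 16 + b'" if "x = y - d / 8 + a + b + c" "a \<le> a'" "c \<le> c'" "b \<le> b'" "a' + c' \<le> d / 16"
        for a b c d x y a' b' c' :: real using that by linarith
      have dv2: "((a + b) / 2 - m) / c = (a / c + b / c) / 2 - m / c" for a b m c :: real
        by (simp add: add_divide_distrib diff_divide_distrib)
      \<comment> \<open>The parallelogram identity supplies the term -d^2 / 8, where d is the
        distance of u and v; half of it pays for the s-term and the p-term by \<open>c1\<close>, and
        the q-term stays as the error in the square norm.\<close>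
      have "energy p q l \<mu> \<nu> ?m = (energy p q l \<mu> \<nu> u + energy p q l \<mu> \<nu> v) / 2 - ?d\<^sup>2 / 8
        + l * (((J s u + J s v) / 2 - J s ?m) / s) + l * (\<nu> * (((J q u + J q v) / 2 - J q ?m) / q))
        + l * (\<mu> * (((J p u + J p v) / 2 - J p ?m) / p))"
        unfolding energy_def H10_parallelogram[OF H] dv2 by (simp add: algebra_simps add_divide_distrib diff_divide_distrib)
      then show "energy p q l \<mu> \<nu> ?m \<le> (energy p q l \<mu> \<nu> u + energy p q l \<mu> \<nu> v) / 2 - ?d\<^sup>2 / 16 + l * (\<nu> * Cq) * ?e"
        by (rule fin[OF _ s1 p1 q1 c1])
    qed
  qed
  ultimately show ?thesis by blast
qed

text \<open>The midpoint of two almost minimizers cannot lie below the infimum, so the midpoint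
  inequality bounds their squared distance by their excess energies and their distance in the square
  norm. The latter tends to 0 along a Rellich subsequence, which is therefore Cauchy in norm; no
  weak convergence is involved. The perturbation drops out since it is affine at midpoints.\<close>

lemma minimizing_sequence_converges:
  fixes E \<Phi> :: "('a \<Rightarrow> real) \<Rightarrow> real" and u :: "nat \<Rightarrow> 'a \<Rightarrow> real"
  assumes mid: "0 \<le> L" "\<And>u v. u \<in> X r \<Longrightarrow> v \<in> X r \<Longrightarrow> E (\<lambda>x. (1/2) * u x + (1/2) * v x)
       \<le> (E u + E v) / 2 - (N (\<lambda>x. u x - v x))\<^sup>2 / 16 + L * L2n M (\<lambda>x. u x - v x)"
    and cont: "\<And>u v. u \<in> X r \<Longrightarrow> v \<in> X r \<Longrightarrow> \<bar>E u - E v\<bar> \<le> C * N (\<lambda>x. u x - v x)"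
    and lin: "\<And>u v. u \<in> H10 \<Omega> \<Longrightarrow> v \<in> H10 \<Omega> \<Longrightarrow> \<Phi> (\<lambda>x. (1/2) * u x + (1/2) * v x) = (1/2) * \<Phi> u + (1/2) * \<Phi> v"
    and \<Phi>: "\<And>u v. u \<in> X r \<Longrightarrow> v \<in> X r \<Longrightarrow> \<bar>\<Phi> u - \<Phi> v\<bar> \<le> \<delta> * N (\<lambda>x. u x - v x)"
    and u: "\<And>n. u n \<in> X r" and low: "\<And>w. w \<in> X r \<Longrightarrow> c \<le> E w - \<Phi> w"
    and lim: "(\<lambda>n. E (u n) - \<Phi> (u n)) \<longlonglongrightarrow> c"
  shows "\<exists>k w. strict_mono k \<and> w \<in> X r \<and> (\<lambda>n. N (\<lambda>x. u (k n) x - w x)) \<longlonglongrightarrow> 0 \<and> E w - \<Phi> w = c"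
proof -
  note uH = X_H10[OF u] and uN = X_N[OF u]
  obtain k :: "nat \<Rightarrow> nat" where k: "strict_mono k"
    "\<And>\<epsilon>. \<epsilon> > 0 \<Longrightarrow> \<exists>N. \<forall>m\<ge>N. \<forall>n\<ge>N. L2n M (\<lambda>x. u (k m) x - u (k n) x) \<le> \<epsilon>"
    using Rellich[of u r, OF uH uN] by blast
  have limk: "(\<lambda>n. E (u (k n)) - \<Phi> (u (k n))) \<longlonglongrightarrow> c"
    using LIMSEQ_subseq_LIMSEQ[OF lim k(1)] by (simp add: o_def)
  have C: "\<exists>n0. \<forall>m\<ge>n0. \<forall>n\<ge>n0. N (\<lambda>x. u (k m) x - u (k n) x) \<le> \<epsilon>" if \<epsilon>: "\<epsilon> > 0" for \<epsilon>
  proof -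
    \<comment> \<open>The excess energies and the L-term contribute at most \<eta> each, and 2
      \<eta> = \<epsilon>^2 / 16 matches the coefficient 1/16 of the squared distance.\<close>
    define \<eta> where "\<eta> = \<epsilon>\<^sup>2 / 32"
    have \<eta>: "\<eta> > 0" using \<epsilon> by (simp add: \<eta>_def)
    obtain n1 where n1: "\<And>m n. m \<ge> n1 \<Longrightarrow> n \<ge> n1 \<Longrightarrow> L2n M (\<lambda>x. u (k m) x - u (k n) x) \<le> \<eta> / (L + 1)"
      using k(2)[of "\<eta> / (L + 1)"] \<eta> mid(1) by (auto simp: add_nonneg_pos)
    have "\<forall>\<^sub>F n in sequentially. E (u (k n)) - \<Phi> (u (k n)) < c + \<eta>"
      using \<eta> by (intro order_tendstoD(2)[OF limk]) auto
    then obtain n2 where n2: "\<And>n. n \<ge> n2 \<Longrightarrow> E (u (k n)) - \<Phi> (u (k n)) < c + \<eta>" by (auto simp: eventually_sequentially)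
    have "N (\<lambda>x. u (k m) x - u (k n) x) \<le> \<epsilon>" if mn: "m \<ge> max n1 n2" "n \<ge> max n1 n2" for m n
    proof -
      let ?a = "u (k m)" and ?b = "u (k n)"
      let ?d = "N (\<lambda>x. ?a x - ?b x)" and ?e = "L2n M (\<lambda>x. ?a x - ?b x)"
      have "c \<le> E (\<lambda>x. (1/2) * ?a x + (1/2) * ?b x) - \<Phi> (\<lambda>x. (1/2) * ?a x + (1/2) * ?b x)"
        by (intro low mid_X u)
      also have "\<dots> \<le> (E ?a - \<Phi> ?a) / 2 + (E ?b - \<Phi> ?b) / 2 - ?d\<^sup>2 / 16 + L * ?e"
        using mid(2)[OF u u, of "k m" "k n"] lin[OF uH uH, of "k m" "k n"] by (simp add: field_simps)
      finally have 1: "?d\<^sup>2 / 16 \<le> (E ?a - \<Phi> ?a) / 2 + (E ?b - \<Phi> ?b) / 2 - c + L * ?e" by linarith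
      have "L * ?e \<le> L * (\<eta> / (L + 1))" using mn mid(1) by (intro mult_left_mono n1) auto
      also have "\<dots> \<le> \<eta>" using mid(1) \<eta> by (simp add: field_simps)
      finally have "L * ?e \<le> \<eta>" .
      moreover have "E ?a - \<Phi> ?a < c + \<eta>" "E ?b - \<Phi> ?b < c + \<eta>" using mn by (auto intro: n2)
      moreover have "D / 16 \<le> 2 * y" if "e \<le> y" "a < z + y" "b < z + y" "D / 16 \<le> a / 2 + b / 2 - z + e"
        for D e y a b z :: real using that by linarith
      ultimately have "?d\<^sup>2 / 16 \<le> 2 * \<eta>" using 1 by blast
      then have "?d\<^sup>2 \<le> \<epsilon>\<^sup>2" by (simp add: \<eta>_def)
      from power2_le_imp_le[OF this] \<epsilon> show ?thesis by (simp only: less_imp_le)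
    qed
    then show ?thesis by blast
  qed
  obtain w where w: "w \<in> H10 \<Omega>" "(\<lambda>n. N (\<lambda>x. u (k n) x - w x)) \<longlonglongrightarrow> 0"
    using H10_complete[of "\<lambda>n. u (k n)", OF uH C] by blast
  have "N w \<le> r"
  proof (rule LIMSEQ_le_const)
    show "(\<lambda>n. r + N (\<lambda>x. u (k n) x - w x)) \<longlonglongrightarrow> r" using tendsto_add[OF tendsto_const w(2), of r] by simp
    show "\<exists>n0. \<forall>n\<ge>n0. N w \<le> r + N (\<lambda>x. u (k n) x - w x)"
    proof (intro exI allI impI)
      fix n
      show "N w \<le> r + N (\<lambda>x. u (k n) x - w x)" using H10_norm_triangle(2)[OF uH[of "k n"] w(1) w(1)] uN[of "k n"] by linarith
    qed
  qed
  then have wX: "w \<in> X r" using w(1) by (simp add: X_def)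
  have "(\<lambda>n. E (u (k n)) - \<Phi> (u (k n))) \<longlonglongrightarrow> E w - \<Phi> w"
  proof (rule LIM_zero_cancel, rule Lim_null_comparison)
    show "\<forall>\<^sub>F n in sequentially. norm ((E (u (k n)) - \<Phi> (u (k n))) - (E w - \<Phi> w)) \<le> (C + \<delta>) * N (\<lambda>x. u (k n) x - w x)"
    proof (intro always_eventually allI)
      fix n
      have "norm ((E (u (k n)) - \<Phi> (u (k n))) - (E w - \<Phi> w)) \<le> \<bar>E (u (k n)) - E w\<bar> + \<bar>\<Phi> (u (k n)) - \<Phi> w\<bar>"
        unfolding real_norm_def by linarith
      then show "norm ((E (u (k n)) - \<Phi> (u (k n))) - (E w - \<Phi> w)) \<le> (C + \<delta>) * N (\<lambda>x. u (k n) x - w x)"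
        unfolding distrib_right using cont[OF u[of "k n"] wX] \<Phi>[OF u[of "k n"] wX] by linarith
    qed
    show "(\<lambda>n. (C + \<delta>) * N (\<lambda>x. u (k n) x - w x)) \<longlonglongrightarrow> 0" by (rule tendsto_mult_right_zero[OF w(2)])
  qed
  from LIMSEQ_unique[OF this limk] show ?thesis using k(1) w(2) wX by blast
qed

text \<open>Small positive multiples of any direction stay in the ball, so all one-sided directional
  derivatives G v are nonnegative; G is odd, hence zero.\<close>

lemma interior_minimizer_critical:
  assumes p: "2 \<le> p" "p \<le> s" and q: "1 < q" "q < 2"
    and \<Phi>: "\<And>u v t. u \<in> H10 \<Omega> \<Longrightarrow> v \<in> H10 \<Omega> \<Longrightarrow> \<Phi> (\<lambda>x. u x + t * v x) = \<Phi> u + t * \<Phi> v"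
    and u: "u \<in> H10 \<Omega>" "N u < r"
    and min: "\<And>w. w \<in> X r \<Longrightarrow> energy p q l \<mu> \<nu> u - \<Phi> u \<le> energy p q l \<mu> \<nu> w - \<Phi> w"
    and v: "v \<in> H10 \<Omega>"
  shows "H10_inner \<Omega> u v - l * (\<integral>x. (signed_pow s (u x) + \<nu> * signed_pow q (u x) + \<mu> * signed_pow p (u x)) * v x \<partial>M) - \<Phi> v = 0"
proof -
  have s: "1 < s" "1 < p" "q \<le> s" using s_gt p q by auto
  define G where "G v = H10_inner \<Omega> u v - l * ((\<integral>x. signed_pow s (u x) * v x \<partial>M) + \<nu> * (\<integral>x. signed_pow q (u x) * v x \<partial>M) + \<mu> * (\<integral>x. signed_pow p (u x) * v x \<partial>M)) - \<Phi> v" for v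
  have ge: "0 \<le> G v" if v: "v \<in> H10 \<Omega>" for v
  proof (rule LIMSEQ_le_const)
    define t where "t n = 1 / real (Suc n)" for n
    have t0: "t \<longlonglongrightarrow> 0" unfolding t_def using LIMSEQ_Suc[OF lim_1_over_n[where 'a=real]] by simp
    let ?w = "\<lambda>n x. u x + (1 / real (Suc n)) * v x"
    define D where "D a n = (J a (?w n) - J a u) * real (Suc n)" for a n
    have JD: "(\<lambda>n. D a n) \<longlonglongrightarrow> a * (\<integral>x. signed_pow a (u x) * v x \<partial>M)" if "1 < a" "a \<le> s" for a
      unfolding D_def by (rule J_derivative(2)[OF that u(1) v])
    have "(\<lambda>n. (H10_inner \<Omega> u v + (t n / 2) * (N v)\<^sup>2) - l * (D s n / s + \<nu> * (D q n / q) + \<mu> * (D p n / p)) - \<Phi> v)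
      \<longlonglongrightarrow> (H10_inner \<Omega> u v + (0 / 2) * (N v)\<^sup>2) - l * ((s * (\<integral>x. signed_pow s (u x) * v x \<partial>M)) / s
         + \<nu> * ((q * (\<integral>x. signed_pow q (u x) * v x \<partial>M)) / q) + \<mu> * ((p * (\<integral>x. signed_pow p (u x) * v x \<partial>M)) / p)) - \<Phi> v"
      using s q p by (intro tendsto_intros JD t0) auto
    then show "(\<lambda>n. (H10_inner \<Omega> u v + (t n / 2) * (N v)\<^sup>2) - l * (D s n / s + \<nu> * (D q n / q) + \<mu> * (D p n / p)) - \<Phi> v) \<longlonglongrightarrow> G v"
      using s q p by (simp add: G_def)
    have ev: "\<forall>\<^sub>F n in sequentially. t n * N v < r - N u"
      using u(2) by (intro order_tendstoD(2)[OF tendsto_mult_left_zero[OF t0]]) simp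
    then obtain n0 where n0: "\<And>n. n \<ge> n0 \<Longrightarrow> t n * N v < r - N u" by (auto simp: eventually_sequentially)
    show "\<exists>n0. \<forall>n\<ge>n0. 0 \<le> (H10_inner \<Omega> u v + (t n / 2) * (N v)\<^sup>2) - l * (D s n / s + \<nu> * (D q n / q) + \<mu> * (D p n / p)) - \<Phi> v"
    proof (intro exI[of _ n0] allI impI)
      fix n assume n: "n \<ge> n0"
      have tp: "t n > 0" "t n * real (Suc n) = 1" by (auto simp: t_def)
      have wX: "?w n \<in> X r"
        using H10_lincomb(1)[OF u(1) v, of 1 "t n"] H10_norm_lincomb[OF u(1) v, of 1 "t n"] n0[OF n] tp(1)
        by (simp add: X_def t_def)
      have Dt: "J a (?w n) = J a u + t n * D a n" for a unfolding D_def t_def by simp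
      have w2: "(N (?w n))\<^sup>2 = (N u)\<^sup>2 + 2 * t n * H10_inner \<Omega> u v + (t n)\<^sup>2 * (N v)\<^sup>2"
        using H10_norm_add_power2[OF u(1) v, of "t n"] by (simp add: t_def)
      have "\<Phi> (?w n) = \<Phi> u + t n * \<Phi> v" using \<Phi>[OF u(1) v, of "t n"] by (simp add: t_def)
      with min[OF wX] have "0 \<le> t n * ((H10_inner \<Omega> u v + (t n / 2) * (N v)\<^sup>2) - l * (D s n / s + \<nu> * (D q n / q) + \<mu> * (D p n / p)) - \<Phi> v)"
        unfolding energy_def w2 Dt by (simp add: algebra_simps power2_eq_square add_divide_distrib)
      then show "0 \<le> (H10_inner \<Omega> u v + (t n / 2) * (N v)\<^sup>2) - l * (D s n / s + \<nu> * (D q n / q) + \<mu> * (D p n / p)) - \<Phi> v"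
        using tp(1) by (simp add: zero_le_mult_iff)
    qed
  qed
  have "H10_inner \<Omega> u (\<lambda>x. - v x) = - H10_inner \<Omega> u v"
    using H10_inner_lincomb[OF u(1) v v, of "-1" 0] by simp
  \<comment> \<open>With t = -2 the hypothesis turns v + t v into -v.\<close>
  moreover have "\<Phi> (\<lambda>x. - v x) = - \<Phi> v"
    using \<Phi>[OF v v, of "-1"] \<Phi>[OF v v, of "-2"] by simp
  ultimately have "G (\<lambda>x. - v x) = - G v" by (simp add: G_def algebra_simps)
  moreover have "(\<lambda>x. - v x) \<in> H10 \<Omega>" using H10_scale[OF v, of "-1"] by simp
  ultimately have "G v = 0" using ge[OF v] ge[of "\<lambda>x. - v x"] by simp
  moreover have "(\<integral>x. (signed_pow s (u x) + \<nu> * signed_pow q (u x) + \<mu> * signed_pow p (u x)) * v x \<partial>M)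
     = (\<integral>x. signed_pow s (u x) * v x \<partial>M) + \<nu> * (\<integral>x. signed_pow q (u x) * v x \<partial>M) + \<mu> * (\<integral>x. signed_pow p (u x) * v x \<partial>M)"
  proof -
    have "integrable M (\<lambda>x. signed_pow a (u x) * v x)" if "1 < a" "a \<le> s" for a
      by (rule J_derivative(1)[OF that u(1) v])
    from this[of s] this[of q] this[of p] show ?thesis using s p q
      by (simp add: distrib_right mult.assoc)
  qed
  ultimately show ?thesis by (simp add: G_def)
qed

text \<open>Along small multiples t of a bump function the negative term of order t^q outweighs the
  terms of order t^2 and higher, because q < 2.\<close>

lemma energy_negative:
  assumes p: "2 \<le> p" "p \<le> s" and q: "1 < q" "q < 2" and r: "0 < r" and \<nu>: "0 < \<nu>" and l: "0 < l" and ne: "\<Omega> \<noteq> {}"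
  shows "\<exists>u\<in>X r. energy p q l \<mu> \<nu> u < 0"
proof -
  obtain x where "x \<in> \<Omega>" using ne by auto
  then obtain e where e: "e > 0" "ball x e \<subseteq> \<Omega>" using open_\<Omega> openE by blast
  obtain a b where ab: "x \<in> box a b" "box a b \<subseteq> ball x (e / 2)" using rational_boxes[of "e / 2" x] e by auto
  have "cbox a b = closure (box a b)" using ab(1) by (intro closure_box[symmetric]) auto
  also have "\<dots> \<subseteq> cball x (e / 2)" using ab(2) by (intro closure_minimal) auto
  also have "\<dots> \<subseteq> \<Omega>" using e by auto
  finally have cb: "cbox a b \<subseteq> \<Omega>" .
  let ?f = "bump a b 1"
  have tf: "test_fun \<Omega> ?f" by (rule test_fun_bump[OF _ cb]) simp
  have f: "?f \<in> H10 \<Omega>" by (rule test_fun_H10(1)[OF tf])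
  have Jq: "J q ?f > 0"
  proof -
    have i: "integrable M (\<lambda>x. \<bar>?f x\<bar> powr q)" using integrable_powr(1)[OF f, of q] q s_gt by simp
    have "J q ?f \<noteq> 0"
    proof
      assume "J q ?f = 0"
      then have "AE x in M. \<bar>?f x\<bar> powr q = 0"
        using integral_nonneg_eq_0_iff_AE[OF i] by (simp add: J_def)
      then have "AE x in lebesgue. x \<in> \<Omega> \<longrightarrow> ?f x = 0" using sets_\<Omega> by (simp add: AE_restrict_space_iff)
      then have "AE x in lebesgue. x \<notin> box a b"
      proof eventually_elim
        case (elim x)
        then show ?case using cb box_subset_cbox[of a b] bump_nonzero[of 1 a b x] by auto
      qed
      then have "AE x in lborel. x \<notin> box a b" by (simp add: AE_completion_iff)
      then have "emeasure lborel (box a b) = 0" using AE_iff_measurable[of "box a b" lborel "\<lambda>x. x \<notin> box a b"] by auto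
      moreover have "emeasure lborel (box a b) > 0"
        using ab(1) by (subst emeasure_lborel_box) (auto simp: mem_box inner_diff_left intro!: prod_pos less_imp_le[OF less_trans] elim: ballE)
      ultimately show False by simp
    qed
    then show ?thesis using J_nonneg[of q ?f] by simp
  qed
  \<comment> \<open>A collects what is at most of order t^2, using t^p <= t^2 for t <= 1 and either
    sign of \<mu>; B is the coefficient of t^q. The critical term has the favourable sign and is
    dropped.\<close>
  define A where "A = (N ?f)\<^sup>2 / 2 + l * \<bar>\<mu>\<bar> * (J p ?f / p)"
  define B where "B = l * (\<nu> * (J q ?f / q))"
  have A: "A \<ge> 0" using l p J_nonneg[of p ?f] by (simp add: A_def)
  have B: "B > 0" using l \<nu> q Jq by (simp add: B_def)
  have upper: "energy p q l \<mu> \<nu> (\<lambda>x. t * ?f x) \<le> t powr 2 * A - t powr q * B" if t: "0 < t" "t \<le> 1" for t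
  proof -
    have "energy p q l \<mu> \<nu> (\<lambda>x. t * ?f x) = t\<^sup>2 * ((N ?f)\<^sup>2 / 2) - l * (t powr s * J s ?f / s) - t powr q * B - t powr p * (l * \<mu> * (J p ?f / p))"
      using t unfolding energy_def J_scale H10_norm_scale[OF f] B_def
      by (simp add: power_mult_distrib algebra_simps)
    also have "\<dots> \<le> t powr 2 * ((N ?f)\<^sup>2 / 2) - t powr q * B + t powr 2 * (l * \<bar>\<mu>\<bar> * (J p ?f / p))"
    proof -
      have "0 \<le> l * (t powr s * J s ?f / s)" using l J_nonneg[of s ?f] s_gt by simp
      moreover have "- (t powr p * (l * \<mu> * (J p ?f / p))) \<le> t powr 2 * (l * \<bar>\<mu>\<bar> * (J p ?f / p))"
      proof -
        have "- (t powr p * (l * \<mu> * (J p ?f / p))) \<le> t powr p * (l * \<bar>\<mu>\<bar> * (J p ?f / p))"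
        proof -
          have "- \<mu> * (t powr p * l * (J p ?f / p)) \<le> \<bar>\<mu>\<bar> * (t powr p * l * (J p ?f / p))"
            using l p J_nonneg[of p ?f] by (intro mult_right_mono) auto
          then show ?thesis by (simp add: mult_ac)
        qed
        also have "\<dots> \<le> t powr 2 * (l * \<bar>\<mu>\<bar> * (J p ?f / p))"
          using l p t J_nonneg[of p ?f] powr_mono'[of 2 p t] by (intro mult_right_mono) auto
        finally show ?thesis .
      qed
      moreover have t2: "t\<^sup>2 = t powr 2" using t by simp
      ultimately show ?thesis unfolding t2 by linarith
    qed
    finally show ?thesis by (simp add: A_def algebra_simps)
  qed
  have "((\<lambda>t. t powr (2 - q) * A) \<longlongrightarrow> 0 powr (2 - q) * A) (at_right 0)"
    using q by (intro tendsto_intros tendsto_powr') (auto intro: eventually_mono[OF eventually_at_right_less])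
  then have "\<forall>\<^sub>F t in at_right 0. t powr (2 - q) * A < B"
    using B by (intro order_tendstoD(2)[of _ "0 powr (2 - q) * A"]) auto
  moreover have "((\<lambda>t. t * N ?f) \<longlongrightarrow> 0 * N ?f) (at_right 0)" by (intro tendsto_intros)
  then have "\<forall>\<^sub>F t in at_right 0. t * N ?f < r" using r by (intro order_tendstoD(2)[of _ "0 * N ?f"]) auto
  moreover have "\<forall>\<^sub>F t::real in at_right 0. t < 1" by (intro eventually_at_right_real[THEN eventually_mono]) (auto simp: eventually_at_right_less)
  moreover have "\<forall>\<^sub>F t::real in at_right 0. 0 < t" by (simp add: eventually_at_right_less)
  ultimately have "\<forall>\<^sub>F t in at_right 0. t powr (2 - q) * A < B \<and> t * N ?f < r \<and> t < 1 \<and> 0 < t"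
    by eventually_elim simp
  then obtain t where t: "t powr (2 - q) * A < B" "t * N ?f < r" "t < 1" "0 < t"
    using eventually_happens[of _ "at_right (0::real)"] by (auto simp: trivial_limit_at_right_real)
  have "t powr 2 * A = t powr q * (t powr (2 - q) * A)" using t(4) by (simp flip: powr_add mult.assoc)
  also have "\<dots> < t powr q * B" using t by (intro mult_strict_left_mono) auto
  finally have "energy p q l \<mu> \<nu> (\<lambda>x. t * ?f x) < 0" using upper[of t] t by simp
  moreover have "(\<lambda>x. t * ?f x) \<in> X r" using H10_scale[OF f] t by (simp add: X_def H10_norm_scale[OF f])
  ultimately show ?thesis by blast
qed

end

section \<open>Two small critical points\<close>

text \<open>The inner product with u, scaled to norm at most r / 2 and with value -(r / 2) H10_norm
  u at u, is approximated within r / 4 by an element of S. The approximation has norm at most 3 r /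
  4, and at least half of the negative value survives. If u has norm 0, the zero functional is
  approximated.\<close>

lemma (in open_set) dense_in_Hm1_separates:
  assumes S: "S \<subseteq> Hm1 \<Omega>" "dense_in_Hm1 \<Omega> S" and r: "0 < r" and u: "u \<in> H10 \<Omega>"
  shows "\<exists>\<phi>\<in>S. Hm1_norm \<Omega> \<phi> < r \<and> \<phi> u \<le> - (r / 4) * H10_norm \<Omega> u"
proof -
  define c where "c = (if H10_norm \<Omega> u = 0 then 0 else - (r / 2) / H10_norm \<Omega> u)"
  define \<psi> where "\<psi> v = (if v \<in> H10 \<Omega> then c * H10_inner \<Omega> u v else 0)" for v
  have \<psi>: "\<psi> \<in> Hm1 \<Omega>" unfolding \<psi>_def[abs_def] by (rule Hm1_inner[OF u])
  have cu: "\<bar>c\<bar> * H10_norm \<Omega> u \<le> r / 2" "c * (H10_norm \<Omega> u)\<^sup>2 = - (r / 2) * H10_norm \<Omega> u"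
    using r by (auto simp: c_def abs_mult power2_eq_square)
  have \<psi>b: "\<bar>\<psi> v\<bar> \<le> (r / 2) * H10_norm \<Omega> v" if "v \<in> H10 \<Omega>" for v
  proof -
    have "\<bar>\<psi> v\<bar> = \<bar>c\<bar> * \<bar>H10_inner \<Omega> u v\<bar>" using that by (simp add: \<psi>_def abs_mult)
    also have "\<dots> \<le> \<bar>c\<bar> * (H10_norm \<Omega> u * H10_norm \<Omega> v)" by (intro mult_left_mono H10_Cauchy_Schwarz u that) simp
    also have "\<dots> \<le> (r / 2) * H10_norm \<Omega> v" using cu(1) by (simp only: mult.assoc[symmetric] mult_right_mono H10_norm_nonneg)
    finally show ?thesis .
  qed
  obtain \<phi> where \<phi>: "\<phi> \<in> S" "Hm1_norm \<Omega> (\<lambda>v. \<phi> v - \<psi> v) < r / 4"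
    using S(2) \<psi> r unfolding dense_in_Hm1_def by (metis divide_pos_pos zero_less_numeral)
  have \<phi>H: "\<phi> \<in> Hm1 \<Omega>" using \<phi> S by auto
  have dH: "(\<lambda>v. \<phi> v - \<psi> v) \<in> Hm1 \<Omega>" using Hm1_lincomb[OF \<phi>H \<psi>, of 1 "-1"] by simp
  have db: "\<bar>\<phi> v - \<psi> v\<bar> \<le> (r / 4) * H10_norm \<Omega> v" if "v \<in> H10 \<Omega>" for v
    using Hm1_bound[OF dH that] mult_right_mono[OF less_imp_le[OF \<phi>(2)], of "H10_norm \<Omega> v"] by simp
  have "Hm1_norm \<Omega> \<phi> \<le> 3 * r / 4"
  proof (rule Hm1_norm_le)
    fix v assume v: "v \<in> H10 \<Omega>"
    have "\<bar>\<phi> v\<bar> \<le> (r / 4) * H10_norm \<Omega> v + (r / 2) * H10_norm \<Omega> v"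
      using db[OF v] \<psi>b[OF v] by linarith
    then show "\<bar>\<phi> v\<bar> \<le> 3 * r / 4 * H10_norm \<Omega> v" by (simp add: algebra_simps)
  qed (use r in simp)
  moreover have "\<psi> u = - (r / 2) * H10_norm \<Omega> u" using u cu(2) by (simp add: \<psi>_def H10_inner_self)
  then have "\<phi> u \<le> - (r / 4) * H10_norm \<Omega> u" using abs_le_D1[OF db[OF u]] by (simp add: field_simps)
  ultimately show ?thesis using \<phi>(1) r by (intro bexI[of _ \<phi>]) auto
qed

context sobolev_set
begin

lemma two_small_critical_points:
  assumes p: "2 \<le> p" "p \<le> s" and q: "1 < q" "q < 2" and r: "0 < r" and \<nu>: "0 < \<nu>" and ne: "\<Omega> \<noteq> {}"
  shows "\<exists>l_star>0. \<forall>l \<mu>. 0 < l \<and> l < l_star \<and> - l_star < \<mu> \<and> \<mu> < l_star \<longrightarrow>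
    (\<forall>S. S \<subseteq> Hm1 \<Omega> \<and> convex_functionals S \<and> dense_in_Hm1 \<Omega> S \<longrightarrow>
      (\<exists>\<phi>\<in>S. Hm1_norm \<Omega> \<phi> < r \<and> (\<exists>u1\<in>H10 \<Omega>. \<exists>u2\<in>H10 \<Omega>. \<not> ae_equal \<Omega> u1 u2 \<and> N u1 \<le> r \<and> N u2 \<le> r \<and>
        (\<forall>u\<in>{u1, u2}. \<forall>v\<in>H10 \<Omega>. H10_inner \<Omega> u v
          - l * (\<integral>x. (signed_pow s (u x) + \<nu> * signed_pow q (u x) + \<mu> * signed_pow p (u x)) * v x \<partial>M) - l * \<phi> v = 0))))"
proof -
  obtain l1 where l1: "l1 > 0" and est: "\<And>l \<mu>. 0 < l \<Longrightarrow> l < l1 \<Longrightarrow> \<bar>\<mu>\<bar> < l1 \<Longrightarrow>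
    (\<exists>L\<ge>0. \<forall>u\<in>X r. \<forall>v\<in>X r. energy p q l \<mu> \<nu> (\<lambda>x. (1/2) * u x + (1/2) * v x)
       \<le> (energy p q l \<mu> \<nu> u + energy p q l \<mu> \<nu> v) / 2 - (N (\<lambda>x. u x - v x))\<^sup>2 / 16 + L * L2n M (\<lambda>x. u x - v x)) \<and>
    (\<forall>u\<in>X r. N u = r \<longrightarrow> l * r\<^sup>2 < energy p q l \<mu> \<nu> u) \<and>
    (\<exists>B. \<forall>u\<in>X r. B \<le> energy p q l \<mu> \<nu> u) \<and>
    (\<exists>C. \<forall>u\<in>X r. \<forall>v\<in>X r. \<bar>energy p q l \<mu> \<nu> u - energy p q l \<mu> \<nu> v\<bar> \<le> C * N (\<lambda>x. u x - v x))"
    using energy_estimates[OF p q r \<nu>] by blast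
  show ?thesis
  proof (intro exI[of _ l1] conjI l1 allI impI)
    fix l \<mu> S assume "0 < l \<and> l < l1 \<and> - l1 < \<mu> \<and> \<mu> < l1"
      and "S \<subseteq> Hm1 \<Omega> \<and> convex_functionals S \<and> dense_in_Hm1 \<Omega> S"
    then have l: "0 < l" "l < l1" "\<bar>\<mu>\<bar> < l1" and S: "S \<subseteq> Hm1 \<Omega>" "convex_functionals S" "dense_in_Hm1 \<Omega> S" by auto
    define E where "E = energy p q l \<mu> \<nu>"
    note est' = est[OF l, folded E_def]
    obtain L where L: "0 \<le> L" "\<And>u v. u \<in> X r \<Longrightarrow> v \<in> X r \<Longrightarrow> E (\<lambda>x. (1/2) * u x + (1/2) * v x)
       \<le> (E u + E v) / 2 - (N (\<lambda>x. u x - v x))\<^sup>2 / 16 + L * L2n M (\<lambda>x. u x - v x)" using est' by blast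
    obtain B where B: "\<And>u. u \<in> X r \<Longrightarrow> B \<le> E u" using est' by blast
    obtain C where C: "\<And>u v. u \<in> X r \<Longrightarrow> v \<in> X r \<Longrightarrow> \<bar>E u - E v\<bar> \<le> C * N (\<lambda>x. u x - v x)" using est' by blast
    have sphere: "\<And>u. u \<in> X r \<Longrightarrow> N u = r \<Longrightarrow> l * r\<^sup>2 < E u" using est' by blast
    have N0: "N (\<lambda>_. 0) = 0" using H10_norm_scale[OF H10_zero, of 0] by simp
    have zX: "(\<lambda>_. 0) \<in> X r" using H10_zero N0 r by (simp add: X_def)
    have E0: "E (\<lambda>_. 0) = 0" unfolding E_def energy_def J_def N0 by simp
    \<comment> \<open>The factor l is built into the functionals, so that the minimax lemma can
      subtract them from E as they stand.\<close>
    define T where "T = (\<lambda>\<phi> v. l * \<phi> v) ` {\<phi> \<in> S. Hm1_norm \<Omega> \<phi> < r}"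
    have bnd: "\<bar>\<phi> u\<bar> \<le> r * N u" if "\<phi> \<in> S" "Hm1_norm \<Omega> \<phi> < r" "u \<in> H10 \<Omega>" for \<phi> u
      using Hm1_bound[of \<phi> u] S(1) that mult_right_mono[of "Hm1_norm \<Omega> \<phi>" r "N u"]
      by (auto intro: order_trans)
    have Tlip: "\<bar>f u - f v\<bar> \<le> (l * r) * N (\<lambda>x. u x - v x)" if f: "f \<in> T" and uv: "u \<in> X r" "v \<in> X r" for f u v
    proof -
      obtain \<phi> where \<phi>: "f = (\<lambda>v. l * \<phi> v)" "\<phi> \<in> S" "Hm1_norm \<Omega> \<phi> < r" using f by (auto simp: T_def)
      have H: "u \<in> H10 \<Omega>" "v \<in> H10 \<Omega>" using uv X_H10 by auto
      have "\<phi> (\<lambda>x. u x - v x) = \<phi> u - \<phi> v" using Hm1_lincomb_arg[of \<phi> u v 1 "-1"] S(1) \<phi>(2) H by auto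
      then have "f u - f v = l * \<phi> (\<lambda>x. u x - v x)" by (simp add: \<phi>(1) right_diff_distrib)
      then have "\<bar>f u - f v\<bar> = l * \<bar>\<phi> (\<lambda>x. u x - v x)\<bar>" using l(1) by (simp add: abs_mult)
      also have "\<dots> \<le> l * (r * N (\<lambda>x. u x - v x))" using l(1) by (intro mult_left_mono bnd \<phi> H10_diff H) auto
      finally show ?thesis by (simp only: mult.assoc)
    qed
    have TK: "\<bar>f u\<bar> \<le> l * r\<^sup>2" if f: "f \<in> T" and u: "u \<in> X r" for f u
    proof -
      obtain \<phi> where \<phi>: "f = (\<lambda>v. l * \<phi> v)" "\<phi> \<in> S" "Hm1_norm \<Omega> \<phi> < r" using f by (auto simp: T_def)
      have "\<bar>\<phi> u\<bar> \<le> r * N u" by (intro bnd \<phi> X_H10[OF u])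
      also have "\<dots> \<le> r * r" using X_N[OF u] r by (intro mult_left_mono) auto
      finally show ?thesis using l(1) by (simp add: \<phi>(1) abs_mult power2_eq_square)
    qed
    \<comment> \<open>The zero functional is treated alongside T, since S need not contain it but
      the unperturbed infimum must be attained too.\<close>
    have comp: "\<exists>k w. strict_mono k \<and> w \<in> X r \<and> (\<lambda>n. N (\<lambda>x. u (k n) x - w x)) \<longlonglongrightarrow> 0 \<and> E w - f w = c'"
      if u: "\<And>n. u n \<in> X r" and f: "f \<in> T \<or> f = (\<lambda>_. 0)" and low: "\<And>w. w \<in> X r \<Longrightarrow> c' \<le> E w - f w"
        and lim: "(\<lambda>n. E (u n) - f (u n)) \<longlonglongrightarrow> c'" for u :: "nat \<Rightarrow> 'a \<Rightarrow> real" and f c'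
    proof (rule minimizing_sequence_converges[OF L C _ _ u low lim])
      fix u v assume H: "u \<in> H10 \<Omega>" "v \<in> H10 \<Omega>"
      show "f (\<lambda>x. (1/2) * u x + (1/2) * v x) = (1/2) * f u + (1/2) * f v"
      proof (cases "f = (\<lambda>_. 0)")
        case False
        then obtain \<phi> where \<phi>: "f = (\<lambda>v. l * \<phi> v)" "\<phi> \<in> S" using f by (auto simp: T_def)
        then have "\<phi> \<in> Hm1 \<Omega>" using S(1) by auto
        from Hm1_lincomb_arg[OF this H, of "1/2" "1/2"] show ?thesis unfolding \<phi>(1) by (simp only: distrib_left mult.left_commute)
      qed simp
    next
      fix u v assume uv: "u \<in> X r" "v \<in> X r"
      show "\<bar>f u - f v\<bar> \<le> (l * r) * N (\<lambda>x. u x - v x)"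
        using f Tlip[OF _ uv] l(1) r by auto
    qed auto
    define c where "c = (INF u\<in>X r. E u)"
    have bd: "bdd_below (E ` X r)" using B by (intro bdd_belowI2[of _ B])
    have clow: "c \<le> E u" if "u \<in> X r" for u unfolding c_def by (intro cINF_lower bd that)
    have neX: "X r \<noteq> {}" using zX by auto
    have "\<exists>u\<in>X r. E u < c + 1 / real (Suc n)" for n
      using cINF_less_iff[OF neX bd, of "c + 1 / real (Suc n)"] by (simp add: c_def[symmetric])
    then obtain w where w: "\<And>n. w n \<in> X r" "\<And>n. E (w n) < c + 1 / real (Suc n)" by metis
    have "(\<lambda>n. E (w n) - 0) \<longlonglongrightarrow> c"
    proof (rule tendsto_sandwich[of "\<lambda>_. c"])
      show "(\<lambda>n. c + 1 / real (Suc n)) \<longlonglongrightarrow> c"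
        using tendsto_add[OF tendsto_const[of c] LIMSEQ_Suc[OF lim_1_over_n[where 'a=real]]] by simp
    qed (use clow w in \<open>auto intro!: always_eventually less_imp_le\<close>)
    from comp[of w "\<lambda>_. 0" c, OF w(1) _ _ this] clow
    obtain u0 where u0: "u0 \<in> X r" "E u0 = c" by auto
    have cneg: "c < 0"
    proof -
      obtain u where "u \<in> X r" "E u < 0" using energy_negative[OF p q r \<nu> l(1) ne] by (auto simp: E_def)
      with clow[of u] show ?thesis by simp
    qed
    have neg: "(\<lambda>x. - u0 x) \<in> X r" "E (\<lambda>x. - u0 x) = c"
      using H10_scale[of u0 "-1"] H10_norm_scale[of u0 "-1"] u0 energy_minus[of u0] by (auto simp: X_def E_def)
    have "\<exists>f\<in>T. \<exists>u\<in>X r. \<exists>v\<in>X r. (\<forall>w\<in>X r. E u - f u \<le> E w - f w) \<and> (\<forall>w\<in>X r. E v - f v \<le> E w - f w) \<and> N (\<lambda>x. u x - v x) \<noteq> 0"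
    proof (rule minimax_two_minimizers[where \<delta>="l * r" and K="l * r\<^sup>2" and N=N and c=c and \<kappa>="l * r / 4" and d="\<lambda>u v. N (\<lambda>x. u x - v x)"])
      show "convex_functionals T"
        unfolding convex_functionals_def
      proof (intro ballI allI impI)
        fix f g and a b :: real assume fg: "f \<in> T" "g \<in> T" and ab: "0 \<le> a" "0 \<le> b" "a + b = 1"
        obtain \<phi> where \<phi>: "f = (\<lambda>v. l * \<phi> v)" "\<phi> \<in> S" "Hm1_norm \<Omega> \<phi> < r" using fg by (auto simp: T_def)
        obtain \<psi> where \<psi>: "g = (\<lambda>v. l * \<psi> v)" "\<psi> \<in> S" "Hm1_norm \<Omega> \<psi> < r" using fg by (auto simp: T_def)
        let ?h = "\<lambda>v. a * \<phi> v + b * \<psi> v"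
        have "?h \<in> S" using S(2) \<phi>(2) \<psi>(2) ab by (auto simp: convex_functionals_def)
        \<comment> \<open>Convexity of the norm in the weak form of a maximum, which preserves the
          strict bound by r; the entry 0 meets the sign condition of
          \<open>Hm1_norm_le\<close>.\<close>
        moreover have "Hm1_norm \<Omega> ?h \<le> max 0 (max (Hm1_norm \<Omega> \<phi>) (Hm1_norm \<Omega> \<psi>))" (is "_ \<le> ?m")
        proof (rule Hm1_norm_le)
          fix u assume u: "u \<in> H10 \<Omega>"
          have b: "\<bar>f u\<bar> \<le> ?m * N u" if "f \<in> {\<phi>, \<psi>}" for f
          proof -
            have "\<bar>f u\<bar> \<le> Hm1_norm \<Omega> f * N u" using Hm1_bound[OF _ u] S(1) \<phi>(2) \<psi>(2) that by auto
            also have "\<dots> \<le> ?m * N u" using that by (intro mult_right_mono) auto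
            finally show ?thesis .
          qed
          have "\<bar>?h u\<bar> \<le> a * \<bar>\<phi> u\<bar> + b * \<bar>\<psi> u\<bar>"
            using ab abs_triangle_ineq[of "a * \<phi> u" "b * \<psi> u"] by (simp add: abs_mult)
          also have "\<dots> \<le> a * (?m * N u) + b * (?m * N u)" using ab b by (intro add_mono mult_left_mono) auto
          also have "\<dots> = ?m * N u" using ab(3) by (simp only: distrib_right[symmetric] mult_1)
          finally show "\<bar>?h u\<bar> \<le> ?m * N u" .
        qed simp
        then have "Hm1_norm \<Omega> ?h < r" using \<phi>(3) \<psi>(3) r by simp
        ultimately have "(\<lambda>v. l * ?h v) \<in> T" by (auto simp: T_def)
        moreover have "(\<lambda>v. l * ?h v) = (\<lambda>v. a * f v + b * g v)" by (simp add: \<phi>(1) \<psi>(1) fun_eq_iff algebra_simps)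
        ultimately show "(\<lambda>v. a * f v + b * g v) \<in> T" by simp
      qed
      show "0 \<le> l * r" "0 < l * r / 4" using l(1) r by auto
      show "N (\<lambda>x. u x - v x) \<le> N (\<lambda>x. u x - w x) + N (\<lambda>x. v x - w x)" if "u \<in> X r" "v \<in> X r" "w \<in> X r" for u v w
        by (rule H10_norm_triangle(1)[OF X_H10[OF that(1)] X_H10[OF that(2)] X_H10[OF that(3)]])
      show "\<bar>N u - N v\<bar> \<le> N (\<lambda>x. u x - v x)" if "u \<in> X r" "v \<in> X r" for u v
        using H10_norm_triangle(2)[OF X_H10[OF that(1)] X_H10[OF that(2)] H10_zero] .
      \<comment> \<open>Both u0 and -u0 have energy c, and the linear f is nonnegative at one of
        them.\<close>
      show "\<exists>u\<in>X r. E u - f u \<le> c" if f: "f \<in> T" for f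
      proof -
        obtain \<phi> where \<phi>: "f = (\<lambda>v. l * \<phi> v)" "\<phi> \<in> S" using f by (auto simp: T_def)
        have "f (\<lambda>x. - u0 x) = - f u0"
          using Hm1_lincomb_arg[of \<phi> u0 u0 "-1" 0] S(1) \<phi> X_H10[OF u0(1)] by auto
        moreover have "E u0 - f u0 \<le> c" if "0 \<le> f u0" using u0(2) that by linarith
        ultimately show ?thesis using u0(1) neg by (cases "0 \<le> f u0") (fastforce intro: bexI[of _ u0] bexI[of _ "\<lambda>x. - u0 x"])+
      qed
      \<comment> \<open>At norm 0 the Lipschitz estimate gives the same energy as the zero function,
        namely 0, which is not c < 0.\<close>
      show "0 < N u" if "u \<in> X r" "E u = c" for u
      proof (rule ccontr)
        assume "\<not> 0 < N u"
        then have "N u = 0" using H10_norm_nonneg[of u] by linarith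
        then have "\<bar>E u - E (\<lambda>_. 0)\<bar> \<le> 0" using C[OF that(1) zX] by simp
        then show False using E0 that(2) cneg by simp
      qed
      show "\<exists>f\<in>T. \<forall>u\<in>X r. \<bar>f u\<bar> \<le> \<epsilon>" if \<epsilon>: "0 < \<epsilon>" for \<epsilon>
      proof -
        \<comment> \<open>The entry r keeps the approximation of the zero functional in T; the other
          bounds l \<phi> by \<epsilon> on the ball of radius r.\<close>
        define \<eta> where "\<eta> = min r (\<epsilon> / (l * r))"
        have \<eta>: "0 < \<eta>" using \<epsilon> l(1) r by (simp add: \<eta>_def)
        obtain \<phi> where \<phi>: "\<phi> \<in> S" "Hm1_norm \<Omega> (\<lambda>v. \<phi> v - 0) < \<eta>"
          using S(3)[unfolded dense_in_Hm1_def, THEN bspec, OF Hm1_zero, THEN spec, THEN mp, OF \<eta>] by (elim bexE)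
        have "(\<lambda>v. l * \<phi> v) \<in> T" using \<phi> by (auto simp: T_def \<eta>_def)
        moreover have "\<bar>l * \<phi> u\<bar> \<le> \<epsilon>" if u: "u \<in> X r" for u
        proof -
          have "\<bar>\<phi> u\<bar> \<le> Hm1_norm \<Omega> \<phi> * N u" using Hm1_bound[of \<phi> u] S(1) \<phi>(1) X_H10[OF u] by auto
          also have "\<dots> \<le> \<eta> * r" using \<phi>(2) \<eta> X_N[OF u] by (intro mult_mono) auto
          also have "\<dots> \<le> \<epsilon> / (l * r) * r" using r by (intro mult_right_mono) (auto simp: \<eta>_def)
          finally have "\<bar>\<phi> u\<bar> \<le> \<epsilon> / l" using r by simp
          then show ?thesis using l(1) by (simp add: abs_mult field_simps)
        qed
        ultimately show ?thesis by (intro bexI[of _ "\<lambda>v. l * \<phi> v"] ballI)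
      qed
      show "\<exists>f\<in>T. f u \<le> - (l * r / 4) * N u" if u: "u \<in> X r" for u
      proof -
        obtain \<phi> where \<phi>: "\<phi> \<in> S" "Hm1_norm \<Omega> \<phi> < r" "\<phi> u \<le> - (r / 4) * N u"
          using dense_in_Hm1_separates[OF S(1,3) r X_H10[OF u]] by blast
        have "l * \<phi> u \<le> l * (- (r / 4) * N u)" using l(1) by (intro mult_left_mono \<phi>(3)) auto
        then have "(\<lambda>v. l * \<phi> v) u \<le> - (l * r / 4) * N u" by simp
        moreover have "(\<lambda>v. l * \<phi> v) \<in> T" using \<phi> by (auto simp: T_def)
        ultimately show ?thesis by (intro bexI[of _ "\<lambda>v. l * \<phi> v"])
      qed
    qed (fact Tlip TK clow comp)+
    then obtain f u1 u2 where f: "f \<in> T" and u: "u1 \<in> X r" "u2 \<in> X r" "N (\<lambda>x. u1 x - u2 x) \<noteq> 0"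
      and min: "\<And>w. w \<in> X r \<Longrightarrow> E u1 - f u1 \<le> E w - f w" "\<And>w. w \<in> X r \<Longrightarrow> E u2 - f u2 \<le> E w - f w"
      by blast
    obtain \<phi> where \<phi>: "f = (\<lambda>v. l * \<phi> v)" "\<phi> \<in> S" "Hm1_norm \<Omega> \<phi> < r" using f by (auto simp: T_def)
    have \<phi>H: "\<phi> \<in> Hm1 \<Omega>" using \<phi> S by auto
    have f0: "f (\<lambda>_. 0) = 0" using Hm1_lincomb_arg[OF \<phi>H H10_zero H10_zero, of 0 0] by (simp add: \<phi>(1))
    have lin: "f (\<lambda>x. u x + t * v x) = f u + t * f v" if "u \<in> H10 \<Omega>" "v \<in> H10 \<Omega>" for u v t
      using Hm1_lincomb_arg[OF \<phi>H that, of 1 t] by (simp add: \<phi>(1) algebra_simps)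
    have crit: "H10_inner \<Omega> u v - l * (\<integral>x. (signed_pow s (u x) + \<nu> * signed_pow q (u x) + \<mu> * signed_pow p (u x)) * v x \<partial>M) - f v = 0"
      if uX: "u \<in> X r" and umin: "\<And>w. w \<in> X r \<Longrightarrow> E u - f u \<le> E w - f w" and v: "v \<in> H10 \<Omega>" for u v
    proof -
      \<comment> \<open>On the sphere E exceeds l r^2, which bounds |f|, so E - f is positive there,
        while a minimizer does at least as well as the value 0 at the zero function.\<close>
      have "N u \<noteq> r"
      proof
        assume "N u = r"
        from sphere[OF uX this] have "0 < E u - f u" using TK[OF f uX] by linarith
        moreover have "E u - f u \<le> 0" using umin[OF zX] E0 f0 by simp
        ultimately show False by simp
      qed
      then have "N u < r" using X_N[OF uX] by simp
      from interior_minimizer_critical[where \<Phi>=f, OF p q lin X_H10[OF uX] this umin[unfolded E_def] v] show ?thesis .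
    qed
    have "\<not> ae_equal \<Omega> u1 u2" using H10_ae_equal[of u1 u2] u X_H10 by blast
    then show "\<exists>\<phi>\<in>S. Hm1_norm \<Omega> \<phi> < r \<and> (\<exists>u1\<in>H10 \<Omega>. \<exists>u2\<in>H10 \<Omega>. \<not> ae_equal \<Omega> u1 u2 \<and> N u1 \<le> r \<and> N u2 \<le> r \<and>
        (\<forall>u\<in>{u1, u2}. \<forall>v\<in>H10 \<Omega>. H10_inner \<Omega> u v
          - l * (\<integral>x. (signed_pow s (u x) + \<nu> * signed_pow q (u x) + \<mu> * signed_pow p (u x)) * v x \<partial>M) - l * \<phi> v = 0))"
      using crit[OF u(1) min(1)] crit[OF u(2) min(2)] u X_H10 X_N \<phi>
      by (intro bexI[of _ \<phi>] conjI bexI[of _ u1] bexI[of _ u2]) auto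
  qed
qed

end

theorem mainTheorem1:
  fixes \<Omega> :: "(real^'n) set" and p q :: real
  assumes "CARD('n) \<ge> 3"
    and "smooth_bounded_domain \<Omega>"
    and "1 < q" and "q < 2" and "2 \<le> p"
    and "p < 2 * real CARD('n) / (real CARD('n) - 2)"
  shows "\<forall>r>0. \<forall>\<nu>>0. \<exists>l_star>0.
    \<forall>l \<mu>. 0 < l \<and> l < l_star \<and> - l_star < \<mu> \<and> \<mu> < l_star \<longrightarrow>
      (\<forall>S. S \<subseteq> Hm1 \<Omega> \<and> convex_functionals S \<and> dense_in_Hm1 \<Omega> S \<longrightarrow>
        (\<exists>\<phi>\<in>S. Hm1_norm \<Omega> \<phi> < r \<and>
          (\<exists>u1 u2. \<not> ae_equal \<Omega> u1 u2 \<and>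
             weak_solution \<Omega> p q l \<mu> \<nu> \<phi> u1 \<and> H10_norm \<Omega> u1 \<le> r \<and>
             weak_solution \<Omega> p q l \<mu> \<nu> \<phi> u2 \<and> H10_norm \<Omega> u2 \<le> r)))"
proof (intro allI impI)
  fix r \<nu> :: real assume r: "0 < r" and \<nu>: "0 < \<nu>"
  interpret sobolev_set \<Omega>
    using assms(1,2) by unfold_locales (auto simp: smooth_bounded_domain_def)
  have p: "p \<le> s" using assms(6) by (simp add: s_def)
  have ne: "\<Omega> \<noteq> {}" using assms(2) by (simp add: smooth_bounded_domain_def)
  \<comment> \<open>Identifies the critical nonlinearity of the equation with
    \<open>signed_pow s\<close>, so that all three powers are treated alike.\<close>
  have "s - 2 = 4 / (real CARD('n) - 2)" using assms(1) by (simp add: s_def field_simps)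
  then have sp: "\<bar>t\<bar> powr (4 / (real CARD('n) - 2)) * t = signed_pow s t" for t
    by (simp add: signed_pow_def)
  have ws: "weak_solution \<Omega> p q l \<mu> \<nu> \<phi> u \<longleftrightarrow> u \<in> H10 \<Omega> \<and> (\<forall>v\<in>H10 \<Omega>. H10_inner \<Omega> u v
      - l * (\<integral>x. (signed_pow s (u x) + \<nu> * signed_pow q (u x) + \<mu> * signed_pow p (u x)) * v x \<partial>M) - l * \<phi> v = 0)"
    for l \<mu> \<phi> u
    unfolding weak_solution_def H10_inner_def sp ..
  from two_small_critical_points[OF assms(5) p assms(3,4) r \<nu> ne]
  obtain l_star where l_star: "l_star > 0" "\<forall>l \<mu>. 0 < l \<and> l < l_star \<and> - l_star < \<mu> \<and> \<mu> < l_star \<longrightarrow>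
    (\<forall>S. S \<subseteq> Hm1 \<Omega> \<and> convex_functionals S \<and> dense_in_Hm1 \<Omega> S \<longrightarrow>
      (\<exists>\<phi>\<in>S. Hm1_norm \<Omega> \<phi> < r \<and> (\<exists>u1\<in>H10 \<Omega>. \<exists>u2\<in>H10 \<Omega>. \<not> ae_equal \<Omega> u1 u2 \<and> N u1 \<le> r \<and> N u2 \<le> r \<and>
        (\<forall>u\<in>{u1, u2}. \<forall>v\<in>H10 \<Omega>. H10_inner \<Omega> u v
          - l * (\<integral>x. (signed_pow s (u x) + \<nu> * signed_pow q (u x) + \<mu> * signed_pow p (u x)) * v x \<partial>M) - l * \<phi> v = 0))))"
    by (elim exE conjE) (rule that)
  show "\<exists>l_star>0. \<forall>l \<mu>. 0 < l \<and> l < l_star \<and> - l_star < \<mu> \<and> \<mu> < l_star \<longrightarrow>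
      (\<forall>S. S \<subseteq> Hm1 \<Omega> \<and> convex_functionals S \<and> dense_in_Hm1 \<Omega> S \<longrightarrow>
        (\<exists>\<phi>\<in>S. Hm1_norm \<Omega> \<phi> < r \<and>
          (\<exists>u1 u2. \<not> ae_equal \<Omega> u1 u2 \<and>
             weak_solution \<Omega> p q l \<mu> \<nu> \<phi> u1 \<and> H10_norm \<Omega> u1 \<le> r \<and>
             weak_solution \<Omega> p q l \<mu> \<nu> \<phi> u2 \<and> H10_norm \<Omega> u2 \<le> r)))"
  proof (intro exI[of _ l_star] conjI l_star(1) allI impI)
    fix l \<mu> S assume a: "0 < l \<and> l < l_star \<and> - l_star < \<mu> \<and> \<mu> < l_star"
      "S \<subseteq> Hm1 \<Omega> \<and> convex_functionals S \<and> dense_in_Hm1 \<Omega> S"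
    from l_star(2)[rule_format, OF a] show "\<exists>\<phi>\<in>S. Hm1_norm \<Omega> \<phi> < r \<and>
          (\<exists>u1 u2. \<not> ae_equal \<Omega> u1 u2 \<and>
             weak_solution \<Omega> p q l \<mu> \<nu> \<phi> u1 \<and> H10_norm \<Omega> u1 \<le> r \<and>
             weak_solution \<Omega> p q l \<mu> \<nu> \<phi> u2 \<and> H10_norm \<Omega> u2 \<le> r)"
      unfolding ws by blast
  qed
qed

end
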